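(* Let $p(\cdot):\mathbb{R}^n\to[1,\infty)$ be a measurable function with $1<p_-\le p_+<\infty$. Then the Hardy--Littlewood maximal operator $M$ is bounded on $L^{p(\cdot)}$ (i.e. $p(\cdot)\in\mathcal{P}$) if and only if $p(\cdot)$ satisfies the $A_{p(\cdot)}$ condition and the following condition holds: there exist $r>1$, $0<\gamma_0<1/2$ and $C\ge1$ such that for all $0<\lambda,\tau<\gamma_0$ and for any sequence $\mathcal{F}$ of pairwise disjoint cubes, $$\sum_{Q\in\mathcal{F}}|Q|\,\tau^{\frac1r(1+\Psi_{Q,p}(\lambda,\tau))}\,\lambda^{\frac1r(1+\Psi_{Q,p'}(\tau,\lambda))}\le C.$$
   Context: Here $p_-:=\operatorname{ess\,inf}_{\mathbb{R}^n}p$ and $p_+:=\operatorname{ess\,sup}_{\mathbb{R}^n}p$. $L^{p(\cdot)}$ is the space of real-valued measurable $f$ on $\mathbb{R}^n$ with $\|f\|_{L^{p(\cdot)}}:=\inf\{\lambda>0:\int_{\mathbb{R}^n}(|f(x)|/\lambda)^{p(x)}dx\le1\}<\infty$. Cubes have sides parallel to the coordinate axes. $Mf(x):=\sup_{Q\ni x}\frac1{|Q|}\int_Q|f(y)|dy$, the supremum over all cubes $Q\subset\mathbb{R}^n$ containing $x$. $\mathcal{P}$ is the class of exponents for which $M$ is bounded on $L^{p(\cdot)}$. Conjugate exponent: $p'(x):=\frac{p(x)}{p(x)-1}$. $A_{p(\cdot)}$ condition: $\sup_Q\frac{\|\chi_Q\|_{L^{p(\cdot)}}\|\chi_Q\|_{L^{p'(\cdot)}}}{|Q|}<\infty$,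 the supremum over all cubes $Q\subset\mathbb{R}^n$. Non-increasing rearrangement: $f^*(t):=\inf\{\alpha>0:|\{x\in\mathbb{R}^n:|f(x)|>\alpha\}|\le t\}$ for $0<t<\infty$. For an exponent $q(\cdot)$ (here $q=p$ or $q=p'$), a cube $Q$ and $a,b\in(0,1)$ with $a+b<1$, $$\Psi_{Q,q}(a,b):=\frac{(q\chi_Q)^*((1-b)|Q|)}{(q\chi_Q)^*(a|Q|)-(q\chi_Q)^*((1-b)|Q|)}.$$ Convention: a positive number divided by $0$ is $\infty$, and $c^\infty=0$ for $0<c<1$. *)

theory Defs
  imports "HOL-Probability.Essential_Supremum"
begin

text \<open>The library provides \<^const>\<open>esssup\<close> but no essential infimum.\<close>

definition essinf :: "'a measure \<Rightarrow> ('a \<Rightarrow> ereal) \<Rightarrow> ereal" where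
  "essinf M f = Sup {c. AE x in M. c \<le> f x}"

text \<open>
  Cubes are closed and nondegenerate; for families of cubes, ``pairwise disjoint'' is meant
  set-theoretically.
\<close>

definition cubes :: "(real ^ 'n) set set" where
  "cubes = {Q. \<exists>a l. 0 < l \<and> Q = cbox a (\<chi> i. a $ i + l)}"

text \<open>
  The value \<^term>\<open>\<infinity>\<close> (infimum of the empty set) signals that the function is not in the space.
\<close>

definition Lp_norm :: "(real ^ 'n \<Rightarrow> real) \<Rightarrow> (real ^ 'n \<Rightarrow> real) \<Rightarrow> ennreal" where
  "Lp_norm p f =
     Inf {ennreal s | s. 0 < s \<and>
            (\<integral>\<^sup>+ x. ennreal ((\<bar>f x\<bar> / s) powr p x) \<partial>lebesgue) \<le> 1}"

definition Lp_space :: "(real ^ 'n \<Rightarrow> real) \<Rightarrow> (real ^ 'n \<Rightarrow> real) set" where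
  "Lp_space p = {f \<in> borel_measurable lebesgue. Lp_norm p f < \<infinity>}"

definition maximal_function :: "(real ^ 'n \<Rightarrow> real) \<Rightarrow> real ^ 'n \<Rightarrow> ennreal" where
  "maximal_function f x =
     (SUP Q \<in> {Q \<in> cubes. x \<in> Q}.
        (\<integral>\<^sup>+ y \<in> Q. ennreal \<bar>f y\<bar> \<partial>lebesgue) / emeasure lebesgue Q)"

text \<open>
  The maximal function may be infinite on a null set even for \<^term>\<open>f\<close> in the space. As the space
  consists of real-valued functions, membership of the maximal function means that it is finite
  almost everywhere and that its real-valued version belongs to the space.
\<close>

definition maximal_bounded :: "(real ^ 'n \<Rightarrow> real) \<Rightarrow> bool" where
  "maximal_bounded p \<longleftrightarrow>
     (\<exists>C::real. 0 \<le> C \<and> (\<forall>f \<in> Lp_space p.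
        (AE x in lebesgue. maximal_function f x < \<infinity>) \<and>
        (\<lambda>x. enn2real (maximal_function f x)) \<in> Lp_space p \<and>
        Lp_norm p (\<lambda>x. enn2real (maximal_function f x)) \<le> ennreal C * Lp_norm p f))"

text \<open>
  Where \<^term>\<open>p x = 1\<close> this has the junk value \<^term>\<open>0::real\<close> instead of infinity. This concerns
  only a null set when the essential infimum of \<^term>\<open>p\<close> exceeds \<^term>\<open>1::real\<close>.
\<close>

definition conj_exponent :: "(real ^ 'n \<Rightarrow> real) \<Rightarrow> real ^ 'n \<Rightarrow> real" where
  "conj_exponent p x = p x / (p x - 1)"

definition A_condition :: "(real ^ 'n \<Rightarrow> real) \<Rightarrow> bool" where
  "A_condition p \<longleftrightarrow>
     (SUP Q \<in> cubes.
        Lp_norm p (indicator Q) * Lp_norm (conj_exponent p) (indicator Q) / emeasure lebesgue Q)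
       < \<infinity>"

definition rearrangement :: "(real ^ 'n \<Rightarrow> real) \<Rightarrow> real \<Rightarrow> ennreal" where
  "rearrangement f t =
     Inf {ennreal \<alpha> | \<alpha>. 0 < \<alpha> \<and> emeasure lebesgue {x. \<bar>f x\<bar> > \<alpha>} \<le> ennreal t}"

text \<open>
  In \<^typ>\<open>ennreal\<close> a positive number divided by \<^term>\<open>0::ennreal\<close> is infinite, as required. The
  truncated subtraction is harmless: the rearrangement is non-increasing, and \<^term>\<open>a < 1 - b\<close>.
\<close>

definition Psi :: "(real ^ 'n) set \<Rightarrow> (real ^ 'n \<Rightarrow> real) \<Rightarrow> real \<Rightarrow> real \<Rightarrow> ennreal" where
  "Psi Q q a b =
     (let u = rearrangement (\<lambda>x. q x * indicator Q x) (a * measure lebesgue Q);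
          v = rearrangement (\<lambda>x. q x * indicator Q x) ((1 - b) * measure lebesgue Q)
      in v / (u - v))"

text \<open>Only meant for bases strictly between \<^term>\<open>0::real\<close> and \<^term>\<open>1::real\<close>.\<close>

definition epowr :: "real \<Rightarrow> ennreal \<Rightarrow> real" where
  "epowr c e = (if e = \<infinity> then 0 else c powr enn2real e)"

definition cube_sum_condition :: "(real ^ 'n \<Rightarrow> real) \<Rightarrow> bool" where
  "cube_sum_condition p \<longleftrightarrow>
     (\<exists>r \<gamma>\<^sub>0 C :: real. 1 < r \<and> 0 < \<gamma>\<^sub>0 \<and> \<gamma>\<^sub>0 < 1/2 \<and> 1 \<le> C \<and>
        (\<forall>l t :: real. 0 < l \<and> l < \<gamma>\<^sub>0 \<and> 0 < t \<and> t < \<gamma>\<^sub>0 \<longrightarrow>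
          (\<forall>F. countable F \<and> F \<subseteq> cubes \<and> disjoint F \<longrightarrow>
            (\<Sum>\<^sub>\<infinity>Q\<in>F. ennreal
               (measure lebesgue Q
                 * epowr t (ennreal (1/r) * (1 + Psi Q p l t))
                 * epowr l (ennreal (1/r) * (1 + Psi Q (conj_exponent p) t l))))
              \<le> ennreal C)))"

end

theory Submission
  imports Defs "HOL-Real_Asymp.Real_Asymp"
begin

text \<open>
  After changing \<open>p\<close> on a null set, \<open>1 < a \<le> p \<le> b\<close> everywhere; let \<open>q\<close> be the conjugate exponent.
  The A condition gives, for a single cube whose averages lie on the right side of the scale \<open>1\<close>,
  a bound for the modular of an average by that of the function, and hence, by iterating a
  Calderon-Zygmund decomposition, a reverse Hoelder inequality. This settles large levels.

  For small levels \<open>t\<close> split each cube into the layers between consecutive quantiles of \<open>p\<close>. By the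
  pigeonhole principle one layer carries enough of the function and one enough of \<open>t powr p\<close>. Then
  the modular estimate holds on the cube with a small power of \<open>t\<close> to spare, or the cube contributes
  at most a small power of \<open>t\<close> times its term in the cube sum condition. Covering the level sets of
  the maximal function by shifted dyadic cubes and summing over the levels \<open>t = 2 powi k\<close> yields
  boundedness.

  Conversely, if the maximal function is bounded, so are the averaging operators over disjoint
  families, also for \<open>q\<close>. Counting the cubes that violate the modular estimate for levels at most
  \<open>1\<close> shows that it holds up to an additive constant, and iterating as above gives
  exponential decay on small subsets of a whole family. Applied to functions that take a constant
  value per cube on the set where \<open>p\<close> is large, this bounds the cube sum with a smaller exponent on
  one of the two factors; the geometric mean with the dual estimate improves both.
\<close>

section \<open>Dyadic stopping cubes\<close>

text \<open>The A condition compares \<open>p\<close> with its conjugate at one level per cube, the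
  reciprocal norm of the indicator. Raised to powers in [0, 1] it reaches the levels between that
  one and 1, and no others. Above 1 a modular bound on \<open>f\<close> keeps the averages in this
  range. For small levels nothing does: a modular is not homogeneous, many cubes may violate the
  estimate, and only their sum can be controlled. The summand of the cube sum condition comes from a
  balance. Let \<open>p\<close> be at most \<alpha> on a portion \<tau> of \<open>Q\<close> and at
  least \<beta> on a portion \<nu>. Concentrating the average \<open>t\<close> on the second portion
  costs \<open>\<nu> * (t / \<nu>) powr \<beta>\<close>, while the level \<open>t\<close> is worth
  \<open>\<tau> * t powr \<alpha>\<close> on the first. The two agree for \<open>t powr (\<beta> -
  \<alpha>) = \<tau> * \<nu> powr (\<beta> - 1)\<close>, and the common value is
  \<open>gap_term\<close>. The power \<open>1 / r < 1\<close> is the room for summation in one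
  direction and the outcome of self-improvement in the other. Level estimates bound by
  \<open>t powr \<epsilon> * f x powr (p x - \<epsilon>)\<close> rather than by the modular of
  \<open>f\<close>, whose sum over all levels would diverge.\<close>

definition hcube :: "real ^ 'n \<Rightarrow> real \<Rightarrow> (real ^ 'n) set" where
  "hcube a l = {x. \<forall>i. a $ i \<le> x $ i \<and> x $ i < a $ i + l}"

lemma measure_cube:
  fixes a :: "real ^ 'n"
  assumes "0 \<le> l"
  shows "measure lebesgue (cbox a (\<chi> i. a $ i + l)) = l ^ CARD('n)"
proof -
  have "measure lborel (cbox a (\<chi> i. a $ i + l)) = l ^ CARD('n)"
    using assms by (subst content_cbox_cart) (auto simp: interval_ne_empty_cart)
  then show ?thesis by simp
qed

lemma hcube_between:
  "box a (\<chi> i. a $ i + l) \<subseteq> hcube a l" "hcube a l \<subseteq> cbox a (\<chi> i. a $ i + l)"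
  by (auto simp: hcube_def mem_box_cart less_imp_le)

lemma hcube_borel [measurable]: "hcube a l \<in> sets borel"
proof -
  have "hcube a l = (\<Inter>i. {x. a $ i \<le> x $ i} \<inter> {x. x $ i < a $ i + l})"
    by (auto simp: hcube_def)
  also have "\<dots> \<in> sets borel"
    by (intro sets.countable_INT'' sets.Int borel_closed borel_open closed_halfspace_component_ge_cart
       open_halfspace_component_lt_cart) auto
  finally show ?thesis .
qed

lemma hcube_lmeasurable: "hcube a l \<in> lmeasurable"
  by (rule bounded_set_imp_lmeasurable[OF bounded_subset[OF bounded_cbox hcube_between(2)]]) auto

lemma cube_diff_hcube_null:
  "cbox a (\<chi> i. a $ i + l) - hcube a l \<in> null_sets lebesgue"
proof -
  have "cbox a (\<chi> i. a $ i + l) - hcube a l \<subseteq> cbox a (\<chi> i. a $ i + l) - box a (\<chi> i. a $ i + l)"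
    using hcube_between(1) by blast
  moreover have "negligible (cbox a (\<chi> i. a $ i + l) - box a (\<chi> i. a $ i + l))"
    by (rule negligible_frontier_interval)
  ultimately show ?thesis
    by (metis negligible_iff_null_sets negligible_subset)
qed

lemma measure_hcube:
  fixes a :: "real ^ 'n"
  assumes "0 \<le> l"
  shows "measure lebesgue (hcube a l) = l ^ CARD('n)"
proof -
  have "hcube a l - cbox a (\<chi> i. a $ i + l) = {}" using hcube_between(2)[of a l] by blast
  then have "negligible ((cbox a (\<chi> i. a $ i + l) - hcube a l) \<union> (hcube a l - cbox a (\<chi> i. a $ i + l)))"
    using cube_diff_hcube_null[of a l] by (metis Un_empty_right negligible_iff_null_sets)
  then have "measure lebesgue (cbox a (\<chi> i. a $ i + l)) = measure lebesgue (hcube a l)"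
    by (intro measure_negligible_symdiff) (simp_all add: Un_commute hcube_lmeasurable)
  then show ?thesis using measure_cube[OF assms, of a] by simp
qed

section \<open>The dyadic grid generated by a half-open cube\<close>

definition dyadic_index :: "real ^ 'n \<Rightarrow> real \<Rightarrow> nat \<Rightarrow> real ^ 'n \<Rightarrow> int ^ 'n" where
  "dyadic_index a l k x = (\<chi> i. \<lfloor>(x $ i - a $ i) * 2 ^ k / l\<rfloor>)"

text \<open>Encoded as the fibre of the index of one of its points, so that cubes of one generation
  partition the whole space; closed cubes would overlap along faces. The grid extends beyond
  \<open>hcube a l\<close>, which the shifted grids rely on later.\<close>

definition dyadic_cube :: "real ^ 'n \<Rightarrow> real \<Rightarrow> nat \<Rightarrow> real ^ 'n \<Rightarrow> (real ^ 'n) set" where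
  "dyadic_cube a l k x = {y. dyadic_index a l k y = dyadic_index a l k x}"

lemma dyadic_cube_self [simp]: "x \<in> dyadic_cube a l k x"
  by (simp add: dyadic_cube_def)

lemma dyadic_cube_eq_hcube:
  assumes "0 < l"
  shows "dyadic_cube a l k x =
    hcube (\<chi> i. a $ i + l / 2 ^ k * of_int (dyadic_index a l k x $ i)) (l / 2 ^ k)"
proof -
  have *: "(\<lfloor>(u - c) * 2 ^ k / l\<rfloor> = z) \<longleftrightarrow> c + l / 2 ^ k * of_int z \<le> u \<and> u < c + l / 2 ^ k * of_int z + l / 2 ^ k"
    for u c :: real and z
  proof -
    have "(\<lfloor>(u - c) * 2 ^ k / l\<rfloor> = z) \<longleftrightarrow> of_int z \<le> (u - c) * 2 ^ k / l \<and> (u - c) * 2 ^ k / l < of_int z + 1"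
      by (rule floor_eq_iff)
    also have "\<dots> \<longleftrightarrow> c + l / 2 ^ k * of_int z \<le> u \<and> u < c + l / 2 ^ k * of_int z + l / 2 ^ k"
      using assms by (auto simp: field_simps)
    finally show ?thesis .
  qed
  show ?thesis
    by (auto simp: dyadic_cube_def hcube_def vec_eq_iff dyadic_index_def *)
qed

text \<open>The floor of \<open>u / 2 ^ m\<close> is the integer quotient of the floor of
  \<open>u\<close> by \<open>2 ^ m\<close>, so a finer index determines every coarser one. This is
  the nesting of dyadic cubes.\<close>

lemma dyadic_index_mono:
  assumes "k \<le> k'" "dyadic_index a l k' y = dyadic_index a l k' x"
  shows "dyadic_index a l k y = dyadic_index a l k x"
proof -
  have *: "\<lfloor>u * 2 ^ k / l\<rfloor> = \<lfloor>u * 2 ^ k' / l\<rfloor> div 2 ^ (k' - k)" for u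
  proof -
    define m where "m = k' - k"
    have k': "k' = m + k" using assms(1) by (simp add: m_def)
    have "u * 2 ^ k / l = (u * 2 ^ k' / l) / of_int (2 ^ m)"
      by (simp add: k' power_add)
    then show ?thesis using floor_divide_real_eq_div[of "2 ^ m" "u * 2 ^ k' / l"] by (simp only: m_def) auto
  qed
  have "\<lfloor>(y $ i - a $ i) * 2 ^ k' / l\<rfloor> = \<lfloor>(x $ i - a $ i) * 2 ^ k' / l\<rfloor>" for i
    using arg_cong[OF assms(2), of "\<lambda>v. v $ i"] by (simp only: dyadic_index_def vec_lambda_beta)
  then show ?thesis
    unfolding dyadic_index_def by (subst (1 2) *) simp
qed

lemma dyadic_cube_mono:
  "k \<le> k' \<Longrightarrow> dyadic_cube a l k' x \<subseteq> dyadic_cube a l k x"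
  by (auto simp: dyadic_cube_def intro: dyadic_index_mono)

lemma dyadic_cube_eq:
  "y \<in> dyadic_cube a l k' x \<Longrightarrow> k \<le> k' \<Longrightarrow> dyadic_cube a l k y = dyadic_cube a l k x"
  using dyadic_index_mono[of k k' a l y x] by (simp add: dyadic_cube_def)

lemma dyadic_cube_0: 
  assumes "0 < l" "x \<in> hcube a l"
  shows "dyadic_cube a l 0 x = hcube a l"
proof -
  have "dyadic_index a l 0 x = 0"
    using assms by (auto simp: dyadic_index_def vec_eq_iff hcube_def floor_eq_iff field_simps)
  then show ?thesis using dyadic_cube_eq_hcube[OF assms(1), of a 0 x] by simp
qed

lemma measure_dyadic_cube:
  fixes a :: "real ^ 'n"
  assumes "0 < l" shows "measure lebesgue (dyadic_cube a l k x) = (l / 2 ^ k) ^ CARD('n)"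
  using assms unfolding dyadic_cube_eq_hcube[OF assms] by (intro measure_hcube) auto

lemma measure_dyadic_cube_Suc:
  fixes a :: "real ^ 'n"
  assumes "0 < l" 
  shows "measure lebesgue (dyadic_cube a l k x) = 2 ^ CARD('n) * measure lebesgue (dyadic_cube a l (Suc k) x)"
proof -
  have "l / 2 ^ k = 2 * (l / 2 ^ Suc k)" by simp
  then show ?thesis unfolding measure_dyadic_cube[OF assms] by (metis power_mult_distrib)
qed

text \<open>\<open>LEAST\<close> selects the largest cube of the grid around the point that
  satisfies \<open>P\<close>. No heredity of \<open>P\<close> is involved, and points sharing a cube
  contribute it once.\<close>

definition stopping_cubes ::
  "real ^ 'n \<Rightarrow> real \<Rightarrow> ((real ^ 'n) set \<Rightarrow> bool) \<Rightarrow> (real ^ 'n) set \<Rightarrow> (real ^ 'n) set set" where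
  "stopping_cubes a l P S =
     {dyadic_cube a l (LEAST k. P (dyadic_cube a l k x)) x | x. x \<in> S \<and> (\<exists>k. P (dyadic_cube a l k x))}"

lemma stopping_cubesE:
  assumes "D \<in> stopping_cubes a l P S"
  obtains x k where "x \<in> S" "D = dyadic_cube a l k x" "P D" "\<And>j. j < k \<Longrightarrow> \<not> P (dyadic_cube a l j x)"
proof -
  obtain x m where x: "x \<in> S" "D = dyadic_cube a l (LEAST k. P (dyadic_cube a l k x)) x"
      "P (dyadic_cube a l m x)"
    using assms unfolding stopping_cubes_def by blast
  show ?thesis
  proof (rule that[OF x(1,2)])
    show "P D" using LeastI[of "\<lambda>k. P (dyadic_cube a l k x)", OF x(3)] x(2) by simp
    show "\<not> P (dyadic_cube a l j x)" if "j < (LEAST k. P (dyadic_cube a l k x))" for j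
      using not_less_Least[OF that] .
  qed
qed

lemma stopping_cubes_cover:
  assumes "x \<in> S" "P (dyadic_cube a l k x)"
  shows "x \<in> \<Union> (stopping_cubes a l P S)"
proof -
  have "dyadic_cube a l (LEAST k. P (dyadic_cube a l k x)) x \<in> stopping_cubes a l P S"
    using assms unfolding stopping_cubes_def by blast
  with dyadic_cube_self[of x a l "LEAST k. P (dyadic_cube a l k x)"] show ?thesis by (rule UnionI[rotated])
qed

text \<open>Two stopping cubes that meet are nested. The larger is then an ancestor, satisfying
  \<open>P\<close>, of the point that produced the smaller, and minimality of the generation forces
  equality.\<close>

lemma stopping_cubes_disjoint: "disjoint (stopping_cubes a l P S)"
proof -
  have aux: "D1 = D2" if D: "D1 = dyadic_cube a l k x" "D2 = dyadic_cube a l m z" "P D1" "P D2"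
    "\<And>j. j < k \<Longrightarrow> \<not> P (dyadic_cube a l j x)" "\<And>j. j < m \<Longrightarrow> \<not> P (dyadic_cube a l j z)"
    "y \<in> D1" "y \<in> D2" "k \<le> m" for D1 D2 k m x z y
  proof (cases "k = m")
    case True
    then show ?thesis using D(7,8) unfolding D(1,2) by (simp add: dyadic_cube_def)
  next
    case False
    then have "k < m" using D(9) by linarith
    then have "\<not> P (dyadic_cube a l k z)" by (rule D(6))
    moreover have "dyadic_cube a l k z = D1"
      using dyadic_cube_eq[OF D(7)[unfolded D(1)] order_refl] dyadic_cube_eq[OF D(8)[unfolded D(2)] D(9)] D(1)
      by simp
    ultimately show ?thesis using D(3) by simp
  qed
  show ?thesis
    unfolding disjoint_def
  proof (intro ballI impI)
    fix A B assume AB: "A \<in> stopping_cubes a l P S" "B \<in> stopping_cubes a l P S" "A \<noteq> B"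
    show "A \<inter> B = {}"
    proof (rule ccontr)
      assume "A \<inter> B \<noteq> {}"
      then obtain y where y: "y \<in> A" "y \<in> B" by blast
      obtain x k where x: "A = dyadic_cube a l k x" "P A" "\<And>j. j < k \<Longrightarrow> \<not> P (dyadic_cube a l j x)"
        using AB(1) by (rule stopping_cubesE) metis
      obtain z m where z: "B = dyadic_cube a l m z" "P B" "\<And>j. j < m \<Longrightarrow> \<not> P (dyadic_cube a l j z)"
        using AB(2) by (rule stopping_cubesE) metis
      have "A = B"
      proof (cases "k \<le> m")
        case True
        show ?thesis by (rule aux[OF x(1) z(1) x(2) z(2) x(3) z(3) y True])
      next
        case False
        then have "m \<le> k" by simp
        from aux[OF z(1) x(1) z(2) x(2) z(3) x(3) y(2,1) this] show ?thesis by simp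
      qed
      then show False using AB by simp
    qed
  qed
qed

lemma interior_hcube_nonempty: "0 < l \<Longrightarrow> interior (hcube a l) \<noteq> {}"
proof -
  assume l: "0 < l"
  have "box a (\<chi> i. a $ i + l) \<noteq> {}" using l by (simp add: interval_ne_empty_cart)
  then show ?thesis using interior_maximal[OF hcube_between(1)[of a l] open_box] by (metis subset_empty)
qed

lemma countable_disjoint_hcubes:
  assumes "disjoint \<D>" "\<And>D. D \<in> \<D> \<Longrightarrow> \<exists>a l. 0 < l \<and> D = hcube a l"
  shows "countable \<D>"
proof (rule countable_disjoint_nonempty_interior_subsets)
  show "pairwise disjnt \<D>" using assms(1) by (auto simp: disjoint_def pairwise_def disjnt_def)
  show "D = {}" if "D \<in> \<D>" "interior D = {}" for D
    using assms(2)[OF that(1)] that(2) interior_hcube_nonempty by blast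
qed

lemma stopping_cubes_hcube:
  assumes "0 < l" "D \<in> stopping_cubes a l P S"
  shows "\<exists>a l. 0 < l \<and> D = hcube a l"
proof -
  obtain x k where "D = dyadic_cube a l k x" using assms(2) by (rule stopping_cubesE)
  moreover have "0 < l / 2 ^ k" using assms(1) by simp
  ultimately show ?thesis using dyadic_cube_eq_hcube[OF assms(1), of a k x] by blast
qed

lemma countable_stopping_cubes:
  assumes "0 < l" shows "countable (stopping_cubes a l P S)"
  using countable_disjoint_hcubes[OF stopping_cubes_disjoint[of a l P S]] stopping_cubes_hcube[OF assms]
  by metis

lemma stopping_cubes_subset_hcube:
  assumes "0 < l" "D \<in> stopping_cubes a l P (hcube a l)"
  shows "D \<subseteq> hcube a l"
  using assms(2)
proof (rule stopping_cubesE)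
  fix x k assume "x \<in> hcube a l" "D = dyadic_cube a l k x"
  then show ?thesis using dyadic_cube_mono[of 0 k a l x] dyadic_cube_0[OF assms(1), of x] by simp
qed

lemma dyadic_cube_in_open:
  fixes x :: "real ^ 'n"
  assumes "open U" "x \<in> U" "0 < l"
  shows "\<exists>k. dyadic_cube a l k x \<subseteq> U"
proof -
  obtain e where e: "0 < e" "ball x e \<subseteq> U" using assms open_contains_ball by blast
  obtain k where k: "(1/2) ^ k < e / (l * CARD('n))"
    using real_arch_pow_inv[of "e / (l * CARD('n))" "1/2"] e assms by auto
  have "dyadic_cube a l k x \<subseteq> ball x e"
  proof
    fix y assume y: "y \<in> dyadic_cube a l k x"
    have *: "\<bar>y $ i - x $ i\<bar> \<le> l / 2 ^ k" for i
      using y dyadic_cube_self[of x a l k] unfolding dyadic_cube_eq_hcube[OF assms(3)] hcube_def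
      by (auto dest!: spec[of _ i])
    have "norm (y - x) \<le> (\<Sum>i\<in>UNIV. \<bar>(y - x) $ i\<bar>)" by (rule norm_le_l1_cart)
    also have "\<dots> \<le> (\<Sum>i\<in>(UNIV::'n set). l / 2 ^ k)" by (rule sum_mono) (simp add: *)
    also have "\<dots> = CARD('n) * l * (1/2) ^ k" by (simp add: power_one_over)
    also have "\<dots> < e" using k assms(3) by (simp add: field_simps)
    finally show "y \<in> ball x e" by (simp add: dist_norm norm_minus_commute)
  qed
  then show ?thesis using e by blast
qed

lemma emeasure_inter_disjoint_le:
  assumes "countable \<E>" "disjoint \<E>" "\<And>E. E \<in> \<E> \<Longrightarrow> E \<in> sets M" "A \<in> sets M"
    and "\<And>E. E \<in> \<E> \<Longrightarrow> emeasure M (A \<inter> E) \<le> c * emeasure M E"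
  shows "emeasure M (A \<inter> \<Union>\<E>) \<le> c * emeasure M (\<Union>\<E>)"
proof -
  have d: "disjoint_family_on (\<lambda>E. E) \<E>" "disjoint_family_on (\<lambda>E. A \<inter> E) \<E>"
    using assms(2) by (auto simp: disjoint_family_on_def disjoint_def)
  have "A \<inter> \<Union>\<E> = (\<Union>E\<in>\<E>. A \<inter> E)" by auto
  then have "emeasure M (A \<inter> \<Union>\<E>) = (\<integral>\<^sup>+E. emeasure M (A \<inter> E) \<partial>count_space \<E>)"
    using emeasure_UN_countable[OF _ assms(1) d(2), of M] assms(3,4) by auto
  also have "\<dots> \<le> (\<integral>\<^sup>+E. c * emeasure M E \<partial>count_space \<E>)"
    by (rule nn_integral_mono) (use assms(5) in auto)
  also have "\<dots> = c * (\<integral>\<^sup>+E. emeasure M E \<partial>count_space \<E>)"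
    by (rule nn_integral_cmult) simp
  also have "(\<integral>\<^sup>+E. emeasure M E \<partial>count_space \<E>) = emeasure M (\<Union>\<E>)"
    using emeasure_UN_countable[OF _ assms(1) d(1), of M] assms(3) by auto
  finally show ?thesis .
qed

lemma hcube_lebesgue [measurable]: "hcube a l \<in> sets lebesgue"
  using hcube_lmeasurable by blast

text \<open>A stopping cube fails the density condition one generation earlier, which bounds the
  density from above. Where the density condition never holds, the set is null: cover it by
  maximal dyadic cubes inside an open set of nearly the same measure.\<close>

lemma calderon_zygmund_set:
  fixes A :: "(real ^ 'n) set"
  assumes l: "0 < l" and A: "A \<in> sets lebesgue"
    and small: "measure lebesgue (A \<inter> hcube a l) \<le> 1 / 2 ^ (CARD('n) + 2) * measure lebesgue (hcube a l)"
  obtains \<D> where "countable \<D>" "disjoint \<D>"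
    "\<And>D. D \<in> \<D> \<Longrightarrow> \<exists>b s. 0 < s \<and> D = hcube b s"
    "\<And>D. D \<in> \<D> \<Longrightarrow> D \<subseteq> hcube a l"
    "\<And>D. D \<in> \<D> \<Longrightarrow> measure lebesgue (A \<inter> D) \<le> 1 / 4 * measure lebesgue D"
    "\<And>D. D \<in> \<D> \<Longrightarrow> 1 / 2 ^ (CARD('n) + 2) * measure lebesgue D \<le> measure lebesgue (A \<inter> D)"
    "A \<inter> hcube a l - \<Union>\<D> \<in> null_sets lebesgue"
proof -
  \<comment> \<open>A parent has \<open>2 ^ CARD('n)\<close> times the measure of its child, so
    density at most \<open>c\<close> on the parent gives density at most \<open>1/4\<close> on the
    child.\<close>
  define c :: real where "c = 1 / 2 ^ (CARD('n) + 2)"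
  have c: "0 < c" "c \<le> 1/4" by (auto simp: c_def field_simps)
  define P where "P D \<longleftrightarrow> c * measure lebesgue D < measure lebesgue (A \<inter> D)" for D
  define \<D> where "\<D> = stopping_cubes a l P (hcube a l)"
  have count: "countable \<D>" unfolding \<D>_def by (rule countable_stopping_cubes[OF l])
  have disj: "disjoint \<D>" unfolding \<D>_def by (rule stopping_cubes_disjoint)
  have hc: "\<exists>b s. 0 < s \<and> D = hcube b s" if "D \<in> \<D>" for D
    using stopping_cubes_hcube[OF l] that unfolding \<D>_def by blast
  have sub: "D \<subseteq> hcube a l" if "D \<in> \<D>" for D
    using stopping_cubes_subset_hcube[OF l] that unfolding \<D>_def by blast
  have lm: "hcube b s \<in> lmeasurable" for b :: "real^'n" and s by (rule hcube_lmeasurable)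
  have Alm: "A \<inter> hcube b s \<in> lmeasurable" for b s using fmeasurable_Int_fmeasurable[OF lm A, of b s] by (simp add: Int_commute)
  have upper: "measure lebesgue (A \<inter> D) \<le> 1 / 4 * measure lebesgue D" if "D \<in> \<D>" for D
    using that unfolding \<D>_def
  proof (rule stopping_cubesE)
    fix x k assume x: "x \<in> hcube a l" "D = dyadic_cube a l k x" "P D"
      and no: "\<And>j. j < k \<Longrightarrow> \<not> P (dyadic_cube a l j x)"
    have "k \<noteq> 0"
    proof
      assume "k = 0"
      then have "D = hcube a l" using x dyadic_cube_0[OF l] by simp
      then show False using x(3) small by (simp add: P_def c_def)
    qed
    then obtain j where j: "k = Suc j" by (cases k) auto
    let ?D = "dyadic_cube a l j x"
    have "measure lebesgue (A \<inter> D) \<le> measure lebesgue (A \<inter> ?D)"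
      using dyadic_cube_mono[of j k a l x] x(2) j Alm dyadic_cube_eq_hcube[OF l, of a]
      by (intro measure_mono_fmeasurable) (auto simp: fmeasurableD)
    also have "\<dots> \<le> c * measure lebesgue ?D" using no[of j] j by (simp add: P_def)
    also have "\<dots> = 1 / 4 * measure lebesgue D"
      unfolding measure_dyadic_cube_Suc[OF l, of a j x] x(2) j by (simp add: c_def power_add)
    finally show ?thesis .
  qed
  have lower: "c * measure lebesgue D \<le> measure lebesgue (A \<inter> D)" if "D \<in> \<D>" for D
    using that unfolding \<D>_def by (rule stopping_cubesE) (simp add: P_def)
  have Dset: "\<Union>\<D> \<in> sets lebesgue" using count hc hcube_lebesgue by (intro sets.countable_Union) blast+
  define N0 where "N0 = A \<inter> hcube a l - \<Union>\<D>"
  have N0: "N0 \<in> sets lebesgue" using A Dset by (auto simp: N0_def)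
  have N0lm: "N0 \<in> lmeasurable"
    using Alm[of a l] Dset unfolding N0_def by (rule fmeasurable_Diff)
  \<comment> \<open>An open set of measure at most \<open>|N0| + e\<close> around \<open>N0\<close>
    yields \<open>|N0| \<le> c * (|N0| + e)\<close>, and \<open>c \<le> 1/4\<close> turns this into
    \<open>|N0| \<le> e\<close>.\<close>
  have small_meas: "measure lebesgue N0 \<le> e" if e: "0 < e" for e :: real
  proof -
    obtain U where U: "open U" "N0 \<subseteq> U" "U - N0 \<in> lmeasurable" "emeasure lebesgue (U - N0) < ennreal e"
      using sets_lebesgue_outer_open[OF N0 e] by blast
    define \<E> where "\<E> = stopping_cubes a l (\<lambda>D. D \<subseteq> U) N0"
    have E1: "countable \<E>" unfolding \<E>_def by (rule countable_stopping_cubes[OF l])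
    have E2: "disjoint \<E>" unfolding \<E>_def by (rule stopping_cubes_disjoint)
    have E3: "\<exists>b s. 0 < s \<and> D = hcube b s" if "D \<in> \<E>" for D
      using stopping_cubes_hcube[OF l] that unfolding \<E>_def by blast
    have E4: "D \<subseteq> U" if "D \<in> \<E>" for D
      using that unfolding \<E>_def by (rule stopping_cubesE)
    have E5: "N0 \<subseteq> \<Union>\<E>"
    proof
      fix x assume x: "x \<in> N0"
      then obtain k where "dyadic_cube a l k x \<subseteq> U" using dyadic_cube_in_open U l by blast
      then show "x \<in> \<Union>\<E>" unfolding \<E>_def using stopping_cubes_cover[of x N0 "\<lambda>D. D \<subseteq> U"] x by blast
    qed
    have E6: "emeasure lebesgue (A \<inter> D) \<le> ennreal c * emeasure lebesgue D" if "D \<in> \<E>" for D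
      using that unfolding \<E>_def
    proof (rule stopping_cubesE)
      fix x k assume x: "x \<in> N0" "D = dyadic_cube a l k x"
      \<comment> \<open>Any grid cube satisfying \<open>P\<close> around a point of
        \<open>hcube a l\<close> places that point in \<open>\<Union>\<D>\<close>, hence outside
        \<open>N0\<close>.\<close>
      have "\<not> P D"
        using x stopping_cubes_cover[of x "hcube a l" P a l k] unfolding N0_def \<D>_def by blast
      then have "measure lebesgue (A \<inter> D) \<le> c * measure lebesgue D" by (simp add: P_def)
      moreover have "D \<in> lmeasurable" "A \<inter> D \<in> lmeasurable"
        using E3[OF that] lm Alm by auto
      ultimately show ?thesis using c(1)
        by (simp add: emeasure_eq_measure2 ennreal_mult[symmetric] ennreal_leI)
    qed
    have Elm: "E \<in> sets lebesgue" if "E \<in> \<E>" for E using E3[OF that] hcube_lebesgue by blast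
    have ES: "\<Union>\<E> \<in> sets lebesgue" using E1 Elm by (intro sets.countable_Union) blast+
    have Ulm: "U \<in> lmeasurable"
    proof -
      have "U = (U - N0) \<union> N0" using U(2) by blast
      then show ?thesis using U(3) N0lm by (metis fmeasurable.Un)
    qed
    have "emeasure lebesgue N0 \<le> emeasure lebesgue (A \<inter> \<Union>\<E>)"
      using E5 A ES by (intro emeasure_mono) (auto simp: N0_def)
    also have "\<dots> \<le> ennreal c * emeasure lebesgue (\<Union>\<E>)"
      by (rule emeasure_inter_disjoint_le[OF E1 E2 Elm A E6])
    also have "\<dots> \<le> ennreal c * emeasure lebesgue U"
      using E4 Ulm by (intro mult_left_mono emeasure_mono) auto
    finally have "measure lebesgue N0 \<le> c * measure lebesgue U"
      using N0lm Ulm c(1) by (simp add: emeasure_eq_measure2 ennreal_mult[symmetric])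
    moreover have "measure lebesgue U \<le> measure lebesgue N0 + e"
    proof -
      have "measure lebesgue (U - N0) < e"
        using U(3,4) e by (simp add: emeasure_eq_measure2 ennreal_less_iff)
      moreover have "measure lebesgue (U - N0) = measure lebesgue U - measure lebesgue N0"
        using Ulm N0lm U(2) by (intro measurable_measure_Diff) auto
      ultimately show ?thesis by simp
    qed
    ultimately have "measure lebesgue N0 \<le> c * (measure lebesgue N0 + e)"
      using c(1) by (meson mult_left_mono less_imp_le order_trans)
    also have "\<dots> \<le> 1/4 * (measure lebesgue N0 + e)" using c e by (intro mult_right_mono) auto
    finally show ?thesis using e by simp
  qed
  have "measure lebesgue N0 \<le> 0" by (rule field_le_epsilon) (use small_meas in simp)
  then have "N0 \<in> null_sets lebesgue"
    using N0lm N0 by (auto simp: null_sets_def emeasure_eq_measure2 measure_le_0_iff)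
  then show thesis
    using that[of \<D>] count disj hc sub upper lower unfolding c_def N0_def by blast
qed

section \<open>Exhausting half-open cubes by closed ones\<close>

definition shrunk_cube :: "real ^ 'n \<Rightarrow> real \<Rightarrow> nat \<Rightarrow> (real ^ 'n) set" where
  "shrunk_cube b s m = cbox b (\<chi> i. b $ i + s * (1 - 1 / (real m + 2)))"

lemma shrunk_cube_in_cubes: "0 < s \<Longrightarrow> shrunk_cube b s m \<in> cubes"
  unfolding shrunk_cube_def cubes_def
  by (auto intro!: exI[of _ b] exI[of _ "s * (1 - 1 / (real m + 2))"] mult_pos_pos)

lemma shrunk_cube_subset: "0 < s \<Longrightarrow> shrunk_cube b s m \<subseteq> hcube b s"
proof -
  assume s: "0 < s"
  have "s * (1 - 1 / (real m + 2)) < s * 1" using s by (intro mult_strict_left_mono) auto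
  then show ?thesis
    unfolding shrunk_cube_def hcube_def by (simp add: mem_box_cart subset_iff) (meson add_left_mono le_less_trans add_less_cancel_left)
qed

lemma incseq_shrunk_cube: "0 < s \<Longrightarrow> incseq (shrunk_cube b s)"
proof (rule incseq_SucI)
  fix m assume s: "0 < s"
  have "s * (1 - 1 / (real m + 2)) \<le> s * (1 - 1 / (real (Suc m) + 2))"
    using s by (intro mult_left_mono diff_mono divide_left_mono) auto
  then show "shrunk_cube b s m \<le> shrunk_cube b s (Suc m)"
    unfolding shrunk_cube_def by (auto simp: mem_box_cart simp del: of_nat_Suc) (meson add_left_mono order_trans)
qed

lemma Union_shrunk_cube:
  fixes b :: "real ^ 'n"
  assumes s: "0 < s" shows "(\<Union>m. shrunk_cube b s m) = hcube b s"
proof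
  show "(\<Union>m. shrunk_cube b s m) \<subseteq> hcube b s" using shrunk_cube_subset[OF s] by blast
  show "hcube b s \<subseteq> (\<Union>m. shrunk_cube b s m)"
  proof
    fix x assume x: "x \<in> hcube b s"
    have lim: "(\<lambda>m. b $ i + s * (1 - 1 / (real m + 2))) \<longlonglongrightarrow> b $ i + s * (1 - 0)" for i
      by (intro tendsto_intros) real_asymp
    have "\<forall>\<^sub>F m in sequentially. x $ i < b $ i + s * (1 - 1 / (real m + 2))" for i
      using x by (intro order_tendstoD(1)[OF lim]) (auto simp: hcube_def)
    then have "\<forall>\<^sub>F m in sequentially. \<forall>i. x $ i < b $ i + s * (1 - 1 / (real m + 2))"
      by (simp add: eventually_all_finite)
    then obtain m where "\<forall>i. x $ i < b $ i + s * (1 - 1 / (real m + 2))"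
      by (auto dest: eventually_happens)
    then have "x \<in> shrunk_cube b s m"
      using x by (auto simp: shrunk_cube_def mem_box_cart hcube_def less_imp_le)
    then show "x \<in> (\<Union>m. shrunk_cube b s m)" by blast
  qed
qed

text \<open>Hypotheses on disjoint families concern closed cubes, whereas stopping cubes are
  half-open and may share faces with their neighbours. This limit transfers inequalities from the
  former to the latter.\<close>

lemma measure_shrunk_cube_tendsto:
  assumes "finite_measure N" "sets N = sets lebesgue" "0 < s" "X \<in> sets lebesgue"
  shows "(\<lambda>m. measure N (shrunk_cube b s m \<inter> X)) \<longlonglongrightarrow> measure N (hcube b s \<inter> X)"
proof -
  interpret finite_measure N by fact
  have "(\<lambda>m. measure N (shrunk_cube b s m \<inter> X)) \<longlonglongrightarrow> measure N (\<Union>m. shrunk_cube b s m \<inter> X)"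
    using incseq_shrunk_cube[OF assms(3), of b] assms(2,4)
    by (intro finite_Lim_measure_incseq) (auto simp: shrunk_cube_def incseq_def)
  then show ?thesis unfolding Union_shrunk_cube[OF assms(3), of b, symmetric] by (simp only: Int_UN_distrib2 UN_simps)
qed

lemma measure_lebesgue_shrunk_cube_tendsto:
  fixes b :: "real ^ 'n"
  assumes "0 < s"
  shows "(\<lambda>m. measure lebesgue (shrunk_cube b s m)) \<longlonglongrightarrow> measure lebesgue (hcube b s)"
proof -
  have "measure lebesgue (shrunk_cube b s m) = (s * (1 - 1 / (real m + 2))) ^ CARD('n)" for m
    unfolding shrunk_cube_def by (rule measure_cube) (use assms in simp)
  moreover have "(\<lambda>m. (s * (1 - 1 / (real m + 2))) ^ CARD('n)) \<longlonglongrightarrow> (s * (1 - 0)) ^ CARD('n)"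
    by (intro tendsto_intros) real_asymp
  ultimately show ?thesis using measure_hcube[of s b] assms by simp
qed

section \<open>Decay estimates for families of cubes\<close>

lemma cubesE:
  assumes "Q \<in> cubes"
  obtains a l where "0 < l" "Q = cbox a (\<chi> i. a $ i + l)"
  using assms unfolding cubes_def by blast

lemma cube_lmeasurable: "Q \<in> cubes \<Longrightarrow> Q \<in> lmeasurable"
  by (auto simp: cubes_def)

lemma cube_lebesgue: "Q \<in> cubes \<Longrightarrow> Q \<in> sets lebesgue"
  by (auto simp: cubes_def)

lemma measure_cube_pos: "Q \<in> cubes \<Longrightarrow> 0 < measure lebesgue Q"
  by (erule cubesE) (simp add: measure_cube del: measure_completion)

lemma measure_split:
  assumes "X \<in> fmeasurable M" "A \<in> sets M"
  shows "measure M X = measure M (X \<inter> A) + measure M (X - A)"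
proof -
  have "measure M (X \<inter> A \<union> X) = measure M (X \<inter> A) + measure M (X - X \<inter> A)"
    using assms by (intro measure_Un2 fmeasurable_Int_fmeasurable)
  moreover have "X \<inter> A \<union> X = X" "X - X \<inter> A = X - A" by blast+
  ultimately show ?thesis by simp
qed

lemma (in finite_measure) measure_Union_le:
  assumes "countable \<D>" "\<D> \<subseteq> sets M" "0 \<le> X"
    and "\<And>\<G>. finite \<G> \<Longrightarrow> \<G> \<subseteq> \<D> \<Longrightarrow> measure M (\<Union>\<G>) \<le> X"
  shows "measure M (\<Union>\<D>) \<le> X"
proof (cases "\<D> = {}")
  case False
  define A where "A n = \<Union> (from_nat_into \<D> ` {..n})" for n
  have sub: "from_nat_into \<D> ` {..n} \<subseteq> \<D>" for n using from_nat_into[OF False] by blast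
  have U: "(\<Union>n. A n) = \<Union>\<D>"
  proof
    show "(\<Union>n. A n) \<subseteq> \<Union>\<D>" unfolding A_def using sub by blast
    show "\<Union>\<D> \<subseteq> (\<Union>n. A n)"
    proof
      fix x assume "x \<in> \<Union>\<D>"
      then obtain D where D: "D \<in> \<D>" "x \<in> D" by blast
      then obtain n where "from_nat_into \<D> n = D" using from_nat_into_surj[OF assms(1)] by metis
      then have "x \<in> A n" using D unfolding A_def by auto
      then show "x \<in> (\<Union>n. A n)" by blast
    qed
  qed
  have "(\<lambda>n. measure M (A n)) \<longlonglongrightarrow> measure M (\<Union>n. A n)"
  proof (rule finite_Lim_measure_incseq)
    show "range A \<subseteq> sets M" using sub assms(2) by (auto simp: A_def)
    show "incseq A" unfolding A_def incseq_def by (intro allI impI Union_mono image_mono) auto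
  qed
  moreover have "measure M (A n) \<le> X" for n
    unfolding A_def by (rule assms(4)) (use sub in auto)
  ultimately show ?thesis unfolding U by (meson LIMSEQ_le_const2)
qed (use assms in simp)

text \<open>A Muckenhoupt A-infinity condition for \<open>N\<close>, summed over families and with
  an additive error \<open>B\<close>. \<open>G\<close> ranges over disjoint subcubes of members of
  \<open>F\<close>, which is what a Calderon-Zygmund decomposition produces. One cube and
  \<open>B = 0\<close> give the classical local condition; a positive \<open>B\<close> tolerates
  families in which individual cubes violate it.\<close>

locale a_infty_family =
  fixes N :: "(real ^ 'n) measure" and F :: "(real ^ 'n) set set" and K B :: real
  assumes fin_N: "finite_measure N" and sets_N: "sets N = sets lebesgue"
    and null_N: "\<And>X. X \<in> null_sets lebesgue \<Longrightarrow> X \<in> null_sets N"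
    and F: "finite F" "F \<subseteq> cubes" "disjoint F"
    and K: "1 \<le> K" and B: "0 \<le> B"
    and H: "\<And>G E. finite G \<Longrightarrow> disjoint G \<Longrightarrow> G \<subseteq> cubes \<Longrightarrow> (\<And>Q'. Q' \<in> G \<Longrightarrow> \<exists>Q\<in>F. Q' \<subseteq> Q) \<Longrightarrow>
      E \<in> sets lebesgue \<Longrightarrow> (\<And>Q. Q \<in> G \<Longrightarrow> measure lebesgue Q / 2 \<le> measure lebesgue (Q \<inter> E)) \<Longrightarrow>
      (\<Sum>Q\<in>G. measure N Q) \<le> K * (\<Sum>Q\<in>G. measure N (Q \<inter> E)) + B"
begin

interpretation finite_measure N by (rule fin_N)

text \<open>With \<open>E\<close> the complement of \<open>A\<close>, \<open>H\<close> bounds the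
  mass of the cubes by \<open>K\<close> times their mass outside \<open>A\<close>; solving for the
  mass inside \<open>A\<close> gives the factor \<open>1 - 1 / K\<close>. The inequality is first
  obtained for closed subcubes and then passed to the limit.\<close>

lemma half_open_family:
  assumes fin: "finite \<G>" and disj: "disjoint \<G>"
    and hc: "\<And>D. D \<in> \<G> \<Longrightarrow> \<exists>b s. 0 < s \<and> D = hcube b s"
    and sub: "\<And>D. D \<in> \<G> \<Longrightarrow> \<exists>Q\<in>F. D \<subseteq> Q"
    and A: "A \<in> sets lebesgue"
    and upper: "\<And>D. D \<in> \<G> \<Longrightarrow> measure lebesgue (A \<inter> D) \<le> 1 / 4 * measure lebesgue D"
  shows "(\<Sum>D\<in>\<G>. measure N (A \<inter> D)) \<le> (1 - 1 / K) * (\<Sum>D\<in>\<G>. measure N D) + B / K"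
proof -
  obtain b s where bs: "\<And>D. D \<in> \<G> \<Longrightarrow> 0 < s D \<and> D = hcube (b D) (s D)"
    using hc by metis
  have Ac: "- A \<in> sets lebesgue" using A sets.compl_sets[of A lebesgue] by (simp add: Compl_eq_Diff_UNIV)
  define S where "S m D = shrunk_cube (b D) (s D) m" for m D
  have S_sub: "S m D \<subseteq> D" and S_cube: "S m D \<in> cubes" if "D \<in> \<G>" for m D
    using shrunk_cube_subset[of "s D" "b D" m] shrunk_cube_in_cubes[of "s D" "b D" m] bs[OF that]
    by (simp_all add: S_def)
  have S_leb: "S m D \<in> sets lebesgue" if "D \<in> \<G>" for m D
    using cube_lebesgue[OF S_cube[OF that]] .
  have limN: "(\<lambda>m. measure N (S m D \<inter> X)) \<longlonglongrightarrow> measure N (D \<inter> X)"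
    if "D \<in> \<G>" "X \<in> sets lebesgue" for D X
    using measure_shrunk_cube_tendsto[OF fin_N sets_N conjunct1[OF bs[OF that(1)]] that(2), of "b D"] bs[OF that(1)]
    unfolding S_def by metis
  have "\<forall>\<^sub>F m in sequentially. measure lebesgue D / 2 < measure lebesgue (S m D)" if "D \<in> \<G>" for D
  proof (rule order_tendstoD(1))
    show "(\<lambda>m. measure lebesgue (S m D)) \<longlonglongrightarrow> measure lebesgue D"
      using measure_lebesgue_shrunk_cube_tendsto[OF conjunct1[OF bs[OF that]], of "b D"] bs[OF that]
      unfolding S_def by metis
    have "0 < measure lebesgue D" using bs[OF that] by (metis measure_hcube less_imp_le zero_less_power)
    then show "measure lebesgue D / 2 < measure lebesgue D" by simp
  qed
  then have ev: "\<forall>\<^sub>F m in sequentially. \<forall>D\<in>\<G>. measure lebesgue D / 2 < measure lebesgue (S m D)"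
    using fin by (simp add: eventually_ball_finite)
  have "\<forall>\<^sub>F m in sequentially. (\<Sum>D\<in>\<G>. measure N (S m D)) \<le>
      K * (\<Sum>D\<in>\<G>. measure N (S m D \<inter> - A)) + B"
    using ev
  proof eventually_elim
    case (elim m)
    have inj: "inj_on (S m) \<G>"
    proof (rule inj_onI)
      fix D E assume DE: "D \<in> \<G>" "E \<in> \<G>" "S m D = S m E"
      have "measure lebesgue (S m D) > 0" using measure_cube_pos[OF S_cube] DE by blast
      then have "S m D \<noteq> {}" by auto
      then have "D \<inter> E \<noteq> {}" using S_sub DE by blast
      then show "D = E" using disj DE by (auto simp: disjoint_def)
    qed
    have half: "measure lebesgue (S m D) / 2 \<le> measure lebesgue (S m D \<inter> - A)" if D: "D \<in> \<G>" for D
    proof -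
      have Dl: "D \<in> lmeasurable" using bs[OF D] hcube_lmeasurable by metis
      have AD: "A \<inter> D \<in> lmeasurable" using fmeasurable_Int_fmeasurable[OF Dl A] by (simp add: Int_commute)
      have "measure lebesgue (S m D \<inter> A) \<le> measure lebesgue (A \<inter> D)"
        using S_sub[OF D, of m] S_leb[OF D] A AD by (intro measure_mono_fmeasurable) auto
      \<comment> \<open>The density \<open>1/4\<close> is made for this: once the closed subcube has
        more than half of the measure of \<open>D\<close>, its part in \<open>A\<close> is at most
        half of it.\<close>
      also have "\<dots> \<le> measure lebesgue (S m D) / 2" using upper[OF D] elim D by fastforce
      finally have "measure lebesgue (S m D \<inter> A) \<le> measure lebesgue (S m D) / 2" .
      moreover have "measure lebesgue (S m D) = measure lebesgue (S m D \<inter> A) + measure lebesgue (S m D - A)"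
        using cube_lmeasurable[OF S_cube[OF D], of m] A by (rule measure_split)
      ultimately show ?thesis by (simp add: Diff_eq)
    qed
    have "(\<Sum>Q\<in>S m ` \<G>. measure N Q) \<le> K * (\<Sum>Q\<in>S m ` \<G>. measure N (Q \<inter> - A)) + B"
    proof (rule H)
      show "disjoint (S m ` \<G>)"
        unfolding disjoint_def
      proof (intro ballI impI)
        fix X Y assume "X \<in> S m ` \<G>" "Y \<in> S m ` \<G>" "X \<noteq> Y"
        then obtain D E where DE: "D \<in> \<G>" "E \<in> \<G>" "X = S m D" "Y = S m E" "D \<noteq> E" by blast
        then have "D \<inter> E = {}" using disj by (auto simp: disjoint_def)
        then show "X \<inter> Y = {}" using S_sub[OF DE(1), of m] S_sub[OF DE(2), of m] DE by blast
      qed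
      show "\<exists>Q\<in>F. Q' \<subseteq> Q" if "Q' \<in> S m ` \<G>" for Q'
        using that sub S_sub by (metis imageE order_trans)
      show "- A \<in> sets lebesgue" by (rule Ac)
    qed (use fin S_cube half in auto)
    then show ?case by (simp add: sum.reindex[OF inj])
  qed
  moreover have "(\<lambda>m. \<Sum>D\<in>\<G>. measure N (S m D)) \<longlonglongrightarrow> (\<Sum>D\<in>\<G>. measure N D)"
    using limN[of _ UNIV] by (intro tendsto_sum) auto
  moreover have "(\<lambda>m. K * (\<Sum>D\<in>\<G>. measure N (S m D \<inter> - A)) + B) \<longlonglongrightarrow>
      K * (\<Sum>D\<in>\<G>. measure N (D \<inter> - A)) + B"
    using limN[OF _ Ac] by (intro tendsto_intros)
  ultimately have le: "(\<Sum>D\<in>\<G>. measure N D) \<le> K * (\<Sum>D\<in>\<G>. measure N (D \<inter> - A)) + B"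
    by (intro tendsto_le[OF sequentially_bot])
  have "measure N (D \<inter> - A) = measure N D - measure N (A \<inter> D)" if "D \<in> \<G>" for D
    using finite_measure_Diff'[of D A] A bs[OF that] hcube_lebesgue sets_N
    by (metis Diff_eq Int_commute)
  then have split: "(\<Sum>D\<in>\<G>. measure N (D \<inter> - A)) = (\<Sum>D\<in>\<G>. measure N D) - (\<Sum>D\<in>\<G>. measure N (A \<inter> D))"
    by (simp add: sum_subtractf)
  have "K * (\<Sum>D\<in>\<G>. measure N (A \<inter> D)) \<le> (K - 1) * (\<Sum>D\<in>\<G>. measure N D) + B"
    using le[unfolded split] by (simp add: algebra_simps)
  then have "(\<Sum>D\<in>\<G>. measure N (A \<inter> D)) \<le> ((K - 1) * (\<Sum>D\<in>\<G>. measure N D) + B) / K"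
    using K by (subst pos_le_divide_eq) (auto simp: mult.commute)
  also have "\<dots> = (1 - 1 / K) * (\<Sum>D\<in>\<G>. measure N D) + B / K"
    using K by (simp add: diff_divide_distrib add_divide_distrib left_diff_distrib)
  finally show ?thesis .
qed

text \<open>\<open>A1\<close> is the union of the stopping cubes of \<open>A\<close> inside the
  members of \<open>F\<close>. The lower density bound limits its growth, the upper one permits
  \<open>half_open_family\<close>, and \<open>A\<close> lies in \<open>A1\<close> up to a null set.
  So the mass shrinks by a fixed factor, up to the error, in passing from \<open>A1\<close> back to
  \<open>A\<close>.\<close>

lemma one_step:
  assumes A: "A \<in> sets lebesgue"
    and small: "\<And>Q. Q \<in> F \<Longrightarrow> measure lebesgue (A \<inter> Q) \<le> 1 / 2 ^ (CARD('n) + 2) * measure lebesgue Q"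
  obtains A1 where "A1 \<in> sets lebesgue"
    "\<And>Q. Q \<in> F \<Longrightarrow> measure lebesgue (A1 \<inter> Q) \<le> 2 ^ (CARD('n) + 2) * measure lebesgue (A \<inter> Q)"
    "(\<Sum>Q\<in>F. measure N (A \<inter> Q)) \<le> (1 - 1 / K) * (\<Sum>Q\<in>F. measure N (A1 \<inter> Q)) + B / K"
proof -
  let ?c = "1 / 2 ^ (CARD('n) + 2) :: real"
  define good where "good Q \<D> \<longleftrightarrow> countable \<D> \<and> disjoint \<D> \<and> (\<forall>D\<in>\<D>. \<exists>b s. 0 < s \<and> D = hcube b s) \<and>
      (\<forall>D\<in>\<D>. D \<subseteq> Q) \<and> (\<forall>D\<in>\<D>. measure lebesgue (A \<inter> D) \<le> 1 / 4 * measure lebesgue D) \<and>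
      (\<forall>D\<in>\<D>. ?c * measure lebesgue D \<le> measure lebesgue (A \<inter> D)) \<and>
      A \<inter> Q - \<Union>\<D> \<in> null_sets lebesgue" for Q \<D>
  have "\<exists>\<D>. good Q \<D>" if Q: "Q \<in> F" for Q
  proof -
    obtain a l where al: "0 < l" "Q = cbox a (\<chi> i. a $ i + l)" using Q F cubesE by blast
    have hQ: "hcube a l \<subseteq> Q" using hcube_between al by blast
    have lmQ: "Q \<in> lmeasurable" using Q F cube_lmeasurable by blast
    have "measure lebesgue (A \<inter> hcube a l) \<le> measure lebesgue (A \<inter> Q)"
      using hQ A fmeasurable_Int_fmeasurable[OF lmQ A]
      by (intro measure_mono_fmeasurable) (auto simp: Int_commute)
    also have "\<dots> \<le> ?c * measure lebesgue (hcube a l)"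
      using small[OF Q] al measure_hcube[of l a] measure_cube[of l a] by simp
    finally have "measure lebesgue (A \<inter> hcube a l) \<le> ?c * measure lebesgue (hcube a l)" .
    from calderon_zygmund_set[OF al(1) A this] obtain \<D> where \<D>: "countable \<D>" "disjoint \<D>"
      "\<And>D. D \<in> \<D> \<Longrightarrow> \<exists>b s. 0 < s \<and> D = hcube b s"
      "\<And>D. D \<in> \<D> \<Longrightarrow> D \<subseteq> hcube a l"
      "\<And>D. D \<in> \<D> \<Longrightarrow> measure lebesgue (A \<inter> D) \<le> 1 / 4 * measure lebesgue D"
      "\<And>D. D \<in> \<D> \<Longrightarrow> ?c * measure lebesgue D \<le> measure lebesgue (A \<inter> D)"
      "A \<inter> hcube a l - \<Union>\<D> \<in> null_sets lebesgue" by blast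
    have "\<Union>\<D> \<in> sets lebesgue"
      using \<D>(1,3) hcube_lebesgue by (intro sets.countable_Union) blast+
    then have "A \<inter> Q - \<Union>\<D> \<in> null_sets lebesgue"
      using A lmQ by (intro null_sets_subset[OF null_sets.Un[OF \<D>(7) cube_diff_hcube_null[of a l]]])
        (auto simp: al(2) intro!: sets.Diff sets.Int)
    then have "good Q \<D>" unfolding good_def using \<D>(1,2,3,5,6) \<D>(4)[THEN order_trans, OF _ hQ] by simp
    then show ?thesis ..
  qed
  then obtain \<D> where good: "\<And>Q. Q \<in> F \<Longrightarrow> good Q (\<D> Q)" by metis
  have \<D>: "\<And>Q. Q \<in> F \<Longrightarrow> countable (\<D> Q)" "\<And>Q. Q \<in> F \<Longrightarrow> disjoint (\<D> Q)"
      "\<And>Q D. Q \<in> F \<Longrightarrow> D \<in> \<D> Q \<Longrightarrow> \<exists>b s. 0 < s \<and> D = hcube b s"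
      "\<And>Q D. Q \<in> F \<Longrightarrow> D \<in> \<D> Q \<Longrightarrow> D \<subseteq> Q"
      "\<And>Q D. Q \<in> F \<Longrightarrow> D \<in> \<D> Q \<Longrightarrow> measure lebesgue (A \<inter> D) \<le> 1 / 4 * measure lebesgue D"
      "\<And>Q D. Q \<in> F \<Longrightarrow> D \<in> \<D> Q \<Longrightarrow> ?c * measure lebesgue D \<le> measure lebesgue (A \<inter> D)"
      "\<And>Q. Q \<in> F \<Longrightarrow> A \<inter> Q - \<Union>(\<D> Q) \<in> null_sets lebesgue"
    using good unfolding good_def by simp_all
  define \<U> where "\<U> = (\<Union>Q\<in>F. \<D> Q)"
  define A1 where "A1 = \<Union>\<U>"
  have Qleb: "Q \<in> sets lebesgue" if "Q \<in> F" for Q using cube_lebesgue F that by blast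
  have count: "countable \<U>" unfolding \<U>_def using F \<D>(1) by (intro countable_UN) (auto simp: countable_finite)
  have Ul: "D \<in> sets lebesgue" if "D \<in> \<U>" for D
    using that \<D>(3) hcube_lebesgue unfolding \<U>_def by blast
  have A1: "A1 \<in> sets lebesgue" unfolding A1_def using count Ul by (intro sets.countable_Union) blast+
  have disj: "disjoint \<U>"
    unfolding disjoint_def
  proof (intro ballI impI)
    fix X Y assume "X \<in> \<U>" "Y \<in> \<U>" "X \<noteq> Y"
    then obtain Q R where QR: "Q \<in> F" "R \<in> F" "X \<in> \<D> Q" "Y \<in> \<D> R" unfolding \<U>_def by blast
    show "X \<inter> Y = {}"
    proof (cases "Q = R")
      case True
      then show ?thesis using \<D>(2)[OF QR(1)] QR \<open>X \<noteq> Y\<close> by (auto simp: disjoint_def)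
    next
      case False
      then have "Q \<inter> R = {}" using F(3) QR by (auto simp: disjoint_def)
      then show ?thesis using \<D>(4)[OF QR(1,3)] \<D>(4)[OF QR(2,4)] by blast
    qed
  qed
  have A1Q: "A1 \<inter> Q = \<Union>(\<D> Q)" if "Q \<in> F" for Q
  proof -
    have "Q \<inter> R = {}" if "R \<in> F" "R \<noteq> Q" for R using F(3) that \<open>Q \<in> F\<close> by (auto simp: disjoint_def)
    then show ?thesis using \<D>(4) that unfolding A1_def \<U>_def by blast
  qed
  have m1: "measure lebesgue (A1 \<inter> Q) \<le> 2 ^ (CARD('n) + 2) * measure lebesgue (A \<inter> Q)" if Q: "Q \<in> F" for Q
  proof -
    have lm: "Q \<in> lmeasurable" using Q F cube_lmeasurable by blast
    have QA: "A \<inter> Q \<in> lmeasurable" "A1 \<inter> Q \<in> lmeasurable"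
      using fmeasurable_Int_fmeasurable[OF lm A] fmeasurable_Int_fmeasurable[OF lm A1] by (auto simp: Int_commute)
    have cnt: "countable (\<D> Q)" using \<D>(1) Q by blast
    have dj: "disjoint_family_on (\<lambda>E. E) (\<D> Q)" "disjoint_family_on (\<lambda>E. A \<inter> E) (\<D> Q)"
      using \<D>(2)[OF Q] by (auto simp: disjoint_family_on_def disjoint_def)
    have Dl: "D \<in> lmeasurable" if "D \<in> \<D> Q" for D using \<D>(3)[OF Q that] hcube_lmeasurable by metis
    have ADl: "A \<inter> D \<in> lmeasurable" if "D \<in> \<D> Q" for D
      using fmeasurable_Int_fmeasurable[OF Dl[OF that] A] by (auto simp: Int_commute)
    have le: "emeasure lebesgue D \<le> ennreal (2 ^ (CARD('n) + 2)) * emeasure lebesgue (A \<inter> D)" if "D \<in> \<D> Q" for D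
      using \<D>(6)[OF Q that] Dl[OF that] ADl[OF that]
      by (simp add: emeasure_eq_measure2 ennreal_mult[symmetric] ennreal_leI field_simps del: ennreal_power ennreal_numeral)
    have "emeasure lebesgue (A1 \<inter> Q) = (\<integral>\<^sup>+D. emeasure lebesgue D \<partial>count_space (\<D> Q))"
      using emeasure_UN_countable[OF _ cnt dj(1), of lebesgue] Dl unfolding A1Q[OF Q] by auto
    also have "\<dots> \<le> (\<integral>\<^sup>+D. ennreal (2 ^ (CARD('n) + 2)) * emeasure lebesgue (A \<inter> D) \<partial>count_space (\<D> Q))"
      by (rule nn_integral_mono) (use le in auto)
    also have "\<dots> = ennreal (2 ^ (CARD('n) + 2)) * (\<integral>\<^sup>+D. emeasure lebesgue (A \<inter> D) \<partial>count_space (\<D> Q))"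
      by (rule nn_integral_cmult) simp
    also have "(\<integral>\<^sup>+D. emeasure lebesgue (A \<inter> D) \<partial>count_space (\<D> Q)) = emeasure lebesgue (\<Union>D\<in>\<D> Q. A \<inter> D)"
      using emeasure_UN_countable[OF _ cnt dj(2), of lebesgue] ADl by auto
    also have "ennreal (2 ^ (CARD('n) + 2)) * emeasure lebesgue (\<Union>D\<in>\<D> Q. A \<inter> D) \<le>
        ennreal (2 ^ (CARD('n) + 2)) * emeasure lebesgue (A \<inter> Q)"
      using QA \<D>(4)[OF Q] by (intro mult_left_mono emeasure_mono) auto
    finally show ?thesis
      using QA by (simp add: emeasure_eq_measure2 ennreal_mult[symmetric] del: ennreal_power ennreal_numeral)
  qed
  have dF: "disjoint_family_on (\<lambda>Q. X \<inter> Q) F" for X using F(3) by (auto simp: disjoint_family_on_def disjoint_def)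
  have sumF: "(\<Sum>Q\<in>F. measure N (X \<inter> Q)) = measure N (X \<inter> \<Union>F)" if "X \<in> sets lebesgue" for X
  proof -
    have "(\<inter>) X ` F \<subseteq> sets N" using that Qleb sets_N by auto
    from finite_measure_finite_Union[OF F(1) this dF[of X]] show ?thesis by simp
  qed
  have UF: "\<Union>F \<in> sets lebesgue" using F(1) Qleb by blast
  have "A \<inter> \<Union>F - A1 \<in> null_sets lebesgue"
  proof -
    have "A \<inter> \<Union>F - A1 = (\<Union>Q\<in>F. A \<inter> Q - \<Union>(\<D> Q))" using A1Q by blast
    also have "\<dots> \<in> null_sets lebesgue" using F(1) \<D>(7) by (intro null_sets.finite_UN) auto
    finally show ?thesis .
  qed
  then have null: "A \<inter> \<Union>F - A1 \<in> null_sets N" by (rule null_N)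
  have "(\<Sum>Q\<in>F. measure N (A \<inter> Q)) = measure N (A \<inter> \<Union>F)" by (rule sumF[OF A])
  also have "\<dots> \<le> measure N ((A \<inter> A1) \<union> (A \<inter> \<Union>F - A1))"
    using A A1 UF sets_N by (intro finite_measure_mono) auto
  also have "\<dots> = measure N (A \<inter> A1)"
    using A A1 sets_N null by (intro measure_Un_null_set) auto
  also have "A \<inter> A1 = \<Union> ((\<inter>) A ` \<U>)" unfolding A1_def by blast
  \<comment> \<open>\<open>half_open_family\<close> is about finite families; the countable union of
    stopping cubes is reached by continuity of \<open>N\<close>.\<close>
  also have "measure N (\<Union> ((\<inter>) A ` \<U>)) \<le> (1 - 1 / K) * measure N A1 + B / K"
  proof (rule measure_Union_le)
    show "countable ((\<inter>) A ` \<U>)" using count by simp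
    show "(\<inter>) A ` \<U> \<subseteq> sets N" using A Ul sets_N by auto
    show "0 \<le> (1 - 1 / K) * measure N A1 + B / K" using K B by (intro add_nonneg_nonneg mult_nonneg_nonneg) auto
    fix \<G>' assume "finite \<G>'" "\<G>' \<subseteq> (\<inter>) A ` \<U>"
    then obtain \<G> where \<G>: "\<G> \<subseteq> \<U>" "finite \<G>" "\<G>' = (\<inter>) A ` \<G>" by (metis finite_subset_image)
    have "measure N (\<Union>\<G>') \<le> (\<Sum>D\<in>\<G>. measure N (A \<inter> D))"
      unfolding \<G>(3) using \<G> A Ul sets_N by (intro finite_measure_subadditive_finite) auto
    also have "\<dots> \<le> (1 - 1 / K) * (\<Sum>D\<in>\<G>. measure N D) + B / K"
    proof (rule half_open_family[OF \<G>(2) _ _ _ A])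
      show "disjoint \<G>" using disj \<G>(1) by (auto simp: disjoint_def)
    qed (use \<G>(1) \<D>(3,4,5) in \<open>unfold \<U>_def, blast+\<close>)
    also have "\<dots> \<le> (1 - 1 / K) * measure N A1 + B / K"
    proof -
      have "disjoint_family_on (\<lambda>D. D) \<G>" using disj \<G>(1) by (auto simp: disjoint_family_on_def disjoint_def)
      then have "(\<Sum>D\<in>\<G>. measure N D) = measure N (\<Union>D\<in>\<G>. D)"
        using \<G> Ul sets_N by (intro finite_measure_finite_Union[symmetric]) auto
      also have "\<dots> \<le> measure N A1" using \<G>(1) A1 sets_N unfolding A1_def by (intro finite_measure_mono) auto
      finally show ?thesis using K by (intro add_mono mult_left_mono) auto
    qed
    finally show "measure N (\<Union>\<G>') \<le> (1 - 1 / K) * measure N A1 + B / K" .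
  qed
  also have "measure N A1 = (\<Sum>Q\<in>F. measure N (A1 \<inter> Q))"
  proof -
    have "A1 \<inter> \<Union>F = A1" using \<D>(4) unfolding A1_def \<U>_def by blast
    then show ?thesis using sumF[OF A1] by simp
  qed
  finally show thesis using that[OF A1 m1] by blast
qed

text \<open>Each step enlarges the set in every cube by at most \<open>2 ^ (CARD('n) + 2)\<close>,
  so the assumed density leaves room for exactly \<open>k\<close> steps. The accumulated errors stay
  below \<open>K * B\<close> because
  \<open>(1 - 1 / K) * (K * B) + B / K \<le> K * B\<close>.\<close>

lemma iterate:
  assumes "A \<in> sets lebesgue"
    and "\<And>Q. Q \<in> F \<Longrightarrow> measure lebesgue (A \<inter> Q) \<le> (1 / 2 ^ (CARD('n) + 2)) ^ k * measure lebesgue Q"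
  shows "(\<Sum>Q\<in>F. measure N (A \<inter> Q)) \<le> (1 - 1 / K) ^ k * (\<Sum>Q\<in>F. measure N Q) + K * B"
  using assms
proof (induction k arbitrary: A)
  case 0
  have "(\<Sum>Q\<in>F. measure N (A \<inter> Q)) \<le> (\<Sum>Q\<in>F. measure N Q)"
    using F(2) cube_lebesgue sets_N by (intro sum_mono finite_measure_mono) auto
  then show ?case using K B by (simp add: add_increasing2)
next
  case (Suc k)
  define c :: real where "c = 1 / 2 ^ (CARD('n) + 2)"
  have c: "0 < c" "c \<le> 1" unfolding c_def by (simp_all add: divide_le_eq_1 one_le_power del: power_add power_Suc)
  have "measure lebesgue (A \<inter> Q) \<le> c * measure lebesgue Q" if "Q \<in> F" for Q
  proof -
    have "measure lebesgue (A \<inter> Q) \<le> c ^ Suc k * measure lebesgue Q" using Suc.prems(2)[OF that] by (simp add: c_def)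
    also have "\<dots> \<le> c ^ 1 * measure lebesgue Q"
      using c by (intro mult_right_mono power_decreasing) auto
    finally show ?thesis by simp
  qed
  then obtain A1 where A1: "A1 \<in> sets lebesgue"
    "\<And>Q. Q \<in> F \<Longrightarrow> measure lebesgue (A1 \<inter> Q) \<le> 2 ^ (CARD('n) + 2) * measure lebesgue (A \<inter> Q)"
    "(\<Sum>Q\<in>F. measure N (A \<inter> Q)) \<le> (1 - 1 / K) * (\<Sum>Q\<in>F. measure N (A1 \<inter> Q)) + B / K"
    using one_step[OF Suc.prems(1)] unfolding c_def by blast
  have "(\<Sum>Q\<in>F. measure N (A1 \<inter> Q)) \<le> (1 - 1 / K) ^ k * (\<Sum>Q\<in>F. measure N Q) + K * B"
  proof (rule Suc.IH[OF A1(1)])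
    fix Q assume Q: "Q \<in> F"
    have "measure lebesgue (A1 \<inter> Q) \<le> 1 / c * (c ^ Suc k * measure lebesgue Q)"
      using A1(2)[OF Q] mult_left_mono[OF Suc.prems(2)[OF Q], of "2 ^ (CARD('n) + 2)"] by (simp add: c_def)
    then show "measure lebesgue (A1 \<inter> Q) \<le> (1 / 2 ^ (CARD('n) + 2)) ^ k * measure lebesgue Q"
      using c by (simp add: c_def)
  qed
  then have "(1 - 1 / K) * (\<Sum>Q\<in>F. measure N (A1 \<inter> Q)) \<le>
      (1 - 1 / K) * ((1 - 1 / K) ^ k * (\<Sum>Q\<in>F. measure N Q) + K * B)"
    using K by (intro mult_left_mono) auto
  also have "\<dots> = (1 - 1 / K) ^ Suc k * (\<Sum>Q\<in>F. measure N Q) + (K - 1) * B"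
    using K by (simp add: field_simps)
  finally have "(\<Sum>Q\<in>F. measure N (A \<inter> Q)) \<le> (1 - 1 / K) ^ Suc k * (\<Sum>Q\<in>F. measure N Q) + (K - 1) * B + B / K"
    using A1(3) by linarith
  moreover have "B / K \<le> B" using K B by (simp add: field_simps mult_le_cancel_left1)
  ultimately show ?case by (simp add: algebra_simps)
qed

end

section \<open>Averages and variable exponents\<close>

text \<open>Boundedness makes every integral over a set of finite measure exist, so that cube
  estimates can use real-valued integrals. Unbounded functions are reached by truncation at the very
  end.\<close>

definition bounded_measurable :: "(real ^ 'n \<Rightarrow> real) \<Rightarrow> bool" where
  "bounded_measurable f \<longleftrightarrow> f \<in> borel_measurable lebesgue \<and> (\<exists>C. \<forall>x. \<bar>f x\<bar> \<le> C)"

abbreviation I :: "(real ^ 'n) set \<Rightarrow> (real ^ 'n \<Rightarrow> real) \<Rightarrow> real" where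
  "I Q f \<equiv> set_lebesgue_integral lebesgue Q f"

definition avg :: "(real ^ 'n) set \<Rightarrow> (real ^ 'n \<Rightarrow> real) \<Rightarrow> real" where
  "avg Q f = I Q f / measure lebesgue Q"

lemma bm_measurable: "bounded_measurable f \<Longrightarrow> f \<in> borel_measurable lebesgue"
  by (simp add: bounded_measurable_def)

lemma bmI: "f \<in> borel_measurable lebesgue \<Longrightarrow> (\<And>x. \<bar>f x\<bar> \<le> C) \<Longrightarrow> bounded_measurable f"
  by (auto simp: bounded_measurable_def)

lemma bmE:
  assumes "bounded_measurable f"
  obtains C where "0 < C" "\<And>x. \<bar>f x\<bar> \<le> C"
proof -
  obtain C where "\<And>x. \<bar>f x\<bar> \<le> C" using assms by (auto simp: bounded_measurable_def)
  then show thesis by (intro that[of "max C 1"]) (auto simp: le_max_iff_disj)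
qed

lemma bm_const: "bounded_measurable (\<lambda>x. c)"
  by (rule bmI) auto

lemma bm_add: 
  assumes "bounded_measurable f" "bounded_measurable g" shows "bounded_measurable (\<lambda>x. f x + g x)"
proof -
  obtain C where C: "0 < C" "\<And>x. \<bar>f x\<bar> \<le> C" using bmE[OF assms(1)] by metis
  obtain D where D: "0 < D" "\<And>x. \<bar>g x\<bar> \<le> D" using bmE[OF assms(2)] by metis
  have "\<bar>f x + g x\<bar> \<le> C + D" for x
    using abs_triangle_ineq[of "f x" "g x"] C(2)[of x] D(2)[of x] by linarith
  then show ?thesis by (rule bmI[OF borel_measurable_add[OF assms[THEN bm_measurable]]])
qed

lemma bm_mult: 
  assumes "bounded_measurable f" "bounded_measurable g" shows "bounded_measurable (\<lambda>x. f x * g x)"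
proof -
  obtain C where C: "0 < C" "\<And>x. \<bar>f x\<bar> \<le> C" using bmE[OF assms(1)] by metis
  obtain D where D: "0 < D" "\<And>x. \<bar>g x\<bar> \<le> D" using bmE[OF assms(2)] by metis
  have "\<bar>f x * g x\<bar> \<le> C * D" for x unfolding abs_mult using C D by (intro mult_mono) auto
  then show ?thesis by (rule bmI[OF borel_measurable_times[OF assms[THEN bm_measurable]]])
qed

lemma bm_uminus: "bounded_measurable f \<Longrightarrow> bounded_measurable (\<lambda>x. - f x)"
  using bm_mult[OF bm_const[of "-1"], of f] by simp

lemma bm_diff: "bounded_measurable f \<Longrightarrow> bounded_measurable g \<Longrightarrow> bounded_measurable (\<lambda>x. f x - g x)"
  using bm_add[OF _ bm_uminus, of f g] by simp

lemma bm_indicator: "A \<in> sets lebesgue \<Longrightarrow> bounded_measurable (indicator A)"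
  by (rule bmI[of _ 1]) (auto simp: indicator_def)

lemma bm_sum: "(\<And>i. i \<in> S \<Longrightarrow> bounded_measurable (f i)) \<Longrightarrow> bounded_measurable (\<lambda>x. \<Sum>i\<in>S. f i x)"
  by (induction S rule: infinite_finite_induct) (auto intro: bm_const bm_add)

lemma bm_powr:
  assumes f: "bounded_measurable f" "\<And>x. 0 \<le> f x" and g: "bounded_measurable g" "\<And>x. 0 \<le> g x"
  shows "bounded_measurable (\<lambda>x. f x powr g x)"
proof -
  obtain C where C: "0 < C" "\<And>x. \<bar>f x\<bar> \<le> C" using bmE[OF f(1)] by metis
  obtain D where D: "0 < D" "\<And>x. \<bar>g x\<bar> \<le> D" using bmE[OF g(1)] by metis
  have "\<bar>f x powr g x\<bar> \<le> max 1 C powr D" for x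
  proof -
    have "f x powr g x \<le> max 1 C powr g x"
      using f(2)[of x] g(2)[of x] C(2)[of x] by (intro powr_mono2) auto
    also have "\<dots> \<le> max 1 C powr D" using D(2)[of x] by (intro powr_mono) auto
    finally show ?thesis by simp
  qed
  then show ?thesis by (rule bmI[OF powr_real_measurable[OF bm_measurable[OF f(1)] bm_measurable[OF g(1)]]])
qed

lemma bm_const_powr:
  assumes "0 < t" "bounded_measurable g" shows "bounded_measurable (\<lambda>x. t powr g x)"
proof -
  obtain D where D: "0 < D" "\<And>x. \<bar>g x\<bar> \<le> D" using bmE[OF assms(2)] by metis
  have "\<bar>t powr g x\<bar> \<le> max 1 t powr D + min 1 t powr (-D)" for x
  proof (cases "1 \<le> t")
    case True
    then have "t powr g x \<le> t powr D" using D(2)[of x] by (intro powr_mono) auto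
    then show ?thesis using True by (simp add: max_def add_increasing2)
  next
    case False
    then have "t powr g x \<le> t powr (-D)" using D(2)[of x] assms by (intro powr_mono') auto
    then show ?thesis using False by (simp add: min_def add_increasing)
  qed
  then show ?thesis by (rule bmI[OF powr_real_measurable[OF borel_measurable_const bm_measurable[OF assms(2)]]])
qed

lemma bm_set_integrable:
  assumes "bounded_measurable f" "S \<in> lmeasurable"
  shows "set_integrable lebesgue S f"
proof -
  obtain C where C: "0 < C" "\<And>x. \<bar>f x\<bar> \<le> C" using bmE[OF assms(1)] by metis
  have "set_integrable lebesgue S (\<lambda>x. C)"
    using assms(2) unfolding set_integrable_def fmeasurable_def
    by (intro integrable_scaleR_left integrable_real_indicator) auto
  then show ?thesis
  proof (rule set_integrable_bound)
    show "set_borel_measurable lebesgue S f"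
      unfolding set_borel_measurable_def using assms
      by (intro borel_measurable_scaleR borel_measurable_indicator bm_measurable) auto
    show "AE x in lebesgue. x \<in> S \<longrightarrow> norm (f x) \<le> norm C"
      using C order_trans[OF C(2) abs_ge_self] by (intro AE_I2) auto
  qed
qed

lemma I_mono:
  assumes "bounded_measurable f" "bounded_measurable g" "S \<in> lmeasurable" "\<And>x. x \<in> S \<Longrightarrow> f x \<le> g x"
  shows "I S f \<le> I S g"
  using assms by (intro set_integral_mono bm_set_integrable)

lemma I_add:
  assumes "bounded_measurable f" "bounded_measurable g" "S \<in> lmeasurable"
  shows "I S (\<lambda>x. f x + g x) = I S f + I S g"
  using assms by (intro set_integral_add bm_set_integrable)

lemma I_sum:
  assumes "\<And>i. i \<in> J \<Longrightarrow> bounded_measurable (f i)" "S \<in> lmeasurable"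
  shows "I S (\<lambda>x. \<Sum>i\<in>J. f i x) = (\<Sum>i\<in>J. I S (f i))"
  using assms(1)
  by (induction J rule: infinite_finite_induct)
     (auto simp: set_lebesgue_integral_def[where f = "\<lambda>x. 0"] I_add bm_sum assms(2))

lemma I_const: "S \<in> lmeasurable \<Longrightarrow> I S (\<lambda>x. c) = c * measure lebesgue S"
  by (subst set_integral_const) (auto simp: fmeasurable_def)

lemma I_nonneg: "(\<And>x. x \<in> S \<Longrightarrow> 0 \<le> f x) \<Longrightarrow> 0 \<le> I S f"
  unfolding set_lebesgue_integral_def by (intro integral_nonneg_AE AE_I2) (auto simp: indicator_def)

lemma I_indicator: "I S (\<lambda>x. f x * indicator T x) = I (S \<inter> T) f"
  unfolding set_lebesgue_integral_def by (intro Bochner_Integration.integral_cong) (auto simp: indicator_def)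

lemma I_cong: "(\<And>x. x \<in> S \<Longrightarrow> f x = g x) \<Longrightarrow> I S f = I S g"
  unfolding set_lebesgue_integral_def by (intro Bochner_Integration.integral_cong) (auto simp: indicator_def)

lemma I_subset:
  assumes "bounded_measurable f" "\<And>x. 0 \<le> f x" "S \<in> sets lebesgue" "T \<in> lmeasurable" "S \<subseteq> T"
  shows "I S f \<le> I T f"
proof -
  have "I S f = I T (\<lambda>x. f x * indicator S x)" using assms(5) by (simp add: I_indicator Int_absorb1)
  also have "\<dots> \<le> I T f"
    using assms by (intro I_mono bm_mult bm_indicator) (auto simp: indicator_def)
  finally show ?thesis .
qed

lemma fmeasurable_Int_sets: "S \<in> lmeasurable \<Longrightarrow> T \<in> sets lebesgue \<Longrightarrow> S \<inter> T \<in> lmeasurable"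
  by (rule fmeasurable_Int_fmeasurable)

text \<open>Cut off to \<open>S\<close>, which makes the measure finite although \<open>w\<close>
  need not be integrable on the whole space. Set integrals inherit continuity and subadditivity from
  it.\<close>

definition weighted :: "(real ^ 'n \<Rightarrow> real) \<Rightarrow> (real ^ 'n) set \<Rightarrow> (real ^ 'n) measure" where
  "weighted w S = density lebesgue (\<lambda>x. ennreal (w x * indicator S x))"

lemma sets_weighted [simp]: "sets (weighted w S) = sets lebesgue"
  by (simp add: weighted_def)

lemma weighted_emeasure:
  assumes "bounded_measurable w" "\<And>x. 0 \<le> w x" "S \<in> lmeasurable" "X \<in> sets lebesgue"
  shows "emeasure (weighted w S) X = ennreal (I (X \<inter> S) w)"
proof -
  have XS: "X \<inter> S \<in> lmeasurable" using fmeasurable_Int_sets[OF assms(3,4)] by (simp add: Int_commute)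
  have [measurable]: "w \<in> borel_measurable lebesgue" using assms(1) by (rule bm_measurable)
  have [measurable]: "S \<in> sets lebesgue" "X \<in> sets lebesgue" using assms by auto
  have "emeasure (weighted w S) X = (\<integral>\<^sup>+x. ennreal (w x * indicator S x) * indicator X x \<partial>lebesgue)"
    unfolding weighted_def by (rule emeasure_density) auto
  also have "\<dots> = (\<integral>\<^sup>+x. ennreal (indicator (X \<inter> S) x *\<^sub>R w x) \<partial>lebesgue)"
    by (intro nn_integral_cong) (auto simp: indicator_def)
  also have "\<dots> = ennreal (I (X \<inter> S) w)"
    unfolding set_lebesgue_integral_def
    using bm_set_integrable[OF assms(1) XS] assms(2)
    by (intro nn_integral_eq_integral) (auto simp: set_integrable_def)
  finally show ?thesis .
qed

lemma weighted_measure: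
  assumes "bounded_measurable w" "\<And>x. 0 \<le> w x" "S \<in> lmeasurable" "X \<in> sets lebesgue"
  shows "measure (weighted w S) X = I (X \<inter> S) w"
  unfolding measure_def weighted_emeasure[OF assms] using assms(2) by (simp add: I_nonneg)

lemma finite_measure_weighted:
  assumes "bounded_measurable w" "\<And>x. 0 \<le> w x" "S \<in> lmeasurable"
  shows "finite_measure (weighted w S)"
  using weighted_emeasure[OF assms, of UNIV] by (intro finite_measureI) (simp add: weighted_def)

lemma null_sets_weighted:
  assumes "bounded_measurable w" "S \<in> lmeasurable" "X \<in> null_sets lebesgue"
  shows "X \<in> null_sets (weighted w S)"
proof -
  have [measurable]: "w \<in> borel_measurable lebesgue" "S \<in> sets lebesgue" using assms by (auto dest: bm_measurable)
  have "AE x in lebesgue. x \<notin> X" using assms(3) by (rule AE_not_in)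
  then show ?thesis
    using assms(3) unfolding weighted_def by (subst null_sets_density_iff) auto
qed

lemma avg_mono:
  assumes "bounded_measurable f" "bounded_measurable g" "Q \<in> cubes" "\<And>x. x \<in> Q \<Longrightarrow> f x \<le> g x"
  shows "avg Q f \<le> avg Q g"
  unfolding avg_def using I_mono[OF assms(1,2) cube_lmeasurable[OF assms(3)] assms(4)] by (simp add: divide_right_mono)

lemma avg_add:
  assumes "bounded_measurable f" "bounded_measurable g" "Q \<in> cubes"
  shows "avg Q (\<lambda>x. f x + g x) = avg Q f + avg Q g"
  unfolding avg_def I_add[OF assms(1,2) cube_lmeasurable[OF assms(3)]] by (simp add: add_divide_distrib)

lemma avg_cmult: "avg Q (\<lambda>x. c * f x) = c * avg Q f"
  unfolding avg_def by simp

lemma avg_const: "Q \<in> cubes \<Longrightarrow> avg Q (\<lambda>x. c) = c"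
  unfolding avg_def using I_const[OF cube_lmeasurable, of Q c] measure_cube_pos[of Q] by simp

lemma avg_nonneg: "(\<And>x. x \<in> Q \<Longrightarrow> 0 \<le> f x) \<Longrightarrow> 0 \<le> avg Q f"
  unfolding avg_def by (simp add: I_nonneg)

lemma avg_cong: "(\<And>x. x \<in> Q \<Longrightarrow> f x = g x) \<Longrightarrow> avg Q f = avg Q g"
  unfolding avg_def using I_cong[of Q f g] by simp

lemma I_eq_avg: "Q \<in> cubes \<Longrightarrow> I Q f = measure lebesgue Q * avg Q f"
  unfolding avg_def using measure_cube_pos[of Q] by simp

text \<open>The right side is the tangent at \<open>m\<close> of the concave power with exponent
  \<open>\<theta>\<close>; averaging it is Jensen's inequality.\<close>

lemma powr_le_tangent:
  fixes X m :: real
  assumes "0 < X" "0 < m" "0 \<le> \<theta>" "\<theta> \<le> 1"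
  shows "X powr \<theta> \<le> (\<theta> * X + (1 - \<theta>) * m) * m powr (\<theta> - 1)"
proof -
  have "X powr \<theta> * m powr (1 - \<theta>) \<le> \<theta> * X + (1 - \<theta>) * m"
    using assms by (intro Youngs_inequality_0) auto
  then have "X powr \<theta> * m powr (1 - \<theta>) * m powr (\<theta> - 1) \<le> (\<theta> * X + (1 - \<theta>) * m) * m powr (\<theta> - 1)"
    by (intro mult_right_mono) auto
  moreover have "m powr (1 - \<theta>) * m powr (\<theta> - 1) = 1"
    using assms(2) by (simp add: powr_add[symmetric])
  ultimately show ?thesis by (simp add: mult.assoc)
qed

lemma avg_powr_le:
  assumes Q: "Q \<in> cubes" and X: "bounded_measurable X" "\<And>x. 0 < X x"
    and m: "avg Q X \<le> m" "0 < m" and \<theta>: "0 \<le> \<theta>" "\<theta> \<le> 1"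
  shows "avg Q (\<lambda>x. X x powr \<theta>) \<le> m powr \<theta>"
proof -
  have "avg Q (\<lambda>x. X x powr \<theta>) \<le> avg Q (\<lambda>x. (\<theta> * m powr (\<theta> - 1)) * X x + (1 - \<theta>) * m * m powr (\<theta> - 1))"
  proof (rule avg_mono[OF _ _ Q])
    show "bounded_measurable (\<lambda>x. X x powr \<theta>)"
      using X \<theta> by (intro bm_powr bm_const) (auto intro: less_imp_le)
    show "X x powr \<theta> \<le> (\<theta> * m powr (\<theta> - 1)) * X x + (1 - \<theta>) * m * m powr (\<theta> - 1)" for x
      using powr_le_tangent[OF X(2) m(2) \<theta>, of x] by (simp add: algebra_simps)
  qed (intro bm_add bm_mult bm_const X)
  also have "\<dots> = (\<theta> * m powr (\<theta> - 1)) * avg Q X + (1 - \<theta>) * m * m powr (\<theta> - 1)"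
    by (subst avg_add) (auto intro!: bm_mult bm_const X Q simp: avg_cmult avg_const[OF Q])
  also have "\<dots> \<le> (\<theta> * m powr (\<theta> - 1)) * m + (1 - \<theta>) * m * m powr (\<theta> - 1)"
    using m \<theta> by (intro add_right_mono mult_left_mono) auto
  also have "\<dots> = m powr (\<theta> - 1) * m powr 1" using m by (simp add: algebra_simps)
  also have "\<dots> = m powr \<theta>" unfolding powr_add[symmetric] by simp
  finally show ?thesis .
qed

section \<open>A pair of conjugate exponents with pointwise bounds\<close>

locale exponents =
  fixes p q :: "real ^ 'n \<Rightarrow> real" and a b a' b' :: real
  assumes p_meas: "p \<in> borel_measurable lebesgue"
    and a: "1 < a" "\<And>x. a \<le> p x" and b: "\<And>x. p x \<le> b"
    and a': "1 < a'" "\<And>x. a' \<le> q x" and b': "\<And>x. q x \<le> b'"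
    and q: "\<And>x. q x = p x / (p x - 1)"
begin

lemma p_gt_1: "1 < p x"
  using a less_le_trans by blast

lemma b_gt_1: "1 < b"
  using p_gt_1 b less_le_trans by blast

lemma p_eq: "p x = q x / (q x - 1)"
  using p_gt_1[of x] unfolding q by (simp add: field_simps)

lemma bm_p: "bounded_measurable p"
proof (rule bmI[OF p_meas])
  show "\<bar>p x\<bar> \<le> b" for x using p_gt_1[of x] b[of x] by linarith
qed

text \<open>Bounds for both exponents are part of the locale for the sake of this symmetry, which
  makes every result available for the conjugate exponent as well.\<close>

lemma dual: "exponents q p a' b' a b"
proof
  have "q = (\<lambda>x. p x / (p x - 1))" using q by auto
  then show "q \<in> borel_measurable lebesgue"
    using p_meas by simp
qed (use a a' b b' p_eq in auto)

lemma bm_powr_p: "0 < t \<Longrightarrow> bounded_measurable (\<lambda>x. t powr p x)"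
  by (rule bm_const_powr[OF _ bm_p])

lemma bm_fun_powr_p:
  assumes "bounded_measurable f" "\<And>x. 0 \<le> f x" "e \<le> 1"
  shows "bounded_measurable (\<lambda>x. f x powr (p x - e))"
proof (intro bm_powr assms bm_diff bm_p bm_const)
  show "0 \<le> p x - e" for x using assms(3) p_gt_1[of x] by simp
qed

lemma powr_p_mono_scale:
  assumes "1 \<le> c" "0 \<le> t" shows "(c * t) powr p x \<le> c powr b * t powr p x"
  using assms b[of x] by (simp add: powr_mult mult_right_mono powr_mono)

lemma powr_p_scale_down:
  assumes "1 \<le> c" "0 \<le> t" shows "c powr a * t powr p x \<le> (c * t) powr p x"
  using assms a(2)[of x] by (simp add: powr_mult mult_right_mono powr_mono)

lemma I_powr_p_pos: 
  assumes "Q \<in> cubes" "0 < t" shows "0 < I Q (\<lambda>x. t powr p x)"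
proof -
  have "min (t powr a) (t powr b) * measure lebesgue Q = I Q (\<lambda>x. min (t powr a) (t powr b))"
    by (simp only: I_const[OF cube_lmeasurable[OF assms(1)]])
  also have "\<dots> \<le> I Q (\<lambda>x. t powr p x)"
  proof (rule I_mono[OF bm_const bm_powr_p[OF assms(2)] cube_lmeasurable[OF assms(1)]])
    fix x
    show "min (t powr a) (t powr b) \<le> t powr p x"
    proof (cases "1 \<le> t")
      case True then show ?thesis using a(2)[of x] by (simp add: min.coboundedI1 powr_mono)
    next
      case False then show ?thesis using b[of x] assms(2) by (simp add: min.coboundedI2 powr_mono')
    qed
  qed
  finally show ?thesis using measure_cube_pos[OF assms(1)] assms(2) by (smt (verit) mult_pos_pos powr_gt_zero)
qed

lemma I_powr_scale_le:
  assumes "Q \<in> cubes" "1 \<le> c" "0 < t"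
  shows "I Q (\<lambda>x. (c * t) powr p x) \<le> c powr b * I Q (\<lambda>x. t powr p x)"
proof -
  have "I Q (\<lambda>x. (c * t) powr p x) \<le> I Q (\<lambda>x. c powr b * t powr p x)"
    using assms powr_p_mono_scale[of c t] by (intro I_mono bm_powr_p bm_mult bm_const cube_lmeasurable) auto
  then show ?thesis by simp
qed

lemma I_powr_scale_ge:
  assumes "Q \<in> cubes" "1 \<le> c" "0 < t"
  shows "c powr a * I Q (\<lambda>x. t powr p x) \<le> I Q (\<lambda>x. (c * t) powr p x)"
proof -
  have "I Q (\<lambda>x. c powr a * t powr p x) \<le> I Q (\<lambda>x. (c * t) powr p x)"
    using assms powr_p_scale_down[of c t] by (intro I_mono bm_powr_p bm_mult bm_const cube_lmeasurable) auto
  then show ?thesis by simp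
qed

lemma I_powr_mono:
  assumes "Q \<in> cubes" "0 < t" "t \<le> s"
  shows "I Q (\<lambda>x. t powr p x) \<le> I Q (\<lambda>x. s powr p x)"
  using assms p_gt_1 by (intro I_mono bm_powr_p cube_lmeasurable powr_mono2) (auto intro: less_imp_le less_trans[OF zero_less_one])

text \<open>Such a \<open>t\<close> is the reciprocal of the Luxemburg norm of the indicator of
  \<open>Q\<close> up to the factor 4. The slack replaces continuity of the modular in
  \<open>t\<close>.\<close>

lemma exists_norm_scale:
  assumes Q: "Q \<in> cubes"
  shows "\<exists>t>0. I Q (\<lambda>x. t powr p x) \<le> 1 \<and> 1 < I Q (\<lambda>x. (4 * t) powr p x)"
proof -
  define S where "S = {t. 0 < t \<and> I Q (\<lambda>x. t powr p x) \<le> 1}"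
  have m: "0 < measure lebesgue Q" using measure_cube_pos[OF Q] .
  have ne: "min 1 (1 / measure lebesgue Q) \<in> S"
  proof -
    let ?t = "min 1 (1 / measure lebesgue Q)"
    have t: "0 < ?t" "?t \<le> 1" using m by auto
    have "I Q (\<lambda>x. ?t powr p x) \<le> I Q (\<lambda>x. ?t)"
    proof (rule I_mono[OF bm_powr_p[OF t(1)] bm_const cube_lmeasurable[OF Q]])
      show "?t powr p x \<le> ?t" for x
        using powr_mono'[of 1 "p x" ?t] t p_gt_1[of x] by auto
    qed
    also have "\<dots> = ?t * measure lebesgue Q" by (rule I_const[OF cube_lmeasurable[OF Q]])
    also have "\<dots> \<le> 1 / measure lebesgue Q * measure lebesgue Q" using m by (intro mult_right_mono) auto
    finally show ?thesis using t m by (simp add: S_def)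
  qed
  have bd: "t \<le> max 1 (1 / measure lebesgue Q)" if "t \<in> S" for t
  proof (cases "t \<le> 1")
    case False
    have "t * measure lebesgue Q = I Q (\<lambda>x. t)" by (simp only: I_const[OF cube_lmeasurable[OF Q]])
    also have "\<dots> \<le> I Q (\<lambda>x. t powr p x)"
    proof (rule I_mono[OF bm_const bm_powr_p cube_lmeasurable[OF Q]])
      show "t \<le> t powr p x" for x using powr_mono[of 1 "p x" t] False p_gt_1[of x] by auto
    qed (use False in simp)
    also have "\<dots> \<le> 1" using that by (simp add: S_def)
    finally show ?thesis using m by (simp add: field_simps le_max_iff_disj)
  qed auto
  then have bdd: "bdd_above S" by (auto simp: bdd_above_def)
  have Sp: "0 < Sup S" using cSup_upper[OF ne bdd] m by (smt (verit, best) divide_pos_pos min_def)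
  then have "Sup S / 2 < Sup S" by simp
  then obtain t where t: "t \<in> S" "Sup S / 2 < t" using less_cSup_iff[OF _ bdd] ne by blast
  have "4 * t \<notin> S" using cSup_upper[OF _ bdd, of "4 * t"] t Sp by auto
  then show ?thesis using t by (intro exI[of _ t]) (auto simp: S_def)
qed

text \<open>Hoelder's inequality made pointwise. Where \<open>f x / t\<close> is at most
  \<open>\<kappa> * W x\<close> it contributes at most \<open>\<kappa> * C1 = 1 / 2\<close> to the
  average. Elsewhere the power \<open>p x - 1 - e\<close> of \<open>f x / t\<close> beats
  \<open>\<mu> * t powr (- p x)\<close> up to a constant, which bounds \<open>f x / t\<close> by a
  multiple of \<open>Z x / \<mu>\<close>. Since \<open>f / t\<close> has average at least 1, this
  second part carries at least \<open>1 / 2\<close>.\<close>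

lemma key_inequality:
  assumes Q: "Q \<in> cubes" and t: "0 < t" and \<mu>: "0 < \<mu>" and e: "0 \<le> e" "e < a - 1" "e \<le> 1"
    and f: "bounded_measurable f" "\<And>x. 0 \<le> f x" and tf: "t \<le> avg Q f"
    and C1: "1 \<le> C1" "avg Q (\<lambda>x. (\<mu> * t powr (- p x)) powr (1 / (p x - 1 - e))) \<le> C1"
  shows "\<mu> \<le> 2 * (2 * C1) powr (b - 1) * avg Q (\<lambda>x. t powr e * f x powr (p x - e))"
proof -
  define \<kappa> where "\<kappa> = 1 / (2 * C1)"
  have \<kappa>: "0 < \<kappa>" "\<kappa> \<le> 1" using C1 by (auto simp: \<kappa>_def)
  define W where "W x = (\<mu> * t powr (- p x)) powr (1 / (p x - 1 - e))" for x
  define Z where "Z x = t powr e * f x powr (p x - e)" for x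
  have r: "0 < p x - 1 - e" for x using a(2)[of x] e by linarith
  have bmW: "bounded_measurable W" unfolding W_def
  proof (intro bm_powr)
    show "bounded_measurable (\<lambda>x. \<mu> * t powr (- p x))"
      by (intro bm_mult bm_const bm_const_powr t bm_uminus bm_p)
    have "\<bar>1 / (p x - 1 - e)\<bar> \<le> 1 / (a - 1 - e)" for x
      using r[of x] a(2)[of x] e by (simp add: frac_le)
    then show "bounded_measurable (\<lambda>x. 1 / (p x - 1 - e))"
      by (rule bmI[rotated]) (use p_meas in measurable)
    show "0 \<le> \<mu> * t powr (- p x)" for x using \<mu> by simp
    show "0 \<le> 1 / (p x - 1 - e)" for x using r[of x] by simp
  qed
  have bmZ: "bounded_measurable Z" unfolding Z_def
    by (intro bm_mult bm_const bm_fun_powr_p f e)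
  have pt: "f x / t \<le> \<kappa> * W x + \<kappa> powr (1 - b) / \<mu> * Z x" for x
  proof (cases "f x / t \<le> \<kappa> * W x")
    case True
    then show ?thesis using \<mu> by (simp add: Z_def add_increasing2)
  next
    case False
    define r where "r = p x - 1 - e"
    define g where "g = f x / t"
    have r0: "0 < r" "r \<le> b - 1" using r[of x] b[of x] e by (auto simp: r_def)
    have g: "\<kappa> * W x < g" using False by (simp add: g_def)
    have W0: "0 < W x" using \<mu> t by (simp add: W_def)
    have g0: "0 < g" using g W0 \<kappa> by (meson less_trans mult_pos_pos)
    have "\<kappa> powr (b - 1) * (\<mu> * t powr (- p x)) \<le> \<kappa> powr r * (\<mu> * t powr (- p x))"
      using r0 \<kappa> \<mu> by (intro mult_right_mono powr_mono') auto
    also have "\<dots> = \<kappa> powr r * W x powr r"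
      using r0 \<mu> by (simp add: W_def r_def[symmetric] powr_powr)
    also have "\<dots> = (\<kappa> * W x) powr r" using \<kappa> W0 by (simp add: powr_mult)
    also have "\<dots> \<le> g powr r" using g r0 \<kappa> W0 by (intro powr_mono2) auto
    finally have "g * (\<kappa> powr (b - 1) * (\<mu> * t powr (- p x))) \<le> g * g powr r"
      using g0 by (intro mult_left_mono) auto
    also have "\<dots> = g powr (1 + r)" using g0 by (simp add: powr_add)
    also have "g powr (1 + r) = f x powr (p x - e) * t powr (e - p x)"
      using t f(2)[of x] powr_minus_divide[of t "p x - e"] by (simp add: g_def r_def powr_divide)
    finally have "g * (\<kappa> powr (b - 1) * (\<mu> * t powr (- p x))) \<le> f x powr (p x - e) * t powr (e - p x)" .
    then have "g * (\<kappa> powr (b - 1) * (\<mu> * t powr (- p x))) * t powr p x \<le> f x powr (p x - e) * t powr (e - p x) * t powr p x"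
      by (intro mult_right_mono) auto
    then have "g * (\<kappa> powr (b - 1) * \<mu>) \<le> Z x"
      using t by (simp add: Z_def mult.assoc powr_add[symmetric]) (simp add: mult_ac)
    then have "g \<le> \<kappa> powr (1 - b) / \<mu> * Z x"
      using \<kappa> \<mu> by (simp add: field_simps powr_diff)
    moreover have "0 \<le> \<kappa> * W x" using \<kappa> W0 by simp
    ultimately show ?thesis by (simp add: g_def)
  qed
  have "1 \<le> avg Q f / t" using tf t by simp
  also have "\<dots> = avg Q (\<lambda>x. f x / t)" using avg_cmult[of Q "1 / t" f] by simp
  also have "\<dots> \<le> avg Q (\<lambda>x. \<kappa> * W x + \<kappa> powr (1 - b) / \<mu> * Z x)"
  proof (rule avg_mono[OF _ _ Q pt])
    show "bounded_measurable (\<lambda>x. f x / t)" using bm_mult[OF f(1) bm_const, of "1 / t"] by simp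
  qed (intro bm_add bm_mult bm_const bmW bmZ)
  also have "\<dots> = \<kappa> * avg Q W + \<kappa> powr (1 - b) / \<mu> * avg Q Z"
    by (subst avg_add[OF _ _ Q]) (intro bm_mult bm_const bmW bmZ | simp only: avg_cmult)+
  also have "\<dots> \<le> \<kappa> * C1 + \<kappa> powr (1 - b) / \<mu> * avg Q Z"
    using C1(2) \<kappa> unfolding W_def[symmetric] by (intro add_right_mono mult_left_mono) auto
  also have "\<kappa> * C1 = 1 / 2" using C1 by (simp add: \<kappa>_def)
  finally have "1 / 2 \<le> \<kappa> powr (1 - b) / \<mu> * avg Q Z" by linarith
  then have "1 / 2 * (2 * \<mu>) \<le> \<kappa> powr (1 - b) / \<mu> * avg Q Z * (2 * \<mu>)"
    using \<mu> by (intro mult_right_mono) auto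
  then have "\<mu> \<le> 2 * \<kappa> powr (1 - b) * avg Q Z" using \<mu> by (simp add: mult_ac)
  moreover have "\<kappa> powr (1 - b) = (2 * C1) powr (b - 1)"
  proof -
    have "\<kappa> powr (1 - b) = inverse (\<kappa> powr (b - 1))" using powr_minus[of \<kappa> "b - 1"] by simp
    also have "\<kappa> powr (b - 1) = 1 / (2 * C1) powr (b - 1)" using C1 by (simp add: \<kappa>_def powr_divide)
    finally show ?thesis by simp
  qed
  ultimately show ?thesis unfolding Z_def by simp
qed

end

section \<open>Consequences of the A condition\<close>

text \<open>The A condition in terms of levels: \<open>t\<close> and \<open>s\<close> are, up to the
  factor 4, the reciprocals of the two norms of the indicator. This form avoids the norms and is
  symmetric in \<open>p\<close> and \<open>q\<close>.\<close>

definition local_condition :: "(real ^ 'n \<Rightarrow> real) \<Rightarrow> (real ^ 'n \<Rightarrow> real) \<Rightarrow> real \<Rightarrow> bool" where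
  "local_condition p q A \<longleftrightarrow>
     (\<forall>Q\<in>cubes. \<forall>t>0. \<forall>s>0. I Q (\<lambda>x. t powr p x) \<le> 1 \<longrightarrow> 1 < I Q (\<lambda>x. (4 * t) powr p x) \<longrightarrow>
        I Q (\<lambda>x. s powr q x) \<le> 1 \<longrightarrow> 1 < I Q (\<lambda>x. (4 * s) powr q x) \<longrightarrow>
        1 \<le> A * t * s * measure lebesgue Q)"

lemma local_condition_sym:
  assumes "local_condition p q A" shows "local_condition q p A"
  unfolding local_condition_def
proof (intro ballI allI impI)
  fix Q and t s :: real
  assume "Q \<in> cubes" "0 < t" "0 < s" "I Q (\<lambda>x. t powr q x) \<le> 1" "1 < I Q (\<lambda>x. (4 * t) powr q x)"
    "I Q (\<lambda>x. s powr p x) \<le> 1" "1 < I Q (\<lambda>x. (4 * s) powr p x)"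
  then have "1 \<le> A * s * t * measure lebesgue Q"
    using assms unfolding local_condition_def by blast
  then show "1 \<le> A * t * s * measure lebesgue Q" by (simp add: mult_ac)
qed

text \<open>On the logarithmic scale \<open>\<theta>\<close> is the position of \<open>t / c\<close>
  between 1 and \<open>t1\<close>. If \<open>t \<le> c\<close>, then \<open>\<theta> = 0\<close>
  suffices; otherwise \<open>t1 > 1\<close>, which the last disjunction records for
  \<open>large_levels\<close>.\<close>

lemma choose_exponent:
  fixes t c t1 :: real
  assumes "1 \<le> t" "t \<le> c * t1" "1 \<le> c" "0 < t1"
  shows "\<exists>\<theta>\<ge>0. \<theta> \<le> 1 \<and> t1 powr \<theta> \<le> t \<and> t \<le> c * t1 powr \<theta> \<and> (\<theta> = 0 \<or> 1 < t1)"
proof (cases "t \<le> c")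
  case True
  then show ?thesis using assms by (intro exI[of _ 0]) auto
next
  case False
  define u where "u = t / c"
  have u: "1 < u" "u \<le> t1" using False assms by (auto simp: u_def field_simps)
  then have t1: "1 < t1" by simp
  define \<theta> where "\<theta> = ln u / ln t1"
  have "t1 powr \<theta> = u" using u t1 by (simp add: \<theta>_def powr_def)
  moreover have "0 \<le> \<theta>" "\<theta> \<le> 1" using u t1 by (auto simp: \<theta>_def field_simps)
  moreover have "u \<le> t" "t = c * u" using assms by (auto simp: u_def field_simps mult_le_cancel_left1)
  ultimately show ?thesis using t1 by (intro exI[of _ \<theta>]) auto
qed

locale local_exponents = exponents p q a b a' b' for p q :: "real ^ 'n \<Rightarrow> real" and a b a' b' +
  fixes A :: real
  assumes A: "1 \<le> A" and local: "local_condition p q A"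
begin

lemma dual_local: "local_exponents q p a' b' a b A"
  using dual A local_condition_sym[OF local] by (simp add: local_exponents_def local_exponents_axioms_def)

text \<open>Jensen's inequality for the power \<open>\<theta>\<close>: the average of
  \<open>t powr p x\<close> is at most \<open>1 / |Q|\<close>.\<close>

lemma interpolated_avg:
  assumes Q: "Q \<in> cubes" and t: "0 < t" "I Q (\<lambda>x. t powr p x) \<le> 1" and \<theta>: "0 \<le> \<theta>" "\<theta> \<le> 1"
  shows "avg Q (\<lambda>x. (t powr \<theta>) powr p x) \<le> measure lebesgue Q powr (-\<theta>)"
proof -
  have m: "0 < measure lebesgue Q" using measure_cube_pos[OF Q] .
  have "avg Q (\<lambda>x. t powr p x) \<le> 1 / measure lebesgue Q"
    using t m unfolding avg_def by (intro divide_right_mono) auto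
  then have "avg Q (\<lambda>x. (t powr p x) powr \<theta>) \<le> (1 / measure lebesgue Q) powr \<theta>"
    using t m by (intro avg_powr_le[OF Q bm_powr_p _ _ _ \<theta>]) auto
  then show ?thesis using m by (simp add: powr_powr mult.commute powr_divide powr_minus_divide)
qed

lemma interpolated_product:
  assumes "0 < m" "0 < t" "0 < s" "1 \<le> A * t * s * m" "0 \<le> \<theta>" "\<theta> \<le> 1"
  shows "m powr (-\<theta>) \<le> A * t powr \<theta> * s powr \<theta>"
proof -
  have "m powr (-\<theta>) = (1 / m) powr \<theta>" using assms by (simp add: powr_divide powr_minus_divide)
  also have "\<dots> \<le> (A * t * s) powr \<theta>" using assms A by (intro powr_mono2) (auto simp: field_simps)
  also have "\<dots> = A powr \<theta> * (t powr \<theta> * s powr \<theta>)" using assms A by (simp add: powr_mult)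
  also have "\<dots> \<le> A powr 1 * (t powr \<theta> * s powr \<theta>)" using assms A by (intro mult_right_mono powr_mono) auto
  finally show ?thesis using A by (simp add: mult.assoc)
qed

text \<open>Because \<open>1 / (p x - 1) = q x - 1\<close> and \<open>p x * (q x - 1) = q x\<close>,
  the left side equals \<open>(\<mu> / t) powr q x / \<mu>\<close>. The weight of
  \<open>key_inequality\<close> is thus a modular density of the conjugate exponent at the level
  \<open>s\<close>.\<close>

lemma dual_weight_le:
  assumes "0 < \<mu>" "0 < t" "0 < s" "\<mu> \<le> A * t * s"
  shows "(\<mu> * t powr (- p x)) powr (1 / (p x - 1)) \<le> A powr b' / \<mu> * s powr q x"
proof -
  have p1: "p x - 1 \<noteq> 0" "0 < p x - 1" using p_gt_1[of x] by auto
  have e: "1 / (p x - 1) = q x - 1" "p x * (q x - 1) = q x"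
    using p1 unfolding q by (auto simp: field_simps)
  have "(\<mu> * t powr (- p x)) powr (1 / (p x - 1)) = \<mu> powr (q x - 1) * t powr (- (p x * (q x - 1)))"
    unfolding e(1) using assms by (simp add: powr_mult powr_powr)
  also have "\<dots> = (\<mu> / t) powr q x / \<mu>"
    unfolding e(2) using assms by (simp add: powr_diff powr_divide powr_minus field_simps)
  also have "\<dots> \<le> (A * s) powr q x / \<mu>"
    using assms A a'(1) a'(2)[of x] by (intro divide_right_mono powr_mono2) (auto simp: field_simps)
  also have "\<dots> \<le> (A powr b' * s powr q x) / \<mu>"
    using assms A b'[of x] by (intro divide_right_mono) (auto simp: powr_mult intro!: mult_right_mono powr_mono)
  finally show ?thesis by simp
qed

definition D\<^sub>0 where "D\<^sub>0 = 2 * (2 * A powr b') powr (b - 1)"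

text \<open>The levels \<open>t1\<close> and \<open>s1\<close> have modular averages at most
  \<open>1 / |Q|\<close> and satisfy the A condition. Their powers with exponent
  \<open>\<theta>\<close> have modular averages at most \<open>\<mu> = |Q| powr (- \<theta>)\<close>
  and satisfy \<open>\<mu> \<le> A * t * s\<close>, so \<open>key_inequality\<close> applies with
  \<open>e = 0\<close> and \<open>C1 = A powr b'\<close>.\<close>

lemma single_cube_interpolated:
  assumes Q: "Q \<in> cubes" and t1: "0 < t1" "I Q (\<lambda>x. t1 powr p x) \<le> 1" "1 < I Q (\<lambda>x. (4 * t1) powr p x)"
    and \<theta>: "0 \<le> \<theta>" "\<theta> \<le> 1" and f: "bounded_measurable f" "\<And>x. 0 \<le> f x"
    and tf: "t1 powr \<theta> \<le> avg Q f"
  shows "I Q (\<lambda>x. (t1 powr \<theta>) powr p x) \<le> D\<^sub>0 * I Q (\<lambda>x. f x powr p x)"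
proof -
  interpret dual: local_exponents q p a' b' a b A by (rule dual_local)
  obtain s1 where s1: "0 < s1" "I Q (\<lambda>x. s1 powr q x) \<le> 1" "1 < I Q (\<lambda>x. (4 * s1) powr q x)"
    using dual.exists_norm_scale[OF Q] by blast
  have AP: "1 \<le> A * t1 * s1 * measure lebesgue Q"
    using local Q t1 s1 unfolding local_condition_def by blast
  have m: "0 < measure lebesgue Q" using measure_cube_pos[OF Q] .
  define t where "t = t1 powr \<theta>"
  define s where "s = s1 powr \<theta>"
  define \<mu> where "\<mu> = measure lebesgue Q powr (-\<theta>)"
  have pos: "0 < t" "0 < s" "0 < \<mu>" using t1 s1 m by (auto simp: t_def s_def \<mu>_def)
  have \<mu>: "\<mu> \<le> A * t * s" unfolding \<mu>_def t_def s_def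
    by (rule interpolated_product[OF m t1(1) s1(1) AP \<theta>])
  have "avg Q (\<lambda>x. t powr p x) \<le> \<mu>" unfolding t_def \<mu>_def by (rule interpolated_avg[OF Q t1(1,2) \<theta>])
  also have "\<mu> \<le> 2 * (2 * A powr b') powr (b - 1) * avg Q (\<lambda>x. t powr 0 * f x powr (p x - 0))"
  proof (rule key_inequality[OF Q pos(1,3) _ _ _ f])
    show "1 \<le> A powr b'" using A dual.b_gt_1 by (simp add: ge_one_powr_ge_zero)
    have "avg Q (\<lambda>x. (\<mu> * t powr - p x) powr (1 / (p x - 1 - 0))) \<le> avg Q (\<lambda>x. A powr b' / \<mu> * s powr q x)"
    proof (rule avg_mono[OF _ _ Q])
      show "bounded_measurable (\<lambda>x. A powr b' / \<mu> * s powr q x)"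
        by (intro bm_mult bm_const dual.bm_powr_p pos)
      show le: "(\<mu> * t powr - p x) powr (1 / (p x - 1 - 0)) \<le> A powr b' / \<mu> * s powr q x" for x
        using dual_weight_le[OF pos(3,1,2) \<mu>] by simp
      have "\<bar>1 / (p x - 1 - 0)\<bar> \<le> 1 / (a - 1)" for x using a(1) a(2)[of x] by (simp add: frac_le)
      then have "bounded_measurable (\<lambda>x. 1 / (p x - 1 - 0))"
        by (rule bmI[rotated]) (use p_meas in measurable)
      moreover have "0 \<le> 1 / (p x - 1 - 0)" for x using p_gt_1[of x] by simp
      ultimately show "bounded_measurable (\<lambda>x. (\<mu> * t powr - p x) powr (1 / (p x - 1 - 0)))"
        using pos by (intro bm_powr bm_mult bm_const bm_const_powr bm_uminus bm_p) auto
    qed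
    also have "\<dots> = A powr b' / \<mu> * avg Q (\<lambda>x. s powr q x)" by (rule avg_cmult)
    also have "\<dots> \<le> A powr b' / \<mu> * \<mu>"
      using dual.interpolated_avg[OF Q s1(1,2) \<theta>] pos unfolding s_def \<mu>_def by (intro mult_left_mono) auto
    finally show "avg Q (\<lambda>x. (\<mu> * t powr - p x) powr (1 / (p x - 1 - 0))) \<le> A powr b'" using pos by simp
  qed (use a tf in \<open>auto simp: t_def\<close>)
  also have "\<dots> = D\<^sub>0 * avg Q (\<lambda>x. f x powr p x)" using pos by (simp add: D\<^sub>0_def)
  finally show ?thesis using m by (simp add: avg_def divide_le_cancel t_def)
qed

lemma D0_ge_1: "1 \<le> D\<^sub>0"
proof -
  interpret dual: local_exponents q p a' b' a b A by (rule dual_local)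
  have "1 \<le> A powr b'" using A dual.b_gt_1 by (simp add: ge_one_powr_ge_zero)
  then have "1 \<le> (2 * A powr b') powr (b - 1)" using b_gt_1 by (intro ge_one_powr_ge_zero) auto
  then show ?thesis by (simp add: D\<^sub>0_def)
qed

definition D\<^sub>1 where "D\<^sub>1 = 4 powr b * D\<^sub>0"

lemma D1_ge_1: "1 \<le> D\<^sub>1"
  using mult_mono[of 1 "4 powr b" 1 D\<^sub>0] D0_ge_1 b_gt_1 ge_one_powr_ge_zero[of 4 b] unfolding D\<^sub>1_def by simp

text \<open>Both alternatives of \<open>tQ\<close> place \<open>t\<close> between 1 and the natural
  level \<open>t1\<close> of the cube, up to the factor 4. Hence \<open>t\<close> is comparable to
  \<open>t1 powr \<theta>\<close> for some \<open>\<theta>\<close> in [0, 1].\<close>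

lemma single_cube:
  assumes Q: "Q \<in> cubes" and t: "0 < t"
    and tQ: "1 \<le> t \<and> I Q (\<lambda>x. t powr p x) \<le> 1 \<or> t \<le> 1 \<and> 1 \<le> I Q (\<lambda>x. t powr p x)"
    and f: "bounded_measurable f" "\<And>x. 0 \<le> f x" and tf: "t \<le> avg Q f"
  shows "I Q (\<lambda>x. t powr p x) \<le> D\<^sub>1 * I Q (\<lambda>x. f x powr p x)"
proof -
  obtain t1 where t1: "0 < t1" "I Q (\<lambda>x. t1 powr p x) \<le> 1" "1 < I Q (\<lambda>x. (4 * t1) powr p x)"
    using exists_norm_scale[OF Q] by blast
  have "\<exists>\<theta>\<ge>0. \<theta> \<le> 1 \<and> t1 powr \<theta> \<le> t \<and> t \<le> 4 * t1 powr \<theta>"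
  proof (cases "1 \<le> t \<and> I Q (\<lambda>x. t powr p x) \<le> 1")
    case True
    have "t \<le> 4 * t1"
    proof (rule ccontr)
      assume "\<not> t \<le> 4 * t1"
      then have "I Q (\<lambda>x. (4 * t1) powr p x) \<le> I Q (\<lambda>x. t powr p x)" using t1(1) by (intro I_powr_mono Q) auto
      then show False using True t1(3) by simp
    qed
    then show ?thesis using choose_exponent[of t 4 t1] True t1(1) by auto
  next
    case False
    then have t': "t \<le> 1" "1 \<le> I Q (\<lambda>x. t powr p x)" using tQ by auto
    \<comment> \<open>Otherwise scaling \<open>t\<close> up by \<open>t1 / t > 1\<close> would push
      the modular at level \<open>t1\<close> above 1.\<close>
    have "t1 \<le> t"
    proof (rule ccontr)
      assume "\<not> t1 \<le> t"
      then have c: "1 < t1 / t" using t by simp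
      have "(t1 / t) powr a * 1 \<le> (t1 / t) powr a * I Q (\<lambda>x. t powr p x)" using t' by (intro mult_left_mono) auto
      also have "\<dots> \<le> I Q (\<lambda>x. (t1 / t * t) powr p x)" using c t by (intro I_powr_scale_ge Q) auto
      also have "\<dots> \<le> 1" using t1(2) t by simp
      finally show False using c a(1) by (smt (verit, best) gr_one_powr)
    qed
    show ?thesis
    proof (cases "t = 1")
      case True
      then show ?thesis by (intro exI[of _ 0]) (use t1 in auto)
    next
      case False
      then have "t < 1" "t1 < 1" using t' \<open>t1 \<le> t\<close> by auto
      then have "t1 powr (ln t / ln t1) = t" "0 \<le> ln t / ln t1" "ln t / ln t1 \<le> 1"
        using t t1(1) \<open>t1 \<le> t\<close> by (auto simp: powr_def divide_le_eq zero_le_divide_iff)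
      then show ?thesis using t by (intro exI[of _ "ln t / ln t1"]) auto
    qed
  qed
  then obtain \<theta> where \<theta>: "0 \<le> \<theta>" "\<theta> \<le> 1" "t1 powr \<theta> \<le> t" "t \<le> 4 * t1 powr \<theta>" by blast
  have "I Q (\<lambda>x. t powr p x) \<le> I Q (\<lambda>x. (4 * t1 powr \<theta>) powr p x)"
    using \<theta> t by (intro I_powr_mono Q) auto
  also have "\<dots> \<le> 4 powr b * I Q (\<lambda>x. (t1 powr \<theta>) powr p x)"
    using t1 by (intro I_powr_scale_le Q) auto
  also have "\<dots> \<le> 4 powr b * (D\<^sub>0 * I Q (\<lambda>x. f x powr p x))"
    using \<theta> tf by (intro mult_left_mono single_cube_interpolated[OF Q t1 \<theta>(1,2) f]) auto
  finally show ?thesis by (simp add: D\<^sub>1_def)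
qed

end

text \<open>A discrete layer-cake bound: if \<open>v\<close> exceeds \<open>m\<close>, the term of
  the last level \<open>c ^ k * m\<close> below \<open>v\<close> alone dominates.\<close>

lemma power_levels:
  fixes v m c \<eta> :: real
  assumes m: "0 < m" "0 < v" and c: "1 < c" and \<eta>: "0 < \<eta>" and v: "v \<le> c ^ n * m"
  shows "v powr \<eta> \<le> m powr \<eta> * (1 + (\<Sum>k<n. (c powr \<eta>) ^ Suc k * (if c ^ k * m < v then 1 else 0)))"
proof (cases "v \<le> m")
  case True
  have "v powr \<eta> \<le> m powr \<eta> * 1" using m True \<eta> by (simp add: powr_mono2)
  also have "\<dots> \<le> m powr \<eta> * (1 + (\<Sum>k<n. (c powr \<eta>) ^ Suc k * (if c ^ k * m < v then 1 else 0)))"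
    using c by (intro mult_left_mono) (auto intro!: sum_nonneg)
  finally show ?thesis .
next
  case False
  define j where "j = (LEAST j. v \<le> c ^ j * m)"
  have j: "v \<le> c ^ j * m" unfolding j_def using v by (rule LeastI)
  have jn: "j \<le> n" unfolding j_def using v by (rule Least_le)
  have "j \<noteq> 0" using j False by (intro notI) simp
  then obtain k where k: "j = Suc k" by (cases j) auto
  have "c ^ k * m < v" using not_less_Least[of k "\<lambda>j. v \<le> c ^ j * m"] k j_def by simp
  have "v powr \<eta> \<le> (c ^ Suc k * m) powr \<eta>" using j k m \<eta> by (intro powr_mono2) auto
  also have "\<dots> = m powr \<eta> * (c powr \<eta>) ^ Suc k"
    using c m by (simp add: powr_mult powr_realpow[symmetric] powr_powr mult.commute del: power_Suc)
  also have "(c powr \<eta>) ^ Suc k = (\<Sum>i\<in>{k}. (c powr \<eta>) ^ Suc i * (if c ^ i * m < v then 1 else 0))"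
    using \<open>c ^ k * m < v\<close> by simp
  also have "\<dots> \<le> (\<Sum>i<n. (c powr \<eta>) ^ Suc i * (if c ^ i * m < v then 1 else 0))"
    using k jn by (intro sum_mono2) auto
  also have "\<dots> \<le> 1 + (\<Sum>i<n. (c powr \<eta>) ^ Suc i * (if c ^ i * m < v then 1 else 0))" by simp
  finally show ?thesis using m by (simp add: mult_left_mono)
qed

section \<open>The reverse Hoelder inequality\<close>

context local_exponents
begin

text \<open>The factor \<open>2 powr b\<close> is the modular cost of the test function
  \<open>2 * t\<close> on \<open>E\<close>, which has average at least \<open>t\<close> as soon as
  \<open>E\<close> fills half of the cube.\<close>

definition K\<^sub>1 where "K\<^sub>1 = D\<^sub>1 * 2 powr b"

lemma K1_gt_1: "1 < K\<^sub>1"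
proof -
  have "1 < 2 powr b" using b_gt_1 by (intro gr_one_powr) auto
  then have "1 * 1 < D\<^sub>1 * 2 powr b" using D1_ge_1 by (intro mult_le_less_imp_less) auto
  then show ?thesis by (simp add: K\<^sub>1_def)
qed

lemma avg_half_test:
  assumes Q: "Q \<in> cubes" and E: "E \<in> sets lebesgue" "measure lebesgue Q / 2 \<le> measure lebesgue (Q \<inter> E)" and t: "0 < t"
  shows "bounded_measurable (\<lambda>x. 2 * t * indicator E x)" "t \<le> avg Q (\<lambda>x. 2 * t * indicator E x)"
    "I Q (\<lambda>x. (2 * t * indicator E x) powr p x) \<le> 2 powr b * I (Q \<inter> E) (\<lambda>x. t powr p x)"
proof -
  have m: "0 < measure lebesgue Q" using measure_cube_pos[OF Q] .
  have lm: "Q \<inter> E \<in> lmeasurable" using cube_lmeasurable[OF Q] E(1) by (rule fmeasurable_Int_sets)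
  show "bounded_measurable (\<lambda>x. 2 * t * indicator E x)" using E by (intro bm_mult bm_const bm_indicator)
  have "I Q (\<lambda>x. 2 * t * indicator E x) = 2 * t * measure lebesgue (Q \<inter> E)"
    by (simp only: I_indicator I_const[OF lm])
  then show "t \<le> avg Q (\<lambda>x. 2 * t * indicator E x)"
    using E(2) m t by (simp add: avg_def pos_le_divide_eq)
  have "(2 * t * indicator E x) powr p x = (2 * t) powr p x * indicator E x" for x
    by (simp add: indicator_def)
  then have "I Q (\<lambda>x. (2 * t * indicator E x) powr p x) = I (Q \<inter> E) (\<lambda>x. (2 * t) powr p x)"
    by (simp only: I_indicator)
  also have "\<dots> \<le> I (Q \<inter> E) (\<lambda>x. 2 powr b * t powr p x)"
    using t powr_p_mono_scale[of 2 t] by (intro I_mono bm_mult bm_const bm_powr_p lm) auto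
  finally show "I Q (\<lambda>x. (2 * t * indicator E x) powr p x) \<le> 2 powr b * I (Q \<inter> E) (\<lambda>x. t powr p x)" by simp
qed

text \<open>The bound 1 on the modular passes to all subcubes and \<open>s \<ge> 1\<close>, so
  \<open>single_cube\<close> holds on each of them at the same level \<open>s\<close>. This is the
  hypothesis of \<open>a_infty_family\<close> for the family \<open>{Q}\<close> without
  error.\<close>

lemma local_decay:
  assumes Q: "Q \<in> cubes" and s: "1 \<le> s" "I Q (\<lambda>x. s powr p x) \<le> 1"
    and X: "X \<in> sets lebesgue" "measure lebesgue (X \<inter> Q) \<le> (1 / 2 ^ (CARD('n) + 2)) ^ k * measure lebesgue Q"
  shows "I (X \<inter> Q) (\<lambda>x. s powr p x) \<le> (1 - 1 / K\<^sub>1) ^ k * I Q (\<lambda>x. s powr p x)"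
proof -
  have s0: "0 < s" using s by simp
  note w = bm_powr_p[OF s0]
  have lmQ: "Q \<in> lmeasurable" using cube_lmeasurable[OF Q] .
  let ?N = "weighted (\<lambda>x. s powr p x) Q"
  have N: "measure ?N Y = I (Y \<inter> Q) (\<lambda>x. s powr p x)" if "Y \<in> sets lebesgue" for Y
    using that by (intro weighted_measure w lmQ) auto
  interpret a_infty_family ?N "{Q}" K\<^sub>1 0
  proof (rule a_infty_family.intro)
    show "finite_measure ?N" by (intro finite_measure_weighted w lmQ) auto
    show "Y \<in> null_sets ?N" if "Y \<in> null_sets lebesgue" for Y by (rule null_sets_weighted[OF w lmQ that])
  next
    fix G E assume G: "finite G" "disjoint G" "G \<subseteq> cubes" "\<And>Q'. Q' \<in> G \<Longrightarrow> \<exists>Q\<in>{Q}. Q' \<subseteq> Q"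
      and E: "E \<in> sets lebesgue" "\<And>Q. Q \<in> G \<Longrightarrow> measure lebesgue Q / 2 \<le> measure lebesgue (Q \<inter> E)"
    have "measure ?N R \<le> K\<^sub>1 * measure ?N (R \<inter> E)" if R: "R \<in> G" for R
    proof -
      have RQ: "R \<subseteq> Q" "R \<in> cubes" using G R by auto
      have "I R (\<lambda>x. s powr p x) \<le> I Q (\<lambda>x. s powr p x)"
        using RQ cube_lebesgue lmQ by (intro I_subset w) auto
      then have "I R (\<lambda>x. s powr p x) \<le> D\<^sub>1 * I R (\<lambda>x. (2 * s * indicator E x) powr p x)"
        using s s0 by (intro single_cube[OF RQ(2) s0] avg_half_test[OF RQ(2) E(1) E(2)[OF R] s0]) auto
      also have "\<dots> \<le> D\<^sub>1 * (2 powr b * I (R \<inter> E) (\<lambda>x. s powr p x))"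
        using D1_ge_1 by (intro mult_left_mono avg_half_test[OF RQ(2) E(1) E(2)[OF R] s0]) auto
      finally have "I R (\<lambda>x. s powr p x) \<le> K\<^sub>1 * I (R \<inter> E) (\<lambda>x. s powr p x)" by (simp add: K\<^sub>1_def)
      moreover have "R \<inter> Q = R" "R \<inter> E \<inter> Q = R \<inter> E" using RQ by auto
      ultimately show ?thesis using N[of R] N[of "R \<inter> E"] cube_lebesgue[OF RQ(2)] E(1) by simp
    qed
    then show "(\<Sum>Q\<in>G. measure ?N Q) \<le> K\<^sub>1 * (\<Sum>Q\<in>G. measure ?N (Q \<inter> E)) + 0"
      by (simp add: sum_distrib_left sum_mono)
  qed (use Q K1_gt_1 in \<open>auto simp: disjoint_def\<close>)
  have "(\<Sum>Q\<in>{Q}. measure ?N (X \<inter> Q)) \<le> (1 - 1 / K\<^sub>1) ^ k * (\<Sum>Q\<in>{Q}. measure ?N Q) + K\<^sub>1 * 0"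
    by (rule iterate[OF X(1)]) (use X(2) in simp)
  then show ?thesis using N[of "X \<inter> Q"] N[of Q] X(1) cube_lebesgue[OF Q] by (simp add: Int_assoc)
qed

text \<open>By Chebyshev's inequality the set where the weight exceeds \<open>c ^ k\<close> times
  its average has density at most \<open>(1 / c) ^ k\<close>, so by \<open>local_decay\<close> it
  carries at most \<open>\<rho> ^ k\<close> of the mass. With \<open>\<eta>\<close> so small that
  \<open>c powr \<eta> * \<rho> < 1\<close> the layers sum geometrically.\<close>

lemma reverse_hoelder:
  "\<exists>\<eta> C. 0 < \<eta> \<and> 1 \<le> C \<and> (\<forall>Q\<in>cubes. \<forall>s\<ge>1. I Q (\<lambda>x. s powr p x) \<le> 1 \<longrightarrow>
     avg Q (\<lambda>x. (s powr p x) powr (1 + \<eta>)) \<le> C * avg Q (\<lambda>x. s powr p x) powr (1 + \<eta>))"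
proof -
  define c :: real where "c = 2 ^ (CARD('n) + 2)"
  have c: "1 < c" unfolding c_def by (intro one_less_power) auto
  define \<rho> where "\<rho> = 1 - 1 / K\<^sub>1"
  have \<rho>: "0 \<le> \<rho>" "\<rho> < 1" using K1_gt_1 by (auto simp: \<rho>_def)
  define z where "z = 2 / (1 + \<rho>)"
  have z: "1 < z" "z * \<rho> < 1" using \<rho> by (auto simp: z_def field_simps)
  define \<eta> where "\<eta> = ln z / ln c"
  have \<eta>: "0 < \<eta>" "c powr \<eta> = z" using z c by (auto simp: \<eta>_def powr_def)
  define C where "C = 1 + z / (1 - z * \<rho>)"
  have C: "1 \<le> C" using z by (simp add: C_def)
  have "avg Q (\<lambda>x. (s powr p x) powr (1 + \<eta>)) \<le> C * avg Q (\<lambda>x. s powr p x) powr (1 + \<eta>)"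
    if Q: "Q \<in> cubes" and s: "1 \<le> s" "I Q (\<lambda>x. s powr p x) \<le> 1" for Q s
  proof -
    have s0: "0 < s" using s by simp
    define w where "w x = s powr p x" for x
    have bw: "bounded_measurable w" unfolding w_def by (rule bm_powr_p[OF s0])
    have wpos: "0 < w x" for x using s0 by (simp add: w_def)
    define m where "m = avg Q w"
    have mQ: "0 < measure lebesgue Q" using measure_cube_pos[OF Q] .
    have m: "0 < m" using I_powr_p_pos[OF Q s0] mQ unfolding m_def avg_def w_def by simp
    have Im: "I Q w = m * measure lebesgue Q" using mQ by (simp add: m_def avg_def)
    have "w x \<le> s powr b" for x using s b[of x] unfolding w_def by (intro powr_mono) auto
    moreover obtain n where "s powr b / m < c ^ n" using real_arch_pow[OF c] by blast
    ultimately have n: "w x \<le> c ^ n * m" for x using m by (smt (verit, ccfv_SIG) pos_divide_less_eq)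
    define X where "X k = {x. c ^ k * m < w x}" for k
    have X: "X k \<in> sets lebesgue" for k
      using bm_measurable[OF bw] unfolding X_def by (simp add: borel_measurable_iff_greater)
    have lm: "X k \<inter> Q \<in> lmeasurable" for k
      using fmeasurable_Int_sets[OF cube_lmeasurable[OF Q] X, of k] by (simp add: Int_commute)
    have dec: "I (X k \<inter> Q) w \<le> \<rho> ^ k * I Q w" for k
    proof -
      have "c ^ k * m * measure lebesgue (X k \<inter> Q) = I (X k \<inter> Q) (\<lambda>x. c ^ k * m)"
        by (simp only: I_const[OF lm])
      also have "\<dots> \<le> I (X k \<inter> Q) w" by (rule I_mono[OF bm_const bw lm]) (auto simp: X_def)
      also have "\<dots> \<le> I Q w" using wpos X cube_lmeasurable[OF Q] cube_lebesgue[OF Q]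
        by (intro I_subset bw) (auto intro: less_imp_le)
      also have "\<dots> = m * measure lebesgue Q" by (rule Im)
      finally have "c ^ k * measure lebesgue (X k \<inter> Q) \<le> measure lebesgue Q" using m by (simp add: mult_ac)
      then have "measure lebesgue (X k \<inter> Q) \<le> (1 / c) ^ k * measure lebesgue Q"
        using c by (simp add: power_one_over field_simps)
      then show ?thesis using local_decay[OF Q s X, of k k] unfolding c_def \<rho>_def w_def by simp
    qed
    have pt: "w x powr (1 + \<eta>) \<le> m powr \<eta> * (w x + (\<Sum>k<n. z ^ Suc k * (w x * indicator (X k) x)))" for x
    proof -
      have "w x powr (1 + \<eta>) = w x * w x powr \<eta>" using wpos[of x] by (simp add: powr_add)
      also have "\<dots> \<le> w x * (m powr \<eta> * (1 + (\<Sum>k<n. z ^ Suc k * (if c ^ k * m < w x then 1 else 0))))"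
        using power_levels[OF m wpos[of x] c \<eta>(1) n[of x]] wpos[of x] unfolding \<eta>(2) by (intro mult_left_mono) auto
      also have "(\<Sum>k<n. z ^ Suc k * (if c ^ k * m < w x then 1 else 0)) = (\<Sum>k<n. z ^ Suc k * indicator (X k) x)"
        by (intro sum.cong) (auto simp: X_def)
      finally show ?thesis by (simp add: algebra_simps sum_distrib_left)
    qed
    have bX: "bounded_measurable (\<lambda>x. z ^ Suc k * (w x * indicator (X k) x))" for k
      using X by (intro bm_mult bm_const bw bm_indicator)
    have bS: "bounded_measurable (\<lambda>x. \<Sum>k<n. z ^ Suc k * (w x * indicator (X k) x))"
      by (rule bm_sum) (rule bX)
    have "I Q (\<lambda>x. w x powr (1 + \<eta>)) \<le> I Q (\<lambda>x. m powr \<eta> * (w x + (\<Sum>k<n. z ^ Suc k * (w x * indicator (X k) x))))"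
    proof (rule I_mono[OF _ _ cube_lmeasurable[OF Q] pt])
      show "bounded_measurable (\<lambda>x. w x powr (1 + \<eta>))"
        using \<eta> wpos by (intro bm_powr bw bm_const) (auto intro: less_imp_le)
    qed (intro bm_mult bm_const bm_add bw bS)
    also have "\<dots> = m powr \<eta> * (I Q w + (\<Sum>k<n. z ^ Suc k * I (Q \<inter> X k) w))"
      by (simp only: set_integral_mult_right I_add[OF bw bS cube_lmeasurable[OF Q]]
          I_sum[OF bX cube_lmeasurable[OF Q]] I_indicator)
    also have "\<dots> \<le> m powr \<eta> * (I Q w + (\<Sum>k<n. z ^ Suc k * (\<rho> ^ k * I Q w)))"
      using dec z by (intro mult_left_mono add_left_mono sum_mono) (auto simp: Int_commute)
    also have "(\<Sum>k<n. z ^ Suc k * (\<rho> ^ k * I Q w)) = z * I Q w * (\<Sum>k<n. (z * \<rho>) ^ k)"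
      unfolding sum_distrib_left by (intro sum.cong) (auto simp: power_mult_distrib)
    also have "m powr \<eta> * (I Q w + z * I Q w * (\<Sum>k<n. (z * \<rho>) ^ k)) \<le>
        m powr \<eta> * (I Q w + z * I Q w * (1 / (1 - z * \<rho>)))"
    proof (intro mult_left_mono add_left_mono)
      show "(\<Sum>k<n. (z * \<rho>) ^ k) \<le> 1 / (1 - z * \<rho>)"
        using z \<rho> by (subst geometric_sum) (auto simp: field_simps divide_le_eq)
      show "0 \<le> z * I Q w" using z m mQ unfolding Im by simp
    qed simp
    also have "\<dots> = C * (m powr \<eta> * I Q w)" by (simp add: C_def algebra_simps)
    also have "\<dots> = C * m powr (1 + \<eta>) * measure lebesgue Q"
      unfolding Im using m by (simp add: powr_add)
    finally have "avg Q (\<lambda>x. w x powr (1 + \<eta>)) \<le> C * m powr (1 + \<eta>)"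
      using mQ by (simp add: avg_def pos_divide_le_eq)
    then show ?thesis unfolding m_def w_def by simp
  qed
  then show ?thesis using \<eta>(1) C by blast
qed

end

section \<open>Levels at least one\<close>

context exponents
begin

lemma young_p_q:
  assumes "0 \<le> u" "0 \<le> v" shows "u * v \<le> u powr p x + v powr q x"
proof -
  have p1: "1 < p x" "1 < q x" using p_gt_1[of x] a'(1) a'(2)[of x] by auto
  have "1 / p x + 1 / q x = 1" unfolding q using p1(1) by (simp add: field_simps)
  then have "u * v \<le> u powr p x / p x + v powr q x / q x"
    using p1 assms by (intro Youngs_inequality) auto
  also have "\<dots> \<le> u powr p x / 1 + v powr q x / 1"
    using p1 by (intro add_mono divide_left_mono) auto
  finally show ?thesis by simp
qed

lemma integral_young:
  assumes S: "S \<in> lmeasurable" and f: "bounded_measurable f" "\<And>x. 0 \<le> f x"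
    and g: "bounded_measurable g" "\<And>x. 0 \<le> g x"
  shows "I S (\<lambda>x. f x * g x) \<le> I S (\<lambda>x. f x powr p x) + I S (\<lambda>x. g x powr q x)"
proof -
  interpret dual: exponents q p a' b' a b by (rule dual)
  have bf: "bounded_measurable (\<lambda>x. f x powr p x)" using bm_fun_powr_p[OF f, of 0] by simp
  have bg: "bounded_measurable (\<lambda>x. g x powr q x)" using dual.bm_fun_powr_p[OF g, of 0] by simp
  have "I S (\<lambda>x. f x * g x) \<le> I S (\<lambda>x. f x powr p x + g x powr q x)"
    using f g by (intro I_mono bm_mult bm_add bf bg S young_p_q) auto
  then show ?thesis using I_add[OF bf bg S] by simp
qed

end

context local_exponents
begin

text \<open>For positive \<open>\<epsilon>\<close> the weight in \<open>key_inequality\<close> is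
  the power \<open>(p x - 1) / (p x - 1 - \<epsilon>)\<close> of the dual weight, and the reverse
  Hoelder inequality for \<open>q\<close> controls powers up to \<open>1 + \<eta>\<close>. That
  \<open>t\<close> does not exceed the natural level of the cube by more than a constant factor
  follows from the bound on the modular of \<open>f\<close>.\<close>

lemma large_levels:
  "\<exists>\<epsilon>\<^sub>0 D. 0 < \<epsilon>\<^sub>0 \<and> \<epsilon>\<^sub>0 \<le> 1 \<and> \<epsilon>\<^sub>0 < a - 1 \<and> 1 \<le> D \<and>
     (\<forall>\<epsilon> Q t f. 0 \<le> \<epsilon> \<longrightarrow> \<epsilon> \<le> \<epsilon>\<^sub>0 \<longrightarrow> Q \<in> cubes \<longrightarrow> 1 \<le> t \<longrightarrow> bounded_measurable f \<longrightarrow> (\<forall>x. 0 \<le> f x) \<longrightarrow>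
        I Q (\<lambda>x. f x powr p x) \<le> 1 \<longrightarrow> t \<le> avg Q f \<longrightarrow>
        I Q (\<lambda>x. t powr p x) \<le> D * I Q (\<lambda>x. t powr \<epsilon> * f x powr (p x - \<epsilon>)))"
proof -
  interpret dual: local_exponents q p a' b' a b A by (rule dual_local)
  obtain \<eta> C where \<eta>: "0 < \<eta>" and C: "1 \<le> C" and RH: "\<And>Q s. Q \<in> cubes \<Longrightarrow> 1 \<le> s \<Longrightarrow> I Q (\<lambda>x. s powr q x) \<le> 1 \<Longrightarrow>
     avg Q (\<lambda>x. (s powr q x) powr (1 + \<eta>)) \<le> C * avg Q (\<lambda>x. s powr q x) powr (1 + \<eta>)"
    using dual.reverse_hoelder by blast
  \<comment> \<open>The second entry is the largest \<open>\<epsilon>\<close> with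
    \<open>(a - 1) / (a - 1 - \<epsilon>) \<le> 1 + \<eta>\<close>; exponents above \<open>a\<close>
    are less demanding.\<close>
  define \<epsilon>\<^sub>0 where "\<epsilon>\<^sub>0 = min 1 ((a - 1) * \<eta> / (1 + \<eta>))"
  have e0: "0 < \<epsilon>\<^sub>0" "\<epsilon>\<^sub>0 \<le> 1" using a \<eta> by (auto simp: \<epsilon>\<^sub>0_def)
  have e1: "\<epsilon>\<^sub>0 * (1 + \<eta>) \<le> (a - 1) * \<eta>"
    using \<eta> min.cobounded2[of 1 "(a - 1) * \<eta> / (1 + \<eta>)"] unfolding \<epsilon>\<^sub>0_def[symmetric]
    by (simp add: pos_le_divide_eq)
  have "(a - 1) * \<eta> < (a - 1) * (1 + \<eta>)" using a \<eta> by simp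
  then have e2: "\<epsilon>\<^sub>0 < a - 1" using e1 \<eta> by (smt (verit, ccfv_SIG) mult_less_cancel_right)
  define C1 where "C1 = 1 + (A powr b') powr (1 + \<eta>) * (C * (4 powr b') powr (1 + \<eta>))"
  have C1: "1 \<le> C1" using C by (simp add: C1_def)
  define D where "D = (2 * A) powr b * (2 * (2 * C1) powr (b - 1))"
  have "1 * 1 \<le> (2 * A) powr b * (2 * (2 * C1) powr (b - 1))"
  proof (rule mult_mono)
    show "1 \<le> (2 * A) powr b" using A b_gt_1 by (intro ge_one_powr_ge_zero) auto
    have "1 \<le> (2 * C1) powr (b - 1)" using C1 b_gt_1 by (intro ge_one_powr_ge_zero) auto
    then show "1 \<le> 2 * (2 * C1) powr (b - 1)" by simp
  qed auto
  then have D: "1 \<le> D" by (simp add: D_def)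
  have main: "I Q (\<lambda>x. t powr p x) \<le> D * I Q (\<lambda>x. t powr \<epsilon> * f x powr (p x - \<epsilon>))"
    if e: "0 \<le> \<epsilon>" "\<epsilon> \<le> \<epsilon>\<^sub>0" and Q: "Q \<in> cubes" and t: "1 \<le> t" and f: "bounded_measurable f" "\<And>x. 0 \<le> f x"
      and fp: "I Q (\<lambda>x. f x powr p x) \<le> 1" and tf: "t \<le> avg Q f" for \<epsilon> Q t f
  proof -
    have m: "0 < measure lebesgue Q" using measure_cube_pos[OF Q] .
    have lm: "Q \<in> lmeasurable" using cube_lmeasurable[OF Q] .
    obtain t1 where t1: "0 < t1" "I Q (\<lambda>x. t1 powr p x) \<le> 1" "1 < I Q (\<lambda>x. (4 * t1) powr p x)"
      using exists_norm_scale[OF Q] by blast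
    obtain s1 where s1: "0 < s1" "I Q (\<lambda>x. s1 powr q x) \<le> 1" "1 < I Q (\<lambda>x. (4 * s1) powr q x)"
      using dual.exists_norm_scale[OF Q] by blast
    have AP: "1 \<le> A * t1 * s1 * measure lebesgue Q"
      using local Q t1 s1 unfolding local_condition_def by blast
    \<comment> \<open>Young's inequality against the constant \<open>s1\<close> gives
      \<open>t * s1 * |Q| \<le> 2\<close>; comparison with \<open>1 \<le> A * t1 * s1 * |Q|\<close>
      leaves \<open>t \<le> 2 * A * t1\<close>.\<close>
    have "I Q (\<lambda>x. f x * s1) \<le> I Q (\<lambda>x. f x powr p x) + I Q (\<lambda>x. s1 powr q x)"
      using s1(1) by (intro integral_young lm f bm_const) auto
    then have "I Q f * s1 \<le> 2" using fp s1(2) by simp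
    then have "avg Q f * (measure lebesgue Q * s1) \<le> 2" using I_eq_avg[OF Q, of f] by (simp add: mult_ac)
    then have "t * (measure lebesgue Q * s1) \<le> 2"
      using tf m s1 by (smt (verit, best) mult_right_mono mult_pos_pos)
    also have "2 \<le> 2 * A * t1 * (measure lebesgue Q * s1)" using AP by (simp add: mult_ac)
    finally have "t \<le> 2 * A * t1" using m s1(1) by (simp add: mult_le_cancel_right)
    then obtain \<theta> where \<theta>: "0 \<le> \<theta>" "\<theta> \<le> 1" "t1 powr \<theta> \<le> t" "t \<le> 2 * A * t1 powr \<theta>" "\<theta> = 0 \<or> 1 < t1"
      using choose_exponent[OF t, of "2 * A" t1] A t1(1) by auto
    define u where "u = t1 powr \<theta>"
    define s where "s = s1 powr \<theta>"
    define \<mu> where "\<mu> = measure lebesgue Q powr (-\<theta>)"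
    have pos: "0 < u" "0 < s" "0 < \<mu>" using t1 s1 m by (auto simp: u_def s_def \<mu>_def)
    have \<mu>: "\<mu> \<le> A * u * s" unfolding \<mu>_def u_def s_def
      by (rule interpolated_product[OF m t1(1) s1(1) AP \<theta>(1,2)])
    have e': "\<epsilon> < a - 1" "\<epsilon> \<le> 1" using e e0 e2 by auto
    have r: "0 < p x - 1 - \<epsilon>" for x using a(2)[of x] e' by linarith
    have bmE: "bounded_measurable (\<lambda>x. 1 / (p x - 1 - \<epsilon>))"
    proof (rule bmI)
      show "\<bar>1 / (p x - 1 - \<epsilon>)\<bar> \<le> 1 / (a - 1 - \<epsilon>)" for x
        using r[of x] a(2)[of x] e' by (simp add: frac_le)
    qed (use p_meas in measurable)
    have bmW: "bounded_measurable (\<lambda>x. (\<mu> * u powr - p x) powr (1 / (p x - 1 - \<epsilon>)))"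
      using pos r by (intro bm_powr bm_mult bm_const bm_const_powr bm_uminus bm_p bmE) (auto intro: less_imp_le)
    have W: "avg Q (\<lambda>x. (\<mu> * u powr - p x) powr (1 / (p x - 1 - \<epsilon>))) \<le> C1"
    proof (cases "\<theta> = 0")
      case True
      then have "(\<mu> * u powr - p x) powr (1 / (p x - 1 - \<epsilon>)) = 1" for x
        using t1(1) m by (simp add: \<mu>_def u_def)
      then show ?thesis using C1 avg_const[OF Q, of 1] by simp
    next
      case False
      then have t1': "1 < t1" using \<theta> by simp
      have Q1: "measure lebesgue Q \<le> 1"
      proof -
        have "1 * measure lebesgue Q = I Q (\<lambda>x. 1)" by (simp only: I_const[OF lm])
        also have "\<dots> \<le> I Q (\<lambda>x. t1 powr p x)"
          using t1' p_gt_1 by (intro I_mono bm_const bm_powr_p lm ge_one_powr_ge_zero)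
            (auto intro: less_imp_le less_trans[OF zero_less_one])
        finally show ?thesis using t1(2) by simp
      qed
      \<comment> \<open>From \<open>t1 > 1\<close> the cube has measure at most 1, so a level with
        modular above 1 for \<open>q\<close> must itself exceed 1.\<close>
      have s4: "1 < 4 * s1"
      proof (rule ccontr)
        assume "\<not> 1 < 4 * s1"
        then have "I Q (\<lambda>x. (4 * s1) powr q x) \<le> I Q (\<lambda>x. 1 powr q x)" using s1(1) by (intro dual.I_powr_mono Q) auto
        also have "\<dots> = measure lebesgue Q" using I_const[OF lm, of 1] by simp
        finally show False using s1(3) Q1 by simp
      qed
      have s4': "1 \<le> 4 * s"
      proof (cases "1 \<le> s1")
        case True then have "1 \<le> s" unfolding s_def using \<theta> by (intro ge_one_powr_ge_zero) auto
        then show ?thesis by simp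
      next
        case False then have "s1 powr 1 \<le> s1 powr \<theta>" using \<theta> s1(1) by (intro powr_mono') auto
        then show ?thesis using s4 s1(1) by (simp add: s_def)
      qed
      \<comment> \<open>\<open>reverse_hoelder\<close> asks for a level at least 1 whose modular is
        at most 1. As \<open>s \<ge> 1 / 4\<close>, raising it to 1 costs at most the factor
        4.\<close>
      define s' where "s' = max 1 s"
      have s': "1 \<le> s'" "s \<le> s'" "s' \<le> 4 * s" using s4' pos by (auto simp: s'_def)
      have Is': "I Q (\<lambda>x. s' powr q x) \<le> 1"
      proof (cases "s \<le> 1")
        case True then show ?thesis using Q1 I_const[OF lm, of 1] by (simp add: s'_def max_def)
      next
        case False
        have "1 < s1"
        proof (rule ccontr)
          assume "\<not> 1 < s1"
          then have "s \<le> 1" unfolding s_def using s1(1) \<theta> by (intro powr_le1) auto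
          then show False using False by simp
        qed
        then have "s \<le> s1 powr 1" unfolding s_def using \<theta> by (intro powr_mono) auto
        then have "I Q (\<lambda>x. s powr q x) \<le> I Q (\<lambda>x. s1 powr q x)" using pos s1(1) by (intro dual.I_powr_mono Q) auto
        then show ?thesis using False s1(2) by (simp add: s'_def max_def)
      qed
      have avs: "avg Q (\<lambda>x. s' powr q x) \<le> 4 powr b' * \<mu>"
      proof -
        have "I Q (\<lambda>x. s' powr q x) \<le> I Q (\<lambda>x. (4 * s) powr q x)" using s' by (intro dual.I_powr_mono Q) auto
        also have "\<dots> \<le> 4 powr b' * I Q (\<lambda>x. s powr q x)" using pos by (intro dual.I_powr_scale_le Q) auto
        finally have "avg Q (\<lambda>x. s' powr q x) \<le> 4 powr b' * avg Q (\<lambda>x. s powr q x)"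
          using m by (simp add: avg_def divide_right_mono)
        also have "\<dots> \<le> 4 powr b' * \<mu>"
          unfolding s_def \<mu>_def by (intro mult_left_mono dual.interpolated_avg Q s1(1,2) \<theta>) auto
        finally show ?thesis .
      qed
      define G where "G = (A powr b' / \<mu>) powr (1 + \<eta>)"
      have G: "0 \<le> G" by (simp add: G_def)
      have pt: "(\<mu> * u powr - p x) powr (1 / (p x - 1 - \<epsilon>)) \<le> 1 + G * (s' powr q x) powr (1 + \<eta>)" for x
      proof -
        define Z where "Z = (\<mu> * u powr - p x) powr (1 / (p x - 1))"
        have Z0: "0 < Z" using pos by (simp add: Z_def)
        have p1: "0 < p x - 1" using p_gt_1[of x] by simp
        have k: "0 \<le> (p x - 1) / (p x - 1 - \<epsilon>)" "(p x - 1) / (p x - 1 - \<epsilon>) \<le> 1 + \<eta>"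
        proof -
          show "0 \<le> (p x - 1) / (p x - 1 - \<epsilon>)" using r[of x] p1 by simp
          have "\<epsilon> * (1 + \<eta>) \<le> \<epsilon>\<^sub>0 * (1 + \<eta>)" using e \<eta> by (intro mult_right_mono) auto
          also have "\<dots> \<le> (a - 1) * \<eta>" by (rule e1)
          also have "\<dots> \<le> (p x - 1) * \<eta>" using a(2)[of x] \<eta> by (intro mult_right_mono) auto
          finally show "(p x - 1) / (p x - 1 - \<epsilon>) \<le> 1 + \<eta>" using r[of x] by (simp add: pos_divide_le_eq algebra_simps)
        qed
        have "(\<mu> * u powr - p x) powr (1 / (p x - 1 - \<epsilon>)) = Z powr ((p x - 1) / (p x - 1 - \<epsilon>))"
          using p1 by (simp add: Z_def powr_powr)
        also have "\<dots> \<le> 1 + Z powr (1 + \<eta>)"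
        proof (cases "Z \<le> 1")
          case True
          then have "Z powr ((p x - 1) / (p x - 1 - \<epsilon>)) \<le> 1" using Z0 k by (intro powr_le1) auto
          then show ?thesis by (simp add: add_increasing2)
        next
          case False
          then have "Z powr ((p x - 1) / (p x - 1 - \<epsilon>)) \<le> Z powr (1 + \<eta>)" using k by (intro powr_mono) auto
          then show ?thesis by simp
        qed
        also have "Z powr (1 + \<eta>) \<le> (A powr b' / \<mu> * s' powr q x) powr (1 + \<eta>)"
        proof (rule powr_mono2)
          have "Z \<le> A powr b' / \<mu> * s powr q x" unfolding Z_def by (rule dual_weight_le[OF pos(3,1,2) \<mu>])
          also have "\<dots> \<le> A powr b' / \<mu> * s' powr q x"
            using s' pos a'(1) a'(2)[of x] by (intro mult_left_mono powr_mono2) auto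
          finally show "Z \<le> A powr b' / \<mu> * s' powr q x" .
        qed (use \<eta> Z0 in auto)
        also have "\<dots> = G * (s' powr q x) powr (1 + \<eta>)"
          unfolding G_def using pos by (subst powr_mult) auto
        finally show ?thesis by simp
      qed
      have bs: "bounded_measurable (\<lambda>x. G * (s' powr q x) powr (1 + \<eta>))"
        using s' \<eta> by (intro bm_mult bm_const bm_powr dual.bm_powr_p) auto
      have "avg Q (\<lambda>x. (\<mu> * u powr - p x) powr (1 / (p x - 1 - \<epsilon>))) \<le> avg Q (\<lambda>x. 1 + G * (s' powr q x) powr (1 + \<eta>))"
        by (rule avg_mono[OF bmW bm_add[OF bm_const bs] Q pt])
      also have "\<dots> = 1 + G * avg Q (\<lambda>x. (s' powr q x) powr (1 + \<eta>))"
        by (simp only: avg_add[OF bm_const bs Q] avg_const[OF Q] avg_cmult)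
      also have "\<dots> \<le> 1 + G * (C * avg Q (\<lambda>x. s' powr q x) powr (1 + \<eta>))"
        using RH[OF Q s'(1) Is'] G by (intro add_left_mono mult_left_mono) auto
      also have "\<dots> \<le> 1 + G * (C * (4 powr b' * \<mu>) powr (1 + \<eta>))"
        using avs G C \<eta> by (intro add_left_mono mult_left_mono powr_mono2) (auto intro!: avg_nonneg)
      also have "\<dots> = 1 + (A powr b') powr (1 + \<eta>) * (C * (4 powr b') powr (1 + \<eta>))"
        using pos by (simp add: G_def powr_mult powr_divide)
      finally show ?thesis by (simp add: C1_def)
    qed
    have bmf: "bounded_measurable (\<lambda>x. c * f x powr (p x - \<epsilon>))" for c
      by (intro bm_mult bm_const bm_fun_powr_p f e')
    have "avg Q (\<lambda>x. u powr p x) \<le> \<mu>" unfolding u_def \<mu>_def by (rule interpolated_avg[OF Q t1(1,2) \<theta>(1,2)])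
    also have "\<mu> \<le> 2 * (2 * C1) powr (b - 1) * avg Q (\<lambda>x. u powr \<epsilon> * f x powr (p x - \<epsilon>))"
      using \<theta>(3) tf by (intro key_inequality[OF Q pos(1,3) e(1) e' f _ C1 W]) (auto simp: u_def)
    also have "\<dots> \<le> 2 * (2 * C1) powr (b - 1) * avg Q (\<lambda>x. t powr \<epsilon> * f x powr (p x - \<epsilon>))"
    proof (rule mult_left_mono[OF avg_mono[OF bmf bmf Q]])
      show "u powr \<epsilon> * f x powr (p x - \<epsilon>) \<le> t powr \<epsilon> * f x powr (p x - \<epsilon>)" for x
        using pos \<theta>(3) e by (intro mult_right_mono powr_mono2) (auto simp: u_def)
    qed auto
    finally have "I Q (\<lambda>x. u powr p x) \<le> 2 * (2 * C1) powr (b - 1) * I Q (\<lambda>x. t powr \<epsilon> * f x powr (p x - \<epsilon>))"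
      unfolding avg_def times_divide_eq_right using m by (simp only: divide_le_cancel)
    then have "(2 * A) powr b * I Q (\<lambda>x. u powr p x) \<le> D * I Q (\<lambda>x. t powr \<epsilon> * f x powr (p x - \<epsilon>))"
      unfolding D_def mult.assoc by (intro mult_left_mono) auto
    moreover have "I Q (\<lambda>x. t powr p x) \<le> I Q (\<lambda>x. (2 * A * u) powr p x)"
      using \<theta>(4) t by (intro I_powr_mono Q) (auto simp: u_def)
    moreover have "I Q (\<lambda>x. (2 * A * u) powr p x) \<le> (2 * A) powr b * I Q (\<lambda>x. u powr p x)"
      using A pos by (intro I_powr_scale_le Q) auto
    ultimately show ?thesis by linarith
  qed
  show ?thesis
    by (intro exI[of _ \<epsilon>\<^sub>0] exI[of _ D] conjI e0 e2 D allI impI main) auto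
qed

end

section \<open>Quantiles and small levels\<close>

text \<open>For positive \<open>h\<close>, such a \<open>\<beta>\<close> is the value at \<open>l\<close> times the measure of \<open>Q\<close> of the
  rearrangement of \<open>h\<close> restricted to \<open>Q\<close>.\<close>

definition upper_level :: "(real ^ 'n \<Rightarrow> real) \<Rightarrow> (real ^ 'n) set \<Rightarrow> real \<Rightarrow> real \<Rightarrow> bool" where
  "upper_level h Q l \<beta> \<longleftrightarrow> measure lebesgue (Q \<inter> {x. \<beta> < h x}) \<le> l * measure lebesgue Q \<and>
     (\<forall>y<\<beta>. l * measure lebesgue Q < measure lebesgue (Q \<inter> {x. y < h x}))"

text \<open>A quantile from below, expressed through \<open>- h\<close> so that the results on
  \<open>upper_level\<close> serve both sides.\<close>

definition lower_level :: "(real ^ 'n \<Rightarrow> real) \<Rightarrow> (real ^ 'n) set \<Rightarrow> real \<Rightarrow> real \<Rightarrow> bool" where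
  "lower_level h Q l \<alpha> \<longleftrightarrow> upper_level (\<lambda>x. - h x) Q l (- \<alpha>)"

lemma superlevel_lebesgue: "bounded_measurable h \<Longrightarrow> {x. y < h x} \<in> sets lebesgue"
  using bm_measurable[of h] by (simp add: borel_measurable_iff_greater)

text \<open>The infimum of the admissible heights is admissible, because
  \<open>{x. \<beta> < h x}\<close> is the increasing union of the superlevel sets at
  \<open>\<beta> + 1 / Suc n\<close>.\<close>

lemma exists_upper_level:
  assumes h: "bounded_measurable h" and Q: "Q \<in> cubes" and l: "0 < l" "l < 1"
  shows "\<exists>\<beta>. upper_level h Q l \<beta>"
proof -
  have mQ: "0 < measure lebesgue Q" using measure_cube_pos[OF Q] .
  have lm: "Q \<inter> {x. y < h x} \<in> lmeasurable" for y
    by (rule fmeasurable_Int_sets[OF cube_lmeasurable[OF Q] superlevel_lebesgue[OF h]])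
  obtain C where C: "0 < C" "\<And>x. \<bar>h x\<bar> \<le> C" using bmE[OF h] by metis
  define Y where "Y = {y. measure lebesgue (Q \<inter> {x. y < h x}) \<le> l * measure lebesgue Q}"
  have up: "z \<in> Y" if "y \<in> Y" "y \<le> z" for y z
  proof -
    have "measure lebesgue (Q \<inter> {x. z < h x}) \<le> measure lebesgue (Q \<inter> {x. y < h x})"
      using that(2) lm by (intro measure_mono_fmeasurable) (auto simp: fmeasurableD)
    then show ?thesis using that(1) by (simp add: Y_def)
  qed
  have "\<not> C < h x" for x using C(2)[of x] by linarith
  then have "{x. C < h x} = {}" by simp
  then have CY: "C \<in> Y" using l mQ by (simp add: Y_def)
  have lower: "- C - 1 \<le> y" if "y \<in> Y" for y
  proof (rule ccontr)
    assume "\<not> - C - 1 \<le> y"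
    then have "y < h x" for x using C(2)[of x] by (simp add: abs_le_iff)
    then have "measure lebesgue Q \<le> l * measure lebesgue Q" using that by (simp add: Y_def)
    then show False using mQ l by simp
  qed
  have bdd: "bdd_below Y" by (rule bdd_belowI[OF lower])
  define \<beta> where "\<beta> = Inf Y"
  have gt: "y \<in> Y" if "\<beta> < y" for y
  proof -
    have "Y \<noteq> {}" using CY by (rule ex_in_conv[THEN iffD1, OF exI])
    from cInf_lessD[OF this, of y] that obtain z where z: "z \<in> Y" "z < y" unfolding \<beta>_def by metis
    show ?thesis by (rule up[OF z(1) less_imp_le[OF z(2)]])
  qed
  have "measure lebesgue (Q \<inter> {x. \<beta> < h x}) \<le> l * measure lebesgue Q"
  proof -
    define A where "A n = Q \<inter> {x. \<beta> + 1 / Suc n < h x}" for n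
    have U: "(\<Union>n. A n) = Q \<inter> {x. \<beta> < h x}"
    proof
      show "(\<Union>n. A n) \<subseteq> Q \<inter> {x. \<beta> < h x}"
      proof
        fix x assume "x \<in> (\<Union>n. A n)"
        then obtain n where "x \<in> Q" "\<beta> + 1 / Suc n < h x" unfolding A_def by blast
        moreover have "0 < 1 / real (Suc n)" by simp
        ultimately have "x \<in> Q" "\<beta> < h x" by linarith+
        then show "x \<in> Q \<inter> {x. \<beta> < h x}" by simp
      qed
      show "Q \<inter> {x. \<beta> < h x} \<subseteq> (\<Union>n. A n)"
      proof
        fix x assume x: "x \<in> Q \<inter> {x. \<beta> < h x}"
        then obtain n where "1 / Suc n < h x - \<beta>" using nat_approx_posE[of "h x - \<beta>"] by auto
        then have "x \<in> A n" using x by (simp add: A_def)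
        then show "x \<in> (\<Union>n. A n)" by blast
      qed
    qed
    have "(\<lambda>n. measure lebesgue (A n)) \<longlonglongrightarrow> measure lebesgue (\<Union>n. A n)"
    proof (rule Lim_measure_incseq)
      show "range A \<subseteq> sets lebesgue" using lm by (auto simp: A_def fmeasurableD)
      have "1 / real (Suc n) \<le> 1 / real (Suc m)" if "m \<le> n" for m n using that by (simp add: frac_le)
      then show "incseq A" unfolding A_def incseq_def
        by (intro allI impI Int_mono order_refl Collect_mono) (smt (verit, best))
      show "emeasure lebesgue (\<Union>n. A n) \<noteq> \<infinity>" unfolding U using lm[of \<beta>] unfolding fmeasurable_def by auto
    qed
    moreover have "measure lebesgue (A n) \<le> l * measure lebesgue Q" for n
      using gt[of "\<beta> + 1 / Suc n"] unfolding A_def Y_def by (simp del: of_nat_Suc)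
    ultimately show ?thesis unfolding U by (meson LIMSEQ_le_const2)
  qed
  moreover have "l * measure lebesgue Q < measure lebesgue (Q \<inter> {x. y < h x})" if "y < \<beta>" for y
    using that cInf_lower[OF _ bdd, of y] unfolding \<beta>_def Y_def by (auto simp: not_le[symmetric])
  ultimately show ?thesis unfolding upper_level_def by blast
qed

lemma upper_level_bounds:
  assumes "upper_level h Q l \<beta>" "Q \<in> cubes" "0 < l" "l < 1" and h: "\<And>x. c \<le> h x" "\<And>x. h x \<le> d"
  shows "c \<le> \<beta>" "\<beta> \<le> d"
proof -
  have mQ: "0 < measure lebesgue Q" using measure_cube_pos[OF assms(2)] .
  show "c \<le> \<beta>"
  proof (rule ccontr)
    assume "\<not> c \<le> \<beta>"
    then have "Q \<inter> {x. \<beta> < h x} = Q" using h(1) by (auto simp: not_le intro: less_le_trans)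
    then have "measure lebesgue Q \<le> l * measure lebesgue Q" using assms(1) by (simp add: upper_level_def)
    then show False using mQ assms by simp
  qed
  show "\<beta> \<le> d"
  proof (rule ccontr)
    assume "\<not> \<beta> \<le> d"
    then have "l * measure lebesgue Q < measure lebesgue (Q \<inter> {x. d < h x})" using assms(1) by (simp add: upper_level_def)
    moreover have "{x. d < h x} = {}" using h(2) by (simp add: not_less)
    moreover have "0 < l * measure lebesgue Q" using mQ assms by simp
    ultimately show False by simp
  qed
qed

lemma lower_le_upper_level:
  assumes "lower_level h Q t \<alpha>" "upper_level h Q l \<beta>" "Q \<in> cubes" "t + l < 1" "bounded_measurable h"
  shows "\<alpha> \<le> \<beta>"
proof (rule ccontr)
  assume "\<not> \<alpha> \<le> \<beta>"
  then have "\<beta> < \<alpha>" by simp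
  then have "Q \<subseteq> Q \<inter> {x. - \<alpha> < - h x} \<union> Q \<inter> {x. \<beta> < h x}" by auto
  moreover have lm: "Q \<inter> {x. - \<alpha> < - h x} \<in> lmeasurable" "Q \<inter> {x. \<beta> < h x} \<in> lmeasurable"
    using fmeasurable_Int_sets[OF cube_lmeasurable[OF assms(3)] superlevel_lebesgue[OF assms(5)]]
      fmeasurable_Int_sets[OF cube_lmeasurable[OF assms(3)] superlevel_lebesgue[OF bm_uminus[OF assms(5)]]]
    by blast+
  ultimately have "measure lebesgue Q \<le> measure lebesgue (Q \<inter> {x. - \<alpha> < - h x} \<union> Q \<inter> {x. \<beta> < h x})"
    using cube_lebesgue[OF assms(3)] by (intro measure_mono_fmeasurable) auto
  also have "\<dots> \<le> measure lebesgue (Q \<inter> {x. - \<alpha> < - h x}) + measure lebesgue (Q \<inter> {x. \<beta> < h x})"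
    using lm by (intro measure_Un_le) (auto simp: fmeasurableD)
  also have "\<dots> \<le> t * measure lebesgue Q + l * measure lebesgue Q"
    using assms(1,2) unfolding lower_level_def upper_level_def by (intro add_mono) auto
  also have "\<dots> < 1 * measure lebesgue Q"
    using assms(4) measure_cube_pos[OF assms(3)] unfolding distrib_right[symmetric] by (intro mult_strict_right_mono)
  finally show False by simp
qed

text \<open>The layers between consecutive quantiles exhaust \<open>Q\<close> up to a null set,
  since the part above \<open>\<beta> j\<close> has measure at most
  \<open>\<gamma> / 2 ^ j * |Q|\<close>. If every layer carried less than its geometric share of the
  integral of \<open>g\<close>, the shares would add up to only half of it.\<close>

lemma layer_pigeonhole:
  fixes \<beta> :: "nat \<Rightarrow> real"
  assumes h: "bounded_measurable h" and Q: "Q \<in> cubes" and \<gamma>: "0 < \<gamma>" "\<gamma> < 1/2"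
    and \<beta>: "\<And>j. upper_level h Q (\<gamma> / 2 ^ j) (\<beta> j)"
    and g: "bounded_measurable g" "\<And>x. 0 \<le> g x" and pos: "0 < I Q g" and \<eta>: "0 < \<eta>"
  shows "\<exists>j S. S \<subseteq> Q \<and> S \<in> lmeasurable \<and> (\<forall>x\<in>S. h x \<le> \<beta> j) \<and>
     measure lebesgue S \<le> 1 / \<gamma> * (\<gamma> / 2 ^ j) * measure lebesgue Q \<and>
     (1 - 2 powr (-\<eta>)) / 2 * (\<gamma> / 2 ^ j) powr \<eta> * I Q g \<le> I S g"
proof -
  have mQ: "0 < measure lebesgue Q" using measure_cube_pos[OF Q] .
  have lmQ: "Q \<in> lmeasurable" using cube_lmeasurable[OF Q] .
  define B where "B j = {x. h x \<le> \<beta> j \<and> (\<forall>i. j = Suc i \<longrightarrow> \<beta> i < h x)}" for j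
  have sl: "{x. y < h x} \<in> sets lebesgue" for y by (rule superlevel_lebesgue[OF h])
  have B: "B j \<in> sets lebesgue" for j
  proof -
    have "B j = - {x. \<beta> j < h x} \<inter> (case j of 0 \<Rightarrow> UNIV | Suc i \<Rightarrow> {x. \<beta> i < h x})"
      by (auto simp: B_def split: nat.split)
    moreover have "- {x. \<beta> j < h x} \<in> sets lebesgue"
      using sl[of "\<beta> j"] sets.compl_sets[of _ lebesgue] by (auto simp: Compl_eq_Diff_UNIV)
    ultimately show ?thesis using sl by (auto split: nat.split)
  qed
  \<comment> \<open>Layer 0 may be all of \<open>Q\<close>, whence the factor
    \<open>1 / \<gamma>\<close>. For later layers \<open>\<gamma> < 1 / 2\<close> absorbs the shift
    from \<open>j\<close> to \<open>j - 1\<close>.\<close>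
  have mS: "measure lebesgue (Q \<inter> B j) \<le> 1 / \<gamma> * (\<gamma> / 2 ^ j) * measure lebesgue Q" for j
  proof (cases j)
    case 0
    have "measure lebesgue (Q \<inter> B j) \<le> measure lebesgue Q"
      using lmQ B by (intro measure_mono_fmeasurable) (auto simp: fmeasurableD)
    then show ?thesis using 0 \<gamma> by simp
  next
    case (Suc i)
    have "measure lebesgue (Q \<inter> B j) \<le> measure lebesgue (Q \<inter> {x. \<beta> i < h x})"
    proof (intro measure_mono_fmeasurable fmeasurable_Int_sets lmQ sl)
      show "Q \<inter> B j \<in> sets lebesgue" using B lmQ by auto
    qed (auto simp: B_def Suc)
    also have "\<dots> \<le> \<gamma> / 2 ^ i * measure lebesgue Q" using \<beta>[of i] by (simp add: upper_level_def)
    also have "\<dots> \<le> 1 / \<gamma> * (\<gamma> / 2 ^ j) * measure lebesgue Q"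
      using \<gamma> Suc mQ by (intro mult_right_mono) (auto simp: field_simps)
    finally show ?thesis .
  qed
  have null: "Q - (\<Union>j. B j) \<in> null_sets lebesgue"
  proof -
    have sub: "Q - (\<Union>j. B j) \<subseteq> Q \<inter> {x. \<beta> j < h x}" for j
    proof
      fix x assume x: "x \<in> Q - (\<Union>j. B j)"
      have "\<beta> j < h x" for j
      proof (induction j)
        case 0 show ?case using x by (auto simp: B_def not_le[symmetric] dest!: spec[of _ 0])
      next
        case (Suc j)
        show ?case
        proof (rule ccontr)
          assume "\<not> \<beta> (Suc j) < h x"
          then have "x \<in> B (Suc j)" using Suc by (auto simp: B_def)
          then show False using x by blast
        qed
      qed
      then show "x \<in> Q \<inter> {x. \<beta> j < h x}" using x by blast
    qed
    have set: "Q - (\<Union>j. B j) \<in> sets lebesgue" using B cube_lebesgue[OF Q] by auto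
    then have lm: "Q - (\<Union>j. B j) \<in> lmeasurable" using B by (intro fmeasurable_Diff lmQ) auto
    have le: "measure lebesgue (Q - (\<Union>j. B j)) \<le> \<gamma> * measure lebesgue Q * (1/2) ^ j" for j
    proof -
      have "measure lebesgue (Q - (\<Union>j. B j)) \<le> measure lebesgue (Q \<inter> {x. \<beta> j < h x})"
        using sub[of j] set sl lmQ by (intro measure_mono_fmeasurable fmeasurable_Int_sets)
      also have "\<dots> \<le> \<gamma> / 2 ^ j * measure lebesgue Q" using \<beta>[of j] by (simp add: upper_level_def)
      finally show ?thesis by (simp add: power_one_over field_simps)
    qed
    have "(\<lambda>j. \<gamma> * measure lebesgue Q * (1/2) ^ j) \<longlonglongrightarrow> \<gamma> * measure lebesgue Q * 0"
      by (intro tendsto_intros) auto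
    then have "measure lebesgue (Q - (\<Union>j. B j)) \<le> 0" using le by (intro LIMSEQ_le_const) auto
    then show ?thesis using lm set by (auto simp: null_sets_def emeasure_eq_measure2 measure_le_0_iff)
  qed
  define z where "z = 2 powr (-\<eta>)"
  have z: "0 < z" "z < 1" using \<eta> by (auto simp: z_def powr_less_one)
  have zj: "(\<gamma> / 2 ^ j) powr \<eta> \<le> z ^ j" for j
  proof -
    have "(\<gamma> / 2 ^ j) powr \<eta> \<le> (1 / 2 ^ j) powr \<eta>" using \<gamma> \<eta> by (intro powr_mono2 divide_right_mono) auto
    also have "\<dots> = z ^ j" by (simp add: z_def powr_divide powr_minus powr_realpow[symmetric] powr_powr mult.commute inverse_eq_divide)
    finally show ?thesis .
  qed
  let ?N = "weighted g Q"
  interpret N: finite_measure ?N by (rule finite_measure_weighted[OF g lmQ])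
  have N: "measure ?N X = I (X \<inter> Q) g" if "X \<in> sets lebesgue" for X by (rule weighted_measure[OF g lmQ that])
  have "\<exists>j. (1 - z) / 2 * z ^ j * I Q g \<le> I (Q \<inter> B j) g"
  proof (rule ccontr)
    assume "\<not> ?thesis"
    then have lt: "measure ?N (B j) \<le> (1 - z) / 2 * z ^ j * I Q g" for j
      using N[OF B, of j] by (simp add: not_le less_imp_le Int_commute)
    have summ: "summable (\<lambda>j. (1 - z) / 2 * z ^ j * I Q g)"
      using z by (intro summable_mult2 summable_mult summable_geometric) auto
    have summ': "summable (\<lambda>j. measure ?N (B j))"
      by (rule summable_comparison_test'[OF summ, of 0]) (use lt in auto)
    have "I Q g = measure ?N Q" using N[OF cube_lebesgue[OF Q]] by simp
    also have "\<dots> \<le> measure ?N ((\<Union>j. B j) \<union> (Q - (\<Union>j. B j)))"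
      using B cube_lebesgue[OF Q] by (intro N.finite_measure_mono) auto
    also have "\<dots> = measure ?N (\<Union>j. B j)"
      using B null_sets_weighted[OF g(1) lmQ null] by (intro measure_Un_null_set) auto
    also have "\<dots> \<le> (\<Sum>j. measure ?N (B j))"
      using B summ' by (intro N.finite_measure_subadditive_countably) auto
    also have "\<dots> \<le> (\<Sum>j. (1 - z) / 2 * z ^ j * I Q g)" by (intro suminf_le lt summ' summ)
    also have "\<dots> = (1 - z) / 2 * (1 / (1 - z)) * I Q g"
      using z by (intro sums_unique[symmetric] sums_mult2 sums_mult geometric_sums) auto
    also have "(1 - z) / 2 * (1 / (1 - z)) = 1 / 2" using z by (simp add: divide_eq_eq)
    finally show False using pos by simp
  qed
  then obtain j where j: "(1 - z) / 2 * z ^ j * I Q g \<le> I (Q \<inter> B j) g" by blast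
  have "(1 - z) / 2 * (\<gamma> / 2 ^ j) powr \<eta> * I Q g \<le> (1 - z) / 2 * z ^ j * I Q g"
    using zj z pos by (intro mult_right_mono mult_left_mono) auto
  then show ?thesis
    using j mS[of j] fmeasurable_Int_sets[OF lmQ B, of j]
    by (intro exI[of _ j] exI[of _ "Q \<inter> B j"]) (auto simp: z_def B_def)
qed

text \<open>Replaces Jensen's inequality when only a lower bound \<open>Y\<close> for the average is
  known: lowering \<open>f\<close> by \<open>Y / 2\<close> costs at most half of the integral, and
  where the result is positive \<open>f x powr (q - 1)\<close> is at least
  \<open>(Y / 2) powr (q - 1)\<close>.\<close>

lemma I_powr_lower_bound:
  fixes q :: real
  assumes S: "S \<in> lmeasurable" and f: "bounded_measurable f" "\<And>x. 0 \<le> f x"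
    and q: "1 \<le> q" and Y: "0 < Y" "Y * measure lebesgue S \<le> I S f"
  shows "(Y / 2) powr (q - 1) * (I S f / 2) \<le> I S (\<lambda>x. f x powr q)"
proof -
  have pt: "(Y / 2) powr (q - 1) * (f x - Y / 2) \<le> f x powr q" for x
  proof (cases "f x \<le> Y / 2")
    case True
    then have "(Y / 2) powr (q - 1) * (f x - Y / 2) \<le> 0" by (simp add: mult_nonneg_nonpos)
    then show ?thesis using powr_ge_zero[of "f x" q] by linarith
  next
    case False
    have "(Y / 2) powr (q - 1) * (f x - Y / 2) \<le> f x powr (q - 1) * f x"
      using False Y q by (intro mult_mono powr_mono2) auto
    also have "\<dots> = f x powr q" using False Y by (simp add: powr_mult_base mult.commute)
    finally show ?thesis .
  qed
  have bf: "bounded_measurable (\<lambda>x. f x - Y / 2)" by (intro bm_diff f bm_const)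
  have "I S f / 2 \<le> I S f - Y / 2 * measure lebesgue S" using Y(2) by simp
  also have "\<dots> = I S (\<lambda>x. f x - Y / 2)"
    using I_add[OF f(1) bm_const[of "- (Y / 2)"] S] I_const[OF S, of "- (Y / 2)"] by simp
  finally have "(Y / 2) powr (q - 1) * (I S f / 2) \<le> (Y / 2) powr (q - 1) * I S (\<lambda>x. f x - Y / 2)"
    by (intro mult_left_mono) auto
  also have "\<dots> = I S (\<lambda>x. (Y / 2) powr (q - 1) * (f x - Y / 2))" by simp
  also have "\<dots> \<le> I S (\<lambda>x. f x powr q)"
    using q by (intro I_mono bm_mult bm_const bf bm_powr f S pt) auto
  finally show ?thesis .
qed

lemma sum_power_le:
  fixes z :: real
  assumes "finite T" "0 \<le> z" "z < 1" shows "(\<Sum>i\<in>T. z ^ i) \<le> 1 / (1 - z)"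
proof -
  have "(\<Sum>i\<in>T. z ^ i) \<le> (\<Sum>i. z ^ i)" using assms by (intro sum_le_suminf) auto
  then show ?thesis using assms by (simp add: suminf_geometric)
qed

text \<open>The term of the cube sum condition in terms of the quantiles \<open>\<alpha>\<close>, \<open>\<beta>\<close> of the exponent:
  \<open>\<beta> / (\<beta> - \<alpha>)\<close> is \<open>1 + \<Psi>\<close> for \<open>p\<close> and \<open>\<alpha> (\<beta> - 1) / (\<beta> - \<alpha>)\<close> is \<open>1 + \<Psi>\<close> for the conjugate exponent.\<close>

definition gap_term :: "real \<Rightarrow> real \<Rightarrow> real \<Rightarrow> real \<Rightarrow> real" where
  "gap_term t l \<alpha> \<beta> = t powr (\<beta> / (\<beta> - \<alpha>)) * l powr (\<alpha> * (\<beta> - 1) / (\<beta> - \<alpha>))"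

text \<open>The cube sum condition for finite families, with both quantiles taken for
  \<open>p\<close> alone: a quantile from below at \<open>t\<close> takes the place of the
  rearrangement at \<open>1 - t\<close>, and the conjugate exponent has disappeared.\<close>

definition quantile_sum_condition :: "(real ^ 'n \<Rightarrow> real) \<Rightarrow> real \<Rightarrow> real \<Rightarrow> real \<Rightarrow> bool" where
  "quantile_sum_condition p r \<gamma> C \<longleftrightarrow>
     (\<forall>l t F \<alpha> \<beta>. 0 < l \<and> l < \<gamma> \<and> 0 < t \<and> t < \<gamma> \<and> finite F \<and> F \<subseteq> cubes \<and> disjoint F \<and>
        (\<forall>Q\<in>F. \<alpha> Q < \<beta> Q \<and> lower_level p Q t (\<alpha> Q) \<and> upper_level p Q l (\<beta> Q)) \<longrightarrow>
        (\<Sum>Q\<in>F. measure lebesgue Q * gap_term t l (\<alpha> Q) (\<beta> Q) powr (1 / r)) \<le> C)"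

text \<open>Solved for \<open>t\<close>, the assumption \<open>bad\<close> reads
  \<open>t powr (\<beta> - \<alpha>) < u powr (1 - \<kappa>)\<close> with
  \<open>u = \<tau> * \<nu> powr (\<beta> - 1)\<close>, and
  \<open>\<tau> * u powr (\<alpha> / (\<beta> - \<alpha>))\<close> is exactly
  \<open>gap_term\<close>. So the left side is at most \<open>gap_term\<close> to the power
  \<open>1 - \<kappa>\<close>. Splitting off its own power \<open>\<kappa>\<close> leaves the
  exponent \<open>(1 - \<kappa>) * (1 - \<kappa>) = 1 / r + \<delta>\<close>; the powers
  \<open>\<kappa>\<close> and \<open>\<delta>\<close> provide the spare factors.\<close>

lemma bad_level_estimate:
  fixes t \<tau> \<nu> \<alpha> \<beta> \<kappa> :: real
  assumes t: "0 < t" "t < 1" and \<tau>: "0 < \<tau>" "\<tau> < 1" and l: "0 < \<nu>" "\<nu> < 1"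
    and ab: "1 < \<alpha>" "\<alpha> \<le> \<beta>" and k: "0 < \<kappa>" "\<kappa> \<le> 1/2" and r: "1 / r + \<delta> = (1 - \<kappa>) * (1 - \<kappa>)" "0 < \<delta>" 
    and bad: "t powr \<beta> * \<nu> powr (- ((1 - \<kappa>) * (\<beta> - 1))) < \<tau> powr (1 - \<kappa>) * t powr \<alpha>"
  shows "\<alpha> < \<beta>" "\<tau> powr (1 - \<kappa>) * t powr \<alpha> \<le>
    \<tau> powr (\<kappa> / 2) * \<nu> powr \<delta> * t powr \<kappa> * gap_term \<tau> \<nu> \<alpha> \<beta> powr (1 / r)"
proof -
  show less: "\<alpha> < \<beta>"
  proof (rule ccontr)
    assume "\<not> \<alpha> < \<beta>"
    then have eq: "\<beta> = \<alpha>" using ab by simp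
    have "\<nu> powr 0 \<le> \<nu> powr (- ((1 - \<kappa>) * (\<beta> - 1)))" using l k ab by (intro powr_mono') auto
    then have "t powr \<beta> * 1 \<le> t powr \<beta> * \<nu> powr (- ((1 - \<kappa>) * (\<beta> - 1)))" using l by (intro mult_left_mono) auto
    moreover have "\<tau> powr (1 - \<kappa>) * t powr \<alpha> \<le> 1 * t powr \<alpha>" using \<tau> k by (intro mult_right_mono powr_le1) auto
    ultimately show False using bad unfolding eq by simp
  qed
  define u where "u = \<tau> * \<nu> powr (\<beta> - 1)"
  have u: "0 < u" using \<tau> l by (simp add: u_def)
  define h where "h = gap_term \<tau> \<nu> \<alpha> \<beta>"
  have h0: "0 < h" using \<tau> l by (simp add: h_def gap_term_def)
  have d: "0 < \<beta> - \<alpha>" using less by simp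
  \<comment> \<open>Thus \<open>gap_term\<close> is at most \<open>\<nu>\<close>, the source of the
    spare factor \<open>\<nu> powr \<delta>\<close>.\<close>
  have y1: "1 \<le> \<alpha> * (\<beta> - 1) / (\<beta> - \<alpha>)"
  proof -
    have "0 \<le> (\<alpha> - 1) * \<beta>" using ab by simp
    then show ?thesis using d by (simp add: pos_le_divide_eq algebra_simps)
  qed
  have hl: "h \<le> \<nu>"
  proof -
    have "h \<le> 1 * \<nu> powr 1" unfolding h_def gap_term_def
      using \<tau> l y1 ab d by (intro mult_mono powr_le1 powr_mono') auto
    then show ?thesis using l by simp
  qed
  define v where "v = \<nu> powr ((1 - \<kappa>) * (\<beta> - 1))"
  have v: "0 < v" "\<nu> powr (- ((1 - \<kappa>) * (\<beta> - 1))) = 1 / v" using l by (auto simp: v_def powr_minus_divide)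
  have "t powr \<beta> < \<tau> powr (1 - \<kappa>) * t powr \<alpha> * v"
    using bad v by (simp add: pos_divide_less_eq)
  moreover have "t powr \<beta> = t powr (\<beta> - \<alpha>) * t powr \<alpha>" by (simp add: powr_add[symmetric])
  ultimately have "t powr (\<beta> - \<alpha>) * t powr \<alpha> < \<tau> powr (1 - \<kappa>) * v * t powr \<alpha>" by (simp add: mult_ac)
  then have "t powr (\<beta> - \<alpha>) < \<tau> powr (1 - \<kappa>) * \<nu> powr ((1 - \<kappa>) * (\<beta> - 1))"
    using t by (simp add: v_def)
  also have "\<dots> = u powr (1 - \<kappa>)" using \<tau> l by (simp add: u_def powr_mult powr_powr mult.commute)
  finally have "(t powr (\<beta> - \<alpha>)) powr (\<alpha> / (\<beta> - \<alpha>)) \<le> (u powr (1 - \<kappa>)) powr (\<alpha> / (\<beta> - \<alpha>))"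
    using ab d by (intro powr_mono2) auto
  then have ta: "t powr \<alpha> \<le> u powr ((1 - \<kappa>) * (\<alpha> / (\<beta> - \<alpha>)))"
    using d by (simp add: powr_powr)
  define e where "e = \<tau> powr (1 - \<kappa>) * t powr \<alpha>"
  have e0: "0 < e" using \<tau> t by (simp add: e_def)
  have "e \<le> \<tau> powr (1 - \<kappa>) * u powr ((1 - \<kappa>) * (\<alpha> / (\<beta> - \<alpha>)))"
    unfolding e_def using ta by (intro mult_left_mono) auto
  also have "\<dots> = (\<tau> * u powr (\<alpha> / (\<beta> - \<alpha>))) powr (1 - \<kappa>)"
    using \<tau> u by (simp add: powr_mult powr_powr mult.commute)
  also have "\<tau> * u powr (\<alpha> / (\<beta> - \<alpha>)) = h"
  proof -
    have "\<tau> * u powr (\<alpha> / (\<beta> - \<alpha>)) = (\<tau> powr 1 * \<tau> powr (\<alpha> / (\<beta> - \<alpha>))) * \<nu> powr ((\<beta> - 1) * (\<alpha> / (\<beta> - \<alpha>)))"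
      using \<tau> l by (simp add: u_def powr_mult powr_powr)
    also have "\<tau> powr 1 * \<tau> powr (\<alpha> / (\<beta> - \<alpha>)) = \<tau> powr (\<beta> / (\<beta> - \<alpha>))"
      unfolding powr_add[symmetric] using d by (simp add: add_divide_eq_iff)
    finally show ?thesis by (simp add: h_def gap_term_def mult.commute)
  qed
  finally have eh: "e \<le> h powr (1 - \<kappa>)" .
  have "e = e powr \<kappa> * e powr (1 - \<kappa>)" using e0 by (simp add: powr_add[symmetric])
  also have "\<dots> \<le> (\<tau> powr (\<kappa> / 2) * t powr \<kappa>) * (h powr (1 / r) * \<nu> powr \<delta>)"
  proof (rule mult_mono)
    have "e powr \<kappa> = \<tau> powr ((1 - \<kappa>) * \<kappa>) * t powr (\<alpha> * \<kappa>)"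
      using \<tau> t by (simp add: e_def powr_mult powr_powr)
    also have "\<dots> \<le> \<tau> powr (\<kappa> / 2) * t powr \<kappa>"
    proof (intro mult_mono powr_mono')
      show "\<kappa> / 2 \<le> (1 - \<kappa>) * \<kappa>" using mult_right_mono[of "1/2" "1 - \<kappa>" \<kappa>] k by simp
      show "\<kappa> \<le> \<alpha> * \<kappa>" using ab k by (simp add: mult_le_cancel_right1)
    qed (use \<tau> t in auto)
    finally show "e powr \<kappa> \<le> \<tau> powr (\<kappa> / 2) * t powr \<kappa>" .
    have "e powr (1 - \<kappa>) \<le> (h powr (1 - \<kappa>)) powr (1 - \<kappa>)" using eh e0 k by (intro powr_mono2) auto
    also have "\<dots> = h powr (1 / r) * h powr \<delta>" using h0 by (simp add: powr_powr r(1)[symmetric] powr_add)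
    also have "\<dots> \<le> h powr (1 / r) * \<nu> powr \<delta>" using hl h0 r by (intro mult_left_mono powr_mono2) auto
    finally show "e powr (1 - \<kappa>) \<le> h powr (1 / r) * \<nu> powr \<delta>" .
  qed auto
  finally show "\<tau> powr (1 - \<kappa>) * t powr \<alpha> \<le>
    \<tau> powr (\<kappa> / 2) * \<nu> powr \<delta> * t powr \<kappa> * gap_term \<tau> \<nu> \<alpha> \<beta> powr (1 / r)"
    unfolding e_def h_def by (simp add: mult_ac)
qed

context exponents
begin

text \<open>Either the required inequality holds on the cube, or the exceptional part is controlled by a
  single term of the cube sum condition, with room to sum over \<open>i\<close>, \<open>j\<close> and the levels \<open>t\<close>.\<close>

lemma small_level_single_cube:
  assumes \<gamma>: "0 < \<gamma>" "\<gamma> < 1/2" and k: "0 < \<kappa>" "\<kappa> \<le> 1/2" and r: "1 / r + \<delta> = (1 - \<kappa>) * (1 - \<kappa>)" "0 < \<delta>"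
    and \<epsilon>: "0 \<le> \<epsilon>" "\<epsilon> \<le> 1" "\<epsilon> < a - 1" and \<eta>: "0 < \<eta>" "\<eta> \<le> \<kappa>" "\<epsilon> + \<eta> * b \<le> \<kappa> * (a - 1)"
    and c: "c = (1 - 2 powr (-\<eta>)) / 2"
    and Q: "Q \<in> cubes" and t: "0 < t" "t < 1"
    and f: "bounded_measurable f" "\<And>x. 0 \<le> f x" "\<And>x. f x \<le> 1" and tf: "t \<le> avg Q f"
    and \<alpha>: "\<And>i. lower_level p Q (\<gamma> / 2 ^ i) (\<alpha> i)" and \<beta>: "\<And>j. upper_level p Q (\<gamma> / 2 ^ j) (\<beta> j)"
  shows "avg Q (\<lambda>x. t powr p x) \<le> (2 / (\<gamma> * c)) * (2 / (\<gamma> * c)) powr b * avg Q (\<lambda>x. t powr \<epsilon> * f x powr (p x - \<epsilon>)) \<or>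
    (\<exists>i j. \<alpha> i < \<beta> j \<and> avg Q (\<lambda>x. t powr p x) \<le> 1 / (\<gamma> * c) * ((\<gamma> / 2 ^ i) powr (\<kappa> / 2) * (\<gamma> / 2 ^ j) powr \<delta> * t powr \<kappa> *
       gap_term (\<gamma> / 2 ^ i) (\<gamma> / 2 ^ j) (\<alpha> i) (\<beta> j) powr (1 / r)))"
proof -
  have mQ: "0 < measure lebesgue Q" using measure_cube_pos[OF Q] .
  have lmQ: "Q \<in> lmeasurable" using cube_lmeasurable[OF Q] .
  define z where "z = 2 powr (-\<eta>)"
  have z: "0 < z" "z < 1" using \<eta> powr_less_one[of 2 "-\<eta>"] by (auto simp: z_def)
  have c0: "0 < c" and c1: "c < 1" using z by (auto simp: c z_def[symmetric])
  note bt = bm_powr_p[OF t(1)]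
  have If: "t * measure lebesgue Q \<le> I Q f" using tf mQ by (simp add: avg_def pos_le_divide_eq)
  have "0 < t * measure lebesgue Q" using t mQ by simp
  then have Ifpos: "0 < I Q f" using If by linarith
  obtain j S where S: "S \<subseteq> Q" "S \<in> lmeasurable" "\<And>x. x \<in> S \<Longrightarrow> p x \<le> \<beta> j"
      "measure lebesgue S \<le> 1 / \<gamma> * (\<gamma> / 2 ^ j) * measure lebesgue Q"
      "c * (\<gamma> / 2 ^ j) powr \<eta> * I Q f \<le> I S f"
    using layer_pigeonhole[OF bm_p Q \<gamma> \<beta> f(1,2) Ifpos \<eta>(1)] unfolding c by blast
  obtain i T where T: "T \<subseteq> Q" "T \<in> lmeasurable" "\<And>x. x \<in> T \<Longrightarrow> - p x \<le> - \<alpha> i"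
      "measure lebesgue T \<le> 1 / \<gamma> * (\<gamma> / 2 ^ i) * measure lebesgue Q"
      "c * (\<gamma> / 2 ^ i) powr \<eta> * I Q (\<lambda>x. t powr p x) \<le> I T (\<lambda>x. t powr p x)"
    using layer_pigeonhole[OF bm_uminus[OF bm_p] Q \<gamma> \<alpha>[unfolded lower_level_def] bt _ I_powr_p_pos[OF Q t(1)] \<eta>(1)]
    unfolding c by (metis powr_ge_zero)
  define l where "l = \<gamma> / 2 ^ j"
  define \<tau> where "\<tau> = \<gamma> / 2 ^ i"
  have lle: "\<gamma> / 2 ^ m \<le> \<gamma>" "0 < \<gamma> / 2 ^ m" for m using \<gamma> by (auto simp: divide_le_eq mult_le_cancel_left1)
  have l: "0 < l" "l < 1/2" "0 < \<tau>" "\<tau> < 1/2" unfolding l_def \<tau>_def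
    by (fact lle(2) | rule le_less_trans[OF lle(1) \<gamma>(2)])+
  have l1: "l < 1" "\<tau> < 1" "\<tau> + l < 1" using l by auto
  have \<beta>j: "upper_level p Q l (\<beta> j)" and \<alpha>i: "lower_level p Q \<tau> (\<alpha> i)"
    unfolding l_def \<tau>_def by (rule \<beta>, rule \<alpha>)
  have \<beta>ab: "a \<le> \<beta> j" "\<beta> j \<le> b"
    using upper_level_bounds[OF \<beta>j Q l(1) l1(1) a(2) b] by auto
  have \<alpha>ab: "a \<le> \<alpha> i" "\<alpha> i \<le> b"
    using upper_level_bounds[OF \<alpha>i[unfolded lower_level_def] Q l(3) l1(2), of "-b" "-a"] a(2) b by auto
  have \<alpha>\<beta>: "\<alpha> i \<le> \<beta> j"
    by (rule lower_le_upper_level[OF \<alpha>i \<beta>j Q l1(3) bm_p])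
  \<comment> \<open>The layer \<open>T\<close> carries at least the share
    \<open>c * \<tau> powr \<eta>\<close> of the modular, has measure at most
    \<open>\<tau> / \<gamma> * |Q|\<close>, and \<open>t powr p x \<le> t powr \<alpha> i\<close> on
    it because \<open>t < 1\<close>.\<close>
  have up: "avg Q (\<lambda>x. t powr p x) \<le> 1 / (\<gamma> * c) * (\<tau> powr (1 - \<kappa>) * t powr \<alpha> i)"
  proof -
    have "c * \<tau> powr \<eta> * I Q (\<lambda>x. t powr p x) \<le> I T (\<lambda>x. t powr p x)" using T(5) by (simp add: \<tau>_def)
    also have "\<dots> \<le> I T (\<lambda>x. t powr \<alpha> i)"
      using t T(3) by (intro I_mono bt bm_const T(2) powr_mono') auto
    also have "\<dots> = t powr \<alpha> i * measure lebesgue T" by (rule I_const[OF T(2)])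
    also have "\<dots> \<le> t powr \<alpha> i * (1 / \<gamma> * \<tau> * measure lebesgue Q)"
      using T(4) by (intro mult_left_mono) (auto simp: \<tau>_def)
    finally have "c * \<tau> powr \<eta> * avg Q (\<lambda>x. t powr p x) \<le> t powr \<alpha> i * (1 / \<gamma> * \<tau>)"
      using mQ by (simp add: avg_def pos_divide_le_eq mult_ac)
    then have "avg Q (\<lambda>x. t powr p x) \<le> t powr \<alpha> i * (1 / \<gamma> * \<tau>) / (c * \<tau> powr \<eta>)"
      using c0 c1 l by (subst pos_le_divide_eq) (auto simp: mult_ac)
    also have "\<dots> = 1 / (\<gamma> * c) * (\<tau> powr (1 - \<eta>) * t powr \<alpha> i)"
      using l c0 c1 \<gamma> by (simp add: powr_diff field_simps)
    also have "\<dots> \<le> 1 / (\<gamma> * c) * (\<tau> powr (1 - \<kappa>) * t powr \<alpha> i)"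
      using l c0 c1 \<gamma> \<eta> by (intro mult_left_mono mult_right_mono powr_mono') auto
    finally show ?thesis .
  qed
  define q where "q = \<beta> j - \<epsilon>"
  have q: "1 \<le> q" "q \<le> b" using \<beta>ab \<epsilon> by (auto simp: q_def)
  \<comment> \<open>A lower bound for the average of \<open>f\<close> over \<open>S\<close>: at
    least the share \<open>c * l powr \<eta>\<close> of its integral sits on a set of measure at
    most \<open>l / \<gamma> * |Q|\<close>.\<close>
  define Y where "Y = c * \<gamma> * l powr (\<eta> - 1) * t"
  have Y0: "0 < Y" using c0 c1 \<gamma> l t by (simp add: Y_def)
  have IS: "c * l powr \<eta> * t * measure lebesgue Q \<le> I S f"
  proof -
    have "c * l powr \<eta> * (t * measure lebesgue Q) \<le> c * l powr \<eta> * I Q f"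
      using If c0 c1 by (intro mult_left_mono) auto
    then show ?thesis using S(5) by (simp add: l_def mult_ac)
  qed
  have low: "t powr \<beta> j * l powr (- ((1 - \<kappa>) * (\<beta> j - 1))) \<le>
      2 * (2 / (\<gamma> * c)) powr b * avg Q (\<lambda>x. t powr \<epsilon> * f x powr (p x - \<epsilon>))"
  proof -
    have "Y * measure lebesgue S \<le> Y * (1 / \<gamma> * l * measure lebesgue Q)"
      using S(4) Y0 by (intro mult_left_mono) (auto simp: l_def)
    also have "\<dots> = c * l powr \<eta> * t * measure lebesgue Q" using \<gamma> l by (simp add: Y_def powr_diff)
    finally have YS: "Y * measure lebesgue S \<le> I S f" using IS by linarith
    have bf: "bounded_measurable (\<lambda>x. t powr \<epsilon> * f x powr (p x - \<epsilon>))"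
      by (intro bm_mult bm_const bm_fun_powr_p f \<epsilon>)
    have "(Y / 2) powr (q - 1) * (c * l powr \<eta> * t * measure lebesgue Q / 2) \<le> (Y / 2) powr (q - 1) * (I S f / 2)"
      using IS by (intro mult_left_mono divide_right_mono) auto
    also have "\<dots> \<le> I S (\<lambda>x. f x powr q)" by (rule I_powr_lower_bound[OF S(2) f(1,2) q(1) Y0 YS])
    \<comment> \<open>This is where \<open>f \<le> 1\<close> enters: on \<open>S\<close> the
      exponent \<open>p x - \<epsilon>\<close> is at most
      \<open>\<beta> j - \<epsilon>\<close>.\<close>
    also have "\<dots> \<le> I S (\<lambda>x. f x powr (p x - \<epsilon>))"
      using S(3) q f by (intro I_mono bm_powr bm_const bm_fun_powr_p f \<epsilon> S(2) powr_mono') (auto simp: q_def)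
    finally have "t powr \<epsilon> * ((Y / 2) powr (q - 1) * (c * l powr \<eta> * t * measure lebesgue Q / 2)) \<le>
       I S (\<lambda>x. t powr \<epsilon> * f x powr (p x - \<epsilon>))"
      unfolding set_integral_mult_right by (rule mult_left_mono) simp
    also have "\<dots> \<le> I Q (\<lambda>x. t powr \<epsilon> * f x powr (p x - \<epsilon>))"
      using S(1,2) lmQ by (intro I_subset bf) auto
    finally have *: "t powr \<epsilon> * ((Y / 2) powr (q - 1) * (c * l powr \<eta> * t / 2)) \<le> avg Q (\<lambda>x. t powr \<epsilon> * f x powr (p x - \<epsilon>))"
      using mQ by (simp add: avg_def pos_le_divide_eq mult_ac)
    define d where "d = \<gamma> * c / 2"
    have d: "0 < d" "d \<le> 1" "d \<le> c" using \<gamma> c0 c1 mult_le_one[of \<gamma> c] mult_right_mono[of \<gamma> 1 c] by (auto simp: d_def)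
    have "t powr \<beta> j * l powr (- ((1 - \<kappa>) * (\<beta> j - 1))) * (d powr b / 2) \<le>
        t powr \<beta> j * l powr ((\<eta> - 1) * (q - 1) + \<eta>) * (d powr (q - 1) * c / 2)"
    proof (intro mult_mono mult_left_mono)
      \<comment> \<open>The loss \<open>\<eta>\<close> from the pigeonhole and the room
        \<open>\<epsilon>\<close> are together paid for by the part \<open>\<kappa>\<close> removed
        from the exponent of \<open>l\<close>; the assumption
        \<open>\<epsilon> + \<eta> * b \<le> \<kappa> * (a - 1)\<close> says so.\<close>
      have "\<eta> * q \<le> \<eta> * b" using q \<eta> by (intro mult_left_mono) auto
      moreover have "\<kappa> * (a - 1) \<le> \<kappa> * (\<beta> j - 1)" using k \<beta>ab by (intro mult_left_mono) auto
      ultimately have "(\<eta> - 1) * (q - 1) + \<eta> \<le> - ((1 - \<kappa>) * (\<beta> j - 1))"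
        using \<eta>(3) by (simp add: q_def algebra_simps)
      then show "l powr (- ((1 - \<kappa>) * (\<beta> j - 1))) \<le> l powr ((\<eta> - 1) * (q - 1) + \<eta>)" using l by (intro powr_mono') auto
      have "d powr b \<le> d powr q" using d q by (intro powr_mono') auto
      also have "\<dots> = d powr (q - 1) * d" using d by (simp add: powr_diff)
      also have "\<dots> \<le> d powr (q - 1) * c" using d by (intro mult_left_mono) auto
      finally show "d powr b / 2 \<le> d powr (q - 1) * c / 2" by simp
    qed auto
    also have "\<dots> = t powr \<epsilon> * ((Y / 2) powr (q - 1) * (c * l powr \<eta> * t / 2))"
    proof -
      have Yd: "Y / 2 = d * (l powr (\<eta> - 1) * t)" by (simp add: Y_def d_def)
      have "(Y / 2) powr (q - 1) = d powr (q - 1) * (l powr ((\<eta> - 1) * (q - 1)) * t powr (q - 1))"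
        unfolding Yd using d l t by (simp add: powr_mult powr_powr)
      moreover have "t powr \<beta> j = t powr \<epsilon> * t powr (q - 1) * t"
        using t powr_add[of t "\<epsilon> + (q - 1)" 1] powr_add[of t \<epsilon> "q - 1"] by (simp add: q_def)
      moreover have "l powr ((\<eta> - 1) * (q - 1) + \<eta>) = l powr ((\<eta> - 1) * (q - 1)) * l powr \<eta>" by (rule powr_add)
      ultimately show ?thesis by (simp add: mult_ac)
    qed
    finally have "t powr \<beta> j * l powr (- ((1 - \<kappa>) * (\<beta> j - 1))) * (d powr b / 2) \<le>
        avg Q (\<lambda>x. t powr \<epsilon> * f x powr (p x - \<epsilon>))" using * by linarith
    then have "t powr \<beta> j * l powr (- ((1 - \<kappa>) * (\<beta> j - 1))) \<le>
        avg Q (\<lambda>x. t powr \<epsilon> * f x powr (p x - \<epsilon>)) / (d powr b / 2)"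
      using d by (subst pos_le_divide_eq) auto
    also have "\<dots> = 2 * (2 / (\<gamma> * c)) powr b * avg Q (\<lambda>x. t powr \<epsilon> * f x powr (p x - \<epsilon>))"
      using d \<gamma> c0 c1 by (simp add: d_def powr_divide field_simps)
    finally show ?thesis .
  qed
  \<comment> \<open>The dichotomy compares the upper bound \<open>up\<close> with the lower bound
    \<open>low\<close>; its second case is the assumption \<open>bad\<close> of
    \<open>bad_level_estimate\<close>.\<close>
  show ?thesis
  proof (cases "\<tau> powr (1 - \<kappa>) * t powr \<alpha> i \<le> t powr \<beta> j * l powr (- ((1 - \<kappa>) * (\<beta> j - 1)))")
    case True
    have "avg Q (\<lambda>x. t powr p x) \<le> 1 / (\<gamma> * c) * (2 * (2 / (\<gamma> * c)) powr b * avg Q (\<lambda>x. t powr \<epsilon> * f x powr (p x - \<epsilon>)))"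
      using up order_trans[OF True low] \<gamma> c0 c1 by (elim order_trans) (intro mult_left_mono, auto)
    then show ?thesis by (simp add: mult_ac)
  next
    case False
    have bad: "\<alpha> i < \<beta> j" "\<tau> powr (1 - \<kappa>) * t powr \<alpha> i \<le>
      \<tau> powr (\<kappa> / 2) * l powr \<delta> * t powr \<kappa> * gap_term \<tau> l (\<alpha> i) (\<beta> j) powr (1 / r)"
      using bad_level_estimate[OF t l(3) _ l(1) _ _ \<alpha>\<beta> k r] False l a(1) \<alpha>ab by (auto simp: not_le)
    have "avg Q (\<lambda>x. t powr p x) \<le> 1 / (\<gamma> * c) * (\<tau> powr (\<kappa> / 2) * l powr \<delta> * t powr \<kappa> * gap_term \<tau> l (\<alpha> i) (\<beta> j) powr (1 / r))"
      using up bad(2) \<gamma> c0 c1 by (elim order_trans) (intro mult_left_mono, auto)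
    then show ?thesis using bad(1) unfolding l_def \<tau>_def by blast
  qed
qed

end

context exponents
begin

text \<open>The failing cubes are grouped by the pair \<open>(i, j)\<close> of their layers, since
  the cube sum condition concerns one pair of parameters at a time. Each group costs at most
  \<open>C\<close>, and the spare factors make the sum over all pairs a product of two geometric
  series.\<close>

lemma small_levels:
  assumes qs: "quantile_sum_condition p r \<gamma>\<^sub>0 C" and r: "1 < r" and \<gamma>0: "0 < \<gamma>\<^sub>0" "\<gamma>\<^sub>0 < 1/2"
  shows "\<exists>\<kappa> \<epsilon>\<^sub>1 D. 0 < \<kappa> \<and> 0 < \<epsilon>\<^sub>1 \<and> \<epsilon>\<^sub>1 \<le> 1 \<and> \<epsilon>\<^sub>1 < a - 1 \<and> 1 \<le> D \<and>
    (\<forall>\<epsilon> F t f. 0 \<le> \<epsilon> \<longrightarrow> \<epsilon> \<le> \<epsilon>\<^sub>1 \<longrightarrow> finite F \<longrightarrow> F \<subseteq> cubes \<longrightarrow> disjoint F \<longrightarrow> 0 < t \<longrightarrow> t < 1 \<longrightarrow>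
       bounded_measurable f \<longrightarrow> (\<forall>x. 0 \<le> f x \<and> f x \<le> 1) \<longrightarrow> (\<forall>Q\<in>F. t \<le> avg Q f) \<longrightarrow>
       (\<Sum>Q\<in>F. I Q (\<lambda>x. t powr p x)) \<le> D * ((\<Sum>Q\<in>F. I Q (\<lambda>x. t powr \<epsilon> * f x powr (p x - \<epsilon>))) + t powr \<kappa>))"
proof -
  define u where "u = 1 / r"
  have u: "0 < u" "u < 1" using r by (auto simp: u_def)
  \<comment> \<open>With \<open>1 / r = 1 - 4 * \<kappa>\<close> the exponent
    \<open>(1 - \<kappa>) * (1 - \<kappa>)\<close> exceeds \<open>1 / r\<close> by
    \<open>2 * \<kappa> + \<kappa> * \<kappa>\<close>.\<close>
  define \<kappa> where "\<kappa> = (1 - u) / 4"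
  have k: "0 < \<kappa>" "\<kappa> \<le> 1/2" using u by (auto simp: \<kappa>_def)
  define \<delta> where "\<delta> = (1 - \<kappa>) * (1 - \<kappa>) - 1 / r"
  have "u = 1 - 4 * \<kappa>" by (simp add: \<kappa>_def field_simps)
  then have "1 / r = 1 - 4 * \<kappa>" by (simp add: u_def)
  then have "\<delta> = 2 * \<kappa> + \<kappa> * \<kappa>" by (simp add: \<delta>_def algebra_simps)
  then have \<delta>: "0 < \<delta>" "1 / r + \<delta> = (1 - \<kappa>) * (1 - \<kappa>)" using k by (auto simp: \<delta>_def intro!: add_pos_pos)
  define \<epsilon>\<^sub>1 where "\<epsilon>\<^sub>1 = min 1 (\<kappa> * (a - 1) / 2)"
  have ka: "\<kappa> * (a - 1) < 1 * (a - 1)" "0 < \<kappa> * (a - 1)" using k a by (intro mult_strict_right_mono mult_pos_pos, auto)+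
  have "0 < \<epsilon>\<^sub>1" unfolding \<epsilon>\<^sub>1_def using ka(2) by simp
  moreover have e1: "\<epsilon>\<^sub>1 \<le> \<kappa> * (a - 1) / 2" "\<epsilon>\<^sub>1 \<le> 1" unfolding \<epsilon>\<^sub>1_def by (rule min.cobounded2, rule min.cobounded1)
  moreover have "\<epsilon>\<^sub>1 < a - 1"
  proof -
    define m where "m = \<kappa> * (a - 1)"
    have "\<epsilon>\<^sub>1 \<le> m / 2" "m < a - 1" "0 < m" using e1(1) ka by (simp_all add: m_def)
    then show ?thesis by linarith
  qed
  ultimately have e1: "0 < \<epsilon>\<^sub>1" "\<epsilon>\<^sub>1 \<le> 1" "\<epsilon>\<^sub>1 < a - 1" "\<epsilon>\<^sub>1 \<le> \<kappa> * (a - 1) / 2" by auto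
  \<comment> \<open>The budget \<open>\<kappa> * (a - 1)\<close> is divided evenly between
    \<open>\<epsilon>\<close> and \<open>\<eta> * b\<close>.\<close>
  define \<eta> where "\<eta> = min \<kappa> (\<kappa> * (a - 1) / (2 * b))"
  have \<eta>: "0 < \<eta>" "\<eta> \<le> \<kappa>" using k a b_gt_1 by (auto simp: \<eta>_def)
  have \<eta>b: "\<eta> * b \<le> \<kappa> * (a - 1) / 2"
  proof -
    have "\<eta> * b \<le> \<kappa> * (a - 1) / (2 * b) * b" unfolding \<eta>_def using b_gt_1 by (intro mult_right_mono) auto
    then show ?thesis using b_gt_1 by simp
  qed
  define \<gamma> where "\<gamma> = \<gamma>\<^sub>0 / 2"
  have \<gamma>: "0 < \<gamma>" "\<gamma> < 1/2" "\<gamma> < \<gamma>\<^sub>0" using \<gamma>0 by (auto simp: \<gamma>_def)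
  define c where "c = (1 - 2 powr (-\<eta>)) / 2"
  have c0: "0 < c" using \<eta> powr_less_one[of 2 "-\<eta>"] by (auto simp: c_def)
  define T where "T i = \<gamma> / 2 ^ i" for i :: nat
  have T: "0 < T i" "T i < \<gamma>\<^sub>0" "T i < 1" for i
  proof -
    have "T i \<le> \<gamma>" using \<gamma> by (simp add: T_def divide_le_eq mult_le_cancel_left1)
    then show "T i < \<gamma>\<^sub>0" "T i < 1" using \<gamma> by linarith+
    show "0 < T i" using \<gamma> by (simp add: T_def)
  qed
  have C: "0 \<le> C" using qs \<gamma> T[of 0] unfolding quantile_sum_condition_def
    by (auto dest!: spec[of _ "T 0"] spec[of _ "{}"])
  define al where "al Q i = (SOME y. lower_level p Q (T i) y)" for Q i
  define be where "be Q i = (SOME y. upper_level p Q (T i) y)" for Q i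
  have al: "lower_level p Q (T i) (al Q i)" if Qc: "Q \<in> cubes" for Q i
  proof -
    obtain y where "upper_level (\<lambda>x. - p x) Q (T i) y" using exists_upper_level[OF bm_uminus[OF bm_p] Qc T(1,3)] by blast
    then have "lower_level p Q (T i) (- y)" by (simp add: lower_level_def)
    then show ?thesis unfolding al_def by (rule someI)
  qed
  have be: "upper_level p Q (T i) (be Q i)" if Qc: "Q \<in> cubes" for Q i
    unfolding be_def by (rule someI_ex) (rule exists_upper_level[OF bm_p Qc T(1,3)])
  define z1 where "z1 = 2 powr (- (\<kappa> / 2))"
  define z2 where "z2 = 2 powr (- \<delta>)"
  have z: "0 \<le> z1" "z1 < 1" "0 \<le> z2" "z2 < 1" using k \<delta> by (auto simp: z1_def z2_def powr_less_one)
  have Tz: "T i powr s \<le> (2 powr (- s)) ^ i" if "0 < s" for i s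
  proof -
    have "T i powr s \<le> (1 / 2 ^ i) powr s" unfolding T_def using that \<gamma> by (intro powr_mono2 divide_right_mono) auto
    also have "\<dots> = (2 powr (- s)) ^ i"
      by (simp add: powr_divide powr_minus powr_realpow[symmetric] powr_powr mult.commute inverse_eq_divide)
    finally show ?thesis .
  qed
  define S where "S = 1 / (1 - z1) * (1 / (1 - z2))"
  have S: "0 \<le> S" using z by (simp add: S_def)
  define D1 where "D1 = (2 / (\<gamma> * c)) * (2 / (\<gamma> * c)) powr b"
  define D2 where "D2 = 1 / (\<gamma> * c)"
  have D12: "0 \<le> D1" "0 \<le> D2" using \<gamma> c0 by (auto simp: D1_def D2_def)
  define D where "D = 1 + D1 + D2 * (S * C)"
  have D: "1 \<le> D" "D1 \<le> D" "D2 * (S * C) \<le> D" using D12 S C by (auto simp: D_def)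
  have main: "(\<Sum>Q\<in>F. I Q (\<lambda>x. t powr p x)) \<le> D * ((\<Sum>Q\<in>F. I Q (\<lambda>x. t powr \<epsilon> * f x powr (p x - \<epsilon>))) + t powr \<kappa>)"
    if e: "0 \<le> \<epsilon>" "\<epsilon> \<le> \<epsilon>\<^sub>1" and F: "finite F" "F \<subseteq> cubes" "disjoint F" and t: "0 < t" "t < 1"
      and f: "bounded_measurable f" "\<forall>x. 0 \<le> f x \<and> f x \<le> 1" and tf: "\<forall>Q\<in>F. t \<le> avg Q f" for \<epsilon> F t f
  proof -
    have f01: "0 \<le> f x" "f x \<le> 1" for x using f by auto
    have e': "\<epsilon> \<le> 1" "\<epsilon> < a - 1" "\<epsilon> + \<eta> * b \<le> \<kappa> * (a - 1)" using e e1 \<eta>b by auto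
    define X where "X Q = avg Q (\<lambda>x. t powr \<epsilon> * f x powr (p x - \<epsilon>))" for Q
    define V where "V Q = avg Q (\<lambda>x. t powr p x)" for Q
    define gt where "gt Q i j = gap_term (T i) (T j) (al Q i) (be Q j) powr (1 / r)" for Q i j
    define w where "w i j = T i powr (\<kappa> / 2) * T j powr \<delta>" for i j
    have X0: "0 \<le> X Q" for Q unfolding X_def by (rule avg_nonneg) simp
    define Bd where "Bd = {Q \<in> F. \<not> V Q \<le> D1 * X Q}"
    have "\<exists>i j. al Q i < be Q j \<and> V Q \<le> D2 * (w i j * t powr \<kappa> * gt Q i j)" if "Q \<in> Bd" for Q
    proof -
      have Q: "Q \<in> cubes" "t \<le> avg Q f" "\<not> V Q \<le> D1 * X Q" using that F tf by (auto simp: Bd_def)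
      show ?thesis
        using small_level_single_cube[OF \<gamma>(1,2) k \<delta>(2,1) e(1) e'(1,2) \<eta> e'(3) c_def Q(1) t f(1) f01 Q(2)
            al[OF Q(1), unfolded T_def] be[OF Q(1), unfolded T_def]] Q(3)
        unfolding V_def[symmetric] X_def[symmetric] D1_def[symmetric] D2_def[symmetric] T_def[symmetric]
          gt_def[symmetric] w_def[symmetric] by blast
    qed
    then obtain ii jj where ij: "\<And>Q. Q \<in> Bd \<Longrightarrow> al Q (ii Q) < be Q (jj Q)"
        "\<And>Q. Q \<in> Bd \<Longrightarrow> V Q \<le> D2 * (w (ii Q) (jj Q) * t powr \<kappa> * gt Q (ii Q) (jj Q))"
      by metis
    have Bd: "finite Bd" "Bd \<subseteq> F" using F by (auto simp: Bd_def)
    define g where "g Q = (ii Q, jj Q)" for Q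
    define W where "W = (\<lambda>(i, j). w i j)"
    define s where "s Q = measure lebesgue Q * gt Q (ii Q) (jj Q)" for Q
    have W0: "0 \<le> W y" for y by (cases y) (simp add: W_def w_def)
    have "(\<Sum>Q\<in>Bd. W (g Q) * s Q) = (\<Sum>y\<in>g ` Bd. \<Sum>Q\<in>{Q\<in>Bd. g Q = y}. W (g Q) * s Q)"
      by (rule sum.image_gen[OF Bd(1)])
    also have "\<dots> \<le> (\<Sum>y\<in>g ` Bd. W y * C)"
    proof (rule sum_mono)
      fix y assume "y \<in> g ` Bd"
      obtain i j where y: "y = (i, j)" by (cases y) auto
      define G where "G = {Q\<in>Bd. g Q = y}"
      have G: "finite G" "G \<subseteq> F" "\<And>Q. Q \<in> G \<Longrightarrow> ii Q = i \<and> jj Q = j \<and> Q \<in> Bd" using Bd by (auto simp: G_def g_def y)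
      have disjG: "disjoint G" using F(3) G(2) by (auto simp: disjoint_def)
      have "(\<Sum>Q\<in>G. measure lebesgue Q * gap_term (T i) (T j) (al Q i) (be Q j) powr (1 / r)) \<le> C"
      proof -
        have "\<forall>Q\<in>G. al Q i < be Q j \<and> lower_level p Q (T i) (al Q i) \<and> upper_level p Q (T j) (be Q j)"
          using G ij(1) al be F(2) by blast
        then show ?thesis
          using qs[unfolded quantile_sum_condition_def, rule_format, of "T j" "T i" G "\<lambda>Q. al Q i" "\<lambda>Q. be Q j"]
            T G(1,2) F(2) disjG by auto
      qed
      moreover have "(\<Sum>Q\<in>G. s Q) = (\<Sum>Q\<in>G. measure lebesgue Q * gap_term (T i) (T j) (al Q i) (be Q j) powr (1 / r))"
        using G(3) by (intro sum.cong) (auto simp: s_def gt_def)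
      moreover have "(\<Sum>Q\<in>G. W (g Q) * s Q) = W y * (\<Sum>Q\<in>G. s Q)"
        unfolding sum_distrib_left by (intro sum.cong) (auto simp: G_def)
      ultimately show "(\<Sum>Q\<in>{Q\<in>Bd. g Q = y}. W (g Q) * s Q) \<le> W y * C"
        unfolding G_def[symmetric] using W0[of y] by (simp add: mult_left_mono)
    qed
    also have "\<dots> = (\<Sum>y\<in>g ` Bd. W y) * C" by (simp add: sum_distrib_right)
    also have "\<dots> \<le> S * C"
    proof (rule mult_right_mono[OF _ C])
      have "(\<Sum>y\<in>g ` Bd. W y) \<le> (\<Sum>y\<in>ii ` Bd \<times> jj ` Bd. W y)"
        using Bd W0 by (intro sum_mono2) (auto simp: g_def)
      also have "\<dots> = (\<Sum>i\<in>ii ` Bd. T i powr (\<kappa> / 2)) * (\<Sum>j\<in>jj ` Bd. T j powr \<delta>)"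
        unfolding W_def w_def by (simp add: sum.cartesian_product[symmetric] sum_product)
      also have "\<dots> \<le> S"
        unfolding S_def
      proof (rule mult_mono)
        have "(\<Sum>i\<in>ii ` Bd. T i powr (\<kappa> / 2)) \<le> (\<Sum>i\<in>ii ` Bd. z1 ^ i)"
          using Tz[of "\<kappa> / 2"] k unfolding z1_def by (intro sum_mono) auto
        also have "\<dots> \<le> 1 / (1 - z1)" using Bd z by (intro sum_power_le) auto
        finally show "(\<Sum>i\<in>ii ` Bd. T i powr (\<kappa> / 2)) \<le> 1 / (1 - z1)" .
        have "(\<Sum>i\<in>jj ` Bd. T i powr \<delta>) \<le> (\<Sum>i\<in>jj ` Bd. z2 ^ i)"
          using Tz[of \<delta>] \<delta> unfolding z2_def by (intro sum_mono) auto
        also have "\<dots> \<le> 1 / (1 - z2)" using Bd z by (intro sum_power_le) auto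
        finally show "(\<Sum>i\<in>jj ` Bd. T i powr \<delta>) \<le> 1 / (1 - z2)" .
      qed (use z in \<open>auto intro!: sum_nonneg\<close>)
      finally show "(\<Sum>y\<in>g ` Bd. W y) \<le> S" .
    qed
    finally have sumBd: "(\<Sum>Q\<in>Bd. W (g Q) * s Q) \<le> S * C" .
    have mp: "0 \<le> measure lebesgue Q" for Q :: "(real^'n) set" by simp
    have bad: "(\<Sum>Q\<in>Bd. measure lebesgue Q * V Q) \<le> D * t powr \<kappa>"
    proof -
      have "(\<Sum>Q\<in>Bd. measure lebesgue Q * V Q) \<le> (\<Sum>Q\<in>Bd. measure lebesgue Q * (D2 * (w (ii Q) (jj Q) * t powr \<kappa> * gt Q (ii Q) (jj Q))))"
        using ij(2) by (intro sum_mono mult_left_mono) auto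
      also have "\<dots> = D2 * t powr \<kappa> * (\<Sum>Q\<in>Bd. W (g Q) * s Q)"
        unfolding sum_distrib_left by (intro sum.cong) (auto simp: W_def g_def s_def mult_ac)
      also have "\<dots> \<le> D2 * t powr \<kappa> * (S * C)" using sumBd D12 by (intro mult_left_mono) auto
      also have "\<dots> = D2 * (S * C) * t powr \<kappa>" by simp
      also have "\<dots> \<le> D * t powr \<kappa>" using D by (intro mult_right_mono) auto
      finally show ?thesis .
    qed
    have good: "(\<Sum>Q\<in>F - Bd. measure lebesgue Q * V Q) \<le> D * (\<Sum>Q\<in>F. measure lebesgue Q * X Q)"
    proof -
      have "(\<Sum>Q\<in>F - Bd. measure lebesgue Q * V Q) \<le> (\<Sum>Q\<in>F - Bd. measure lebesgue Q * (D * X Q))"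
      proof (intro sum_mono mult_left_mono mp)
        fix Q assume "Q \<in> F - Bd"
        then have "V Q \<le> D1 * X Q" by (auto simp: Bd_def)
        also have "\<dots> \<le> D * X Q" using D X0 by (intro mult_right_mono) auto
        finally show "V Q \<le> D * X Q" .
      qed
      also have "\<dots> \<le> (\<Sum>Q\<in>F. measure lebesgue Q * (D * X Q))"
        using F X0 D by (intro sum_mono2) auto
      also have "\<dots> = D * (\<Sum>Q\<in>F. measure lebesgue Q * X Q)" by (simp add: sum_distrib_left mult_ac)
      finally show ?thesis .
    qed
    have "(\<Sum>Q\<in>F. I Q (\<lambda>x. t powr p x)) = (\<Sum>Q\<in>F. measure lebesgue Q * V Q)"
      unfolding V_def using F I_eq_avg by (intro sum.cong) auto
    also have "\<dots> = (\<Sum>Q\<in>F - Bd. measure lebesgue Q * V Q) + (\<Sum>Q\<in>Bd. measure lebesgue Q * V Q)"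
      by (rule sum.subset_diff[OF Bd(2) F(1)])
    also have "\<dots> \<le> D * (\<Sum>Q\<in>F. measure lebesgue Q * X Q) + D * t powr \<kappa>" using good bad by linarith
    also have "(\<Sum>Q\<in>F. measure lebesgue Q * X Q) = (\<Sum>Q\<in>F. I Q (\<lambda>x. t powr \<epsilon> * f x powr (p x - \<epsilon>)))"
      unfolding X_def using F by (intro sum.cong I_eq_avg[symmetric]) auto
    finally show ?thesis by (simp add: distrib_left)
  qed
  show ?thesis
    by (rule exI[of _ \<kappa>], rule exI[of _ \<epsilon>\<^sub>1], rule exI[of _ D], intro conjI, rule k(1),
      rule e1(1), rule e1(2), rule e1(3), rule D(1), intro allI impI, rule main)
qed

end

section \<open>Level sets of the maximal function\<close>

text \<open>A short interval cannot contain points of both \<open>L \<int>\<close> and its translate by \<open>2 ^ k L / 3\<close>, because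
  \<open>3\<close> does not divide \<open>2 ^ k\<close>.\<close>

lemma shifted_floor_const:
  fixes u s L :: real
  assumes "0 < L" "3 * s \<le> L"
  shows "(\<forall>y. u \<le> y \<and> y \<le> u + s \<longrightarrow> \<lfloor>y / L\<rfloor> = \<lfloor>u / L\<rfloor>) \<or>
    (\<forall>y. u \<le> y \<and> y \<le> u + s \<longrightarrow> \<lfloor>(y - 2 ^ k * L / 3) / L\<rfloor> = \<lfloor>(u - 2 ^ k * L / 3) / L\<rfloor>)"
proof (rule ccontr)
  assume "\<not> ?thesis"
  then obtain y y' where y: "u \<le> y" "y \<le> u + s" "\<lfloor>y / L\<rfloor> \<noteq> \<lfloor>u / L\<rfloor>"
    and y': "u \<le> y'" "y' \<le> u + s" "\<lfloor>(y' - 2 ^ k * L / 3) / L\<rfloor> \<noteq> \<lfloor>(u - 2 ^ k * L / 3) / L\<rfloor>" by blast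
  have jump: "\<exists>m::int. v < L * m \<and> L * m \<le> z" if "v \<le> z" "\<lfloor>z / L\<rfloor> \<noteq> \<lfloor>v / L\<rfloor>" for v z :: real
  proof -
    have "\<lfloor>v / L\<rfloor> < \<lfloor>z / L\<rfloor>" using that assms floor_mono[of "v / L" "z / L"] by (simp add: divide_right_mono)
    then have "v / L < of_int \<lfloor>z / L\<rfloor>" by (simp add: floor_less_iff)
    moreover have "of_int \<lfloor>z / L\<rfloor> \<le> z / L" by simp
    ultimately have "v < of_int \<lfloor>z / L\<rfloor> * L" "of_int \<lfloor>z / L\<rfloor> * L \<le> z"
      using pos_divide_less_eq[OF assms(1)] pos_le_divide_eq[OF assms(1)] by blast+
    then show ?thesis by (intro exI[of _ "\<lfloor>z / L\<rfloor>"]) (simp add: mult.commute)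
  qed
  obtain m :: int where m: "u < L * m" "L * m \<le> y" using jump[OF y(1,3)] by blast
  obtain m' :: int where m': "u - 2 ^ k * L / 3 < L * m'" "L * m' \<le> y' - 2 ^ k * L / 3"
    using jump[of "u - 2 ^ k * L / 3" "y' - 2 ^ k * L / 3"] y' by auto
  have "L * (3 * (m - m') - 2 ^ k) < L * 1" "L * (-1) < L * (3 * (m - m') - 2 ^ k)"
    using m m' y y' assms by (auto simp: algebra_simps)
  then have "3 * (m - m') - 2 ^ k < real_of_int 1" "real_of_int (-1) < 3 * (m - m') - 2 ^ k"
    unfolding mult_less_cancel_left_pos[OF assms(1)] by auto
  then have "3 * (m - m') - 2 ^ k < 1" "-1 < 3 * (m - m') - 2 ^ k" by (simp_all only: of_int_less_iff)
  then have "3 * (m - m') = 2 ^ k" by linarith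
  then have "(3::int) dvd 2 ^ k" by (metis dvd_triv_left)
  then have "(3::int) dvd 2" using prime_dvd_power[of "3::int" 2 k] by simp
  then show False by simp
qed

text \<open>The generation \<open>k\<close> is the last one of side at least \<open>3 * s\<close>,
  hence of side below \<open>6 * s\<close>. Each coordinate separately uses the original or the
  shifted grid, whichever does not cut its interval, and \<open>V\<close> collects the shifted
  coordinates.\<close>

lemma shifted_dyadic_cover:
  fixes c :: "real ^ 'n"
  assumes s: "0 < s" "3 * s \<le> l"
  shows "\<exists>V k x. cbox c (\<chi> i. c $ i + s) \<subseteq> dyadic_cube (\<chi> i. if i \<in> V then l / 3 else 0) l k x \<and> l / 2 ^ k \<le> 6 * s"
proof -
  have l: "0 < l" using s by simp
  obtain n where "(1/2) ^ n < 3 * s / l" using real_arch_pow_inv[of "3 * s / l" "1/2"] s l by auto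
  then have n: "l / 2 ^ n < 3 * s" using l by (simp add: power_one_over field_simps)
  define j where "j = (LEAST j. l / 2 ^ j < 3 * s)"
  have j: "l / 2 ^ j < 3 * s" unfolding j_def using n by (rule LeastI)
  have "j \<noteq> 0" using j s by (intro notI) simp
  then obtain k where k: "j = Suc k" by (cases j) auto
  have k3: "3 * s \<le> l / 2 ^ k" using not_less_Least[of k "\<lambda>j. l / 2 ^ j < 3 * s"] k j_def by simp
  define L where "L = l / 2 ^ k"
  have L: "0 < L" "3 * s \<le> L" "l = 2 ^ k * L" using l k3 by (auto simp: L_def)
  have "\<forall>i. \<exists>b. \<forall>y. c $ i \<le> y \<and> y \<le> c $ i + s \<longrightarrow>
      \<lfloor>(y - (if b then l / 3 else 0)) / L\<rfloor> = \<lfloor>(c $ i - (if b then l / 3 else 0)) / L\<rfloor>"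
  proof
    fix i
    show "\<exists>b. \<forall>y. c $ i \<le> y \<and> y \<le> c $ i + s \<longrightarrow>
      \<lfloor>(y - (if b then l / 3 else 0)) / L\<rfloor> = \<lfloor>(c $ i - (if b then l / 3 else 0)) / L\<rfloor>"
    proof -
      have h: "l / 3 = 2 ^ k * L / 3" by (simp add: L(3))
      consider "\<forall>y. c $ i \<le> y \<and> y \<le> c $ i + s \<longrightarrow> \<lfloor>y / L\<rfloor> = \<lfloor>c $ i / L\<rfloor>"
        | "\<forall>y. c $ i \<le> y \<and> y \<le> c $ i + s \<longrightarrow> \<lfloor>(y - l / 3) / L\<rfloor> = \<lfloor>(c $ i - l / 3) / L\<rfloor>"
        using shifted_floor_const[OF L(1,2), of "c $ i" k] unfolding h by blast
      then show ?thesis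
      proof cases
        case 1 then show ?thesis by (intro exI[of _ False]) (simp only: if_False diff_zero)
      next
        case 2 then show ?thesis by (intro exI[of _ True]) (simp only: if_True)
      qed
    qed
  qed
  then obtain b where b: "\<And>i y. c $ i \<le> y \<Longrightarrow> y \<le> c $ i + s \<Longrightarrow>
      \<lfloor>(y - (if b i then l / 3 else 0)) / L\<rfloor> = \<lfloor>(c $ i - (if b i then l / 3 else 0)) / L\<rfloor>" by metis
  define V where "V = {i. b i}"
  have "cbox c (\<chi> i. c $ i + s) \<subseteq> dyadic_cube (\<chi> i. if i \<in> V then l / 3 else 0) l k c"
  proof
    fix y assume y: "y \<in> cbox c (\<chi> i. c $ i + s)"
    have "\<lfloor>(y $ i - (if i \<in> V then l / 3 else 0)) * 2 ^ k / l\<rfloor> = \<lfloor>(c $ i - (if i \<in> V then l / 3 else 0)) * 2 ^ k / l\<rfloor>" for i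
    proof -
      have *: "z * 2 ^ k / l = z / L" for z using l by (simp add: L_def)
      have "c $ i \<le> y $ i" "y $ i \<le> c $ i + s" using y by (auto simp: mem_box_cart)
      from b[OF this] show ?thesis unfolding * V_def by simp
    qed
    then show "y \<in> dyadic_cube (\<chi> i. if i \<in> V then l / 3 else 0) l k c"
      by (simp add: dyadic_cube_def dyadic_index_def vec_eq_iff)
  qed
  moreover have "l / 2 ^ k \<le> 6 * s" using j unfolding k by simp
  ultimately show ?thesis by blast
qed

text \<open>A cube lies in a cube of some shifted grid whose side is at most six times larger, so
  averages of a nonnegative function drop by at most \<open>6 ^ CARD('n)\<close>. Within one grid
  the maximal cubes among the finitely many obtained are disjoint and cover the same set.\<close>

lemma finite_shifted_cover:
  fixes \<Q> :: "(real ^ 'n) set set"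
  assumes fin: "finite \<Q>" and cub: "\<Q> \<subseteq> cubes" and f: "bounded_measurable f" "\<And>x. 0 \<le> f x"
    and t: "0 \<le> t" and big: "\<And>Q. Q \<in> \<Q> \<Longrightarrow> t < avg Q f"
  obtains \<D> :: "'n set \<Rightarrow> (real ^ 'n) set set" where "\<And>V. finite (\<D> V)" "\<And>V. disjoint (\<D> V)"
    "\<And>V D. D \<in> \<D> V \<Longrightarrow> \<exists>b s. 0 < s \<and> D = hcube b s" "\<Union>\<Q> \<subseteq> (\<Union>V. \<Union>(\<D> V))"
    "\<And>V D. D \<in> \<D> V \<Longrightarrow> t / 6 ^ CARD('n) < avg D f"
proof -
  have "\<exists>c s. 0 < s \<and> Q = cbox c (\<chi> i. c $ i + s)" if "Q \<in> \<Q>" for Q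
    using cub that unfolding cubes_def by blast
  then obtain c s where cs: "\<And>Q. Q \<in> \<Q> \<Longrightarrow> 0 < s Q \<and> Q = cbox (c Q) (\<chi> i. c Q $ i + s Q)"
    by metis
  define l where "l = 3 * Max (insert 1 (s ` \<Q>))"
  have l: "3 * s Q \<le> l" if "Q \<in> \<Q>" for Q using fin that by (auto simp: l_def)
  have l0: "0 < l" using fin by (auto simp: l_def Max_gr_iff)
  define o' where "o' V = (\<chi> i. if i \<in> V then l / 3 else 0)" for V :: "'n set"
  have "\<exists>V k x. Q \<subseteq> dyadic_cube (o' V) l k x \<and> l / 2 ^ k \<le> 6 * s Q" if "Q \<in> \<Q>" for Q
    using shifted_dyadic_cover[of "s Q" l "c Q"] cs[OF that] l[OF that] unfolding o'_def by metis
  then obtain v k x where vkx: "\<And>Q. Q \<in> \<Q> \<Longrightarrow> Q \<subseteq> dyadic_cube (o' (v Q)) l (k Q) (x Q)"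
      "\<And>Q. Q \<in> \<Q> \<Longrightarrow> l / 2 ^ k Q \<le> 6 * s Q" by metis
  define P where "P V = (\<lambda>Q. dyadic_cube (o' V) l (k Q) (x Q)) ` {Q \<in> \<Q>. v Q = V}" for V
  define \<D> where "\<D> V = stopping_cubes (o' V) l (\<lambda>D. D \<in> P V) (\<Union>(P V))" for V
  have sub: "\<D> V \<subseteq> P V" for V
  proof
    fix D assume "D \<in> \<D> V"
    then show "D \<in> P V" unfolding \<D>_def by (rule stopping_cubesE)
  qed
  have big': "t / 6 ^ CARD('n) < avg D f" if D: "D \<in> P V" for D V
  proof -
    obtain Q where Q: "Q \<in> \<Q>" "D = dyadic_cube (o' V) l (k Q) (x Q)" "v Q = V" using D by (auto simp: P_def)
    have Dh: "\<exists>b r. 0 < r \<and> D = hcube b r"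
      unfolding Q(2) dyadic_cube_eq_hcube[OF l0] by (rule exI, rule exI, rule conjI[OF _ refl]) (use l0 in simp)
    then have Dlm: "D \<in> lmeasurable" using hcube_lmeasurable by blast
    have mD: "measure lebesgue D = (l / 2 ^ k Q) ^ CARD('n)" unfolding Q(2) by (rule measure_dyadic_cube[OF l0])
    have mD0: "0 < measure lebesgue D" using l0 unfolding mD by simp
    have sQ: "0 < s Q" "Q = cbox (c Q) (\<chi> i. c Q $ i + s Q)" using cs[OF Q(1)] by auto
    have mQ: "measure lebesgue Q = s Q ^ CARD('n)" using measure_cube[of "s Q" "c Q"] sQ by simp
    have "measure lebesgue D \<le> (6 * s Q) ^ CARD('n)" unfolding mD using vkx(2)[OF Q(1)] l0 by (intro power_mono) auto
    also have "\<dots> = 6 ^ CARD('n) * measure lebesgue Q" unfolding mQ by (simp add: power_mult_distrib)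
    finally have "t / 6 ^ CARD('n) * measure lebesgue D \<le> t / 6 ^ CARD('n) * (6 ^ CARD('n) * measure lebesgue Q)"
      using t by (intro mult_left_mono) auto
    also have "\<dots> = t * measure lebesgue Q" by simp
    also have "\<dots> < I Q f" using big[OF Q(1)] measure_cube_pos[of Q] cub Q(1) by (auto simp: avg_def pos_less_divide_eq)
    also have "\<dots> \<le> I D f" using vkx(1)[OF Q(1)] Q Dlm cub cube_lebesgue by (intro I_subset f) auto
    finally show ?thesis using mD0 by (simp add: avg_def pos_less_divide_eq)
  qed
  show thesis
  proof
    show "finite (\<D> V)" for V using finite_subset[OF sub[of V]] fin by (simp add: P_def)
    show "disjoint (\<D> V)" for V unfolding \<D>_def by (rule stopping_cubes_disjoint)
    show "\<exists>b s. 0 < s \<and> D = hcube b s" if "D \<in> \<D> V" for D V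
      using stopping_cubes_hcube[OF l0] that unfolding \<D>_def by blast
    show "t / 6 ^ CARD('n) < avg D f" if "D \<in> \<D> V" for D V using that sub big' by blast
    show "\<Union>\<Q> \<subseteq> (\<Union>V. \<Union>(\<D> V))"
    proof
      fix y assume "y \<in> \<Union>\<Q>"
      then obtain Q where Q: "Q \<in> \<Q>" "y \<in> Q" by blast
      let ?V = "v Q" let ?D = "dyadic_cube (o' ?V) l (k Q) (x Q)"
      have D: "?D \<in> P ?V" "y \<in> ?D" using Q vkx(1) by (auto simp: P_def)
      have "dyadic_cube (o' ?V) l (k Q) y = ?D" by (rule dyadic_cube_eq[OF D(2) order_refl])
      then have "y \<in> \<Union>(\<D> ?V)" unfolding \<D>_def using D
        by (intro stopping_cubes_cover[where k = "k Q"]) auto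
      then show "y \<in> (\<Union>V. \<Union>(\<D> V))" by blast
    qed
  qed
qed

text \<open>The strict inequality \<open>t < avg D f\<close> persists for closed subcubes close
  enough to \<open>D\<close>, to which \<open>core\<close> applies; the sum then passes to the
  limit.\<close>

lemma half_open_sum_le:
  fixes \<D> :: "(real ^ 'n) set set" and X :: real
  assumes fin: "finite \<D>" and disj: "disjoint \<D>" and hc: "\<And>D. D \<in> \<D> \<Longrightarrow> \<exists>b s. 0 < s \<and> D = hcube b s"
    and f: "bounded_measurable f" "\<And>x. 0 \<le> f x" and w: "bounded_measurable w" "\<And>x. 0 \<le> w x"
    and big: "\<And>D. D \<in> \<D> \<Longrightarrow> t < avg D f"
    and core: "\<And>F. finite F \<Longrightarrow> F \<subseteq> cubes \<Longrightarrow> disjoint F \<Longrightarrow> (\<And>Q. Q \<in> F \<Longrightarrow> t < avg Q f) \<Longrightarrow> (\<Sum>Q\<in>F. I Q w) \<le> X"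
  shows "(\<Sum>D\<in>\<D>. I D w) \<le> X"
proof -
  obtain b s where bs: "\<And>D. D \<in> \<D> \<Longrightarrow> 0 < s D \<and> D = hcube (b D) (s D)" using hc by metis
  define S where "S m D = shrunk_cube (b D) (s D) m" for m D
  have S_sub: "S m D \<subseteq> D" and S_cube: "S m D \<in> cubes" if "D \<in> \<D>" for m D
    using shrunk_cube_subset[of "s D" "b D" m] shrunk_cube_in_cubes[of "s D" "b D" m] bs[OF that]
    by (simp_all add: S_def)
  have Dlm: "D \<in> lmeasurable" if "D \<in> \<D>" for D using bs[OF that] hcube_lmeasurable by metis
  have lim: "(\<lambda>m. I (S m D) g) \<longlonglongrightarrow> I D g" if D: "D \<in> \<D>" and g: "bounded_measurable g" "\<And>x. 0 \<le> g x" for D g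
  proof -
    have "(\<lambda>m. measure (weighted g D) (S m D \<inter> UNIV)) \<longlonglongrightarrow> measure (weighted g D) (hcube (b D) (s D) \<inter> UNIV)"
      unfolding S_def using bs[OF D] by (intro measure_shrunk_cube_tendsto finite_measure_weighted g Dlm D) auto
    moreover have "measure (weighted g D) (S m D \<inter> UNIV) = I (S m D) g" for m
      using weighted_measure[OF g Dlm[OF D], of "S m D"] cube_lebesgue[OF S_cube[OF D]] S_sub[OF D, of m]
      by (simp add: Int_absorb2)
    moreover have "measure (weighted g D) (hcube (b D) (s D) \<inter> UNIV) = I D g"
      using weighted_measure[OF g Dlm[OF D], of D] Dlm[OF D] bs[OF D] by (metis Int_UNIV_right Int_absorb fmeasurableD)
    ultimately show ?thesis by simp
  qed
  have "\<forall>\<^sub>F m in sequentially. t < avg (S m D) f" if D: "D \<in> \<D>" for D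
  proof (rule order_tendstoD(1)[OF _ big[OF D]])
    have mD: "(\<lambda>m. measure lebesgue (S m D)) \<longlonglongrightarrow> measure lebesgue D"
      using measure_lebesgue_shrunk_cube_tendsto[OF conjunct1[OF bs[OF D]], of "b D"] bs[OF D] unfolding S_def by metis
    have "0 < measure lebesgue D" using bs[OF D] by (metis measure_hcube less_imp_le zero_less_power)
    then show "(\<lambda>m. avg (S m D) f) \<longlonglongrightarrow> avg D f"
      unfolding avg_def by (intro tendsto_divide lim D f mD) auto
  qed
  then have ev: "\<forall>\<^sub>F m in sequentially. \<forall>D\<in>\<D>. t < avg (S m D) f"
    using fin by (simp add: eventually_ball_finite)
  have "\<forall>\<^sub>F m in sequentially. (\<Sum>D\<in>\<D>. I (S m D) w) \<le> X"
    using ev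
  proof eventually_elim
    case (elim m)
    have inj: "inj_on (S m) \<D>"
    proof (rule inj_onI)
      fix D E assume DE: "D \<in> \<D>" "E \<in> \<D>" "S m D = S m E"
      have "measure lebesgue (S m D) > 0" using measure_cube_pos[OF S_cube] DE by blast
      then have "S m D \<noteq> {}" by auto
      then have "D \<inter> E \<noteq> {}" using S_sub DE by blast
      then show "D = E" using disj DE by (auto simp: disjoint_def)
    qed
    have "(\<Sum>Q\<in>S m ` \<D>. I Q w) \<le> X"
    proof (rule core)
      show "disjoint (S m ` \<D>)"
        unfolding disjoint_def
      proof (intro ballI impI)
        fix X Y assume "X \<in> S m ` \<D>" "Y \<in> S m ` \<D>" "X \<noteq> Y"
        then obtain D E where DE: "D \<in> \<D>" "E \<in> \<D>" "X = S m D" "Y = S m E" "D \<noteq> E" by blast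
        then have "D \<inter> E = {}" using disj by (auto simp: disjoint_def)
        then show "X \<inter> Y = {}" using S_sub[OF DE(1), of m] S_sub[OF DE(2), of m] DE by blast
      qed
    qed (use fin S_cube elim in auto)
    then show ?case by (simp add: sum.reindex[OF inj])
  qed
  moreover have "(\<lambda>m. \<Sum>D\<in>\<D>. I (S m D) w) \<longlonglongrightarrow> (\<Sum>D\<in>\<D>. I D w)"
    by (intro tendsto_sum lim w)
  ultimately show ?thesis by (intro tendsto_upperbound[OF _ _ sequentially_bot])
qed

text \<open>Extends a bound on disjoint families to arbitrary finite ones. The price is the factor
  \<open>6 ^ CARD('n)\<close> in the level and one copy of \<open>X\<close> per shifted grid, the
  grids being indexed by sets of coordinates.\<close>

lemma level_set_cover_bound:
  fixes \<Q> :: "(real ^ 'n) set set" and X :: real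
  assumes fin: "finite \<Q>" and cub: "\<Q> \<subseteq> cubes" and f: "bounded_measurable f" "\<And>x. 0 \<le> f x"
    and w: "bounded_measurable w" "\<And>x. 0 \<le> w x" and t: "0 \<le> t"
    and big: "\<And>Q. Q \<in> \<Q> \<Longrightarrow> 6 ^ CARD('n) * t < avg Q f"
    and core: "\<And>F. finite F \<Longrightarrow> F \<subseteq> cubes \<Longrightarrow> disjoint F \<Longrightarrow> (\<And>Q. Q \<in> F \<Longrightarrow> t < avg Q f) \<Longrightarrow> (\<Sum>Q\<in>F. I Q w) \<le> X"
  shows "I (\<Union>\<Q>) w \<le> CARD('n set) * X"
proof -
  have t6: "0 \<le> 6 ^ CARD('n) * t" using t by simp
  obtain \<D> :: "'n set \<Rightarrow> (real ^ 'n) set set" where \<D>: "\<And>V. finite (\<D> V)" "\<And>V. disjoint (\<D> V)"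
    "\<And>V D. D \<in> \<D> V \<Longrightarrow> \<exists>b s. 0 < s \<and> D = hcube b s" "\<Union>\<Q> \<subseteq> (\<Union>V. \<Union>(\<D> V))"
    "\<And>V D. D \<in> \<D> V \<Longrightarrow> 6 ^ CARD('n) * t / 6 ^ CARD('n) < avg D f"
    using finite_shifted_cover[OF fin cub f t6 big] by blast
  have Dl: "D \<in> lmeasurable" if "D \<in> \<D> V" for D V using \<D>(3)[OF that] hcube_lmeasurable by blast
  have UV: "\<Union>(\<D> V) \<in> lmeasurable" for V using \<D>(1) Dl by (intro fmeasurable.finite_Union) auto
  have U: "(\<Union>V. \<Union>(\<D> V)) \<in> lmeasurable" using UV by (intro fmeasurable.finite_UN) auto
  let ?N = "weighted w (\<Union>V. \<Union>(\<D> V))"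
  interpret N: finite_measure ?N by (rule finite_measure_weighted[OF w U])
  have N: "measure ?N Y = I Y w" if "Y \<in> sets lebesgue" "Y \<subseteq> (\<Union>V. \<Union>(\<D> V))" for Y
    using weighted_measure[OF w U that(1)] that(2) by (simp add: Int_absorb2)
  have QS: "\<Union>\<Q> \<in> sets lebesgue" using fin cub cube_lebesgue by (intro sets.finite_Union) auto
  have "I (\<Union>\<Q>) w = measure ?N (\<Union>\<Q>)" using N QS \<D>(4) by simp
  also have "\<dots> \<le> measure ?N (\<Union>V. \<Union>(\<D> V))" using \<D>(4) U by (intro N.finite_measure_mono) auto
  also have "\<dots> \<le> (\<Sum>V\<in>UNIV. measure ?N (\<Union>(\<D> V)))"
    using UV by (intro N.finite_measure_subadditive_finite) auto
  also have "\<dots> \<le> (\<Sum>V\<in>(UNIV :: 'n set set). X)"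
  proof (rule sum_mono)
    fix V
    have "measure ?N (\<Union>(\<D> V)) \<le> (\<Sum>D\<in>\<D> V. measure ?N D)"
      using N.finite_measure_subadditive_finite[OF \<D>(1)[of V], of "\<lambda>D. D"] Dl by auto
    also have "\<dots> = (\<Sum>D\<in>\<D> V. I D w)" using Dl by (intro sum.cong refl N) auto
    also have "\<dots> \<le> X"
      using \<D>(5) by (intro half_open_sum_le[OF \<D>(1,2,3) f w _ core]) auto
    finally show "measure ?N (\<Union>(\<D> V)) \<le> X" .
  qed
  finally show ?thesis by simp
qed

lemma nn_integral_I:
  assumes "bounded_measurable g" "\<And>x. 0 \<le> g x" "S \<in> lmeasurable"
  shows "(\<integral>\<^sup>+x. ennreal (g x) * indicator S x \<partial>lebesgue) = ennreal (I S g)"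
proof -
  have "(\<integral>\<^sup>+x. ennreal (g x) * indicator S x \<partial>lebesgue) = (\<integral>\<^sup>+x. ennreal (indicator S x *\<^sub>R g x) \<partial>lebesgue)"
    by (intro nn_integral_cong) (auto simp: indicator_def)
  also have "\<dots> = ennreal (I S g)"
    unfolding set_lebesgue_integral_def
    using bm_set_integrable[OF assms(1,3)] assms(2)
    by (intro nn_integral_eq_integral) (auto simp: set_integrable_def)
  finally show ?thesis .
qed

lemma I_disjoint_Union:
  assumes "finite F" "disjoint F" "\<And>Q. Q \<in> F \<Longrightarrow> Q \<in> lmeasurable" and g: "bounded_measurable g" "\<And>x. 0 \<le> g x"
  shows "(\<Sum>Q\<in>F. I Q g) = I (\<Union>F) g"
proof -
  have U: "\<Union>F \<in> lmeasurable" using assms(1,3) by (intro fmeasurable.finite_Union) auto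
  interpret N: finite_measure "weighted g (\<Union>F)" by (rule finite_measure_weighted[OF g U])
  have N: "measure (weighted g (\<Union>F)) X = I X g" if "X \<in> sets lebesgue" "X \<subseteq> \<Union>F" for X
    using weighted_measure[OF g U that(1)] that(2) by (simp add: Int_absorb2)
  have "(\<Sum>Q\<in>F. I Q g) = (\<Sum>Q\<in>F. measure (weighted g (\<Union>F)) Q)"
    using assms(3) by (intro sum.cong refl N[symmetric]) auto
  also have "\<dots> = measure (weighted g (\<Union>F)) (\<Union>Q\<in>F. Q)"
    using assms by (intro N.finite_measure_finite_Union[symmetric]) (auto simp: disjoint_family_on_def disjoint_def)
  also have "\<dots> = I (\<Union>F) g" using N U by simp
  finally show ?thesis .
qed

context local_exponents
begin

text \<open>Since the averages are at least \<open>2 * t\<close>, discarding the values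
  \<open>f x \<le> t\<close> leaves averages at least \<open>t\<close>; the resulting indicator is
  what makes the later sum over levels converge. For \<open>t < 1\<close> the part of
  \<open>f\<close> above 1 is separated, because \<open>small_levels\<close> concerns functions with
  values in [0, 1].\<close>

lemma cube_level_estimate:
  assumes qs: "quantile_sum_condition p r \<gamma>\<^sub>0 C" and r: "1 < r" and \<gamma>0: "0 < \<gamma>\<^sub>0" "\<gamma>\<^sub>0 < 1/2"
  shows "\<exists>\<epsilon> \<kappa> D. 0 < \<epsilon> \<and> \<epsilon> \<le> 1 \<and> \<epsilon> < a - 1 \<and> 0 < \<kappa> \<and> 1 \<le> D \<and>
    (\<forall>F t f. finite F \<longrightarrow> F \<subseteq> cubes \<longrightarrow> disjoint F \<longrightarrow> 0 < t \<longrightarrow> bounded_measurable f \<longrightarrow> (\<forall>x. 0 \<le> f x) \<longrightarrow>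
       (\<Sum>Q\<in>F. I Q (\<lambda>x. f x powr p x)) \<le> 1 \<longrightarrow> (\<forall>Q\<in>F. 2 * t \<le> avg Q f) \<longrightarrow>
       (\<Sum>Q\<in>F. I Q (\<lambda>x. t powr p x)) \<le>
         D * ((\<Sum>Q\<in>F. I Q (\<lambda>x. t powr \<epsilon> * f x powr (p x - \<epsilon>) * indicator {x. t < f x} x)) + (if t < 1 then t powr \<kappa> else 0)))"
proof -
  obtain \<epsilon>\<^sub>0 D1 where e0: "0 < \<epsilon>\<^sub>0" "\<epsilon>\<^sub>0 \<le> 1" "\<epsilon>\<^sub>0 < a - 1" and D1: "1 \<le> D1"
    and large: "\<And>\<epsilon> Q t f. 0 \<le> \<epsilon> \<Longrightarrow> \<epsilon> \<le> \<epsilon>\<^sub>0 \<Longrightarrow> Q \<in> cubes \<Longrightarrow> 1 \<le> t \<Longrightarrow> bounded_measurable f \<Longrightarrow> \<forall>x. 0 \<le> f x \<Longrightarrow>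
        I Q (\<lambda>x. f x powr p x) \<le> 1 \<Longrightarrow> t \<le> avg Q f \<Longrightarrow>
        I Q (\<lambda>x. t powr p x) \<le> D1 * I Q (\<lambda>x. t powr \<epsilon> * f x powr (p x - \<epsilon>))"
    using large_levels by blast
  define P where "P \<kappa> \<epsilon>\<^sub>1 D2 \<longleftrightarrow> 0 < \<kappa> \<and> 0 < \<epsilon>\<^sub>1 \<and> \<epsilon>\<^sub>1 \<le> 1 \<and> \<epsilon>\<^sub>1 < a - 1 \<and> 1 \<le> D2 \<and>
    (\<forall>\<epsilon> F t f. 0 \<le> \<epsilon> \<longrightarrow> \<epsilon> \<le> \<epsilon>\<^sub>1 \<longrightarrow> finite F \<longrightarrow> F \<subseteq> cubes \<longrightarrow> disjoint F \<longrightarrow> 0 < t \<longrightarrow> t < 1 \<longrightarrow>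
       bounded_measurable f \<longrightarrow> (\<forall>x. 0 \<le> f x \<and> f x \<le> 1) \<longrightarrow> (\<forall>Q\<in>F. t \<le> avg Q f) \<longrightarrow>
       (\<Sum>Q\<in>F. I Q (\<lambda>x. t powr p x)) \<le> D2 * ((\<Sum>Q\<in>F. I Q (\<lambda>x. t powr \<epsilon> * f x powr (p x - \<epsilon>))) + t powr \<kappa>))" for \<kappa> \<epsilon>\<^sub>1 D2 :: real
  have "\<exists>\<kappa> \<epsilon>\<^sub>1 D2. P \<kappa> \<epsilon>\<^sub>1 D2" unfolding P_def by (rule small_levels[OF qs r \<gamma>0])
  then obtain \<kappa> \<epsilon>\<^sub>1 D2 where "P \<kappa> \<epsilon>\<^sub>1 D2" by blast
  note sm = this[unfolded P_def]
  have k: "0 < \<kappa>" and e1: "0 < \<epsilon>\<^sub>1" "\<epsilon>\<^sub>1 \<le> 1" "\<epsilon>\<^sub>1 < a - 1" and D2: "1 \<le> D2" using sm by simp_all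
  note small = conjunct2[OF conjunct2[OF conjunct2[OF conjunct2[OF conjunct2[OF sm]]]], rule_format]
  define \<epsilon> where "\<epsilon> = min \<epsilon>\<^sub>0 \<epsilon>\<^sub>1"
  have e: "0 < \<epsilon>" "\<epsilon> \<le> \<epsilon>\<^sub>0" "\<epsilon> \<le> \<epsilon>\<^sub>1" "\<epsilon> \<le> 1" "\<epsilon> < a - 1" using e0 e1 by (auto simp: \<epsilon>_def)
  define D where "D = D1 + 2 + 2 powr b * D2"
  have "0 \<le> 2 powr b * D2" using D2 by simp
  then have D: "1 \<le> D" "D1 \<le> D" "2 + 2 powr b * D2 \<le> D" using D1 by (auto simp: D_def)
  have main: "(\<Sum>Q\<in>F. I Q (\<lambda>x. t powr p x)) \<le>
         D * ((\<Sum>Q\<in>F. I Q (\<lambda>x. t powr \<epsilon> * f x powr (p x - \<epsilon>) * indicator {x. t < f x} x)) + (if t < 1 then t powr \<kappa> else 0))"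
    if F: "finite F" "F \<subseteq> cubes" "disjoint F" and t: "0 < t" and f: "bounded_measurable f" "\<forall>x. 0 \<le> f x"
      and fp: "(\<Sum>Q\<in>F. I Q (\<lambda>x. f x powr p x)) \<le> 1" and tf: "\<forall>Q\<in>F. 2 * t \<le> avg Q f" for F t f
  proof -
    have f0: "0 \<le> f x" for x using f by simp
    define G where "G = {x. t < f x}"
    have G: "G \<in> sets lebesgue" unfolding G_def by (rule superlevel_lebesgue[OF f(1)])
    define g where "g x = t powr \<epsilon> * f x powr (p x - \<epsilon>) * indicator G x" for x
    have bg: "bounded_measurable g" unfolding g_def
      by (intro bm_mult bm_const bm_fun_powr_p f f0 e bm_indicator G)
    have g0: "0 \<le> g x" for x by (simp add: g_def)
    have Ig0: "0 \<le> I Q g" for Q by (rule I_nonneg) (rule g0)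
    define h where "h x = f x * indicator G x" for x
    have bh: "bounded_measurable h" unfolding h_def by (intro bm_mult f bm_indicator G)
    have h0: "0 \<le> h x" for x by (simp add: h_def f0)
    have hg: "t powr \<epsilon> * h x powr (p x - \<epsilon>) = g x" for x by (simp add: h_def g_def indicator_def)
    have avh: "t \<le> avg Q h" if Q: "Q \<in> F" for Q
    proof -
      have Qc: "Q \<in> cubes" using Q F by auto
      have "2 * t \<le> avg Q f" using tf Q by simp
      also have "\<dots> \<le> avg Q (\<lambda>x. h x + t)"
        by (intro avg_mono f bm_add bh bm_const Qc) (auto simp: h_def G_def indicator_def t less_imp_le)
      also have "\<dots> = avg Q h + t" using avg_add[OF bh bm_const Qc] avg_const[OF Qc] by simp
      finally show ?thesis by simp
    qed
    have "(\<Sum>Q\<in>F. I Q (\<lambda>x. t powr p x)) \<le> D * ((\<Sum>Q\<in>F. I Q g) + (if t < 1 then t powr \<kappa> else 0))"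
    proof (cases "1 \<le> t")
      case True
      have "I Q (\<lambda>x. t powr p x) \<le> D * I Q g" if Q: "Q \<in> F" for Q
      proof -
        have Qc: "Q \<in> cubes" using Q F by auto
        have bfp: "bounded_measurable (\<lambda>x. f x powr p x)" using bm_fun_powr_p[OF f(1) f0, of 0] by simp
        have bhp: "bounded_measurable (\<lambda>x. h x powr p x)" using bm_fun_powr_p[OF bh h0, of 0] by simp
        have "I Q (\<lambda>x. h x powr p x) \<le> I Q (\<lambda>x. f x powr p x)"
          by (rule I_mono[OF bhp bfp cube_lmeasurable[OF Qc]]) (simp add: h_def indicator_def)
        also have "\<dots> \<le> (\<Sum>Q\<in>F. I Q (\<lambda>x. f x powr p x))"
          using F Q by (intro member_le_sum) (auto intro!: I_nonneg)
        finally have "I Q (\<lambda>x. h x powr p x) \<le> 1" using fp by simp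
        then have "I Q (\<lambda>x. t powr p x) \<le> D1 * I Q (\<lambda>x. t powr \<epsilon> * h x powr (p x - \<epsilon>))"
          using e True bh h0 avh[OF Q] by (intro large Qc) auto
        also have "\<dots> = D1 * I Q g" by (simp only: hg)
        also have "\<dots> \<le> D * I Q g" by (rule mult_right_mono[OF D(2) Ig0])
        finally show ?thesis .
      qed
      then have "(\<Sum>Q\<in>F. I Q (\<lambda>x. t powr p x)) \<le> D * (\<Sum>Q\<in>F. I Q g)"
        unfolding sum_distrib_left by (rule sum_mono)
      then show ?thesis using True by simp
    next
      case False
      then have t1: "t < 1" by simp
      have big: "{x. 1 < f x} \<in> sets lebesgue" by (rule superlevel_lebesgue[OF f(1)])
      have bigc: "- {x. 1 < f x} \<in> sets lebesgue"
        using big sets.compl_sets[of "{x. 1 < f x}" lebesgue] by (simp add: Compl_eq_Diff_UNIV)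
      define h1 where "h1 x = h x * indicator {x. 1 < f x} x" for x
      define h2 where "h2 x = h x * indicator (- {x. 1 < f x}) x" for x
      have bh1: "bounded_measurable h1" unfolding h1_def by (intro bm_mult bh bm_indicator big)
      have bh2: "bounded_measurable h2" unfolding h2_def by (intro bm_mult bh bm_indicator bigc)
      have h2: "\<forall>x. 0 \<le> h2 x \<and> h2 x \<le> 1" using h0 by (auto simp: h2_def h_def indicator_def)
      have h12: "h x = h1 x + h2 x" for x by (auto simp: h1_def h2_def indicator_def)
      \<comment> \<open>On these cubes the part above 1 suffices, by the elementary bounds
        \<open>t powr p x \<le> t powr \<epsilon> * t\<close> and
        \<open>f x \<le> f x powr (p x - \<epsilon>)\<close> where \<open>f x > 1\<close>.\<close>
      define F1 where "F1 = {Q\<in>F. t / 2 \<le> avg Q h1}"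
      have F1: "I Q (\<lambda>x. t powr p x) \<le> 2 * I Q g" if Q: "Q \<in> F1" for Q
      proof -
        have Qc: "Q \<in> cubes" "t / 2 \<le> avg Q h1" using Q F by (auto simp: F1_def)
        have lm: "Q \<in> lmeasurable" by (rule cube_lmeasurable[OF Qc(1)])
        have "I Q (\<lambda>x. t powr p x) \<le> I Q (\<lambda>x. t powr \<epsilon> * t)"
        proof (rule I_mono[OF bm_powr_p[OF t] bm_const lm])
          fix x
          have "t powr p x \<le> t powr (\<epsilon> + 1)" using t t1 e a(2)[of x] by (intro powr_mono') auto
          then show "t powr p x \<le> t powr \<epsilon> * t" using t by (simp add: powr_add)
        qed
        also have "\<dots> = t powr \<epsilon> * (t * measure lebesgue Q)" by (simp only: I_const[OF lm] mult.assoc)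
        also have "\<dots> \<le> t powr \<epsilon> * (2 * I Q h1)"
          using Qc measure_cube_pos[OF Qc(1)] by (intro mult_left_mono) (auto simp: avg_def field_simps)
        also have "\<dots> = 2 * I Q (\<lambda>x. t powr \<epsilon> * h1 x)" by simp
        also have "\<dots> \<le> 2 * I Q g"
        proof (intro mult_left_mono I_mono bm_mult bm_const bh1 bg lm)
          fix x
          show "t powr \<epsilon> * h1 x \<le> g x"
          proof (cases "1 < f x")
            case True
            have "f x powr 1 \<le> f x powr (p x - \<epsilon>)" using True a(2)[of x] e by (intro powr_mono) auto
            then show ?thesis using True by (simp add: h1_def h_def g_def indicator_def mult_left_mono)
          qed (simp add: h1_def g0)
        qed auto
        finally show ?thesis .
      qed
      have F2: "t / 2 \<le> avg Q h2" if Q: "Q \<in> F - F1" for Q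
      proof -
        have Qc: "Q \<in> F" "Q \<in> cubes" "avg Q h1 < t / 2" using Q F by (auto simp: F1_def)
        have "avg Q h = avg Q (\<lambda>x. h1 x + h2 x)" by (intro avg_cong h12)
        also have "\<dots> = avg Q h1 + avg Q h2" by (rule avg_add[OF bh1 bh2 Qc(2)])
        finally have "avg Q h = avg Q h1 + avg Q h2" .
        then show ?thesis using avh[OF Qc(1)] Qc(3) by linarith
      qed
      \<comment> \<open>On the other cubes the part bounded by 1 has average at least
        \<open>t / 2\<close>, so that is the level at which \<open>small_levels\<close> is
        used.\<close>
      have "(\<Sum>Q\<in>F - F1. I Q (\<lambda>x. (t / 2) powr p x)) \<le>
          D2 * ((\<Sum>Q\<in>F - F1. I Q (\<lambda>x. (t / 2) powr \<epsilon> * h2 x powr (p x - \<epsilon>))) + (t / 2) powr \<kappa>)"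
        using e t t1 F F2 bh2 h2 by (intro small) (auto simp: disjoint_def)
      also have "\<dots> \<le> D2 * ((\<Sum>Q\<in>F - F1. I Q g) + t powr \<kappa>)"
      proof (intro mult_left_mono add_mono sum_mono)
        show "(t / 2) powr \<kappa> \<le> t powr \<kappa>" using t k by (intro powr_mono2) auto
        fix Q assume "Q \<in> F - F1"
        then have lm: "Q \<in> lmeasurable" using F cube_lmeasurable by auto
        show "I Q (\<lambda>x. (t / 2) powr \<epsilon> * h2 x powr (p x - \<epsilon>)) \<le> I Q g"
        proof (rule I_mono[OF _ bg lm])
          show "bounded_measurable (\<lambda>x. (t / 2) powr \<epsilon> * h2 x powr (p x - \<epsilon>))"
            using h2 e by (intro bm_mult bm_const bm_fun_powr_p bh2) auto
          fix x
          have "(t / 2) powr \<epsilon> * h2 x powr (p x - \<epsilon>) \<le> t powr \<epsilon> * h x powr (p x - \<epsilon>)"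
          proof (rule mult_mono)
            show "(t / 2) powr \<epsilon> \<le> t powr \<epsilon>" using t e by (intro powr_mono2) auto
            show "h2 x powr (p x - \<epsilon>) \<le> h x powr (p x - \<epsilon>)" by (simp add: h2_def indicator_def)
          qed auto
          then show "(t / 2) powr \<epsilon> * h2 x powr (p x - \<epsilon>) \<le> g x" by (simp only: hg)
        qed
      qed (use D2 in auto)
      finally have le2: "(\<Sum>Q\<in>F - F1. I Q (\<lambda>x. (t / 2) powr p x)) \<le> D2 * ((\<Sum>Q\<in>F - F1. I Q g) + t powr \<kappa>)" .
      have S0: "0 \<le> (\<Sum>Q\<in>X. I Q g)" for X by (intro sum_nonneg Ig0)
      have split: "(\<Sum>Q\<in>F. w Q) = (\<Sum>Q\<in>F - F1. w Q) + (\<Sum>Q\<in>F1. w Q)" for w :: "_ \<Rightarrow> real"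
        by (rule sum.subset_diff) (use F in \<open>auto simp: F1_def\<close>)
      have "(\<Sum>Q\<in>F - F1. I Q (\<lambda>x. t powr p x)) \<le> (\<Sum>Q\<in>F - F1. 2 powr b * I Q (\<lambda>x. (t / 2) powr p x))"
        using I_powr_scale_le[of _ 2 "t / 2"] t F(2) by (intro sum_mono) auto
      also have "\<dots> = 2 powr b * (\<Sum>Q\<in>F - F1. I Q (\<lambda>x. (t / 2) powr p x))" by (simp only: sum_distrib_left)
      also have "\<dots> \<le> 2 powr b * (D2 * ((\<Sum>Q\<in>F - F1. I Q g) + t powr \<kappa>))" using le2 by (intro mult_left_mono) auto
      finally have A1: "(\<Sum>Q\<in>F - F1. I Q (\<lambda>x. t powr p x)) \<le> 2 powr b * D2 * ((\<Sum>Q\<in>F - F1. I Q g) + t powr \<kappa>)" by simp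
      have A2: "(\<Sum>Q\<in>F1. I Q (\<lambda>x. t powr p x)) \<le> 2 * (\<Sum>Q\<in>F1. I Q g)"
        unfolding sum_distrib_left by (intro sum_mono F1)
      define W where "W = (\<Sum>Q\<in>F. I Q g) + t powr \<kappa>"
      have "(\<Sum>Q\<in>F - F1. I Q g) + t powr \<kappa> \<le> W" "(\<Sum>Q\<in>F1. I Q g) \<le> W" "0 \<le> W"
        using split[of "\<lambda>Q. I Q g"] S0[of F1] S0[of "F - F1"] S0[of F] powr_ge_zero[of t \<kappa>] unfolding W_def by linarith+
      then have "2 powr b * D2 * ((\<Sum>Q\<in>F - F1. I Q g) + t powr \<kappa>) \<le> 2 powr b * D2 * W" "2 * (\<Sum>Q\<in>F1. I Q g) \<le> 2 * W"
        using D2 by (auto intro!: mult_left_mono)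
      then have "(\<Sum>Q\<in>F. I Q (\<lambda>x. t powr p x)) \<le> 2 powr b * D2 * W + 2 * W"
        using A1 A2 split[of "\<lambda>Q. I Q (\<lambda>x. t powr p x)"] by linarith
      also have "\<dots> = (2 + 2 powr b * D2) * W" by (simp add: algebra_simps)
      also have "\<dots> \<le> D * W" using D(3) \<open>0 \<le> W\<close> by (rule mult_right_mono)
      finally show ?thesis using t1 by (simp add: W_def)
    qed
    then show ?thesis unfolding g_def G_def .
  qed
  show ?thesis
    by (rule exI[of _ \<epsilon>], rule exI[of _ \<kappa>], rule exI[of _ D], intro conjI, rule e(1), rule e(4), rule e(5), rule k,
      rule D(1), intro allI impI, rule main)
qed

end

section \<open>Superlevel sets of the maximal function\<close>

lemma ennreal_less_divide_iff:
  assumes "0 < m" "0 \<le> s" shows "ennreal s < J / ennreal m \<longleftrightarrow> ennreal (s * m) < J"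
proof (cases J)
  case (real r)
  then show ?thesis using assms
    by (simp add: divide_ennreal ennreal_less_iff pos_less_divide_eq del: ennreal_mult')
next
  case top
  then show ?thesis using assms by (simp add: ennreal_top_divide less_top)
qed

lemma emeasure_Union_le:
  assumes "countable \<D>" "\<D> \<subseteq> sets M" and le: "\<And>\<G>. finite \<G> \<Longrightarrow> \<G> \<subseteq> \<D> \<Longrightarrow> emeasure M (\<Union>\<G>) \<le> X"
  shows "emeasure M (\<Union>\<D>) \<le> X"
proof (cases "\<D> = {}")
  case False
  define A where "A n = \<Union> (from_nat_into \<D> ` {..n})" for n
  have sub: "from_nat_into \<D> ` {..n} \<subseteq> \<D>" for n using from_nat_into[OF False] by blast
  have U: "(\<Union>n. A n) = \<Union>\<D>"
  proof
    show "(\<Union>n. A n) \<subseteq> \<Union>\<D>" unfolding A_def using sub by blast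
    show "\<Union>\<D> \<subseteq> (\<Union>n. A n)"
    proof
      fix x assume "x \<in> \<Union>\<D>"
      then obtain D where D: "D \<in> \<D>" "x \<in> D" by blast
      then obtain n where "from_nat_into \<D> n = D" using from_nat_into_surj[OF assms(1)] by metis
      then have "x \<in> A n" using D unfolding A_def by auto
      then show "x \<in> (\<Union>n. A n)" by blast
    qed
  qed
  have "emeasure M (\<Union>n. A n) = (SUP n. emeasure M (A n))"
  proof (rule SUP_emeasure_incseq[symmetric])
    show "range A \<subseteq> sets M" using sub assms(2) by (auto simp: A_def)
    show "incseq A" unfolding A_def incseq_def by (intro allI impI Union_mono image_mono) auto
  qed
  also have "\<dots> \<le> X" unfolding A_def by (intro SUP_least le) (use sub in auto)
  finally show ?thesis unfolding U .
qed (use le[of "{}"] in simp)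

definition superlevel_cubes :: "(real ^ 'n \<Rightarrow> real) \<Rightarrow> real \<Rightarrow> (real ^ 'n) set set" where
  "superlevel_cubes f s = {Q \<in> cubes. ennreal (s * measure lebesgue Q) < (\<integral>\<^sup>+ y \<in> Q. ennreal \<bar>f y\<bar> \<partial>lebesgue)}"

lemma superlevel_cubes_iff:
  assumes "Q \<in> cubes" "0 \<le> s"
  shows "ennreal s < (\<integral>\<^sup>+ y \<in> Q. ennreal \<bar>f y\<bar> \<partial>lebesgue) / emeasure lebesgue Q \<longleftrightarrow> Q \<in> superlevel_cubes f s"
proof -
  have "emeasure lebesgue Q = ennreal (measure lebesgue Q)"
    using cube_lmeasurable[OF assms(1)] by (rule emeasure_eq_measure2)
  then show ?thesis using assms ennreal_less_divide_iff[OF measure_cube_pos[OF assms(1)] assms(2)]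
    by (simp add: superlevel_cubes_def)
qed

text \<open>The inequality is strict, so it survives a slight enlargement of the cube, while the
  integral of the absolute value can only grow. Superlevel sets of the maximal function are
  therefore open, which yields measurability and countable covers.\<close>

lemma enlarge_superlevel_cube:
  fixes Q :: "(real ^ 'n) set"
  assumes Q: "Q \<in> superlevel_cubes f s" and s: "0 \<le> s"
  shows "\<exists>R\<in>superlevel_cubes f s. Q \<subseteq> interior R"
proof -
  define J where "J = (\<integral>\<^sup>+ y \<in> Q. ennreal \<bar>f y\<bar> \<partial>lebesgue)"
  obtain a l where al: "0 < l" "Q = cbox a (\<chi> i. a $ i + l)" using Q cubesE unfolding superlevel_cubes_def by blast
  have mQ: "measure lebesgue Q = l ^ CARD('n)" using measure_cube[of l a] al by simp
  have "ennreal (s * l ^ CARD('n)) < J" using Q mQ by (simp add: superlevel_cubes_def J_def)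
  then obtain z where z: "ennreal (s * l ^ CARD('n)) < z" "z < J" using dense by blast
  then obtain j where j: "z = ennreal j" "0 \<le> j" by (cases z) auto
  have lt: "s * l ^ CARD('n) < j" using z(1) s al(1) unfolding j(1) by (simp add: ennreal_less_iff)
  have "(\<lambda>m. 2 / (real m + 1)) \<longlonglongrightarrow> 0" by real_asymp
  then have "(\<lambda>m. s * (l + 2 / (real m + 1)) ^ CARD('n)) \<longlonglongrightarrow> s * (l + 0) ^ CARD('n)"
    by (intro tendsto_mult tendsto_power tendsto_add tendsto_const)
  then have "\<forall>\<^sub>F m in sequentially. s * (l + 2 / (real m + 1)) ^ CARD('n) < j"
    by (rule order_tendstoD(2)) (use lt in simp)
  then obtain m where m: "s * (l + 2 / (real m + 1)) ^ CARD('n) < j" by (auto dest: eventually_happens)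
  define h where "h = 1 / (real m + 1)"
  have h: "0 < h" by (simp add: h_def)
  define R where "R = cbox (\<chi> i. a $ i - h) (\<chi> i. (\<chi> i. a $ i - h) $ i + (l + 2 * h))"
  have R: "R \<in> cubes" unfolding R_def cubes_def mem_Collect_eq
    by (rule exI, rule exI, rule conjI[OF _ refl]) (use al h in simp)
  have mR: "measure lebesgue R = (l + 2 * h) ^ CARD('n)" unfolding R_def by (rule measure_cube) (use al h in simp)
  have "Q \<subseteq> box (\<chi> i. a $ i - h) (\<chi> i. (\<chi> i. a $ i - h) $ i + (l + 2 * h))"
    unfolding al(2) using h by (auto simp: mem_box_cart) (smt (verit, best))+
  also have "\<dots> \<subseteq> interior R" unfolding R_def by (simp add: interior_cbox)
  finally have QR: "Q \<subseteq> interior R" .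
  have "ennreal (s * measure lebesgue R) < z" using m s al h unfolding mR j(1) by (simp add: h_def ennreal_less_iff)
  also have "\<dots> < J" by (rule z(2))
  also have "J \<le> (\<integral>\<^sup>+ y \<in> R. ennreal \<bar>f y\<bar> \<partial>lebesgue)"
    unfolding J_def using QR interior_subset[of R] by (intro nn_integral_mono) (auto simp: indicator_def)
  finally show ?thesis using R QR by (intro bexI[of _ R]) (auto simp: superlevel_cubes_def)
qed

lemma maximal_superlevel:
  fixes f :: "real ^ 'n \<Rightarrow> real"
  assumes "0 \<le> s"
  shows "{x. ennreal s < maximal_function f x} = (\<Union>R\<in>superlevel_cubes f s. interior R)"
proof -
  have "{x. ennreal s < maximal_function f x} = \<Union>(superlevel_cubes f s)"
  proof -
    have "ennreal s < maximal_function f x \<longleftrightarrow> (\<exists>Q\<in>superlevel_cubes f s. x \<in> Q)" for x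
      unfolding maximal_function_def less_SUP_iff using superlevel_cubes_iff[OF _ assms, of _ f]
      by (auto simp: superlevel_cubes_def)
    then show ?thesis by auto
  qed
  also have "\<dots> = (\<Union>R\<in>superlevel_cubes f s. interior R)"
  proof
    show "\<Union>(superlevel_cubes f s) \<subseteq> (\<Union>R\<in>superlevel_cubes f s. interior R)"
    proof
      fix x assume "x \<in> \<Union>(superlevel_cubes f s)"
      then obtain Q where Q: "Q \<in> superlevel_cubes f s" "x \<in> Q" by blast
      from enlarge_superlevel_cube[OF Q(1) assms] obtain R where "R \<in> superlevel_cubes f s" "Q \<subseteq> interior R" by blast
      with Q show "x \<in> (\<Union>R\<in>superlevel_cubes f s. interior R)" by blast
    qed
    show "(\<Union>R\<in>superlevel_cubes f s. interior R) \<subseteq> \<Union>(superlevel_cubes f s)"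
      using interior_subset by blast
  qed
  finally show ?thesis .
qed

lemma maximal_function_measurable: "maximal_function f \<in> borel_measurable lebesgue"
proof (rule borel_measurableI_greater)
  fix y :: ennreal
  have "{x. y < maximal_function f x} \<in> sets lebesgue"
  proof (cases y)
    case (real s)
    have "open (\<Union>R\<in>superlevel_cubes f s. interior R)" by auto
    then show ?thesis unfolding real(2) maximal_superlevel[OF real(1)]
      by (intro sets_completionI_sets) (simp add: borel_open)
  qed simp
  then show "{x \<in> space lebesgue. y < maximal_function f x} \<in> sets lebesgue" by simp
qed

text \<open>The passage from unbounded to bounded functions: by monotone convergence some truncation
  keeps each average above \<open>s\<close>, and finitely many cubes admit a common one.\<close>

lemma truncation_superlevel:
  fixes f :: "real ^ 'n \<Rightarrow> real"
  assumes f: "f \<in> borel_measurable lebesgue" "\<And>x. 0 \<le> f x" and s: "0 \<le> s"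
    and \<Q>: "finite \<Q>" "\<Q> \<subseteq> superlevel_cubes f s"
  shows "\<exists>m::nat. \<forall>Q\<in>\<Q>. s < avg Q (\<lambda>x. min (f x) (real m))"
proof -
  define g where "g m x = min (f x) (real m)" for m :: nat and x
  have bg: "bounded_measurable (g m)" for m
    unfolding g_def using f by (intro bmI[where C = "real m"]) (auto simp: min_def)
  have g0: "0 \<le> g m x" for m x using f(2) by (simp add: g_def)
  have "\<exists>m. s * measure lebesgue Q < I Q (g m)" if Q: "Q \<in> \<Q>" for Q
  proof -
    have Qc: "Q \<in> cubes" using Q \<Q> by (auto simp: superlevel_cubes_def)
    have lm: "Q \<in> lmeasurable" by (rule cube_lmeasurable[OF Qc])
    have [measurable]: "f \<in> borel_measurable lebesgue" by (rule f(1))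
    have [measurable]: "Q \<in> sets lebesgue" using lm by auto
    have sup: "(SUP m. ennreal (g m x) * indicator Q x) = ennreal \<bar>f x\<bar> * indicator Q x" for x
    proof (rule antisym)
      show "(SUP m. ennreal (g m x) * indicator Q x) \<le> ennreal \<bar>f x\<bar> * indicator Q x"
        using f(2) by (intro SUP_least mult_right_mono) (auto simp: g_def ennreal_leI)
      obtain m where "f x \<le> real m" using real_arch_simple by blast
      then have "g m x = \<bar>f x\<bar>" using f(2) by (simp add: g_def)
      then show "ennreal \<bar>f x\<bar> * indicator Q x \<le> (SUP m. ennreal (g m x) * indicator Q x)"
        by (metis SUP_upper UNIV_I)
    qed
    have "(\<integral>\<^sup>+x\<in>Q. ennreal \<bar>f x\<bar> \<partial>lebesgue) = (\<integral>\<^sup>+x. (SUP m. ennreal (g m x) * indicator Q x) \<partial>lebesgue)"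
      by (simp only: sup)
    also have "\<dots> = (SUP m. \<integral>\<^sup>+x. ennreal (g m x) * indicator Q x \<partial>lebesgue)"
    proof (rule nn_integral_monotone_convergence_SUP)
      show "incseq (\<lambda>m x. ennreal (g m x) * indicator Q x)"
        unfolding incseq_def le_fun_def by (intro allI impI mult_right_mono ennreal_leI) (auto simp: g_def)
      show "(\<lambda>x. ennreal (g m x) * indicator Q x) \<in> borel_measurable lebesgue" for m
        unfolding g_def by measurable
    qed
    also have "\<dots> = (SUP m. ennreal (I Q (g m)))" using nn_integral_I[OF bg g0 lm] by simp
    finally have "ennreal (s * measure lebesgue Q) < (SUP m. ennreal (I Q (g m)))"
      using Q \<Q>(2) by (auto simp: superlevel_cubes_def)
    then obtain m where "ennreal (s * measure lebesgue Q) < ennreal (I Q (g m))" by (auto simp: less_SUP_iff)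
    then show ?thesis using s by (auto simp: ennreal_less_iff)
  qed
  then obtain m where m: "\<And>Q. Q \<in> \<Q> \<Longrightarrow> s * measure lebesgue Q < I Q (g (m Q))" by metis
  define M where "M = Max (insert 0 (m ` \<Q>))"
  have "s < avg Q (g M)" if Q: "Q \<in> \<Q>" for Q
  proof -
    have Qc: "Q \<in> cubes" using Q \<Q> by (auto simp: superlevel_cubes_def)
    have mM: "m Q \<le> M" using \<Q>(1) Q by (simp add: M_def)
    have "s * measure lebesgue Q < I Q (g (m Q))" by (rule m[OF Q])
    also have "\<dots> \<le> I Q (g M)"
      using mM by (intro I_mono bg cube_lmeasurable Qc) (auto simp: g_def)
    finally show ?thesis using measure_cube_pos[OF Qc] by (simp add: avg_def pos_less_divide_eq)
  qed
  then show ?thesis unfolding g_def by blast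
qed

context local_exponents
begin

text \<open>A superlevel set is a union of open interiors, which the Lindelof property makes
  countable and continuity of the measure makes finite. For finitely many cubes \<open>f\<close> can
  be truncated, and \<open>level_set_cover_bound\<close> at the level \<open>2 * t\<close> reduces
  the claim to disjoint families.\<close>

lemma maximal_level_estimate:
  assumes qs: "quantile_sum_condition p r \<gamma>\<^sub>0 C" and r: "1 < r" and \<gamma>0: "0 < \<gamma>\<^sub>0" "\<gamma>\<^sub>0 < 1/2"
  shows "\<exists>\<epsilon> \<kappa> D. 0 < \<epsilon> \<and> \<epsilon> \<le> 1 \<and> \<epsilon> < a - 1 \<and> 0 < \<kappa> \<and> (1::real) \<le> D \<and>
    (\<forall>f t. f \<in> borel_measurable lebesgue \<longrightarrow> (\<forall>x. 0 \<le> f x) \<longrightarrow> (\<integral>\<^sup>+x. ennreal (f x powr p x) \<partial>lebesgue) \<le> 1 \<longrightarrow> 0 < t \<longrightarrow>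
      (\<integral>\<^sup>+x. ennreal (t powr p x) * indicator {x. ennreal (6 ^ CARD('n) * (2 * t)) < maximal_function f x} x \<partial>lebesgue) \<le>
      ennreal D * ((\<integral>\<^sup>+x. ennreal (t powr \<epsilon> * f x powr (p x - \<epsilon>) * indicator {x. t < f x} x) \<partial>lebesgue) +
        ennreal (if t < 1 then t powr \<kappa> else 0)))"
proof -
  define P where "P \<epsilon> \<kappa> D \<longleftrightarrow> 0 < \<epsilon> \<and> \<epsilon> \<le> 1 \<and> \<epsilon> < a - 1 \<and> 0 < \<kappa> \<and> 1 \<le> D \<and>
    (\<forall>F t f. finite F \<longrightarrow> F \<subseteq> cubes \<longrightarrow> disjoint F \<longrightarrow> 0 < t \<longrightarrow> bounded_measurable f \<longrightarrow> (\<forall>x. 0 \<le> f x) \<longrightarrow>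
       (\<Sum>Q\<in>F. I Q (\<lambda>x. f x powr p x)) \<le> 1 \<longrightarrow> (\<forall>Q\<in>F. 2 * t \<le> avg Q f) \<longrightarrow>
       (\<Sum>Q\<in>F. I Q (\<lambda>x. t powr p x)) \<le>
         D * ((\<Sum>Q\<in>F. I Q (\<lambda>x. t powr \<epsilon> * f x powr (p x - \<epsilon>) * indicator {x. t < f x} x)) + (if t < 1 then t powr \<kappa> else 0)))"
    for \<epsilon> \<kappa> D :: real
  have "\<exists>\<epsilon> \<kappa> D. P \<epsilon> \<kappa> D" unfolding P_def by (rule cube_level_estimate[OF qs r \<gamma>0])
  then obtain \<epsilon> \<kappa> D0 where "P \<epsilon> \<kappa> D0" by blast
  note P = this[unfolded P_def]
  have e: "0 < \<epsilon>" "\<epsilon> \<le> 1" "\<epsilon> < a - 1" and k: "0 < \<kappa>" and D0: "1 \<le> D0" using P by simp_all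
  note core = conjunct2[OF conjunct2[OF conjunct2[OF conjunct2[OF conjunct2[OF P]]]], rule_format]
  define D where "D = real CARD('n set) * D0"
  have "1 * 1 \<le> real CARD('n set) * D0" using D0 by (intro mult_mono) (auto simp: Suc_le_eq)
  then have D: "1 \<le> D" by (simp add: D_def)
  have main: "(\<integral>\<^sup>+x. ennreal (t powr p x) * indicator {x. ennreal (6 ^ CARD('n) * (2 * t)) < maximal_function f x} x \<partial>lebesgue) \<le>
      ennreal D * ((\<integral>\<^sup>+x. ennreal (t powr \<epsilon> * f x powr (p x - \<epsilon>) * indicator {x. t < f x} x) \<partial>lebesgue) +
        ennreal (if t < 1 then t powr \<kappa> else 0))"
    if f: "f \<in> borel_measurable lebesgue" "\<forall>x. 0 \<le> f x" and fp: "(\<integral>\<^sup>+x. ennreal (f x powr p x) \<partial>lebesgue) \<le> 1" and t: "0 < t"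
    for f t
  proof -
    have f0: "0 \<le> f x" for x using f by simp
    have [measurable]: "f \<in> borel_measurable lebesgue" "p \<in> borel_measurable lebesgue" using f p_meas by auto
    define e' where "e' = (if t < 1 then t powr \<kappa> else 0)"
    have e'0: "0 \<le> e'" by (simp add: e'_def)
    define R where "R = (\<integral>\<^sup>+x. ennreal (t powr \<epsilon> * f x powr (p x - \<epsilon>) * indicator {x. t < f x} x) \<partial>lebesgue)"
    define s where "s = 6 ^ CARD('n) * (2 * t)"
    have s0: "0 \<le> s" using t by (simp add: s_def)
    let ?N = "density lebesgue (\<lambda>x. ennreal (t powr p x))"
    have N: "emeasure ?N X = (\<integral>\<^sup>+x. ennreal (t powr p x) * indicator X x \<partial>lebesgue)" if "X \<in> sets lebesgue" for X
      using that by (intro emeasure_density) auto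
    have "(\<integral>\<^sup>+x. ennreal (t powr p x) * indicator {x. ennreal s < maximal_function f x} x \<partial>lebesgue) \<le> ennreal D * (R + ennreal e')"
    proof (cases R)
      case top
      then show ?thesis using D by (simp add: ennreal_mult_top)
    next
      case (real \<rho>)
      obtain T where T: "T \<subseteq> interior ` superlevel_cubes f s" "countable T" "\<Union>T = \<Union>(interior ` superlevel_cubes f s)"
        using Lindelof[of "interior ` superlevel_cubes f s"] by (metis imageE open_interior)
      have Topen: "X \<in> sets lebesgue" if "X \<in> T" for X
        using that T(1) by (intro sets_completionI_sets) (auto simp: borel_open)
      have "emeasure ?N (\<Union>T) \<le> ennreal (D * (\<rho> + e'))"
      proof (rule emeasure_Union_le[OF T(2)])
        show "T \<subseteq> sets ?N" using Topen by auto
        fix \<G> assume \<G>: "finite \<G>" "\<G> \<subseteq> T"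
        then obtain \<Q> where \<Q>: "\<Q> \<subseteq> superlevel_cubes f s" "finite \<Q>" "\<G> = interior ` \<Q>"
          using T(1) by (metis finite_subset_image order_trans)
        have Qc: "\<Q> \<subseteq> cubes" using \<Q>(1) by (auto simp: superlevel_cubes_def)
        have UQ: "\<Union>\<Q> \<in> lmeasurable" using \<Q>(2) Qc cube_lmeasurable by (intro fmeasurable.finite_Union) auto
        obtain m :: nat where m: "\<And>Q. Q \<in> \<Q> \<Longrightarrow> s < avg Q (\<lambda>x. min (f x) (real m))"
          using truncation_superlevel[OF f(1) f0 s0 \<Q>(2,1)] by blast
        define g where "g x = min (f x) (real m)" for x
        have bg: "bounded_measurable g"
          unfolding g_def using f by (intro bmI[where C = "real m"]) (auto simp: min_def)
        have g0: "0 \<le> g x" and gf: "g x \<le> f x" for x using f0 by (auto simp: g_def)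
        define h where "h x = t powr \<epsilon> * g x powr (p x - \<epsilon>) * indicator {x. t < g x} x" for x
        have bh: "bounded_measurable h" unfolding h_def
          by (intro bm_mult bm_const bm_fun_powr_p bg g0 e bm_indicator superlevel_lebesgue)
        have h0: "0 \<le> h x" for x by (simp add: h_def)
        have bgp: "bounded_measurable (\<lambda>x. g x powr p x)" using bm_fun_powr_p[OF bg g0, of 0] by simp
        have "I (\<Union>\<Q>) (\<lambda>x. t powr p x) \<le> CARD('n set) * (D0 * (\<rho> + e'))"
        proof (rule level_set_cover_bound[OF \<Q>(2) Qc bg g0 bm_powr_p[OF t], of "2 * t"])
          show "6 ^ CARD('n) * (2 * t) < avg Q g" if "Q \<in> \<Q>" for Q using m[OF that] by (simp add: s_def g_def[abs_def])
          fix F assume F: "finite F" "F \<subseteq> cubes" "disjoint F" "\<And>Q. Q \<in> F \<Longrightarrow> 2 * t < avg Q g"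
          have Flm: "Q \<in> lmeasurable" if "Q \<in> F" for Q using that F(2) cube_lmeasurable by blast
          have UF: "\<Union>F \<in> lmeasurable" using F(1) Flm by (intro fmeasurable.finite_Union) auto
          have "ennreal (I (\<Union>F) (\<lambda>x. g x powr p x)) = (\<integral>\<^sup>+x. ennreal (g x powr p x) * indicator (\<Union>F) x \<partial>lebesgue)"
            using nn_integral_I[OF bgp _ UF] by simp
          also have "\<dots> \<le> (\<integral>\<^sup>+x. ennreal (f x powr p x) \<partial>lebesgue)"
          proof (rule nn_integral_mono)
            fix x
            have "g x powr p x \<le> f x powr p x" using g0 gf p_gt_1[of x] by (intro powr_mono2) auto
            then show "ennreal (g x powr p x) * indicator (\<Union>F) x \<le> ennreal (f x powr p x)"
              by (auto simp: indicator_def ennreal_leI)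
          qed
          also have "\<dots> \<le> ennreal 1" using fp by simp
          finally have "I (\<Union>F) (\<lambda>x. g x powr p x) \<le> 1" by simp
          then have g1: "(\<Sum>Q\<in>F. I Q (\<lambda>x. g x powr p x)) \<le> 1"
            using I_disjoint_Union[OF F(1,3) Flm bgp] by simp
          have "ennreal (I (\<Union>F) h) = (\<integral>\<^sup>+x. ennreal (h x) * indicator (\<Union>F) x \<partial>lebesgue)"
            using nn_integral_I[OF bh h0 UF] by simp
          also have "\<dots> \<le> R" unfolding R_def
          proof (rule nn_integral_mono)
            fix x
            have "g x powr (p x - \<epsilon>) \<le> f x powr (p x - \<epsilon>)" using g0 gf p_gt_1[of x] e by (intro powr_mono2) auto
            then have "t powr \<epsilon> * g x powr (p x - \<epsilon>) \<le> t powr \<epsilon> * f x powr (p x - \<epsilon>)" by (rule mult_left_mono) simp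
            then have "h x \<le> t powr \<epsilon> * f x powr (p x - \<epsilon>) * indicator {x. t < f x} x"
              using gf[of x] by (auto simp: h_def indicator_def)
            then show "ennreal (h x) * indicator (\<Union>F) x \<le> ennreal (t powr \<epsilon> * f x powr (p x - \<epsilon>) * indicator {x. t < f x} x)"
              using h0[of x] by (cases "x \<in> \<Union>F") (auto intro: ennreal_leI)
          qed
          finally have "I (\<Union>F) h \<le> \<rho>" using real by simp
          then have h1: "(\<Sum>Q\<in>F. I Q h) \<le> \<rho>" using I_disjoint_Union[OF F(1,3) Flm bh h0] by simp
          have "(\<Sum>Q\<in>F. I Q (\<lambda>x. t powr p x)) \<le> D0 * ((\<Sum>Q\<in>F. I Q h) + e')"
            unfolding h_def e'_def using F(4) by (intro core F(1-3) t bg g0 g1) (auto intro: less_imp_le)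
          also have "\<dots> \<le> D0 * (\<rho> + e')" using h1 D0 by (intro mult_left_mono) auto
          finally show "(\<Sum>Q\<in>F. I Q (\<lambda>x. t powr p x)) \<le> D0 * (\<rho> + e')" .
        qed (use t in auto)
        then have Ile: "I (\<Union>\<Q>) (\<lambda>x. t powr p x) \<le> D * (\<rho> + e')" by (simp add: D_def mult_ac)
        have "emeasure ?N (\<Union>\<G>) \<le> emeasure ?N (\<Union>\<Q>)"
          unfolding \<Q>(3) using UQ interior_subset by (intro emeasure_mono) auto
        also have "\<dots> = ennreal (I (\<Union>\<Q>) (\<lambda>x. t powr p x))"
          using nn_integral_I[OF bm_powr_p[OF t] _ UQ] N UQ by auto
        also have "\<dots> \<le> ennreal (D * (\<rho> + e'))" using Ile by (rule ennreal_leI)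
        finally show "emeasure ?N (\<Union>\<G>) \<le> ennreal (D * (\<rho> + e'))" .
      qed
      moreover have "{x. ennreal s < maximal_function f x} = \<Union>T" using maximal_superlevel[OF s0, of f] T(3) by simp
      moreover have "\<Union>T \<in> sets lebesgue" using T(2) Topen by (intro sets.countable_Union) auto
      moreover have "ennreal (D * (\<rho> + e')) = ennreal D * (R + ennreal e')"
        using real D e'0 by (simp add: ennreal_mult ennreal_plus)
      ultimately show ?thesis using N by simp
    qed
    then show ?thesis unfolding s_def R_def e'_def .
  qed
  show ?thesis
    by (rule exI[of _ \<epsilon>], rule exI[of _ \<kappa>], rule exI[of _ D], intro conjI, rule e(1), rule e(2), rule e(3), rule k,
      rule D(1), intro allI impI, rule main)
qed

end

section \<open>Summation over dyadic levels\<close>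

lemma truncated_power_increment:
  fixes T y \<epsilon> :: real
  assumes "0 < T" "0 \<le> y" "0 < \<epsilon>"
  shows "(1 - 2 powr (-\<epsilon>)) * (T powr \<epsilon> * indicator {x. T < x} y) \<le> min T y powr \<epsilon> - min (T / 2) y powr \<epsilon>"
proof (cases "T < y")
  case True
  have "(T / 2) powr \<epsilon> = T powr \<epsilon> * 2 powr (-\<epsilon>)" using assms by (simp add: powr_divide powr_minus_divide)
  then show ?thesis using True assms by (simp add: min_def algebra_simps)
next
  case False
  have "min (T / 2) y powr \<epsilon> \<le> min T y powr \<epsilon>" using assms by (intro powr_mono2) auto
  then show ?thesis using False by simp
qed

lemma suminf_ennreal_le:
  assumes "\<And>k. 0 \<le> c k" "\<And>n. (\<Sum>k<n. c k) \<le> B"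
  shows "(\<Sum>k. ennreal (c k)) \<le> ennreal B"
proof -
  have "(\<Sum>k<n. ennreal (c k)) \<le> ennreal B" for n
    using assms by (subst sum_ennreal) (auto intro: ennreal_leI)
  then show ?thesis by (intro suminf_le_const) auto
qed

text \<open>The terms are dominated by increments of \<open>min T y powr \<epsilon>\<close> along
  powers of 2, which telescope. Levels are split at 1 because only those below 1 will carry the
  additional error \<open>t powr \<kappa>\<close>.\<close>

lemma dyadic_level_sums:
  fixes y \<epsilon> :: real
  assumes y: "0 \<le> y" and e: "0 < \<epsilon>"
  shows "(\<Sum>k. ennreal ((2 ^ k) powr \<epsilon> * indicator {x. 2 ^ k < x} y)) \<le> ennreal (y powr \<epsilon> / (1 - 2 powr (-\<epsilon>)))"
    "(\<Sum>k. ennreal (((1/2) ^ Suc k) powr \<epsilon> * indicator {x. (1/2) ^ Suc k < x} y)) \<le> ennreal (y powr \<epsilon> / (1 - 2 powr (-\<epsilon>)))"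
proof -
  define z where "z = 1 - 2 powr (-\<epsilon>)"
  have z: "0 < z" using e powr_less_one[of 2 "-\<epsilon>"] by (simp add: z_def)
  define \<phi> where "\<phi> T = min T y powr \<epsilon>" for T
  have phi: "0 \<le> \<phi> T" for T by (simp add: \<phi>_def)
  have phi_le: "\<phi> T \<le> y powr \<epsilon>" if "0 \<le> T" for T unfolding \<phi>_def using that y e by (intro powr_mono2) auto
  have inc: "z * (T powr \<epsilon> * indicator {x. T < x} y) \<le> \<phi> T - \<phi> (T / 2)" if "0 < T" for T
    unfolding z_def \<phi>_def by (rule truncated_power_increment[OF that y e])
  show "(\<Sum>k. ennreal ((2 ^ k) powr \<epsilon> * indicator {x. 2 ^ k < x} y)) \<le> ennreal (y powr \<epsilon> / (1 - 2 powr (-\<epsilon>)))"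
    unfolding z_def[symmetric]
  proof (rule suminf_ennreal_le)
    fix n
    have "z * (\<Sum>k<n. (2 ^ k) powr \<epsilon> * indicator {x. 2 ^ k < x} y) \<le> (\<Sum>k<n. \<phi> (2 ^ Suc k / 2) - \<phi> (2 ^ k / 2))"
      unfolding sum_distrib_left by (intro sum_mono) (use inc[of "2 ^ _"] in simp)
    also have "\<dots> = \<phi> (2 ^ n / 2) - \<phi> (2 ^ 0 / 2)" by (rule sum_lessThan_telescope)
    also have "\<dots> \<le> y powr \<epsilon>" using phi[of "2 ^ 0 / 2"] phi_le[of "2 ^ n / 2"] by simp
    finally show "(\<Sum>k<n. (2 ^ k) powr \<epsilon> * indicator {x. 2 ^ k < x} y) \<le> y powr \<epsilon> / z"
      using z by (simp add: pos_le_divide_eq mult.commute)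
  qed simp
  show "(\<Sum>k. ennreal (((1/2) ^ Suc k) powr \<epsilon> * indicator {x. (1/2) ^ Suc k < x} y)) \<le> ennreal (y powr \<epsilon> / (1 - 2 powr (-\<epsilon>)))"
    unfolding z_def[symmetric]
  proof (rule suminf_ennreal_le)
    fix n
    have "z * (\<Sum>k<n. ((1/2) ^ Suc k) powr \<epsilon> * indicator {x. (1/2) ^ Suc k < x} y) \<le> (\<Sum>k<n. \<phi> ((1/2) ^ Suc k) - \<phi> ((1/2) ^ Suc (Suc k)))"
      unfolding sum_distrib_left
    proof (intro sum_mono)
      fix k
      have "(1/2) ^ Suc (Suc k) = (1/2) ^ Suc k / (2::real)" by simp
      then show "z * (((1/2) ^ Suc k) powr \<epsilon> * indicator {x. (1/2) ^ Suc k < x} y) \<le> \<phi> ((1/2) ^ Suc k) - \<phi> ((1/2) ^ Suc (Suc k))"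
        using inc[of "(1/2) ^ Suc k"] by (simp only:) simp
    qed
    also have "\<dots> = \<phi> ((1/2) ^ Suc 0) - \<phi> ((1/2) ^ Suc n)" by (rule sum_lessThan_telescope')
    also have "\<dots> \<le> y powr \<epsilon>" using phi[of "(1/2) ^ Suc n"] phi_le[of "(1/2) ^ Suc 0"] by simp
    finally show "(\<Sum>k<n. ((1/2) ^ Suc k) powr \<epsilon> * indicator {x. (1/2) ^ Suc k < x} y) \<le> y powr \<epsilon> / z"
      using z by (simp add: pos_le_divide_eq mult.commute)
  qed simp
qed

lemma level_between_powers:
  fixes y :: real
  assumes "1 < y" shows "\<exists>k. 2 ^ k < y \<and> y \<le> 2 ^ Suc k"
proof -
  obtain n where n: "y < 2 ^ n" using real_arch_pow[of 2 y] by auto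
  define j where "j = (LEAST j. y \<le> 2 ^ j)"
  have j: "y \<le> 2 ^ j" unfolding j_def using n by (intro LeastI[of "\<lambda>j. y \<le> 2 ^ j" n]) auto
  have "j \<noteq> 0" using j assms by (intro notI) simp
  then obtain k where k: "j = Suc k" by (cases j) auto
  have "\<not> y \<le> 2 ^ k" using not_less_Least[of k "\<lambda>j. y \<le> 2 ^ j"] k j_def by simp
  then show ?thesis using j k by (intro exI[of _ k]) auto
qed

lemma level_between_inverse_powers:
  fixes y :: real
  assumes "0 < y" "y \<le> 1" shows "\<exists>k. (1/2) ^ Suc k < y \<and> y \<le> (1/2) ^ k"
proof -
  obtain n where n: "(1/2) ^ n < y" using real_arch_pow_inv[of y "1/2"] assms by auto
  define j where "j = (LEAST j. (1/2) ^ j < y)"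
  have j: "(1/2) ^ j < y" unfolding j_def using n by (rule LeastI)
  have "j \<noteq> 0" using j assms by (intro notI) simp
  then obtain k where k: "j = Suc k" by (cases j) auto
  have "\<not> (1/2) ^ k < y" using not_less_Least[of k "\<lambda>j. (1/2) ^ j < y"] k j_def by simp
  then show ?thesis using j k by (intro exI[of _ k]) auto
qed

lemma ennreal_term_le_suminf: "f k \<le> (\<Sum>k. f k :: ennreal)"
  using sum_le_suminf[of f "{k}"] by simp

context local_exponents
begin

text \<open>In the sum over levels the factors \<open>t powr \<epsilon>\<close> with
  \<open>t < f x\<close> add up to a multiple of \<open>f x powr \<epsilon>\<close> and restore the
  modular of \<open>f\<close>, while the errors \<open>t powr \<kappa>\<close> over
  \<open>t < 1\<close> form a geometric series.\<close>

lemma maximal_modular_bound: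
  assumes qs: "quantile_sum_condition p r \<gamma>\<^sub>0 C" and r: "1 < r" and \<gamma>0: "0 < \<gamma>\<^sub>0" "\<gamma>\<^sub>0 < 1/2"
  shows "\<exists>B\<ge>1. \<forall>f. f \<in> borel_measurable lebesgue \<longrightarrow> (\<forall>x. 0 \<le> f x) \<longrightarrow> (\<integral>\<^sup>+x. ennreal (f x powr p x) \<partial>lebesgue) \<le> 1 \<longrightarrow>
    (AE x in lebesgue. maximal_function f x < \<infinity>) \<and>
    (\<integral>\<^sup>+x. ennreal (enn2real (maximal_function f x) powr p x) \<partial>lebesgue) \<le> ennreal B"
proof -
  define P where "P \<epsilon> \<kappa> D \<longleftrightarrow> 0 < \<epsilon> \<and> \<epsilon> \<le> 1 \<and> \<epsilon> < a - 1 \<and> 0 < \<kappa> \<and> (1::real) \<le> D \<and>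
    (\<forall>f t. f \<in> borel_measurable lebesgue \<longrightarrow> (\<forall>x. 0 \<le> f x) \<longrightarrow> (\<integral>\<^sup>+x. ennreal (f x powr p x) \<partial>lebesgue) \<le> 1 \<longrightarrow> 0 < t \<longrightarrow>
      (\<integral>\<^sup>+x. ennreal (t powr p x) * indicator {x. ennreal (6 ^ CARD('n) * (2 * t)) < maximal_function f x} x \<partial>lebesgue) \<le>
      ennreal D * ((\<integral>\<^sup>+x. ennreal (t powr \<epsilon> * f x powr (p x - \<epsilon>) * indicator {x. t < f x} x) \<partial>lebesgue) +
        ennreal (if t < 1 then t powr \<kappa> else 0)))" for \<epsilon> \<kappa> D :: real
  have "\<exists>\<epsilon> \<kappa> D. P \<epsilon> \<kappa> D" unfolding P_def by (rule maximal_level_estimate[OF qs r \<gamma>0])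
  then obtain \<epsilon> \<kappa> D where "P \<epsilon> \<kappa> D" by blast
  note P = this[unfolded P_def]
  have e: "0 < \<epsilon>" "\<epsilon> \<le> 1" "\<epsilon> < a - 1" and k: "0 < \<kappa>" and D: "1 \<le> D" using P by simp_all
  note level = conjunct2[OF conjunct2[OF conjunct2[OF conjunct2[OF conjunct2[OF P]]]], rule_format]
  define c :: real where "c = 6 ^ CARD('n) * 2"
  have "1 \<le> (6::real) ^ CARD('n)" by simp
  then have c: "1 \<le> c" "0 < c" unfolding c_def by linarith+
  define z where "z = 1 - 2 powr (-\<epsilon>)"
  have z: "0 < z" using e powr_less_one[of 2 "-\<epsilon>"] by (simp add: z_def)
  define w where "w = 2 powr (-\<kappa>)"
  have w: "0 < w" "w < 1" using k powr_less_one[of 2 "-\<kappa>"] by (auto simp: w_def)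
  define B where "B = c powr b * 2 powr b * (D / z + D * (1 / z + 1 / (1 - w))) + 1"
  have B: "1 \<le> B" using D z w by (simp add: B_def)
  define T1 :: "nat \<Rightarrow> real" where "T1 k = 2 ^ k" for k
  define T2 :: "nat \<Rightarrow> real" where "T2 k = (1/2) ^ Suc k" for k
  have T: "0 < T1 k" "1 \<le> T1 k" "0 < T2 k" "T2 k < 1" for k
    unfolding T1_def T2_def using power_le_one[of "1/2::real" k] by (auto intro: le_less_trans)
  have main: "(AE x in lebesgue. maximal_function f x < \<infinity>) \<and>
    (\<integral>\<^sup>+x. ennreal (enn2real (maximal_function f x) powr p x) \<partial>lebesgue) \<le> ennreal B"
    if f: "f \<in> borel_measurable lebesgue" "\<forall>x. 0 \<le> f x" and fp: "(\<integral>\<^sup>+x. ennreal (f x powr p x) \<partial>lebesgue) \<le> 1" for f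
  proof -
    have f0: "0 \<le> f x" for x using f by simp
    have [measurable]: "f \<in> borel_measurable lebesgue" "p \<in> borel_measurable lebesgue" "maximal_function f \<in> borel_measurable lebesgue"
      using f p_meas maximal_function_measurable by auto
    define M where "M = maximal_function f"
    have [measurable]: "M \<in> borel_measurable lebesgue" by (simp add: M_def)
    define \<Omega> where "\<Omega> t = {x. ennreal (c * t) < M x}" for t
    define W where "W t = (\<integral>\<^sup>+x. ennreal (t powr p x) * indicator (\<Omega> t) x \<partial>lebesgue)" for t
    define g where "g t x = ennreal (t powr \<epsilon> * f x powr (p x - \<epsilon>) * indicator {x. t < f x} x)" for t x
    have gm [measurable]: "g t \<in> borel_measurable lebesgue" for t unfolding g_def by measurable
    have lev: "W t \<le> ennreal D * ((\<integral>\<^sup>+x. g t x \<partial>lebesgue) + ennreal (if t < 1 then t powr \<kappa> else 0))" if "0 < t" for t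
      using level[OF f(1) f0 fp that] unfolding W_def g_def \<Omega>_def M_def c_def by (simp add: mult.assoc)
    have sum_g: "(\<Sum>k. \<integral>\<^sup>+x. g (T k) x \<partial>lebesgue) \<le> ennreal (1 / z)"
      if Tsum: "\<And>y. 0 \<le> y \<Longrightarrow> (\<Sum>k. ennreal (T k powr \<epsilon> * indicator {x. T k < x} y)) \<le> ennreal (y powr \<epsilon> / z)" for T
    proof -
      have "(\<Sum>k. \<integral>\<^sup>+x. g (T k) x \<partial>lebesgue) = (\<integral>\<^sup>+x. (\<Sum>k. g (T k) x) \<partial>lebesgue)"
        by (rule nn_integral_suminf[symmetric]) simp
      also have "\<dots> \<le> (\<integral>\<^sup>+x. ennreal (1 / z) * ennreal (f x powr p x) \<partial>lebesgue)"
      proof (rule nn_integral_mono)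
        fix x
        have "(\<Sum>k. g (T k) x) = (\<Sum>k. ennreal (f x powr (p x - \<epsilon>)) * ennreal (T k powr \<epsilon> * indicator {x. T k < x} (f x)))"
          by (intro suminf_cong) (simp add: g_def ennreal_mult[symmetric] indicator_def)
        also have "\<dots> = ennreal (f x powr (p x - \<epsilon>)) * (\<Sum>k. ennreal (T k powr \<epsilon> * indicator {x. T k < x} (f x)))"
          by (rule ennreal_suminf_cmult)
        also have "\<dots> \<le> ennreal (f x powr (p x - \<epsilon>)) * ennreal (f x powr \<epsilon> / z)"
          by (intro mult_left_mono Tsum f0) auto
        also have "\<dots> = ennreal (1 / z * f x powr p x)"
        proof -
          have "f x powr (p x - \<epsilon>) * f x powr \<epsilon> = f x powr p x" by (simp add: powr_add[symmetric])
          then show ?thesis using z by (simp add: ennreal_mult[symmetric])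
        qed
        also have "\<dots> = ennreal (1 / z) * ennreal (f x powr p x)" using z by (intro ennreal_mult) auto
        finally show "(\<Sum>k. g (T k) x) \<le> ennreal (1 / z) * ennreal (f x powr p x)" .
      qed
      also have "\<dots> = ennreal (1 / z) * (\<integral>\<^sup>+x. ennreal (f x powr p x) \<partial>lebesgue)" by (rule nn_integral_cmult) simp
      also have "\<dots> \<le> ennreal (1 / z) * 1" using fp by (intro mult_left_mono) auto
      finally show ?thesis by simp
    qed
    have S1: "(\<Sum>k. \<integral>\<^sup>+x. g (T1 k) x \<partial>lebesgue) \<le> ennreal (1 / z)"
      by (rule sum_g) (use dyadic_level_sums(1)[OF _ e(1)] in \<open>simp add: T1_def z_def\<close>)
    have S2: "(\<Sum>k. \<integral>\<^sup>+x. g (T2 k) x \<partial>lebesgue) \<le> ennreal (1 / z)"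
    proof (rule sum_g)
      show "(\<Sum>k. ennreal (T2 k powr \<epsilon> * indicator {x. T2 k < x} y)) \<le> ennreal (y powr \<epsilon> / z)" if "0 \<le> y" for y
        unfolding T2_def z_def by (rule dyadic_level_sums(2)[OF that e(1)])
    qed
    have W1: "(\<Sum>k. W (T1 k)) \<le> ennreal (D / z)"
    proof -
      have "(\<Sum>k. W (T1 k)) \<le> (\<Sum>k. ennreal D * (\<integral>\<^sup>+x. g (T1 k) x \<partial>lebesgue))"
      proof (intro suminf_le)
        show "W (T1 k) \<le> ennreal D * (\<integral>\<^sup>+x. g (T1 k) x \<partial>lebesgue)" for k
          using lev[OF T(1)[of k]] T(2)[of k] by (simp add: not_less[symmetric])
      qed auto
      also have "\<dots> = ennreal D * (\<Sum>k. \<integral>\<^sup>+x. g (T1 k) x \<partial>lebesgue)" by (rule ennreal_suminf_cmult)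
      also have "\<dots> \<le> ennreal D * ennreal (1 / z)" using S1 by (rule mult_left_mono) simp
      also have "\<dots> = ennreal (D / z)" using D z by (simp add: ennreal_mult[symmetric])
      finally show ?thesis .
    qed
    have Tk: "(\<Sum>k. ennreal (T2 k powr \<kappa>)) \<le> ennreal (1 / (1 - w))"
    proof (rule suminf_ennreal_le)
      fix n
      have "T2 k powr \<kappa> = w * w ^ k" for k
      proof -
        have "T2 k powr \<kappa> = ((1/2) powr real (Suc k)) powr \<kappa>" unfolding T2_def by (subst powr_realpow) auto
        also have "\<dots> = ((1/2) powr \<kappa>) powr real (Suc k)" by (simp add: powr_powr mult.commute)
        also have "(1/2) powr \<kappa> = w" by (simp add: w_def powr_divide powr_minus_divide)
        also have "w powr real (Suc k) = w ^ Suc k" using w by (subst powr_realpow) auto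
        finally show ?thesis by simp
      qed
      then have "(\<Sum>k<n. T2 k powr \<kappa>) = w * (\<Sum>k<n. w ^ k)" by (simp add: sum_distrib_left)
      also have "\<dots> \<le> 1 * (\<Sum>k<n. w ^ k)" using w by (intro mult_right_mono sum_nonneg) auto
      also have "\<dots> \<le> 1 / (1 - w)" using sum_power_le[of "{..<n}" w] w by simp
      finally show "(\<Sum>k<n. T2 k powr \<kappa>) \<le> 1 / (1 - w)" .
    qed simp
    have W2: "(\<Sum>k. W (T2 k)) \<le> ennreal (D * (1 / z + 1 / (1 - w)))"
    proof -
      have "(\<Sum>k. W (T2 k)) \<le> (\<Sum>k. ennreal D * ((\<integral>\<^sup>+x. g (T2 k) x \<partial>lebesgue) + ennreal (T2 k powr \<kappa>)))"
      proof (intro suminf_le)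
        show "W (T2 k) \<le> ennreal D * ((\<integral>\<^sup>+x. g (T2 k) x \<partial>lebesgue) + ennreal (T2 k powr \<kappa>))" for k
          using lev[OF T(3)[of k]] T(4)[of k] by simp
      qed auto
      also have "\<dots> = ennreal D * ((\<Sum>k. \<integral>\<^sup>+x. g (T2 k) x \<partial>lebesgue) + (\<Sum>k. ennreal (T2 k powr \<kappa>)))"
        by (simp add: ennreal_suminf_cmult suminf_add[symmetric])
      also have "\<dots> \<le> ennreal D * (ennreal (1 / z) + ennreal (1 / (1 - w)))"
        by (intro mult_left_mono add_mono S2 Tk) simp
      also have "\<dots> = ennreal (D * (1 / z + 1 / (1 - w)))"
        using D z w by (simp add: ennreal_mult[symmetric] ennreal_plus[symmetric] del: ennreal_plus)
      finally show ?thesis .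
    qed
    \<comment> \<open>The set where the maximal function is infinite lies in every superlevel set.
      At the level \<open>T1 k\<close> the weight is at least \<open>2 ^ k\<close> there, with a
      bound independent of \<open>k\<close>.\<close>
    have fin: "AE x in lebesgue. M x < \<infinity>"
    proof -
      define E where "E = {x. M x = \<infinity>}"
      have [measurable]: "E \<in> sets lebesgue"
      proof -
        have "{x \<in> space lebesgue. M x = \<infinity>} \<in> sets lebesgue" by measurable
        then show ?thesis by (simp add: E_def)
      qed
      have "ennreal (2 ^ k) * emeasure lebesgue E \<le> ennreal (D / z)" for k
      proof -
        have "ennreal (2 ^ k) * emeasure lebesgue E = (\<integral>\<^sup>+x. ennreal (T1 k) * indicator E x \<partial>lebesgue)"
          by (simp add: nn_integral_cmult_indicator T1_def)
        also have "\<dots> \<le> W (T1 k)" unfolding W_def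
        proof (rule nn_integral_mono)
          fix x
          have "T1 k powr 1 \<le> T1 k powr p x" using T(2)[of k] p_gt_1[of x] by (intro powr_mono) auto
          then have "ennreal (T1 k) \<le> ennreal (T1 k powr p x)" using T(1)[of k] by (intro ennreal_leI) simp
          then show "ennreal (T1 k) * indicator E x \<le> ennreal (T1 k powr p x) * indicator (\<Omega> (T1 k)) x"
            by (auto simp: indicator_def E_def \<Omega>_def)
        qed
        also have "\<dots> \<le> (\<Sum>k. W (T1 k))" by (rule ennreal_term_le_suminf)
        also have "\<dots> \<le> ennreal (D / z)" by (rule W1)
        finally show ?thesis .
      qed
      note small = this
      have "emeasure lebesgue E = 0"
      proof (rule ccontr)
        assume ne: "emeasure lebesgue E \<noteq> 0"
        have "emeasure lebesgue E \<noteq> top" using small[of 0] by (auto simp: top_unique)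
        then obtain \<epsilon>' where e': "emeasure lebesgue E = ennreal \<epsilon>'" "0 \<le> \<epsilon>'" by (cases "emeasure lebesgue E") auto
        then have "0 < \<epsilon>'" using ne by (cases "\<epsilon>' = 0") auto
        obtain k where "D / z / \<epsilon>' < 2 ^ k" using real_arch_pow[of 2 "D / z / \<epsilon>'"] by auto
        then have "D / z < 2 ^ k * \<epsilon>'" using pos_divide_less_eq[OF \<open>0 < \<epsilon>'\<close>] by blast
        moreover have "2 ^ k * \<epsilon>' \<le> D / z"
          using small[of k] e' D z unfolding e'(1) by (simp add: ennreal_mult[symmetric] del: ennreal_power)
        ultimately show False by simp
      qed
      then have "E \<in> null_sets lebesgue" by (auto simp: null_sets_def)
      then have "AE x in lebesgue. x \<notin> E" by (rule AE_not_in)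
      then show ?thesis by (auto simp: E_def less_top elim: eventually_mono)
    qed
    \<comment> \<open>A positive finite value of \<open>M\<close> lies between consecutive multiples
      of \<open>c\<close> by powers of 2; the single term of that level dominates, with
      \<open>2 powr b\<close> for the width of the interval.\<close>
    have "(\<integral>\<^sup>+x. ennreal (enn2real (M x) powr p x) \<partial>lebesgue) \<le>
        (\<integral>\<^sup>+x. ennreal (c powr b * 2 powr b) * ((\<Sum>k. ennreal (T1 k powr p x) * indicator (\<Omega> (T1 k)) x) +
          (\<Sum>k. ennreal (T2 k powr p x) * indicator (\<Omega> (T2 k)) x)) \<partial>lebesgue)"
    proof (rule nn_integral_mono_AE, use fin in eventually_elim)
      case (elim x)
      define y where "y = enn2real (M x) / c"
      have y0: "0 \<le> y" using c by (simp add: y_def)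
      have My: "M x = ennreal (c * y)" using elim c by (simp add: y_def)
      have in_\<Omega>: "x \<in> \<Omega> t" if "0 < t" "t < y" for t
        unfolding \<Omega>_def mem_Collect_eq My using that c y0 by (simp add: ennreal_less_iff)
      have step: "ennreal (enn2real (M x) powr p x) \<le> ennreal (c powr b * 2 powr b) * (ennreal (t powr p x) * indicator (\<Omega> t) x)"
        if t: "0 < t" "t < y" "y \<le> 2 * t" for t
      proof -
        have "enn2real (M x) powr p x = (c * y) powr p x" using c by (simp add: y_def)
        also have "\<dots> \<le> (c * (2 * t)) powr p x" using c y0 t p_gt_1[of x] by (intro powr_mono2 mult_left_mono) auto
        also have "\<dots> \<le> c powr b * (2 * t) powr p x" using c t by (intro powr_p_mono_scale) auto
        also have "\<dots> \<le> c powr b * (2 powr b * t powr p x)" using t by (intro mult_left_mono powr_p_mono_scale) auto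
        finally have "ennreal (enn2real (M x) powr p x) \<le> ennreal (c powr b * 2 powr b * t powr p x)"
          by (intro ennreal_leI) (simp add: mult.assoc)
        then show ?thesis using in_\<Omega>[OF t(1,2)] by (simp add: ennreal_mult)
      qed
      consider "y = 0" | "0 < y" "y \<le> 1" | "1 < y" using y0 by linarith
      then show ?case
      proof cases
        case 1
        then show ?thesis using My by simp
      next
        case 2
        obtain k where kk: "(1/2) ^ Suc k < y" "y \<le> (1/2) ^ k" using level_between_inverse_powers[OF 2] by blast
        have "ennreal (T2 k powr p x) * indicator (\<Omega> (T2 k)) x \<le> (\<Sum>k. ennreal (T2 k powr p x) * indicator (\<Omega> (T2 k)) x)"
          by (rule ennreal_term_le_suminf)
        then have "ennreal (T2 k powr p x) * indicator (\<Omega> (T2 k)) x \<le> (\<Sum>k. ennreal (T1 k powr p x) * indicator (\<Omega> (T1 k)) x) +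
            (\<Sum>k. ennreal (T2 k powr p x) * indicator (\<Omega> (T2 k)) x)" by (rule add_increasing[rotated]) simp
        then show ?thesis using kk T(3)[of k]
          by (intro order_trans[OF step[of "T2 k"] mult_left_mono]) (auto simp: T2_def)
      next
        case 3
        obtain k where kk: "2 ^ k < y" "y \<le> 2 ^ Suc k" using level_between_powers[OF 3] by blast
        have "ennreal (T1 k powr p x) * indicator (\<Omega> (T1 k)) x \<le> (\<Sum>k. ennreal (T1 k powr p x) * indicator (\<Omega> (T1 k)) x)"
          by (rule ennreal_term_le_suminf)
        then have "ennreal (T1 k powr p x) * indicator (\<Omega> (T1 k)) x \<le> (\<Sum>k. ennreal (T1 k powr p x) * indicator (\<Omega> (T1 k)) x) +
            (\<Sum>k. ennreal (T2 k powr p x) * indicator (\<Omega> (T2 k)) x)" by (rule add_increasing2[rotated]) simp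
        then show ?thesis using kk T(1)[of k]
          by (intro order_trans[OF step[of "T1 k"] mult_left_mono]) (auto simp: T1_def)
      qed
    qed
    also have "\<dots> = ennreal (c powr b * 2 powr b) * ((\<Sum>k. W (T1 k)) + (\<Sum>k. W (T2 k)))"
    proof -
      have [measurable]: "\<Omega> t \<in> sets lebesgue" for t
      proof -
        have "{x \<in> space lebesgue. ennreal (c * t) < M x} \<in> sets lebesgue" by measurable
        then show ?thesis by (simp add: \<Omega>_def)
      qed
      show ?thesis unfolding W_def
        by (simp add: nn_integral_cmult nn_integral_add nn_integral_suminf)
    qed
    also have "\<dots> \<le> ennreal (c powr b * 2 powr b) * (ennreal (D / z) + ennreal (D * (1 / z + 1 / (1 - w))))"
      by (intro mult_left_mono add_mono W1 W2) simp
    also have "\<dots> = ennreal (c powr b * 2 powr b * (D / z + D * (1 / z + 1 / (1 - w))))"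
      using D z w by (simp add: ennreal_mult[symmetric] ennreal_plus[symmetric] del: ennreal_plus)
    also have "\<dots> \<le> ennreal B" by (intro ennreal_leI) (simp add: B_def)
    finally show ?thesis using fin unfolding M_def by simp
  qed
  show ?thesis by (rule exI[of _ B], intro conjI, rule B, intro allI impI, rule main)
qed

text \<open>From modulars to norms: the exponents exceed 1, so dividing a function of modular at
  most \<open>B\<close> by \<open>B \<ge> 1\<close> brings its modular below 1. Homogeneity of the
  maximal function reduces to \<open>f\<close> of modular at most 1.\<close>

lemma maximal_boundedI:
  assumes qs: "quantile_sum_condition p r \<gamma>\<^sub>0 C" and r: "1 < r" and \<gamma>0: "0 < \<gamma>\<^sub>0" "\<gamma>\<^sub>0 < 1/2"
  shows "maximal_bounded p"
proof -
  obtain B where B: "1 \<le> B" and main: "\<And>f. f \<in> borel_measurable lebesgue \<Longrightarrow> \<forall>x. 0 \<le> f x \<Longrightarrow> (\<integral>\<^sup>+x. ennreal (f x powr p x) \<partial>lebesgue) \<le> 1 \<Longrightarrow>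
    (AE x in lebesgue. maximal_function f x < \<infinity>) \<and>
    (\<integral>\<^sup>+x. ennreal (enn2real (maximal_function f x) powr p x) \<partial>lebesgue) \<le> ennreal B"
    using maximal_modular_bound[OF qs r \<gamma>0] by blast
  have [measurable]: "p \<in> borel_measurable lebesgue" by (rule p_meas)
  have scaled: "(AE x in lebesgue. maximal_function f x < \<infinity>) \<and>
      Lp_norm p (\<lambda>x. enn2real (maximal_function f x)) \<le> ennreal (B * s)"
    if f [measurable]: "f \<in> borel_measurable lebesgue" and s: "0 < s" "(\<integral>\<^sup>+x. ennreal ((\<bar>f x\<bar> / s) powr p x) \<partial>lebesgue) \<le> 1" for f s
  proof -
    define g where "g x = \<bar>f x\<bar> / s" for x
    have g: "g \<in> borel_measurable lebesgue" "\<forall>x. 0 \<le> g x" using s unfolding g_def by auto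
    have Mg: "maximal_function f x = ennreal s * maximal_function g x" for x
    proof -
      have int: "(\<integral>\<^sup>+y\<in>Q. ennreal \<bar>f y\<bar> \<partial>lebesgue) = ennreal s * (\<integral>\<^sup>+y\<in>Q. ennreal \<bar>g y\<bar> \<partial>lebesgue)" if Q: "Q \<in> cubes" for Q
      proof -
        have [measurable]: "Q \<in> sets lebesgue" by (rule cube_lebesgue[OF Q])
        have "(\<integral>\<^sup>+y\<in>Q. ennreal \<bar>f y\<bar> \<partial>lebesgue) = (\<integral>\<^sup>+y. ennreal s * (ennreal \<bar>g y\<bar> * indicator Q y) \<partial>lebesgue)"
          using s by (intro nn_integral_cong) (simp add: g_def mult.assoc[symmetric] ennreal_mult[symmetric])
        also have "\<dots> = ennreal s * (\<integral>\<^sup>+y\<in>Q. ennreal \<bar>g y\<bar> \<partial>lebesgue)"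
          using g by (intro nn_integral_cmult, measurable)
        finally show ?thesis .
      qed
      have "maximal_function f x = (SUP Q\<in>{Q \<in> cubes. x \<in> Q}. ennreal s * ((\<integral>\<^sup>+y\<in>Q. ennreal \<bar>g y\<bar> \<partial>lebesgue) / emeasure lebesgue Q))"
        unfolding maximal_function_def by (intro SUP_cong refl) (simp add: int ennreal_times_divide)
      also have "\<dots> = ennreal s * maximal_function g x"
        unfolding maximal_function_def by (rule SUP_mult_left_ennreal[symmetric])
      finally show ?thesis .
    qed
    have "(\<integral>\<^sup>+x. ennreal (g x powr p x) \<partial>lebesgue) \<le> 1" using s(2) by (simp add: g_def)
    from main[OF g this] have fin: "AE x in lebesgue. maximal_function g x < \<infinity>"
      and int: "(\<integral>\<^sup>+x. ennreal (enn2real (maximal_function g x) powr p x) \<partial>lebesgue) \<le> ennreal B" by auto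
    have [measurable]: "maximal_function g \<in> borel_measurable lebesgue" by (rule maximal_function_measurable)
    have "AE x in lebesgue. maximal_function f x < \<infinity>"
      using fin by eventually_elim (simp add: Mg ennreal_mult_less_top)
    moreover have "Lp_norm p (\<lambda>x. enn2real (maximal_function f x)) \<le> ennreal (B * s)"
      unfolding Lp_norm_def
    proof (rule Inf_lower, rule CollectI, rule exI[of _ "B * s"], intro conjI refl)
      show "0 < B * s" using B s by simp
      have "(\<integral>\<^sup>+x. ennreal ((\<bar>enn2real (maximal_function f x)\<bar> / (B * s)) powr p x) \<partial>lebesgue) \<le>
          (\<integral>\<^sup>+x. ennreal (1 / B) * ennreal (enn2real (maximal_function g x) powr p x) \<partial>lebesgue)"
      proof (rule nn_integral_mono)
        fix x
        define y where "y = enn2real (maximal_function g x)"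
        have y0: "0 \<le> y" by (simp add: y_def)
        have "\<bar>enn2real (maximal_function f x)\<bar> / (B * s) = y * (1 / B)"
          using s B by (simp add: Mg y_def enn2real_mult)
        then have "(\<bar>enn2real (maximal_function f x)\<bar> / (B * s)) powr p x = y powr p x * (1 / B) powr p x"
          using y0 B by (simp only: powr_mult)
        also have "\<dots> \<le> y powr p x * (1 / B) powr 1"
          using B p_gt_1[of x] by (intro mult_left_mono powr_mono') auto
        also have "\<dots> = 1 / B * y powr p x" using B by simp
        finally show "ennreal ((\<bar>enn2real (maximal_function f x)\<bar> / (B * s)) powr p x) \<le> ennreal (1 / B) * ennreal (enn2real (maximal_function g x) powr p x)"
          using B by (simp add: y_def ennreal_mult[symmetric] ennreal_leI)
      qed
      also have "\<dots> = ennreal (1 / B) * (\<integral>\<^sup>+x. ennreal (enn2real (maximal_function g x) powr p x) \<partial>lebesgue)"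
        by (rule nn_integral_cmult, measurable)
      also have "\<dots> \<le> ennreal (1 / B) * ennreal B" using int by (intro mult_left_mono) auto
      also have "\<dots> = 1" using B by (simp add: ennreal_mult[symmetric])
      finally show "(\<integral>\<^sup>+x. ennreal ((\<bar>enn2real (maximal_function f x)\<bar> / (B * s)) powr p x) \<partial>lebesgue) \<le> 1" .
    qed
    ultimately show ?thesis by blast
  qed
  show ?thesis
    unfolding maximal_bounded_def
  proof (intro exI[of _ B] conjI ballI)
    show "0 \<le> B" using B by simp
    fix f assume "f \<in> Lp_space p"
    then have f: "f \<in> borel_measurable lebesgue" "Lp_norm p f < \<infinity>" by (auto simp: Lp_space_def)
    define S where "S = {ennreal s |s. 0 < s \<and> (\<integral>\<^sup>+x. ennreal ((\<bar>f x\<bar> / s) powr p x) \<partial>lebesgue) \<le> 1}"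
    have norm: "Lp_norm p f = Inf S" unfolding Lp_norm_def S_def ..
    have "S \<noteq> {}" using f(2) unfolding norm by (intro notI) simp
    then obtain s where s: "0 < s" "(\<integral>\<^sup>+x. ennreal ((\<bar>f x\<bar> / s) powr p x) \<partial>lebesgue) \<le> 1" unfolding S_def by blast
    note sc = scaled[OF f(1) s]
    then show "AE x in lebesgue. maximal_function f x < \<infinity>" by blast
    have "Lp_norm p (\<lambda>x. enn2real (maximal_function f x)) < \<infinity>"
      using conjunct2[OF sc] by (rule le_less_trans) simp
    moreover have "(\<lambda>x. enn2real (maximal_function f x)) \<in> borel_measurable lebesgue"
      using maximal_function_measurable[of f] by measurable
    ultimately show "(\<lambda>x. enn2real (maximal_function f x)) \<in> Lp_space p" by (simp add: Lp_space_def)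
    \<comment> \<open>With the constant on the left, the infimum over admissible scalings of
      \<open>f\<close> can be taken directly.\<close>
    have "Lp_norm p (\<lambda>x. enn2real (maximal_function f x)) / ennreal B \<le> Inf S"
    proof (rule Inf_greatest)
      fix u assume "u \<in> S"
      then obtain s where s: "u = ennreal s" "0 < s" "(\<integral>\<^sup>+x. ennreal ((\<bar>f x\<bar> / s) powr p x) \<partial>lebesgue) \<le> 1" unfolding S_def by blast
      have "Lp_norm p (\<lambda>x. enn2real (maximal_function f x)) \<le> ennreal (B * s)" using scaled[OF f(1) s(2,3)] by blast
      then have "Lp_norm p (\<lambda>x. enn2real (maximal_function f x)) / ennreal B \<le> ennreal (B * s) / ennreal B"
        by (rule divide_right_mono_ennreal)
      also have "\<dots> = u" using B s by (simp add: divide_ennreal)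
      finally show "Lp_norm p (\<lambda>x. enn2real (maximal_function f x)) / ennreal B \<le> u" .
    qed
    then have "ennreal B * (Lp_norm p (\<lambda>x. enn2real (maximal_function f x)) / ennreal B) \<le> ennreal B * Lp_norm p f"
      unfolding norm by (rule mult_left_mono) simp
    moreover have "ennreal B * (Lp_norm p (\<lambda>x. enn2real (maximal_function f x)) / ennreal B) = Lp_norm p (\<lambda>x. enn2real (maximal_function f x))"
      using B ennreal_mult_divide_eq[of "ennreal B"] by (simp add: ennreal_times_divide mult.commute[of "ennreal B"])
    ultimately show "Lp_norm p (\<lambda>x. enn2real (maximal_function f x)) \<le> ennreal B * Lp_norm p f" by simp
  qed
qed

end

section \<open>Averaging operators over disjoint families\<close>

text \<open>Uniform boundedness with norm at most \<open>B\<close>, in modular form, of the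
  operators that replace a function on each cube of a disjoint family by its average.\<close>

definition averaging_bounded :: "(real ^ 'n \<Rightarrow> real) \<Rightarrow> real \<Rightarrow> bool" where
  "averaging_bounded p B \<longleftrightarrow>
     (\<forall>F f. finite F \<and> F \<subseteq> cubes \<and> disjoint F \<and> bounded_measurable f \<and> (\<forall>x. 0 \<le> f x) \<and>
        (\<Sum>Q\<in>F. I Q (\<lambda>x. f x powr p x)) \<le> 1 \<longrightarrow> (\<Sum>Q\<in>F. I Q (\<lambda>x. (avg Q f / B) powr p x)) \<le> 1)"

lemma sum_disjoint_indicator:
  fixes f :: "'a set \<Rightarrow> 'a \<Rightarrow> real"
  assumes "finite F" "disjoint F" "Q \<in> F" "x \<in> Q"
  shows "(\<Sum>R\<in>F. f R x * indicator R x) = f Q x"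
proof -
  have "indicator R x = (0::real)" if "R \<in> F - {Q}" for R
    using assms that by (auto simp: disjoint_def indicator_def)
  then have "(\<Sum>R\<in>F. f R x * indicator R x) = (\<Sum>R\<in>{Q}. f R x * indicator R x)"
    using assms by (intro sum.mono_neutral_right) auto
  then show ?thesis using assms(4) by simp
qed

lemma averaging_bounded_family:
  assumes "averaging_bounded p B" and F: "finite F" "F \<subseteq> cubes" "disjoint F"
    and f: "\<And>Q. Q \<in> F \<Longrightarrow> bounded_measurable (f Q)" "\<And>Q x. Q \<in> F \<Longrightarrow> 0 \<le> f Q x"
    and le: "(\<Sum>Q\<in>F. I Q (\<lambda>x. f Q x powr p x)) \<le> 1"
  shows "(\<Sum>Q\<in>F. I Q (\<lambda>x. (avg Q (f Q) / B) powr p x)) \<le> 1"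
proof -
  define g where "g x = (\<Sum>Q\<in>F. f Q x * indicator Q x)" for x
  have g: "g x = f Q x" if "Q \<in> F" "x \<in> Q" for x Q
    unfolding g_def by (rule sum_disjoint_indicator[OF F(1,3) that])
  have bg: "bounded_measurable g" unfolding g_def
    using F(2) cube_lebesgue by (intro bm_sum bm_mult f bm_indicator) auto
  have g0: "0 \<le> g x" for x unfolding g_def using f(2) by (intro sum_nonneg) auto
  have "(\<Sum>Q\<in>F. I Q (\<lambda>x. g x powr p x)) = (\<Sum>Q\<in>F. I Q (\<lambda>x. f Q x powr p x))"
    by (intro sum.cong refl I_cong) (simp add: g)
  then have "(\<Sum>Q\<in>F. I Q (\<lambda>x. (avg Q g / B) powr p x)) \<le> 1"
    using assms(1) F bg g0 le unfolding averaging_bounded_def by auto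
  moreover have "avg Q g = avg Q (f Q)" if "Q \<in> F" for Q using that by (intro avg_cong g)
  ultimately show ?thesis by simp
qed

text \<open>Spheres are null, so the measure of \<open>S\<close> within the ball of radius
  \<open>r\<close> depends continuously on \<open>r\<close>, and the intermediate value theorem
  applies. Radius \<open>-1\<close> provides the empty ball.\<close>

lemma exists_subset_of_measure:
  fixes S :: "(real ^ 'n) set"
  assumes S: "S \<in> lmeasurable" "bounded S" and m: "0 \<le> m" "m \<le> measure lebesgue S"
  shows "\<exists>X. X \<in> sets lebesgue \<and> X \<subseteq> S \<and> measure lebesgue X = m"
proof -
  define g where "g r = measure lebesgue (S \<inter> cball 0 r)" for r :: real
  have lm: "S \<inter> cball 0 r \<in> lmeasurable" for r by (intro fmeasurable_Int_sets S) auto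
  have gI: "g r = (\<integral>x. indicator (S \<inter> cball 0 r) x \<partial>lebesgue)" for r
    unfolding g_def using lm[of r] by simp
  have cont: "isCont g r" for r
    unfolding continuous_at_sequentially
  proof (intro allI impI)
    fix s assume s: "s \<longlonglongrightarrow> r"
    show "(g \<circ> s) \<longlonglongrightarrow> g r"
      unfolding comp_def gI
    proof (rule integral_dominated_convergence[where w = "indicator S"])
      show "(\<lambda>x. indicator (S \<inter> cball 0 r) x :: real) \<in> borel_measurable lebesgue" using lm[of r] by (auto intro!: borel_measurable_indicator)
      show "(\<lambda>x. indicator (S \<inter> cball 0 (s i)) x :: real) \<in> borel_measurable lebesgue" for i using lm[of "s i"] by (auto intro!: borel_measurable_indicator)
      show "integrable lebesgue (indicator S :: real ^ 'n \<Rightarrow> real)" using S(1) by (intro integrable_real_indicator) (auto simp: fmeasurable_def)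
      show "AE x in lebesgue. norm (indicator (S \<inter> cball 0 (s i)) x :: real) \<le> indicator S x" for i
        by (intro AE_I2) (auto simp: indicator_def)
      have "sphere (0 :: real ^ 'n) r \<in> null_sets lebesgue"
        using negligible_sphere[of 0 r] by (simp add: negligible_iff_null_sets)
      then have "AE x in lebesgue. x \<notin> sphere (0 :: real ^ 'n) r" by (rule AE_not_in)
      then show "AE x in lebesgue. (\<lambda>i. indicator (S \<inter> cball 0 (s i)) x :: real) \<longlonglongrightarrow> indicator (S \<inter> cball 0 r) x"
      proof eventually_elim
        case (elim x)
        then consider "norm x < r" | "r < norm x" by (auto simp: dist_norm) (use not_less_iff_gr_or_eq in blast)
        then have "\<forall>\<^sub>F i in sequentially. indicator (S \<inter> cball 0 (s i)) x = (indicator (S \<inter> cball 0 r) x :: real)"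
        proof cases
          case 1
          show ?thesis using order_tendstoD(1)[OF s 1] by eventually_elim (use 1 in \<open>auto simp: indicator_def\<close>)
        next
          case 2
          show ?thesis using order_tendstoD(2)[OF s 2] by eventually_elim (use 2 in \<open>auto simp: indicator_def\<close>)
        qed
        then show ?case by (rule tendsto_eventually)
      qed
    qed
  qed
  obtain R where R: "0 < R" "S \<subseteq> cball 0 R" using bounded_subset_ballD[OF S(2), of 0] ball_subset_cball by blast
  have "S \<inter> cball 0 R = S" using R by blast
  then have gR: "g R = measure lebesgue S" by (simp add: g_def)
  have "g (-1) = 0" by (simp add: g_def)
  then obtain r where "g r = m"
    using IVT[of g "-1" m R] m gR R cont by auto
  then show ?thesis using lm[of r] unfolding g_def by (intro exI[of _ "S \<inter> cball 0 r"]) auto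
qed

context exponents
begin

lemma powr_p_conj:
  assumes "0 \<le> c" shows "(c powr (q x - 1)) powr p x = c powr q x" "c * c powr (q x - 1) = c powr q x"
proof -
  have p1: "p x - 1 \<noteq> 0" using p_gt_1[of x] by simp
  have "(q x - 1) * p x = q x" unfolding q using p1 by (simp add: field_simps)
  then show "(c powr (q x - 1)) powr p x = c powr q x" by (simp add: powr_powr)
  show "c * c powr (q x - 1) = c powr q x" using assms by (cases "c = 0") (auto simp: powr_mult_base)
qed

text \<open>These functions give equality in the Hoelder inequality against the constants \<open>c Q\<close>.\<close>

lemma normalised_test:
  fixes c :: "(real ^ 'n) set \<Rightarrow> real"
  assumes F: "finite F" "F \<subseteq> cubes" and c: "\<And>Q. Q \<in> F \<Longrightarrow> 0 \<le> c Q"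
    and R: "R = (\<Sum>Q\<in>F. I Q (\<lambda>x. c Q powr q x))" "1 \<le> R"
  defines "h \<equiv> \<lambda>Q x. R powr (-1 / a) * c Q powr (q x - 1)"
  shows "\<And>Q. Q \<in> F \<Longrightarrow> bounded_measurable (h Q)" "\<And>Q x. 0 \<le> h Q x"
    "(\<Sum>Q\<in>F. I Q (\<lambda>x. h Q x powr p x)) \<le> 1"
    "(\<Sum>Q\<in>F. c Q * I Q (h Q)) = R powr (1 - 1 / a)"
proof -
  interpret dual: exponents q p a' b' a b by (rule dual)
  show bh: "bounded_measurable (h Q)" if "Q \<in> F" for Q
    unfolding h_def using c[OF that] dual.p_gt_1
    by (intro bm_mult bm_const bm_powr bm_diff dual.bm_p) (auto intro: less_imp_le)
  show h0: "0 \<le> h Q x" for Q x by (simp add: h_def)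
  have bcq: "bounded_measurable (\<lambda>x. c Q powr q x)" if "Q \<in> F" for Q
    using dual.bm_fun_powr_p[OF bm_const, of "c Q" 0] c[OF that] by simp
  have "(\<Sum>Q\<in>F. I Q (\<lambda>x. h Q x powr p x)) \<le> (\<Sum>Q\<in>F. I Q (\<lambda>x. 1 / R * c Q powr q x))"
  proof (rule sum_mono, rule I_mono)
    fix Q x assume Q: "Q \<in> F"
    show "bounded_measurable (\<lambda>x. h Q x powr p x)" using bm_fun_powr_p[OF bh[OF Q] h0, of 0] by simp
    show "bounded_measurable (\<lambda>x. 1 / R * c Q powr q x)" by (intro bm_mult bm_const bcq Q)
    show "Q \<in> lmeasurable" using Q F cube_lmeasurable by blast
    have "h Q x powr p x = (R powr (-1 / a)) powr p x * c Q powr q x"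
      unfolding h_def using powr_p_conj(1)[OF c[OF Q]] by (simp add: powr_mult)
    \<comment> \<open>As \<open>R \<ge> 1\<close> and \<open>p x \<ge> a\<close>, normalising with
      the exponent \<open>1 / a\<close> is enough at every point.\<close>
    also have "(R powr (-1 / a)) powr p x \<le> R powr (-1)"
      unfolding powr_powr using R(2) a(1) a(2)[of x] by (intro powr_mono) (auto simp: field_simps)
    also have "R powr (-1) = 1 / R" using R(2) by (simp add: powr_minus_divide)
    finally show "h Q x powr p x \<le> 1 / R * c Q powr q x" by (simp add: mult_right_mono)
  qed
  also have "\<dots> = 1 / R * R" unfolding R(1) by (simp add: sum_distrib_left)
  finally show "(\<Sum>Q\<in>F. I Q (\<lambda>x. h Q x powr p x)) \<le> 1" using R(2) by simp
  have "c Q * I Q (h Q) = R powr (-1 / a) * I Q (\<lambda>x. c Q powr q x)" if Q: "Q \<in> F" for Q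
  proof -
    have "c Q * I Q (h Q) = I Q (\<lambda>x. c Q * h Q x)" by simp
    also have "\<dots> = I Q (\<lambda>x. R powr (-1 / a) * c Q powr q x)"
      by (intro I_cong) (simp add: h_def powr_p_conj(2)[OF c[OF Q], symmetric] mult_ac)
    finally show ?thesis by simp
  qed
  then have "(\<Sum>Q\<in>F. c Q * I Q (h Q)) = R powr (-1 / a) * R" unfolding R(1) by (simp add: sum_distrib_left)
  also have "\<dots> = R powr (1 - 1 / a)" using R(2) powr_add[of R "-1 / a" 1] by simp
  finally show "(\<Sum>Q\<in>F. c Q * I Q (h Q)) = R powr (1 - 1 / a)" .
qed

text \<open>Averaging is self-adjoint, so the constants \<open>c Q\<close> tested against
  \<open>h\<close> can be rewritten as averages of \<open>h\<close> tested against \<open>g\<close>.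
  For the extremal \<open>h\<close> a modular \<open>R > 1\<close> would give
  \<open>R powr (1 - 1 / a) \<le> 1\<close>; the factor 2 in \<open>2 * B\<close> pays for the two
  terms of Young's inequality.\<close>

lemma averaging_bounded_dual:
  assumes av: "averaging_bounded p B" and B: "0 < B"
  shows "averaging_bounded q (2 * B)"
  unfolding averaging_bounded_def
proof (intro allI impI, elim conjE)
  interpret dual: exponents q p a' b' a b by (rule dual)
  fix F g assume F: "finite F" "F \<subseteq> cubes" "disjoint F" and g: "bounded_measurable g" "\<forall>x. 0 \<le> g x"
    and gq: "(\<Sum>Q\<in>F. I Q (\<lambda>x. g x powr q x)) \<le> 1"
  define c where "c Q = avg Q g / (2 * B)" for Q
  have c0: "0 \<le> c Q" for Q unfolding c_def using g(2) B by (intro divide_nonneg_pos avg_nonneg) auto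
  define R where "R = (\<Sum>Q\<in>F. I Q (\<lambda>x. c Q powr q x))"
  have "R \<le> 1"
  proof (rule ccontr)
    assume "\<not> R \<le> 1"
    then have R1: "1 \<le> R" "1 < R" by auto
    define h where "h Q x = R powr (-1 / a) * c Q powr (q x - 1)" for Q x
    note nt = normalised_test[OF F(1,2) c0 R_def R1(1), folded h_def]
    have le: "(\<Sum>Q\<in>F. I Q (\<lambda>x. (avg Q (h Q) / B) powr p x)) \<le> 1"
      by (rule averaging_bounded_family[OF av F nt(1,2,3)])
    have "R powr (1 - 1 / a) = (\<Sum>Q\<in>F. c Q * I Q (h Q))" by (rule nt(4)[symmetric])
    also have "\<dots> \<le> (\<Sum>Q\<in>F. 1 / 2 * (I Q (\<lambda>x. (avg Q (h Q) / B) powr p x) + I Q (\<lambda>x. g x powr q x)))"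
    proof (rule sum_mono)
      fix Q assume Q: "Q \<in> F"
      then have Qc: "Q \<in> cubes" using F by auto
      have h0: "0 \<le> avg Q (h Q) / B" using B nt(2) by (intro divide_nonneg_pos avg_nonneg) auto
      have "c Q * I Q (h Q) = 1 / 2 * (avg Q (h Q) / B * I Q g)"
        unfolding I_eq_avg[OF Qc] c_def using B by (simp add: field_simps)
      also have "avg Q (h Q) / B * I Q g = I Q (\<lambda>x. avg Q (h Q) / B * g x)" by simp
      also have "\<dots> \<le> I Q (\<lambda>x. (avg Q (h Q) / B) powr p x) + I Q (\<lambda>x. g x powr q x)"
        using g h0 by (intro integral_young cube_lmeasurable Qc bm_const) auto
      finally show "c Q * I Q (h Q) \<le> 1 / 2 * (I Q (\<lambda>x. (avg Q (h Q) / B) powr p x) + I Q (\<lambda>x. g x powr q x))"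
        by simp
    qed
    also have "\<dots> = 1 / 2 * ((\<Sum>Q\<in>F. I Q (\<lambda>x. (avg Q (h Q) / B) powr p x)) + (\<Sum>Q\<in>F. I Q (\<lambda>x. g x powr q x)))"
      unfolding sum.distrib[symmetric] by (rule sum_distrib_left[symmetric])
    also have "\<dots> \<le> 1" using le gq by simp
    finally have "R powr (1 - 1 / a) \<le> 1" .
    moreover have "1 < R powr (1 - 1 / a)" using R1 a(1) by (intro gr_one_powr) auto
    ultimately show False by simp
  qed
  then show "(\<Sum>Q\<in>F. I Q (\<lambda>x. (avg Q g / (2 * B)) powr q x)) \<le> 1" unfolding R_def c_def .
qed

text \<open>The extremal function for the constant \<open>4 * s\<close> has modular at most 1 and
  average at least \<open>1 / (4 * s * |Q|)\<close>. Divided by \<open>B\<close>, this average has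
  modular at most 1 on \<open>Q\<close> and so lies below \<open>4 * t\<close>, whose modular
  exceeds 1. The two factors 4 make up the 16.\<close>

lemma averaging_imp_local_condition:
  assumes av: "averaging_bounded p B" and B: "0 < B"
  shows "local_condition p q (16 * B)"
  unfolding local_condition_def
proof (intro ballI allI impI)
  interpret dual: exponents q p a' b' a b by (rule dual)
  fix Q and t s :: real
  assume Q: "Q \<in> cubes" and t: "0 < t" "1 < I Q (\<lambda>x. (4 * t) powr p x)"
    and s: "0 < s" "1 < I Q (\<lambda>x. (4 * s) powr q x)"
  have mQ: "0 < measure lebesgue Q" using measure_cube_pos[OF Q] .
  define R where "R = I Q (\<lambda>x. (4 * s) powr q x)"
  define c where "c = (\<lambda>_ :: (real ^ 'n) set. 4 * s)"
  have F: "finite {Q}" "{Q} \<subseteq> cubes" "disjoint {Q}" using Q by (auto simp: disjoint_def)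
  have R1: "1 \<le> R" using s by (simp add: R_def)
  have R: "R = (\<Sum>Q\<in>{Q}. I Q (\<lambda>x. c Q powr q x))" by (simp add: R_def c_def)
  have c0: "0 \<le> c X" for X using s by (simp add: c_def)
  define h where "h X x = R powr (-1 / a) * c X powr (q x - 1)" for X :: "(real ^ 'n) set" and x
  note nt = normalised_test[OF F(1,2) c0 R R1, folded h_def]
  have le: "I Q (\<lambda>x. (avg Q (h Q) / B) powr p x) \<le> 1"
    using averaging_bounded_family[OF av F nt(1,2,3)] by simp
  have "1 \<le> R powr (1 - 1 / a)" using R1 a(1) by (intro ge_one_powr_ge_zero) auto
  then have "1 \<le> 4 * s * I Q (h Q)" using nt(4) by (simp add: c_def)
  then have av: "1 / (4 * s * measure lebesgue Q) \<le> avg Q (h Q)"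
    using s mQ by (simp add: avg_def field_simps)
  define u where "u = 1 / (4 * s * measure lebesgue Q) / B"
  have u: "0 < u" "u \<le> avg Q (h Q) / B"
    unfolding u_def using s mQ B divide_right_mono[OF av, of B] by auto
  have "u < 4 * t"
  proof (rule ccontr)
    assume "\<not> u < 4 * t"
    then have "I Q (\<lambda>x. (4 * t) powr p x) \<le> I Q (\<lambda>x. (avg Q (h Q) / B) powr p x)"
      using t u by (intro I_powr_mono Q) auto
    then show False using le t by simp
  qed
  then have "u * (4 * s * measure lebesgue Q * B) \<le> 4 * t * (4 * s * measure lebesgue Q * B)"
    using s mQ B by (intro mult_right_mono) auto
  moreover have "u * (4 * s * measure lebesgue Q * B) = 1" using s mQ B by (simp add: u_def)
  ultimately show "1 \<le> 16 * B * t * s * measure lebesgue Q" by (simp add: mult_ac)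
qed

end

section \<open>Disjoint families at levels at most one\<close>

context local_exponents
begin

text \<open>The first entry makes a violation of the estimate with this constant also a violation of
  \<open>single_cube\<close>; the second turns the averaging bound \<open>B powr b\<close> into
  total modular at most \<open>1 / 2\<close>.\<close>

definition "M\<^sub>1 B = max D\<^sub>1 (2 * B powr b)"

lemma M1_ge_2: "1 \<le> B \<Longrightarrow> 2 \<le> M\<^sub>1 B"
  using ge_one_powr_ge_zero[of B b] b_gt_1 by (simp add: M\<^sub>1_def le_max_iff_disj)

text \<open>Cubes violating the estimate with the constant \<open>M\<^sub>1 B\<close> have small modular by the single cube
  estimate, so adding them one at a time keeps the family within reach of the averaging bound.\<close>

lemma averaging_modular_sum:
  assumes av: "averaging_bounded p B" and B: "1 \<le> B" and F: "finite F" "F \<subseteq> cubes" "disjoint F"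
    and t: "\<And>Q. Q \<in> F \<Longrightarrow> 0 < t Q" "\<And>Q. Q \<in> F \<Longrightarrow> t Q \<le> 1"
    and f: "\<And>Q. Q \<in> F \<Longrightarrow> bounded_measurable (f Q)" "\<And>Q x. Q \<in> F \<Longrightarrow> 0 \<le> f Q x"
    and tf: "\<And>Q. Q \<in> F \<Longrightarrow> t Q \<le> avg Q (f Q)"
  shows "(\<Sum>Q\<in>F. I Q (\<lambda>x. t Q powr p x)) \<le> M\<^sub>1 B * (\<Sum>Q\<in>F. I Q (\<lambda>x. f Q x powr p x)) + B powr b"
proof -
  define M where "M = M\<^sub>1 B"
  have M: "D\<^sub>1 \<le> M" "2 * B powr b \<le> M" "2 \<le> M" using M1_ge_2[OF B] by (auto simp: M_def M\<^sub>1_def)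
  define y where "y Q = I Q (\<lambda>x. t Q powr p x)" for Q
  define x where "x Q = I Q (\<lambda>x. f Q x powr p x)" for Q
  have x0: "0 \<le> x Q" for Q unfolding x_def by (rule I_nonneg) simp
  \<comment> \<open>The averaging bound needs total modular at most 1; undoing the division by
    \<open>B\<close> costs \<open>B powr b\<close>.\<close>
  have fam: "sum y G \<le> B powr b" if G: "G \<subseteq> F" "sum x G \<le> 1" for G
  proof -
    have G': "finite G" "G \<subseteq> cubes" "disjoint G"
      using G(1) F finite_subset[OF G(1)] pairwise_subset[OF F(3) G(1)] by auto
    have "sum y G \<le> (\<Sum>Q\<in>G. B powr b * I Q (\<lambda>x. (avg Q (f Q) / B) powr p x))"
    proof (rule sum_mono)
      fix Q assume "Q \<in> G"
      then have Q: "Q \<in> F" "Q \<in> cubes" using G G' by auto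
      have pos: "0 < avg Q (f Q)" using t(1)[OF Q(1)] tf[OF Q(1)] by linarith
      have "y Q \<le> I Q (\<lambda>x. (B * (avg Q (f Q) / B)) powr p x)"
        unfolding y_def using B t(1)[OF Q(1)] tf[OF Q(1)] by (intro I_powr_mono Q) auto
      also have "\<dots> \<le> B powr b * I Q (\<lambda>x. (avg Q (f Q) / B) powr p x)"
        using B pos by (intro I_powr_scale_le Q) auto
      finally show "y Q \<le> B powr b * I Q (\<lambda>x. (avg Q (f Q) / B) powr p x)" .
    qed
    also have "\<dots> = B powr b * (\<Sum>Q\<in>G. I Q (\<lambda>x. (avg Q (f Q) / B) powr p x))" by (simp add: sum_distrib_left)
    also have "\<dots> \<le> B powr b * 1"
    proof (intro mult_left_mono averaging_bounded_family[OF av G'])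
      show "bounded_measurable (f Q)" if "Q \<in> G" for Q using f(1) that G(1) by blast
      show "0 \<le> f Q x" if "Q \<in> G" for Q x using f(2) that G(1) by blast
      show "(\<Sum>Q\<in>G. I Q (\<lambda>x. f Q x powr p x)) \<le> 1" using G(2) by (simp add: x_def)
    qed simp
    finally show ?thesis by simp
  qed
  define bad where "bad = {Q \<in> F. M * x Q < y Q}"
  \<comment> \<open>As \<open>t Q \<le> 1\<close>, \<open>single_cube\<close> could fail only if
    \<open>y Q < 1\<close>; then \<open>2 * x Q \<le> M * x Q < y Q < 1\<close>.\<close>
  have half: "x Q \<le> 1 / 2" if "Q \<in> bad" for Q
  proof -
    have Q: "Q \<in> F" "Q \<in> cubes" "M * x Q < y Q" using that F by (auto simp: bad_def)
    have "y Q < 1"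
    proof (rule ccontr)
      assume "\<not> y Q < 1"
      then have "y Q \<le> D\<^sub>1 * x Q" unfolding x_def y_def
        using t[OF Q(1)] tf[OF Q(1)] f[OF Q(1)] by (intro single_cube Q) auto
      also have "\<dots> \<le> M * x Q" using M x0 by (intro mult_right_mono) auto
      finally show False using Q(3) by simp
    qed
    moreover have "2 * x Q \<le> M * x Q" using M x0 by (intro mult_right_mono) auto
    ultimately show ?thesis using Q(3) by linarith
  qed
  have finbad: "finite bad" "bad \<subseteq> F" using F(1) by (auto simp: bad_def)
  \<comment> \<open>With one more cube the sum is still at most 1, so \<open>fam\<close> applies,
    and the violated estimates push the sum back to at most \<open>1 / 2\<close>.\<close>
  have "sum x G \<le> 1 / 2" if "finite G" "G \<subseteq> bad" for G
    using that
  proof (induction G rule: finite_induct)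
    case (insert Q G)
    have s1: "sum x (insert Q G) \<le> 1" using insert half[of Q] by simp
    have "M * sum x (insert Q G) = (\<Sum>R\<in>insert Q G. M * x R)" by (rule sum_distrib_left)
    also have "\<dots> \<le> sum y (insert Q G)" using insert.prems by (intro sum_mono) (auto simp: bad_def)
    also have "\<dots> \<le> B powr b" using insert.prems finbad(2) by (intro fam s1) auto
    also have "\<dots> \<le> M * (1 / 2)" using M by simp
    finally show ?case using M by (simp only: mult_le_cancel_left_pos)
  qed simp
  from this[OF finbad(1) order_refl] have bad_y: "sum y bad \<le> B powr b" using finbad(2) by (intro fam) auto
  have "sum y (F - bad) \<le> (\<Sum>Q\<in>F - bad. M * x Q)" by (intro sum_mono) (auto simp: bad_def)
  also have "\<dots> \<le> (\<Sum>Q\<in>F. M * x Q)" using F(1) M x0 by (intro sum_mono2) auto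
  also have "\<dots> = M * sum x F" by (simp add: sum_distrib_left)
  finally have "sum y F \<le> M * sum x F + B powr b"
    using sum.subset_diff[OF finbad(2) F(1), of y] bad_y by linarith
  then show ?thesis unfolding x_def y_def M_def .
qed

text \<open>A subcube inherits the level of the member of \<open>F\<close> containing it. With the
  test functions of \<open>avg_half_test\<close>, \<open>averaging_modular_sum\<close> is then the
  hypothesis of \<open>a_infty_family\<close> for the weight equal to \<open>t Q powr p x\<close> on
  each \<open>Q\<close>. The levels may vary with the cube, as \<open>gap_gain\<close>
  requires.\<close>

lemma family_decay:
  assumes av: "averaging_bounded p B" and B: "1 \<le> B" and F: "finite F" "F \<subseteq> cubes" "disjoint F"
    and t: "\<And>Q. Q \<in> F \<Longrightarrow> 0 < t Q" "\<And>Q. Q \<in> F \<Longrightarrow> t Q \<le> 1"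
    and X: "X \<in> sets lebesgue"
      "\<And>Q. Q \<in> F \<Longrightarrow> measure lebesgue (X \<inter> Q) \<le> (1 / 2 ^ (CARD('n) + 2)) ^ k * measure lebesgue Q"
  defines "K \<equiv> M\<^sub>1 B * 2 powr b"
  shows "(\<Sum>Q\<in>F. I (X \<inter> Q) (\<lambda>x. t Q powr p x)) \<le>
    (1 - 1 / K) ^ k * (\<Sum>Q\<in>F. I Q (\<lambda>x. t Q powr p x)) + K * B powr b"
proof -
  define w where "w x = (\<Sum>Q\<in>F. t Q powr p x * indicator Q x)" for x
  have w_eq: "w x = t Q powr p x" if "Q \<in> F" "x \<in> Q" for x Q
    unfolding w_def by (rule sum_disjoint_indicator[OF F(1,3) that, of "\<lambda>Q x. t Q powr p x"])
  have w: "bounded_measurable w" unfolding w_def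
    using F(2) cube_lebesgue t by (intro bm_sum bm_mult bm_powr_p bm_indicator) auto
  have w0: "0 \<le> w x" for x unfolding w_def by (intro sum_nonneg) auto
  have lmF: "\<Union>F \<in> lmeasurable" using F cube_lmeasurable by (intro fmeasurable.finite_Union) auto
  let ?N = "weighted w (\<Union>F)"
  have N: "measure ?N Y = I Y (\<lambda>x. t Q powr p x)" if "Y \<in> sets lebesgue" "Y \<subseteq> Q" "Q \<in> F" for Y Q
  proof -
    have "measure ?N Y = I (Y \<inter> \<Union>F) w" by (intro weighted_measure w lmF w0 that)
    also have "Y \<inter> \<Union>F = Y" using that by auto
    also have "I Y w = I Y (\<lambda>x. t Q powr p x)" using w_eq that by (intro I_cong) auto
    finally show ?thesis .
  qed
  have K: "1 \<le> K" using M1_ge_2[OF B] b_gt_1 ge_one_powr_ge_zero[of 2 b] mult_mono[of 1 "M\<^sub>1 B" 1 "2 powr b"]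
    by (simp add: K_def)
  interpret a_infty_family ?N F K "B powr b"
  proof (rule a_infty_family.intro)
    show "finite_measure ?N" by (intro finite_measure_weighted w lmF w0)
    show "Y \<in> null_sets ?N" if "Y \<in> null_sets lebesgue" for Y by (rule null_sets_weighted[OF w lmF that])
  next
    fix G E assume G: "finite G" "disjoint G" "G \<subseteq> cubes" "\<And>Q'. Q' \<in> G \<Longrightarrow> \<exists>Q\<in>F. Q' \<subseteq> Q"
      and E: "E \<in> sets lebesgue" "\<And>Q. Q \<in> G \<Longrightarrow> measure lebesgue Q / 2 \<le> measure lebesgue (Q \<inter> E)"
    obtain par where par: "\<And>R. R \<in> G \<Longrightarrow> par R \<in> F" "\<And>R. R \<in> G \<Longrightarrow> R \<subseteq> par R" using G(4) by metis
    define s where "s R = t (par R)" for R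
    have s: "0 < s R" "s R \<le> 1" if "R \<in> G" for R using t par that by (auto simp: s_def)
    have "(\<Sum>R\<in>G. measure ?N R) = (\<Sum>R\<in>G. I R (\<lambda>x. s R powr p x))"
      unfolding s_def using G(3) cube_lebesgue par by (intro sum.cong N refl) auto
    also have "\<dots> \<le> M\<^sub>1 B * (\<Sum>R\<in>G. I R (\<lambda>x. (2 * s R * indicator E x) powr p x)) + B powr b"
    proof (rule averaging_modular_sum[OF av B G(1,3,2) s])
      fix R assume R: "R \<in> G"
      then have Rc: "R \<in> cubes" using G by auto
      note h = avg_half_test[OF Rc E(1) E(2)[OF R] s(1)[OF R]]
      show "bounded_measurable (\<lambda>x. 2 * s R * indicator E x)" "s R \<le> avg R (\<lambda>x. 2 * s R * indicator E x)"
        by (rule h)+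
      show "0 \<le> 2 * s R * indicator E x" for x using s(1)[OF R] by simp
    qed auto
    also have "(\<Sum>R\<in>G. I R (\<lambda>x. (2 * s R * indicator E x) powr p x)) \<le> (\<Sum>R\<in>G. 2 powr b * I (R \<inter> E) (\<lambda>x. s R powr p x))"
      using G(3) s by (intro sum_mono avg_half_test(3) E) auto
    also have "\<dots> = (\<Sum>R\<in>G. 2 powr b * measure ?N (R \<inter> E))"
    proof (intro sum.cong refl arg_cong[where f = "\<lambda>z. 2 powr b * z"])
      fix R assume R: "R \<in> G"
      then have "measure ?N (R \<inter> E) = I (R \<inter> E) (\<lambda>x. t (par R) powr p x)"
        using par[OF R] G(3) cube_lebesgue E(1) by (intro N) auto
      then show "I (R \<inter> E) (\<lambda>x. s R powr p x) = measure ?N (R \<inter> E)" by (simp add: s_def)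
    qed
    also have "\<dots> = 2 powr b * (\<Sum>R\<in>G. measure ?N (R \<inter> E))" by (simp add: sum_distrib_left)
    finally show "(\<Sum>Q\<in>G. measure ?N Q) \<le> K * (\<Sum>Q\<in>G. measure ?N (Q \<inter> E)) + B powr b"
      using M1_ge_2[OF B] by (simp add: K_def mult.assoc)
  qed (use F K in auto)
  have "(\<Sum>Q\<in>F. measure ?N (X \<inter> Q)) \<le> (1 - 1 / K) ^ k * (\<Sum>Q\<in>F. measure ?N Q) + K * B powr b"
    by (rule iterate[OF X])
  moreover have "(\<Sum>Q\<in>F. measure ?N (X \<inter> Q)) = (\<Sum>Q\<in>F. I (X \<inter> Q) (\<lambda>x. t Q powr p x))"
    using X(1) F(2) cube_lebesgue by (intro sum.cong refl N) auto
  moreover have "(\<Sum>Q\<in>F. measure ?N Q) = (\<Sum>Q\<in>F. I Q (\<lambda>x. t Q powr p x))"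
    using F(2) cube_lebesgue by (intro sum.cong refl N) auto
  ultimately show ?thesis by simp
qed

end

text \<open>Converts geometric decay in the number of steps into a power of the density:
  \<open>k\<close> is the last exponent with \<open>\<tau> \<le> c ^ k\<close>, and
  \<open>\<rho> = c powr d\<close>. The cap \<open>1 / 2\<close> on the exponent keeps
  \<open>1 - \<delta>\<close> positive later.\<close>

lemma power_decay_rate:
  fixes \<rho> c :: real
  assumes \<rho>: "0 < \<rho>" "\<rho> < 1" and c: "0 < c" "c < 1"
  shows "\<exists>\<delta>>0. \<delta> \<le> 1 / 2 \<and> (\<forall>\<tau>. 0 < \<tau> \<and> \<tau> \<le> 1 \<longrightarrow> (\<exists>k. \<tau> \<le> c ^ k \<and> \<rho> ^ k \<le> 1 / c * \<tau> powr \<delta>))"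
proof -
  define d where "d = ln \<rho> / ln c"
  have d: "0 < d" "c powr d = \<rho>" using \<rho> c by (auto simp: d_def powr_def divide_neg_neg)
  define \<delta> where "\<delta> = min d (1 / 2)"
  have \<delta>: "0 < \<delta>" "\<delta> \<le> d" "\<delta> \<le> 1 / 2" using d by (auto simp: \<delta>_def)
  have "\<exists>k. \<tau> \<le> c ^ k \<and> \<rho> ^ k \<le> 1 / c * \<tau> powr \<delta>" if \<tau>: "0 < \<tau>" "\<tau> \<le> 1" for \<tau>
  proof -
    have "\<exists>m. c ^ m < \<tau>" using real_arch_pow_inv[OF \<tau>(1) c(2)] .
    define m where "m = (LEAST m. c ^ m < \<tau>)"
    have m: "c ^ m < \<tau>" unfolding m_def using \<open>\<exists>m. c ^ m < \<tau>\<close> by (rule LeastI_ex)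
    have "m \<noteq> 0" using m \<tau> by (intro notI) simp
    then obtain k where k: "m = Suc k" by (cases m) auto
    have le: "\<tau> \<le> c ^ k" using not_less_Least[of k "\<lambda>m. c ^ m < \<tau>"] k unfolding m_def by simp
    have "\<rho> ^ k = (c ^ k) powr d" unfolding d(2)[symmetric] using c by (simp add: powr_realpow[symmetric] powr_powr mult.commute)
    also have "\<dots> \<le> (c ^ k) powr \<delta>" using c \<delta> by (intro powr_mono') (auto simp: power_le_one)
    also have "c ^ k = 1 / c * c ^ m" using k c by simp
    also have "(1 / c * c ^ m) powr \<delta> = (1 / c) powr \<delta> * (c ^ m) powr \<delta>" using c by (intro powr_mult)
    also have "\<dots> \<le> (1 / c) powr 1 * \<tau> powr \<delta>"
      using c \<delta> m \<tau> by (intro mult_mono powr_mono powr_mono2) auto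
    finally show ?thesis using le c by auto
  qed
  then show ?thesis using \<delta> by blast
qed

text \<open>\<open>t\<close> is the balancing level of the two portions, with an extra factor
  \<open>\<tau> powr (- \<delta>) / C\<close> granted to the portion \<open>\<tau>\<close>. Without
  that factor the value \<open>\<tau> * t powr \<alpha>\<close> would be \<open>gap_term\<close>;
  with it the exponent of \<open>\<tau>\<close> improves by a fixed proportion. Half of
  \<open>\<delta>\<close> is spent on absorbing \<open>C\<close>, which is why
  \<open>\<gamma>\<close> must be small.\<close>

lemma gap_exponent_gain:
  fixes \<tau> \<nu> \<alpha> \<beta> \<delta> C \<gamma> :: real
  assumes \<tau>: "0 < \<tau>" "\<tau> < \<gamma>" "\<gamma> < 1" and l: "0 < \<nu>" "\<nu> < 1"
    and ab: "1 < a" "a \<le> \<alpha>" "\<alpha> < \<beta>" "\<beta> \<le> b" and \<delta>: "0 < \<delta>" "\<delta> \<le> 1 / 2" and C: "1 \<le> C" "C * \<gamma> powr (\<delta> / 2) \<le> 1"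
  defines "t \<equiv> (\<tau> powr (1 - \<delta>) * \<nu> powr (\<beta> - 1) / C) powr (1 / (\<beta> - \<alpha>))"
  shows "0 < t" "t \<le> \<nu>" "\<nu> * (t / \<nu>) powr \<beta> = \<tau> powr (1 - \<delta>) / C * t powr \<alpha>"
    "\<tau> powr ((1 - \<delta> * a / (2 * b)) * (\<beta> / (\<beta> - \<alpha>))) * \<nu> powr (\<alpha> * (\<beta> - 1) / (\<beta> - \<alpha>)) \<le> \<tau> * t powr \<alpha>"
proof -
  define T where "T = \<tau> powr (1 - \<delta>) * \<nu> powr (\<beta> - 1) / C"
  have T: "0 < T" using \<tau> l C by (simp add: T_def)
  have g: "0 < \<beta> - \<alpha>" using ab by simp
  show t0: "0 < t" using T by (simp add: t_def T_def[symmetric])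
  have tT: "t powr (\<beta> - \<alpha>) = T" using g T by (simp add: t_def T_def[symmetric] powr_powr)
  have \<tau>1: "\<tau> powr (1 - \<delta>) \<le> 1" using \<tau> \<delta> by (intro powr_le1) auto
  have "\<tau> powr (1 - \<delta>) * \<nu> powr (\<beta> - 1) \<le> C * \<nu> powr (\<beta> - 1)"
    using \<tau>1 C by (intro mult_right_mono) auto
  then have "T \<le> \<nu> powr (\<beta> - 1)" using C by (simp add: T_def divide_le_eq mult.commute)
  also have "\<dots> \<le> \<nu> powr (\<beta> - \<alpha>)" using l ab by (intro powr_mono') auto
  finally have "t powr (\<beta> - \<alpha>) \<le> \<nu> powr (\<beta> - \<alpha>)" using tT by simp
  then show tl: "t \<le> \<nu>" using g t0 l powr_less_mono2[of "\<beta> - \<alpha>" \<nu> t] by (smt (verit))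
  have "t powr \<beta> = T * t powr \<alpha>" using tT powr_add[of t "\<beta> - \<alpha>" \<alpha>] by simp
  then have "\<nu> * (t / \<nu>) powr \<beta> = T * t powr \<alpha> * (\<nu> / \<nu> powr \<beta>)" using t0 l by (simp add: powr_divide)
  also have "\<nu> / \<nu> powr \<beta> = \<nu> powr (1 - \<beta>)" using l by (simp add: powr_diff)
  also have "T * t powr \<alpha> * \<nu> powr (1 - \<beta>) = \<tau> powr (1 - \<delta>) / C * t powr \<alpha> * (\<nu> powr (\<beta> - 1) * \<nu> powr (1 - \<beta>))"
    by (simp add: T_def)
  also have "\<nu> powr (\<beta> - 1) * \<nu> powr (1 - \<beta>) = 1" using l by (simp add: powr_add[symmetric])
  finally show "\<nu> * (t / \<nu>) powr \<beta> = \<tau> powr (1 - \<delta>) / C * t powr \<alpha>" by simp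
  define z where "z = \<alpha> / (\<beta> - \<alpha>)"
  have z: "0 < z" "\<beta> / (\<beta> - \<alpha>) = 1 + z" "\<alpha> * (\<beta> - 1) / (\<beta> - \<alpha>) = (\<beta> - 1) * z"
    using ab g by (auto simp: z_def field_simps)
  \<comment> \<open>The saving is proportional to \<open>z\<close>, the whole exponent of
    \<open>\<tau>\<close> is \<open>1 + z\<close>; comparing them produces the ratio
    \<open>a / b\<close> in the final exponent.\<close>
  have az: "a / b * (1 + z) \<le> z"
  proof -
    have "a * \<beta> \<le> \<alpha> * b" using ab by (intro mult_mono) auto
    then have "a / b \<le> \<alpha> / \<beta>" using ab by (simp add: field_simps)
    moreover have "z = \<alpha> / \<beta> * (1 + z)" unfolding z(2)[symmetric] using ab by (simp add: z_def)
    ultimately show ?thesis using z(1) mult_right_mono[of "a / b" "\<alpha> / \<beta>" "1 + z"] by linarith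
  qed
  have "\<tau> powr (\<delta> / 2) \<le> \<gamma> powr (\<delta> / 2)" using \<tau> \<delta> by (intro powr_mono2) auto
  then have "C * \<tau> powr (\<delta> / 2) \<le> 1" using C(2) C(1) mult_left_mono[of "\<tau> powr (\<delta> / 2)" "\<gamma> powr (\<delta> / 2)" C] by linarith
  then have C': "\<tau> powr (\<delta> / 2) \<le> 1 / C" using C(1) by (simp add: pos_le_divide_eq mult.commute)
  have "\<tau> powr ((1 - \<delta> * a / (2 * b)) * (1 + z)) \<le> \<tau> powr (1 + (1 - \<delta>) * z + \<delta> / 2 * z)"
  proof (rule powr_mono')
    have "\<delta> / 2 * (a / b * (1 + z)) \<le> \<delta> / 2 * z" using az \<delta> by (intro mult_left_mono) auto
    then show "1 + (1 - \<delta>) * z + \<delta> / 2 * z \<le> (1 - \<delta> * a / (2 * b)) * (1 + z)" by (simp add: algebra_simps)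
  qed (use \<tau> in auto)
  also have "\<dots> = \<tau> * (\<tau> powr (1 - \<delta>)) powr z * (\<tau> powr (\<delta> / 2)) powr z"
    using \<tau> by (simp add: powr_add powr_powr)
  also have "\<dots> \<le> \<tau> * (\<tau> powr (1 - \<delta>)) powr z * (1 / C) powr z"
    using C' \<tau> z(1) by (intro mult_left_mono powr_mono2) auto
  finally have "\<tau> powr ((1 - \<delta> * a / (2 * b)) * (1 + z)) * \<nu> powr ((\<beta> - 1) * z)
      \<le> \<tau> * (\<tau> powr (1 - \<delta>)) powr z * (1 / C) powr z * (\<nu> powr (\<beta> - 1)) powr z"
    unfolding powr_powr by (intro mult_right_mono) auto
  also have "\<dots> = \<tau> * T powr z" using C by (simp add: T_def powr_mult powr_divide)
  also have "T powr z = t powr \<alpha>" using T by (simp add: t_def T_def[symmetric] powr_powr z_def)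
  finally show "\<tau> powr ((1 - \<delta> * a / (2 * b)) * (\<beta> / (\<beta> - \<alpha>))) * \<nu> powr (\<alpha> * (\<beta> - 1) / (\<beta> - \<alpha>)) \<le> \<tau> * t powr \<alpha>"
    unfolding z(2,3) .
qed

lemma conj_le_iff: "1 < u \<Longrightarrow> 1 < v \<Longrightarrow> u / (u - 1) \<le> v / (v - 1) \<longleftrightarrow> v \<le> (u::real)"
  by (simp add: field_simps)

lemma conj_less_iff: "1 < u \<Longrightarrow> 1 < v \<Longrightarrow> u / (u - 1) < v / (v - 1) \<longleftrightarrow> v < (u::real)"
  using conj_le_iff[of v u] by (simp add: not_le[symmetric])

lemma conj_conj: "1 < u \<Longrightarrow> u / (u - 1) / (u / (u - 1) - 1) = (u::real)"
  by (simp add: field_simps)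

lemma conj_gt_1: "1 < u \<Longrightarrow> 1 < u / (u - 1 :: real)"
  by (simp add: field_simps)

text \<open>For \<open>u = \<alpha>\<close> and \<open>v = \<beta>\<close> the right side is the
  second exponent of \<open>gap_term\<close>: passing to conjugate exponents interchanges the two
  exponents there.\<close>

lemma conj_ratio:
  fixes u v :: real
  assumes "1 < u" "1 < v" "u < v"
  shows "u / (u - 1) / (u / (u - 1) - v / (v - 1)) = u * (v - 1) / (v - u)"
proof -
  have nz: "u - 1 \<noteq> 0" "v - 1 \<noteq> 0" "v - u \<noteq> 0" using assms by auto
  have "u / (u - 1) - v / (v - 1) = (v - u) / ((u - 1) * (v - 1))"
    using nz by (simp add: diff_frac_eq) (simp add: algebra_simps)
  then show ?thesis using nz by simp
qed

section \<open>Self-improvement of the cube sum\<close>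

context local_exponents
begin

text \<open>\<open>Z\<close> is the mass assigned to portions where
  \<open>p \<le> \<alpha> Q\<close>, \<open>S\<close> the total modular. Testing with
  \<open>t Q / \<nu>\<close> on portions where \<open>p \<ge> \<beta> Q\<close> bounds
  \<open>S\<close> by a multiple of \<open>\<tau> powr (- \<delta>) * Z\<close>, and decay on small
  sets bounds \<open>Z\<close> by a multiple of \<open>\<tau> powr \<delta> * S\<close>, up to
  constants. The powers cancel, leaving \<open>Z\<close> at most half of itself plus a
  constant.\<close>

lemma gap_gain:
  assumes av: "averaging_bounded p B" and B: "1 \<le> B"
  shows "\<exists>\<theta> \<gamma> C. 0 < \<theta> \<and> \<theta> < 1 \<and> 0 < \<gamma> \<and> \<gamma> < 1 \<and>
    (\<forall>F \<tau> \<nu> \<alpha> \<beta>. finite F \<and> F \<subseteq> cubes \<and> disjoint F \<and> 0 < \<tau> \<and> \<tau> < \<gamma> \<and> 0 < \<nu> \<and> \<nu> < \<gamma> \<and>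
       (\<forall>Q\<in>F. a \<le> \<alpha> Q \<and> \<alpha> Q < \<beta> Q \<and> \<beta> Q \<le> b \<and>
          \<tau> * measure lebesgue Q \<le> measure lebesgue (Q \<inter> {x. p x \<le> \<alpha> Q}) \<and>
          \<nu> * measure lebesgue Q \<le> measure lebesgue (Q \<inter> {x. \<beta> Q \<le> p x})) \<longrightarrow>
       (\<Sum>Q\<in>F. measure lebesgue Q * (\<tau> powr (\<theta> * (\<beta> Q / (\<beta> Q - \<alpha> Q))) *
          \<nu> powr (\<alpha> Q * (\<beta> Q - 1) / (\<beta> Q - \<alpha> Q)))) \<le> C)"
proof -
  define M where "M = M\<^sub>1 B"
  define K where "K = M\<^sub>1 B * 2 powr b"
  have M: "2 \<le> M" using M1_ge_2[OF B] by (simp add: M_def)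
  have K: "1 < K"
  proof -
    have "1 * 1 < M\<^sub>1 B * 2 powr b"
      using M1_ge_2[OF B] b_gt_1 ge_one_powr_ge_zero[of 2 b] by (intro mult_less_le_imp_less) auto
    then show ?thesis by (simp add: K_def)
  qed
  define c :: real where "c = 1 / 2 ^ (CARD('n) + 2)"
  have c: "0 < c" "c < 1" unfolding c_def using one_less_power[of "2::real" "CARD('n) + 2"] by auto
  have r: "0 < 1 - 1 / K" "1 - 1 / K < 1" using K by auto
  define P where "P \<delta> \<longleftrightarrow> 0 < \<delta> \<and> \<delta> \<le> 1 / 2 \<and> (\<forall>\<tau>. 0 < \<tau> \<and> \<tau> \<le> 1 \<longrightarrow> (\<exists>k. \<tau> \<le> c ^ k \<and> (1 - 1 / K) ^ k \<le> 1 / c * \<tau> powr \<delta>))" for \<delta> :: real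
  have "\<exists>\<delta>. P \<delta>" unfolding P_def by (rule power_decay_rate[OF r c])
  then obtain \<delta> where "P \<delta>" by blast
  note \<delta> = this[unfolded P_def]
  have \<delta>1: "0 < \<delta>" "\<delta> \<le> 1 / 2" using \<delta> by auto
  \<comment> \<open>Makes the product of the constants of the two estimates equal to
    \<open>1 / 2\<close>, so that \<open>Z\<close> can be absorbed.\<close>
  define C1 where "C1 = 2 * M / c"
  have "1 * 1 \<le> (2 * M) * (1 / c)" using M c by (intro mult_mono) auto
  then have C1: "1 \<le> C1" by (simp add: C1_def)
  define \<gamma> where "\<gamma> = min (1 / 2) ((1 / C1) powr (2 / \<delta>))"
  have \<gamma>: "0 < \<gamma>" "\<gamma> < 1" using C1 by (auto simp: \<gamma>_def)
  have "\<gamma> powr (\<delta> / 2) \<le> ((1 / C1) powr (2 / \<delta>)) powr (\<delta> / 2)" using \<gamma> \<delta>1 by (intro powr_mono2) (auto simp: \<gamma>_def)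
  also have "\<dots> = 1 / C1" using C1 \<delta>1 by (simp add: powr_powr)
  finally have C\<gamma>: "C1 * \<gamma> powr (\<delta> / 2) \<le> 1" using C1 by (simp add: field_simps)
  define \<theta> where "\<theta> = 1 - \<delta> * a / (2 * b)"
  have "a \<le> b" using a(2) b order_trans by blast
  then have "0 < \<delta> * a / (2 * b)" "\<delta> * a / (2 * b) < 1"
    using \<delta>1 a(1) mult_mono[of \<delta> "1/2" a b] by (auto simp: divide_less_eq)
  then have \<theta>: "0 < \<theta>" "\<theta> < 1" by (auto simp: \<theta>_def)
  define C where "C = 2 * (1 / c * B powr b + K * B powr b)"
  have main: "(\<Sum>Q\<in>F. measure lebesgue Q * (\<tau> powr (\<theta> * (\<beta> Q / (\<beta> Q - \<alpha> Q))) *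
          \<nu> powr (\<alpha> Q * (\<beta> Q - 1) / (\<beta> Q - \<alpha> Q)))) \<le> C"
    if F: "finite F" "F \<subseteq> cubes" "disjoint F" and \<tau>: "0 < \<tau>" "\<tau> < \<gamma>" and l: "0 < \<nu>" "\<nu> < \<gamma>"
      and ab: "\<And>Q. Q \<in> F \<Longrightarrow> a \<le> \<alpha> Q" "\<And>Q. Q \<in> F \<Longrightarrow> \<alpha> Q < \<beta> Q" "\<And>Q. Q \<in> F \<Longrightarrow> \<beta> Q \<le> b"
      and lo: "\<And>Q. Q \<in> F \<Longrightarrow> \<tau> * measure lebesgue Q \<le> measure lebesgue (Q \<inter> {x. p x \<le> \<alpha> Q})"
      and hi: "\<And>Q. Q \<in> F \<Longrightarrow> \<nu> * measure lebesgue Q \<le> measure lebesgue (Q \<inter> {x. \<beta> Q \<le> p x})"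
    for F \<tau> \<nu> \<alpha> \<beta>
  proof -
    have sub: "\<exists>X. X \<in> sets lebesgue \<and> X \<subseteq> Q \<inter> {x. p x \<le> \<alpha> Q} \<and> measure lebesgue X = \<tau> * measure lebesgue Q"
      "\<exists>X. X \<in> sets lebesgue \<and> X \<subseteq> Q \<inter> {x. \<beta> Q \<le> p x} \<and> measure lebesgue X = \<nu> * measure lebesgue Q"
      if Q: "Q \<in> F" for Q
    proof -
      have Qc: "Q \<in> cubes" using Q F by auto
      have bQ: "bounded Q" using Qc by (auto simp: cubes_def bounded_cbox)
      have m: "{x. p x \<le> \<alpha> Q} \<in> sets lebesgue"
        using p_meas by (simp add: borel_measurable_iff_le)
      have m': "{x. \<beta> Q \<le> p x} \<in> sets lebesgue"
        using p_meas by (simp add: borel_measurable_iff_ge)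
      show "\<exists>X. X \<in> sets lebesgue \<and> X \<subseteq> Q \<inter> {x. p x \<le> \<alpha> Q} \<and> measure lebesgue X = \<tau> * measure lebesgue Q"
        using lo[OF Q] \<tau> measure_cube_pos[OF Qc] bQ
        by (intro exists_subset_of_measure fmeasurable_Int_sets cube_lmeasurable Qc m) (auto intro: bounded_subset)
      show "\<exists>X. X \<in> sets lebesgue \<and> X \<subseteq> Q \<inter> {x. \<beta> Q \<le> p x} \<and> measure lebesgue X = \<nu> * measure lebesgue Q"
        using hi[OF Q] l measure_cube_pos[OF Qc] bQ
        by (intro exists_subset_of_measure fmeasurable_Int_sets cube_lmeasurable Qc m') (auto intro: bounded_subset)
    qed
    have "\<forall>Q\<in>F. \<exists>X. X \<in> sets lebesgue \<and> X \<subseteq> Q \<inter> {x. p x \<le> \<alpha> Q} \<and> measure lebesgue X = \<tau> * measure lebesgue Q"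
      using sub(1) by (rule ballI)
    from bchoice[OF this] obtain X where X: "\<And>Q. Q \<in> F \<Longrightarrow> X Q \<in> sets lebesgue"
      "\<And>Q. Q \<in> F \<Longrightarrow> X Q \<subseteq> Q \<inter> {x. p x \<le> \<alpha> Q}" "\<And>Q. Q \<in> F \<Longrightarrow> measure lebesgue (X Q) = \<tau> * measure lebesgue Q"
      by auto
    have "\<forall>Q\<in>F. \<exists>X. X \<in> sets lebesgue \<and> X \<subseteq> Q \<inter> {x. \<beta> Q \<le> p x} \<and> measure lebesgue X = \<nu> * measure lebesgue Q"
      using sub(2) by (rule ballI)
    from bchoice[OF this] obtain Y where Y: "\<And>Q. Q \<in> F \<Longrightarrow> Y Q \<in> sets lebesgue"
      "\<And>Q. Q \<in> F \<Longrightarrow> Y Q \<subseteq> Q \<inter> {x. \<beta> Q \<le> p x}" "\<And>Q. Q \<in> F \<Longrightarrow> measure lebesgue (Y Q) = \<nu> * measure lebesgue Q"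
      by auto
    define t where "t Q = (\<tau> powr (1 - \<delta>) * \<nu> powr (\<beta> Q - 1) / C1) powr (1 / (\<beta> Q - \<alpha> Q))" for Q
    have l1: "\<nu> < 1" using l \<gamma> by simp
    have t: "0 < t Q" "t Q \<le> \<nu>" "\<nu> * (t Q / \<nu>) powr \<beta> Q = \<tau> powr (1 - \<delta>) / C1 * t Q powr \<alpha> Q"
      "\<tau> powr (\<theta> * (\<beta> Q / (\<beta> Q - \<alpha> Q))) * \<nu> powr (\<alpha> Q * (\<beta> Q - 1) / (\<beta> Q - \<alpha> Q)) \<le> \<tau> * t Q powr \<alpha> Q"
      if Q: "Q \<in> F" for Q
      unfolding t_def \<theta>_def
      using gap_exponent_gain[OF \<tau> \<gamma>(2) l(1) l1 a(1) ab(1)[OF Q] ab(2)[OF Q] ab(3)[OF Q] \<delta>1 C1 C\<gamma>] by auto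
    have t1: "t Q \<le> 1" if "Q \<in> F" for Q using t(2)[OF that] l1 by simp
    define Z where "Z = (\<Sum>Q\<in>F. measure lebesgue Q * (\<tau> * t Q powr \<alpha> Q))"
    define S where "S = (\<Sum>Q\<in>F. I Q (\<lambda>x. t Q powr p x))"
    have Z0: "0 \<le> Z" unfolding Z_def using \<tau> by (intro sum_nonneg) auto
    have S: "S \<le> M * (\<tau> powr (-\<delta>) / C1 * Z) + B powr b"
    proof -
      have "S \<le> M * (\<Sum>Q\<in>F. I Q (\<lambda>x. (t Q / \<nu> * indicator (Y Q) x) powr p x)) + B powr b"
        unfolding S_def M_def
      proof (rule averaging_modular_sum[OF av B F t(1) t1])
        fix Q assume Q: "Q \<in> F"
        then have Qc: "Q \<in> cubes" using F by auto
        have mQ: "0 < measure lebesgue Q" using measure_cube_pos[OF Qc] .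
        show "bounded_measurable (\<lambda>x. t Q / \<nu> * indicator (Y Q) x)" using Y(1)[OF Q] by (intro bm_mult bm_const bm_indicator)
        show "0 \<le> t Q / \<nu> * indicator (Y Q) x" for x using t(1)[OF Q] l by simp
        have YQ: "Q \<inter> Y Q = Y Q" using Y(2)[OF Q] by auto
        have lmY: "Y Q \<in> lmeasurable" using fmeasurable_Int_sets[OF cube_lmeasurable[OF Qc] Y(1)[OF Q]] YQ by simp
        have "I Q (\<lambda>x. t Q / \<nu> * indicator (Y Q) x) = t Q / \<nu> * (\<nu> * measure lebesgue Q)"
          by (simp only: I_indicator YQ I_const[OF lmY] Y(3)[OF Q])
        then show "t Q \<le> avg Q (\<lambda>x. t Q / \<nu> * indicator (Y Q) x)" using mQ l by (simp add: avg_def)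
      qed
      also have "(\<Sum>Q\<in>F. I Q (\<lambda>x. (t Q / \<nu> * indicator (Y Q) x) powr p x)) \<le>
          (\<Sum>Q\<in>F. \<tau> powr (-\<delta>) / C1 * (measure lebesgue Q * (\<tau> * t Q powr \<alpha> Q)))"
      proof (rule sum_mono)
        fix Q assume Q: "Q \<in> F"
        then have Qc: "Q \<in> cubes" using F by auto
        have YQ: "Q \<inter> Y Q = Y Q" using Y(2)[OF Q] by auto
        have lmY: "Y Q \<in> lmeasurable" using fmeasurable_Int_sets[OF cube_lmeasurable[OF Qc] Y(1)[OF Q]] YQ by simp
        have "I Q (\<lambda>x. (t Q / \<nu> * indicator (Y Q) x) powr p x) = I Q (\<lambda>x. (t Q / \<nu>) powr p x * indicator (Y Q) x)"
          using p_gt_1 by (intro I_cong) (auto simp: indicator_def)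
        also have "\<dots> = I (Y Q) (\<lambda>x. (t Q / \<nu>) powr p x)" by (simp only: I_indicator YQ)
        also have "\<dots> \<le> I (Y Q) (\<lambda>x. (t Q / \<nu>) powr \<beta> Q)"
          using t(1,2)[OF Q] l Y(2)[OF Q] by (intro I_mono bm_const bm_powr_p lmY powr_mono') auto
        also have "\<dots> = (t Q / \<nu>) powr \<beta> Q * (\<nu> * measure lebesgue Q)" by (simp only: I_const[OF lmY] Y(3)[OF Q])
        also have "\<dots> = measure lebesgue Q * (\<nu> * (t Q / \<nu>) powr \<beta> Q)" by simp
        also have "\<dots> = measure lebesgue Q * (\<tau> powr (1 - \<delta>) / C1 * t Q powr \<alpha> Q)" unfolding t(3)[OF Q] ..
        also have "\<tau> powr (1 - \<delta>) = \<tau> powr (-\<delta>) * \<tau>" using \<tau> powr_add[of \<tau> "-\<delta>" 1] by simp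
        finally show "I Q (\<lambda>x. (t Q / \<nu> * indicator (Y Q) x) powr p x) \<le>
            \<tau> powr (-\<delta>) / C1 * (measure lebesgue Q * (\<tau> * t Q powr \<alpha> Q))" by (simp add: mult_ac)
      qed
      also have "\<dots> = \<tau> powr (-\<delta>) / C1 * Z" by (simp add: Z_def sum_distrib_left)
      finally show ?thesis using M by simp
    qed
    have \<tau>1: "\<tau> \<le> 1" using \<tau> \<gamma> by simp
    obtain k where k: "\<tau> \<le> c ^ k" "(1 - 1 / K) ^ k \<le> 1 / c * \<tau> powr \<delta>" using \<delta> \<tau>(1) \<tau>1 by blast
    define XX where "XX = (\<Union>Q\<in>F. X Q)"
    have XX: "XX \<inter> Q = X Q" if "Q \<in> F" for Q
    proof -
      have "X R \<inter> Q \<subseteq> X Q" if "R \<in> F" for R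
        using F(3) X(2)[OF that] \<open>Q \<in> F\<close> that by (cases "R = Q") (auto simp: disjoint_def)
      then show ?thesis using X(2)[OF that] that by (auto simp: XX_def)
    qed
    have "Z \<le> (\<Sum>Q\<in>F. I (XX \<inter> Q) (\<lambda>x. t Q powr p x))"
      unfolding Z_def
    proof (rule sum_mono)
      fix Q assume Q: "Q \<in> F"
      then have Qc: "Q \<in> cubes" using F by auto
      have "Q \<inter> X Q = X Q" using X(2)[OF Q] by auto
      then have lmX: "X Q \<in> lmeasurable" using fmeasurable_Int_sets[OF cube_lmeasurable[OF Qc] X(1)[OF Q]] by simp
      have "measure lebesgue Q * (\<tau> * t Q powr \<alpha> Q) = I (X Q) (\<lambda>x. t Q powr \<alpha> Q)"
        by (simp add: I_const[OF lmX] X(3)[OF Q])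
      also have "\<dots> \<le> I (X Q) (\<lambda>x. t Q powr p x)"
        using t(1)[OF Q] t1[OF Q] X(2)[OF Q] by (intro I_mono bm_const bm_powr_p lmX powr_mono') auto
      finally show "measure lebesgue Q * (\<tau> * t Q powr \<alpha> Q) \<le> I (XX \<inter> Q) (\<lambda>x. t Q powr p x)" by (simp add: XX[OF Q])
    qed
    also have "\<dots> \<le> (1 - 1 / K) ^ k * S + K * B powr b"
      unfolding S_def K_def
    proof (rule family_decay[OF av B F t(1) t1])
      show "XX \<in> sets lebesgue" unfolding XX_def using X(1) F(1) by auto
      fix Q assume Q: "Q \<in> F"
      show "measure lebesgue (XX \<inter> Q) \<le> (1 / 2 ^ (CARD('n) + 2)) ^ k * measure lebesgue Q"
        unfolding XX[OF Q] X(3)[OF Q] c_def[symmetric] using k(1) by (intro mult_right_mono) auto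
    qed
    also have "(1 - 1 / K) ^ k * S \<le> (1 / c * \<tau> powr \<delta>) * (M * (\<tau> powr (-\<delta>) / C1 * Z) + B powr b)"
      using k(2) S c by (intro mult_mono) (auto simp: S_def intro!: sum_nonneg I_nonneg)
    also have "\<dots> = (\<tau> powr \<delta> * \<tau> powr (-\<delta>)) * (M / (c * C1)) * Z + 1 / c * \<tau> powr \<delta> * B powr b"
      using c C1 by (simp add: field_simps)
    also have "\<tau> powr \<delta> * \<tau> powr (-\<delta>) = 1" using \<tau> by (simp add: powr_add[symmetric])
    also have "M / (c * C1) = 1 / 2" using c M by (simp add: C1_def)
    also have "1 / c * \<tau> powr \<delta> * B powr b \<le> 1 / c * 1 * B powr b"
      using c \<tau> \<tau>1 \<delta>1 by (intro mult_right_mono mult_left_mono powr_le1) auto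
    finally have ZC: "Z \<le> C" by (simp add: C_def)
    have "(\<Sum>Q\<in>F. measure lebesgue Q * (\<tau> powr (\<theta> * (\<beta> Q / (\<beta> Q - \<alpha> Q))) *
          \<nu> powr (\<alpha> Q * (\<beta> Q - 1) / (\<beta> Q - \<alpha> Q)))) \<le> Z"
      unfolding Z_def using t(4) by (intro sum_mono mult_left_mono) auto
    then show ?thesis using ZC by simp
  qed
  show ?thesis
    by (rule exI[of _ \<theta>], rule exI[of _ \<gamma>], rule exI[of _ C], intro conjI, rule \<theta>(1), rule \<theta>(2), rule \<gamma>(1), rule \<gamma>(2),
        intro allI impI, rule main) auto
qed

text \<open>The gain for \<open>p\<close> lowers the exponent of \<open>\<tau>\<close>, that for \<open>q\<close> the exponent of \<open>\<nu>\<close>; the geometric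
  mean of the two sums lowers both.\<close>

lemma gap_sum:
  assumes av: "averaging_bounded p B" and B: "1 \<le> B"
  shows "\<exists>r \<gamma> C. 1 < r \<and> 0 < \<gamma> \<and> \<gamma> < 1 / 2 \<and> 1 \<le> C \<and>
    (\<forall>F \<tau> \<nu> \<alpha> \<beta>. finite F \<and> F \<subseteq> cubes \<and> disjoint F \<and> 0 < \<tau> \<and> \<tau> < \<gamma> \<and> 0 < \<nu> \<and> \<nu> < \<gamma> \<and>
       (\<forall>Q\<in>F. a \<le> \<alpha> Q \<and> \<alpha> Q < \<beta> Q \<and> \<beta> Q \<le> b \<and>
          \<tau> * measure lebesgue Q \<le> measure lebesgue (Q \<inter> {x. p x \<le> \<alpha> Q}) \<and>
          \<nu> * measure lebesgue Q \<le> measure lebesgue (Q \<inter> {x. \<beta> Q \<le> p x})) \<longrightarrow>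
       (\<Sum>Q\<in>F. measure lebesgue Q * gap_term \<tau> \<nu> (\<alpha> Q) (\<beta> Q) powr (1 / r)) \<le> C)"
proof -
  interpret dual: local_exponents q p a' b' a b A by (rule dual_local)
  define P where "P \<theta> \<gamma> C \<longleftrightarrow> 0 < \<theta> \<and> \<theta> < 1 \<and> 0 < \<gamma> \<and> \<gamma> < 1 \<and>
    (\<forall>F \<tau> \<nu> \<alpha> \<beta>. finite F \<and> F \<subseteq> cubes \<and> disjoint F \<and> 0 < \<tau> \<and> \<tau> < \<gamma> \<and> 0 < \<nu> \<and> \<nu> < \<gamma> \<and>
       (\<forall>Q\<in>F. a \<le> \<alpha> Q \<and> \<alpha> Q < \<beta> Q \<and> \<beta> Q \<le> b \<and>
          \<tau> * measure lebesgue Q \<le> measure lebesgue (Q \<inter> {x. p x \<le> \<alpha> Q}) \<and>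
          \<nu> * measure lebesgue Q \<le> measure lebesgue (Q \<inter> {x. \<beta> Q \<le> p x})) \<longrightarrow>
       (\<Sum>Q\<in>F. measure lebesgue Q * (\<tau> powr (\<theta> * (\<beta> Q / (\<beta> Q - \<alpha> Q))) *
          \<nu> powr (\<alpha> Q * (\<beta> Q - 1) / (\<beta> Q - \<alpha> Q)))) \<le> C)" for \<theta> \<gamma> C :: real
  have "\<exists>\<theta> \<gamma> C. P \<theta> \<gamma> C" unfolding P_def by (rule gap_gain[OF av B])
  then obtain \<theta>1 \<gamma>1 C1 where "P \<theta>1 \<gamma>1 C1" by blast
  note g1 = this[unfolded P_def]
  define P' where "P' \<theta> \<gamma> C \<longleftrightarrow> 0 < \<theta> \<and> \<theta> < 1 \<and> 0 < \<gamma> \<and> \<gamma> < 1 \<and>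
    (\<forall>F \<tau> \<nu> \<alpha> \<beta>. finite F \<and> F \<subseteq> cubes \<and> disjoint F \<and> 0 < \<tau> \<and> \<tau> < \<gamma> \<and> 0 < \<nu> \<and> \<nu> < \<gamma> \<and>
       (\<forall>Q\<in>F. a' \<le> \<alpha> Q \<and> \<alpha> Q < \<beta> Q \<and> \<beta> Q \<le> b' \<and>
          \<tau> * measure lebesgue Q \<le> measure lebesgue (Q \<inter> {x. q x \<le> \<alpha> Q}) \<and>
          \<nu> * measure lebesgue Q \<le> measure lebesgue (Q \<inter> {x. \<beta> Q \<le> q x})) \<longrightarrow>
       (\<Sum>Q\<in>F. measure lebesgue Q * (\<tau> powr (\<theta> * (\<beta> Q / (\<beta> Q - \<alpha> Q))) *
          \<nu> powr (\<alpha> Q * (\<beta> Q - 1) / (\<beta> Q - \<alpha> Q)))) \<le> C)" for \<theta> \<gamma> C :: real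
  have "averaging_bounded q (2 * B)" "1 \<le> 2 * B" using averaging_bounded_dual[OF av] B by auto
  then have "\<exists>\<theta> \<gamma> C. P' \<theta> \<gamma> C" unfolding P'_def by (rule dual.gap_gain)
  then obtain \<theta>2 \<gamma>2 C2 where "P' \<theta>2 \<gamma>2 C2" by blast
  note g2 = this[unfolded P'_def]
  define \<theta> where "\<theta> = max \<theta>1 \<theta>2"
  have \<theta>: "0 < \<theta>" "\<theta> < 1" "\<theta>1 \<le> \<theta>" "\<theta>2 \<le> \<theta>" using g1 g2 by (auto simp: \<theta>_def)
  \<comment> \<open>In the geometric mean the two exponents are multiplied by
    \<open>(1 + \<theta>1) / 2\<close> and \<open>(1 + \<theta>2) / 2\<close>, neither of which
    exceeds \<open>1 / r\<close>.\<close>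
  define r where "r = 2 / (1 + \<theta>)"
  have r: "1 < r" "1 / r = (1 + \<theta>) / 2" using \<theta> by (auto simp: r_def)
  define \<gamma> where "\<gamma> = min (1 / 4) (min \<gamma>1 \<gamma>2)"
  have \<gamma>: "0 < \<gamma>" "\<gamma> < 1 / 2" "\<gamma> \<le> \<gamma>1" "\<gamma> \<le> \<gamma>2" using g1 g2 by (auto simp: \<gamma>_def)
  define C where "C = max 1 ((C1 + C2) / 2)"
  have main: "(\<Sum>Q\<in>F. measure lebesgue Q * gap_term \<tau> \<nu> (\<alpha> Q) (\<beta> Q) powr (1 / r)) \<le> C"
    if F: "finite F" "F \<subseteq> cubes" "disjoint F" and \<tau>: "0 < \<tau>" "\<tau> < \<gamma>" and l: "0 < \<nu>" "\<nu> < \<gamma>"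
      and ab: "\<And>Q. Q \<in> F \<Longrightarrow> a \<le> \<alpha> Q" "\<And>Q. Q \<in> F \<Longrightarrow> \<alpha> Q < \<beta> Q" "\<And>Q. Q \<in> F \<Longrightarrow> \<beta> Q \<le> b"
      and lo: "\<And>Q. Q \<in> F \<Longrightarrow> \<tau> * measure lebesgue Q \<le> measure lebesgue (Q \<inter> {x. p x \<le> \<alpha> Q})"
      and hi: "\<And>Q. Q \<in> F \<Longrightarrow> \<nu> * measure lebesgue Q \<le> measure lebesgue (Q \<inter> {x. \<beta> Q \<le> p x})"
    for F \<tau> \<nu> \<alpha> \<beta>
  proof -
    define x where "x Q = \<beta> Q / (\<beta> Q - \<alpha> Q)" for Q
    define y where "y Q = \<alpha> Q * (\<beta> Q - 1) / (\<beta> Q - \<alpha> Q)" for Q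
    define \<alpha>' where "\<alpha>' Q = \<beta> Q / (\<beta> Q - 1)" for Q
    define \<beta>' where "\<beta>' Q = \<alpha> Q / (\<alpha> Q - 1)" for Q
    have le1: "(\<Sum>Q\<in>F. measure lebesgue Q * (\<tau> powr (\<theta>1 * x Q) * \<nu> powr y Q)) \<le> C1"
      unfolding x_def y_def using F \<tau> l ab lo hi \<gamma> by (intro conjunct2[OF conjunct2[OF conjunct2[OF conjunct2[OF g1]]], rule_format]) auto
    \<comment> \<open>Conjugation reverses order: a sublevel set of \<open>q\<close> is a superlevel
      set of \<open>p\<close>, the portions \<open>\<tau>\<close> and \<open>\<nu>\<close> change
      roles, and the two exponents of \<open>gap_term\<close> trade places.\<close>
    have conj: "a' \<le> \<alpha>' Q" "\<alpha>' Q < \<beta>' Q" "\<beta>' Q \<le> b'" "{x. q x \<le> \<alpha>' Q} = {x. \<beta> Q \<le> p x}" "{x. \<beta>' Q \<le> q x} = {x. p x \<le> \<alpha> Q}"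
      "\<beta>' Q / (\<beta>' Q - \<alpha>' Q) = y Q" "\<alpha>' Q * (\<beta>' Q - 1) / (\<beta>' Q - \<alpha>' Q) = x Q"
      if Q: "Q \<in> F" for Q
    proof -
      have al: "1 < \<alpha> Q" "\<alpha> Q < \<beta> Q" using a(1) ab[OF Q] by auto
      show s1: "{x. q x \<le> \<alpha>' Q} = {x. \<beta> Q \<le> p x}" unfolding \<alpha>'_def q using al p_gt_1 by (auto simp: conj_le_iff)
      show s2: "{x. \<beta>' Q \<le> q x} = {x. p x \<le> \<alpha> Q}" unfolding \<beta>'_def q using al p_gt_1 by (auto simp: conj_le_iff)
      have mQ: "0 < measure lebesgue Q" using measure_cube_pos F(2) Q by blast
      have ne: "\<exists>x. x \<in> S" if "0 < measure lebesgue (Q \<inter> S)" for S using that by (cases "S = {}") auto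
      have "0 < measure lebesgue (Q \<inter> {x. \<beta> Q \<le> p x})" "0 < measure lebesgue (Q \<inter> {x. p x \<le> \<alpha> Q})"
        using lo[OF Q] hi[OF Q] mult_pos_pos[OF l(1) mQ] mult_pos_pos[OF \<tau>(1) mQ] by linarith+
      then obtain u v where "u \<in> {x. q x \<le> \<alpha>' Q}" "v \<in> {x. \<beta>' Q \<le> q x}" unfolding s1 s2 using ne by metis
      then have "q u \<le> \<alpha>' Q" "\<beta>' Q \<le> q v" by auto
      then show "a' \<le> \<alpha>' Q" "\<beta>' Q \<le> b'" using a'(2)[of u] b'[of v] by linarith+
      have be: "1 < \<beta> Q" using al by simp
      show less: "\<alpha>' Q < \<beta>' Q" using al be by (simp add: \<alpha>'_def \<beta>'_def conj_less_iff)
      show "\<beta>' Q / (\<beta>' Q - \<alpha>' Q) = y Q"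
        unfolding y_def \<alpha>'_def \<beta>'_def by (rule conj_ratio[OF al(1) be al(2)])
      have "1 < \<alpha>' Q" "1 < \<beta>' Q" using al be conj_gt_1 by (auto simp: \<alpha>'_def \<beta>'_def)
      from conj_ratio[OF this less] show "\<alpha>' Q * (\<beta>' Q - 1) / (\<beta>' Q - \<alpha>' Q) = x Q"
        unfolding x_def \<alpha>'_def \<beta>'_def conj_conj[OF al(1)] conj_conj[OF be] by simp
    qed
    have "(\<Sum>Q\<in>F. measure lebesgue Q * (\<nu> powr (\<theta>2 * (\<beta>' Q / (\<beta>' Q - \<alpha>' Q))) * \<tau> powr (\<alpha>' Q * (\<beta>' Q - 1) / (\<beta>' Q - \<alpha>' Q)))) \<le> C2"
      using F \<tau> l conj lo hi \<gamma> by (intro conjunct2[OF conjunct2[OF conjunct2[OF conjunct2[OF g2]]], rule_format]) auto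
    then have le2: "(\<Sum>Q\<in>F. measure lebesgue Q * (\<nu> powr (\<theta>2 * y Q) * \<tau> powr x Q)) \<le> C2"
      using conj by simp
    have "measure lebesgue Q * gap_term \<tau> \<nu> (\<alpha> Q) (\<beta> Q) powr (1 / r) \<le>
        1 / 2 * (measure lebesgue Q * (\<tau> powr (\<theta>1 * x Q) * \<nu> powr y Q) + measure lebesgue Q * (\<nu> powr (\<theta>2 * y Q) * \<tau> powr x Q))"
      if Q: "Q \<in> F" for Q
    proof -
      have al: "1 < \<alpha> Q" "\<alpha> Q < \<beta> Q" using a(1) ab[OF Q] by auto
      have xy: "0 \<le> x Q" "0 \<le> y Q" using al by (auto simp: x_def y_def)
      have t1: "\<tau> \<le> 1" "\<nu> \<le> 1" using \<tau> l \<gamma> by auto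
      define u where "u = \<tau> powr (\<theta>1 * x Q) * \<nu> powr y Q"
      define v where "v = \<nu> powr (\<theta>2 * y Q) * \<tau> powr x Q"
      have uv: "0 \<le> u" "0 \<le> v" by (auto simp: u_def v_def)
      have "gap_term \<tau> \<nu> (\<alpha> Q) (\<beta> Q) powr (1 / r) = \<tau> powr ((\<theta> * x Q + x Q) / 2) * \<nu> powr ((y Q + \<theta> * y Q) / 2)"
        unfolding r(2) gap_term_def x_def[symmetric] y_def[symmetric] using \<tau> l by (simp add: powr_mult powr_powr field_simps)
      also have "\<dots> \<le> \<tau> powr ((\<theta>1 * x Q + x Q) / 2) * \<nu> powr ((y Q + \<theta>2 * y Q) / 2)"
        using \<tau> l t1 xy \<theta> by (intro mult_mono powr_mono' divide_right_mono add_mono mult_right_mono) auto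
      also have "\<dots> = u powr (1 / 2) * v powr (1 / 2)"
        unfolding u_def v_def using \<tau> l by (simp add: powr_mult powr_powr powr_add add_divide_distrib)
      also have "\<dots> = sqrt (u * v)" using uv by (simp add: powr_half_sqrt real_sqrt_mult)
      also have "\<dots> \<le> (u + v) / 2" using arith_geo_mean_sqrt[OF uv] by simp
      finally have "measure lebesgue Q * gap_term \<tau> \<nu> (\<alpha> Q) (\<beta> Q) powr (1 / r) \<le> measure lebesgue Q * ((u + v) / 2)"
        by (intro mult_left_mono) auto
      also have "\<dots> = 1 / 2 * (measure lebesgue Q * u + measure lebesgue Q * v)" by (simp add: field_simps)
      finally show ?thesis unfolding u_def v_def .
    qed
    then have "(\<Sum>Q\<in>F. measure lebesgue Q * gap_term \<tau> \<nu> (\<alpha> Q) (\<beta> Q) powr (1 / r)) \<le>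
       (\<Sum>Q\<in>F. 1 / 2 * (measure lebesgue Q * (\<tau> powr (\<theta>1 * x Q) * \<nu> powr y Q) + measure lebesgue Q * (\<nu> powr (\<theta>2 * y Q) * \<tau> powr x Q)))"
      by (rule sum_mono)
    also have "\<dots> = 1 / 2 * ((\<Sum>Q\<in>F. measure lebesgue Q * (\<tau> powr (\<theta>1 * x Q) * \<nu> powr y Q)) +
        (\<Sum>Q\<in>F. measure lebesgue Q * (\<nu> powr (\<theta>2 * y Q) * \<tau> powr x Q)))"
      unfolding sum.distrib[symmetric] by (rule sum_distrib_left[symmetric])
    also have "\<dots> \<le> C" using add_mono[OF le1 le2] by (simp add: C_def le_max_iff_disj)
    finally show ?thesis .
  qed
  have C1: "1 \<le> C" by (simp add: C_def)
  show ?thesis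
    by (rule exI[of _ r], rule exI[of _ \<gamma>], rule exI[of _ C], intro conjI, rule r(1), rule \<gamma>(1), rule \<gamma>(2), rule C1,
        intro allI impI, rule main) auto
qed

end

section \<open>Rearrangements and the conditions of the theorem\<close>

lemma emeasure_cube: "Q \<in> cubes \<Longrightarrow> emeasure lebesgue Q = ennreal (measure lebesgue Q)"
  using cube_lmeasurable by (rule emeasure_eq_measure2)

section \<open>Norms of indicators and the A condition\<close>

context exponents
begin

lemma modular_indicator:
  assumes "Q \<in> cubes" "0 < s"
  shows "(\<integral>\<^sup>+x. ennreal ((\<bar>indicator Q x\<bar> / s) powr p x) \<partial>lebesgue) = ennreal (I Q (\<lambda>x. (1 / s) powr p x))"
proof -
  have "(\<integral>\<^sup>+x. ennreal ((\<bar>indicator Q x\<bar> / s) powr p x) \<partial>lebesgue) = (\<integral>\<^sup>+x. ennreal ((1 / s) powr p x) * indicator Q x \<partial>lebesgue)"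
    by (intro nn_integral_cong) (auto simp: indicator_def)
  also have "\<dots> = ennreal (I Q (\<lambda>x. (1 / s) powr p x))"
    using assms by (intro nn_integral_I bm_powr_p cube_lmeasurable) auto
  finally show ?thesis .
qed

lemma Lp_norm_indicator_bounds:
  assumes Q: "Q \<in> cubes" and t: "0 < t" "I Q (\<lambda>x. t powr p x) \<le> 1" "1 < I Q (\<lambda>x. (4 * t) powr p x)"
  shows "Lp_norm p (indicator Q) \<le> ennreal (1 / t)" "ennreal (1 / (4 * t)) \<le> Lp_norm p (indicator Q)"
proof -
  show "Lp_norm p (indicator Q) \<le> ennreal (1 / t)"
    unfolding Lp_norm_def
  proof (rule Inf_lower, rule CollectI, rule exI[of _ "1 / t"], intro conjI refl)
    show "0 < 1 / t" using t by simp
    show "(\<integral>\<^sup>+ x. ennreal ((\<bar>indicator Q x\<bar> / (1 / t)) powr p x) \<partial>lebesgue) \<le> 1"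
      using t modular_indicator[OF Q, of "1 / t"] by simp
  qed
  show "ennreal (1 / (4 * t)) \<le> Lp_norm p (indicator Q)"
    unfolding Lp_norm_def
  proof (rule Inf_greatest, elim CollectE exE conjE)
    fix z s assume z: "z = ennreal s" and s: "0 < s" "(\<integral>\<^sup>+ x. ennreal ((\<bar>indicator Q x\<bar> / s) powr p x) \<partial>lebesgue) \<le> 1"
    have le: "I Q (\<lambda>x. (1 / s) powr p x) \<le> 1" using s(2) modular_indicator[OF Q s(1)] by simp
    have "1 / s < 4 * t"
    proof (rule ccontr)
      assume "\<not> 1 / s < 4 * t"
      then have "I Q (\<lambda>x. (4 * t) powr p x) \<le> I Q (\<lambda>x. (1 / s) powr p x)" using t by (intro I_powr_mono Q) auto
      then show False using le t by simp
    qed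
    then have "1 / (4 * t) \<le> s" using s t by (simp add: field_simps)
    then show "ennreal (1 / (4 * t)) \<le> z" unfolding z by (rule ennreal_leI)
  qed
qed

text \<open>The level determines each of the two norms up to the factor 4, whence the constant
  16.\<close>

lemma A_condition_imp_local:
  assumes "A_condition p" and qc: "q = conj_exponent p"
  shows "\<exists>A\<ge>1. local_condition p q A"
proof -
  interpret dual: exponents q p a' b' a b by (rule dual)
  define S where "S = (SUP Q \<in> cubes. Lp_norm p (indicator Q) * Lp_norm q (indicator Q) / emeasure lebesgue Q)"
  have S: "S < \<infinity>" using assms(1) unfolding A_condition_def S_def qc by simp
  define A0 where "A0 = enn2real S"
  have A0: "S = ennreal A0" using S by (simp add: A0_def)
  define A where "A = max 1 (16 * A0)"
  have "1 \<le> A * t * s * measure lebesgue Q"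
    if Q: "Q \<in> cubes" and t: "0 < t" "I Q (\<lambda>x. t powr p x) \<le> 1" "1 < I Q (\<lambda>x. (4 * t) powr p x)"
      and s: "0 < s" "I Q (\<lambda>x. s powr q x) \<le> 1" "1 < I Q (\<lambda>x. (4 * s) powr q x)" for Q t s
  proof -
    have mQ: "0 < measure lebesgue Q" using measure_cube_pos[OF Q] .
    have "ennreal (1 / (4 * t) * (1 / (4 * s)) / measure lebesgue Q) = ennreal (1 / (4 * t)) * ennreal (1 / (4 * s)) / emeasure lebesgue Q"
      unfolding emeasure_cube[OF Q] using t s mQ by (simp add: ennreal_mult[symmetric] divide_ennreal)
    also have "\<dots> \<le> Lp_norm p (indicator Q) * Lp_norm q (indicator Q) / emeasure lebesgue Q"
      using Lp_norm_indicator_bounds(2)[OF Q t] dual.Lp_norm_indicator_bounds(2)[OF Q s]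
      by (intro divide_right_mono_ennreal mult_mono) auto
    also have "\<dots> \<le> ennreal A0" unfolding A0[symmetric] S_def by (intro SUP_upper Q)
    finally have "1 / (4 * t) * (1 / (4 * s)) / measure lebesgue Q \<le> A0"
      by (subst (asm) ennreal_le_iff) (auto simp: A0_def)
    then have "1 \<le> 16 * A0 * (t * s * measure lebesgue Q)" using t s mQ by (simp add: field_simps)
    also have "\<dots> \<le> A * (t * s * measure lebesgue Q)" using t s mQ by (intro mult_right_mono) (auto simp: A_def)
    finally show ?thesis by (simp add: mult.assoc)
  qed
  then have "local_condition p q A" unfolding local_condition_def by blast
  then show ?thesis by (intro exI[of _ A]) (auto simp: A_def)
qed

lemma local_imp_A_condition:
  assumes A: "local_condition p q A" and qc: "q = conj_exponent p"
  shows "A_condition p"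
proof -
  interpret dual: exponents q p a' b' a b by (rule dual)
  have "Lp_norm p (indicator Q) * Lp_norm q (indicator Q) / emeasure lebesgue Q \<le> ennreal A" if Q: "Q \<in> cubes" for Q
  proof -
    have mQ: "0 < measure lebesgue Q" using measure_cube_pos[OF Q] .
    obtain t where t: "0 < t" "I Q (\<lambda>x. t powr p x) \<le> 1" "1 < I Q (\<lambda>x. (4 * t) powr p x)" using exists_norm_scale[OF Q] by blast
    obtain s where s: "0 < s" "I Q (\<lambda>x. s powr q x) \<le> 1" "1 < I Q (\<lambda>x. (4 * s) powr q x)" using dual.exists_norm_scale[OF Q] by blast
    have "Lp_norm p (indicator Q) * Lp_norm q (indicator Q) / emeasure lebesgue Q \<le> ennreal (1 / t) * ennreal (1 / s) / emeasure lebesgue Q"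
      using Lp_norm_indicator_bounds(1)[OF Q t] dual.Lp_norm_indicator_bounds(1)[OF Q s]
      by (intro divide_right_mono_ennreal mult_mono) auto
    also have "\<dots> = ennreal (1 / t * (1 / s) / measure lebesgue Q)"
      unfolding emeasure_cube[OF Q] using t s mQ by (simp add: ennreal_mult[symmetric] divide_ennreal)
    also have "\<dots> \<le> ennreal A"
    proof (rule ennreal_leI)
      have "1 \<le> A * t * s * measure lebesgue Q" using A Q t s unfolding local_condition_def by blast
      then show "1 / t * (1 / s) / measure lebesgue Q \<le> A" using t s mQ by (simp add: field_simps)
    qed
    finally show ?thesis .
  qed
  then have "(SUP Q \<in> cubes. Lp_norm p (indicator Q) * Lp_norm q (indicator Q) / emeasure lebesgue Q) \<le> ennreal A"
    by (rule SUP_least)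
  then show ?thesis unfolding A_condition_def qc[symmetric] by (rule order.strict_trans1) simp
qed

text \<open>On a cube of \<open>F\<close> the average of \<open>f\<close> is at most the maximal
  function of \<open>f\<close> cut off to the union of \<open>F\<close>. Taking \<open>B\<close>
  strictly above \<open>C\<close> guarantees an admissible scaling below \<open>B\<close> in the
  infimum that defines the norm.\<close>

lemma maximal_imp_averaging:
  assumes "maximal_bounded p"
  shows "\<exists>B\<ge>1. averaging_bounded p B"
proof -
  obtain C where C: "0 \<le> C" and max: "\<forall>f \<in> Lp_space p.
        (AE x in lebesgue. maximal_function f x < \<infinity>) \<and>
        (\<lambda>x. enn2real (maximal_function f x)) \<in> Lp_space p \<and>
        Lp_norm p (\<lambda>x. enn2real (maximal_function f x)) \<le> ennreal C * Lp_norm p f"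
    using assms unfolding maximal_bounded_def by blast
  define B where "B = C + 1"
  have B: "1 \<le> B" "C < B" using C by (auto simp: B_def)
  have "averaging_bounded p B"
    unfolding averaging_bounded_def
  proof (intro allI impI, elim conjE)
    fix F f assume F: "finite F" "F \<subseteq> cubes" "disjoint F" and f: "bounded_measurable f" "\<forall>x. 0 \<le> f x"
      and le: "(\<Sum>Q\<in>F. I Q (\<lambda>x. f x powr p x)) \<le> 1"
    have lm: "Q \<in> lmeasurable" if "Q \<in> F" for Q using that F cube_lmeasurable by blast
    have U: "\<Union>F \<in> lmeasurable" using F(1) lm by (intro fmeasurable.finite_Union) auto
    define g where "g x = f x * indicator (\<Union>F) x" for x
    have gm: "g \<in> borel_measurable lebesgue" unfolding g_def
      using U by (intro bm_measurable bm_mult f bm_indicator) auto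
    have bfp: "bounded_measurable (\<lambda>x. f x powr p x)" using bm_fun_powr_p[OF f(1), of 0] f(2) by simp
    have "(\<integral>\<^sup>+x. ennreal ((\<bar>g x\<bar> / 1) powr p x) \<partial>lebesgue) = (\<integral>\<^sup>+x. ennreal (f x powr p x) * indicator (\<Union>F) x \<partial>lebesgue)"
      using f(2) p_gt_1 by (intro nn_integral_cong) (auto simp: g_def indicator_def)
    also have "\<dots> = ennreal (I (\<Union>F) (\<lambda>x. f x powr p x))" by (intro nn_integral_I bfp U) auto
    also have "I (\<Union>F) (\<lambda>x. f x powr p x) = (\<Sum>Q\<in>F. I Q (\<lambda>x. f x powr p x))"
      by (intro I_disjoint_Union[symmetric] F lm bfp) auto
    also have "ennreal \<dots> \<le> 1" using le by simp
    finally have g1: "Lp_norm p g \<le> 1"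
      unfolding Lp_norm_def by (intro Inf_lower CollectI exI[of _ 1]) auto
    then have gL: "g \<in> Lp_space p" using gm by (simp add: Lp_space_def order.strict_trans1[OF _ ennreal_one_less_top])
    have fin: "AE x in lebesgue. maximal_function g x < \<infinity>" using max gL by blast
    have "Lp_norm p (\<lambda>x. enn2real (maximal_function g x)) \<le> ennreal C * Lp_norm p g" using max gL by blast
    also have "\<dots> \<le> ennreal C * 1" using g1 by (rule mult_left_mono) simp
    also have "\<dots> < ennreal B" using B C by (simp add: ennreal_less_iff)
    finally obtain s where s: "0 < s" "s < B"
      "(\<integral>\<^sup>+x. ennreal ((\<bar>enn2real (maximal_function g x)\<bar> / s) powr p x) \<partial>lebesgue) \<le> 1"
      unfolding Lp_norm_def Inf_less_iff by (auto simp: ennreal_less_iff)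
    define h where "h x = (\<Sum>Q\<in>F. avg Q f / B * indicator Q x)" for x
    have h: "h x = avg Q f / B" if "Q \<in> F" "x \<in> Q" for Q x
    unfolding h_def by (rule sum_disjoint_indicator[OF F(1,3) that, of "\<lambda>Q x. avg Q f / B"])
    have a0: "0 \<le> avg Q f" for Q using f(2) by (intro avg_nonneg) auto
    have h0: "0 \<le> h x" for x unfolding h_def using a0 B by (intro sum_nonneg) auto
    have bh: "bounded_measurable h" unfolding h_def using lm by (intro bm_sum bm_mult bm_const bm_indicator) auto
    have bhp: "bounded_measurable (\<lambda>x. h x powr p x)" using bm_fun_powr_p[OF bh h0, of 0] by simp
    have ge: "ennreal (avg Q f) \<le> maximal_function g x" if Q: "Q \<in> F" "x \<in> Q" for Q x
    proof -
      have Qc: "Q \<in> cubes" using Q F by auto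
      have "(\<integral>\<^sup>+ y \<in> Q. ennreal \<bar>g y\<bar> \<partial>lebesgue) = (\<integral>\<^sup>+ y \<in> Q. ennreal (f y) \<partial>lebesgue)"
        using f(2) Q by (intro nn_integral_cong) (auto simp: g_def indicator_def)
      also have "\<dots> = ennreal (I Q f)" using f(2) by (intro nn_integral_I f(1) lm Q) auto
      finally have "ennreal (avg Q f) = (\<integral>\<^sup>+ y \<in> Q. ennreal \<bar>g y\<bar> \<partial>lebesgue) / emeasure lebesgue Q"
        unfolding avg_def emeasure_cube[OF Qc] using measure_cube_pos[OF Qc] f(2) by (simp add: divide_ennreal I_nonneg)
      also have "\<dots> \<le> maximal_function g x" unfolding maximal_function_def using Qc Q by (intro SUP_upper) auto
      finally show ?thesis .
    qed
    have "(\<Sum>Q\<in>F. I Q (\<lambda>x. (avg Q f / B) powr p x)) = (\<Sum>Q\<in>F. I Q (\<lambda>x. h x powr p x))"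
      by (intro sum.cong refl I_cong) (simp add: h)
    also have "\<dots> = I (\<Union>F) (\<lambda>x. h x powr p x)" by (intro I_disjoint_Union F lm bhp) auto
    also have "ennreal \<dots> = (\<integral>\<^sup>+x. ennreal (h x powr p x) * indicator (\<Union>F) x \<partial>lebesgue)"
      by (intro nn_integral_I[symmetric] bhp U) auto
    also have "\<dots> \<le> (\<integral>\<^sup>+x. ennreal ((\<bar>enn2real (maximal_function g x)\<bar> / s) powr p x) \<partial>lebesgue)"
    proof (rule nn_integral_mono_AE)
      show "AE x in lebesgue. ennreal (h x powr p x) * indicator (\<Union>F) x \<le> ennreal ((\<bar>enn2real (maximal_function g x)\<bar> / s) powr p x)"
        using fin
      proof eventually_elim
        case (elim x)
        show ?case
        proof (cases "x \<in> \<Union>F")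
          case True
          then obtain Q where Q: "Q \<in> F" "x \<in> Q" by blast
          have "avg Q f \<le> enn2real (maximal_function g x)"
            using enn2real_mono[OF ge[OF Q]] elim a0 by simp
          then have "h x \<le> enn2real (maximal_function g x) / s"
            unfolding h[OF Q] using a0 B s by (intro frac_le) auto
          then show ?thesis using h0 p_gt_1[of x] True by (auto intro!: ennreal_leI powr_mono2)
        qed simp
      qed
    qed
    also have "\<dots> \<le> 1" by (rule s(3))
    finally show "(\<Sum>Q\<in>F. I Q (\<lambda>x. (avg Q f / B) powr p x)) \<le> 1" by simp
  qed
  then show ?thesis using B by blast
qed

end

text \<open>Since \<open>h\<close> is at least \<open>c > 0\<close>, the level \<open>u\<close> is
  positive and thus admissible in the infimum, and superlevel sets at positive heights ignore the
  zero extension outside \<open>Q\<close>.\<close>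

lemma rearrangement_upper_level:
  assumes Q: "Q \<in> cubes" and h: "bounded_measurable h" "0 < c" "\<And>x. c \<le> h x"
    and s: "0 < s" "s < 1" and u: "upper_level h Q s u"
  shows "rearrangement (\<lambda>x. h x * indicator Q x) (s * measure lebesgue Q) = ennreal u"
proof -
  have u0: "0 < u"
  proof (rule ccontr)
    assume "\<not> 0 < u"
    then have "u < h x" for x using h(2) h(3)[of x] by linarith
    then have "Q \<inter> {x. u < h x} = Q" by auto
    then have "1 * measure lebesgue Q \<le> s * measure lebesgue Q" using u by (simp add: upper_level_def)
    then show False using s measure_cube_pos[OF Q] by simp
  qed
  have em: "emeasure lebesgue {x. y < \<bar>h x * indicator Q x\<bar>} \<le> ennreal (s * measure lebesgue Q) \<longleftrightarrow>
      measure lebesgue (Q \<inter> {x. y < h x}) \<le> s * measure lebesgue Q" if y: "0 < y" for y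
  proof -
    have "{x. y < \<bar>h x * indicator Q x\<bar>} = Q \<inter> {x. y < h x}"
      using y h(2) h(3) by (auto simp: indicator_def split: if_splits) (smt (verit))+
    moreover have "Q \<inter> {x. y < h x} \<in> lmeasurable"
      by (intro fmeasurable_Int_sets cube_lmeasurable Q superlevel_lebesgue h)
    ultimately show ?thesis using s by (simp add: emeasure_eq_measure2)
  qed
  show ?thesis
    unfolding rearrangement_def
  proof (rule antisym)
    show "Inf {ennreal \<alpha> |\<alpha>. 0 < \<alpha> \<and> emeasure lebesgue {x. \<alpha> < \<bar>h x * indicator Q x\<bar>} \<le> ennreal (s * measure lebesgue Q)} \<le> ennreal u"
      using u u0 em[OF u0] by (intro Inf_lower) (auto simp: upper_level_def)
    show "ennreal u \<le> Inf {ennreal \<alpha> |\<alpha>. 0 < \<alpha> \<and> emeasure lebesgue {x. \<alpha> < \<bar>h x * indicator Q x\<bar>} \<le> ennreal (s * measure lebesgue Q)}"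
    proof (rule Inf_greatest, elim CollectE exE conjE)
      fix z y assume z: "z = ennreal y" and y: "0 < y" "emeasure lebesgue {x. y < \<bar>h x * indicator Q x\<bar>} \<le> ennreal (s * measure lebesgue Q)"
      have "\<not> y < u" using y em[OF y(1)] u by (auto simp: upper_level_def not_less[symmetric])
      then show "ennreal u \<le> z" unfolding z by (intro ennreal_leI) simp
    qed
  qed
qed

lemma upper_level_antimono:
  assumes "upper_level h Q s u" "upper_level h Q s' v" "s \<le> s'"
  shows "v \<le> u"
proof (rule ccontr)
  assume "\<not> v \<le> u"
  then have "s' * measure lebesgue Q < measure lebesgue (Q \<inter> {x. u < h x})" using assms(2) by (simp add: upper_level_def)
  also have "\<dots> \<le> s * measure lebesgue Q" using assms(1) by (simp add: upper_level_def)
  also have "\<dots> \<le> s' * measure lebesgue Q" using assms(3) by (rule mult_right_mono) simp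
  finally show False by simp
qed

text \<open>The 1 added to \<open>Psi\<close> simplifies it, as
  \<open>1 + v / (u - v) = u / (u - v)\<close>. When the levels coincide \<open>Psi\<close> is
  infinite and the convention of \<open>epowr\<close> gives 0.\<close>

lemma epowr_Psi:
  assumes Q: "Q \<in> cubes" and h: "bounded_measurable h" "0 < c" "\<And>x. c \<le> h x"
    and s: "0 < s" "s < 1 - s'" "0 < s'" and u: "upper_level h Q s u" and v: "upper_level h Q (1 - s') v" and r: "0 < r"
  shows "epowr z (ennreal (1 / r) * (1 + Psi Q h s s')) = (if v < u then z powr (u / (u - v) / r) else 0)"
proof -
  have U: "rearrangement (\<lambda>x. h x * indicator Q x) (s * measure lebesgue Q) = ennreal u"
    using s by (intro rearrangement_upper_level[OF Q h] u) auto
  have V: "rearrangement (\<lambda>x. h x * indicator Q x) ((1 - s') * measure lebesgue Q) = ennreal v"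
    using s by (intro rearrangement_upper_level[OF Q h] v) auto
  obtain d where d: "\<And>x. \<bar>h x\<bar> \<le> d" using bmE[OF h(1)] by metis
  have hd: "h x \<le> d" for x using d[of x] by simp
  have "c \<le> v" using s by (intro upper_level_bounds[OF v Q _ _ h(3) hd]) auto
  then have v0: "0 < v" using h(2) by simp
  have vu: "v \<le> u" using upper_level_antimono[OF u v] s by simp
  show ?thesis
  proof (cases "v < u")
    case True
    have "1 + v / (u - v) = u / (u - v)" using True by (simp add: field_simps)
    moreover have "1 + Psi Q h s s' = ennreal (1 + v / (u - v))"
      unfolding Psi_def Let_def U V using v0 True by (simp add: ennreal_minus divide_ennreal)
    ultimately have "ennreal (1 / r) * (1 + Psi Q h s s') = ennreal (u / (u - v) / r)"
      using True v0 r by (simp add: ennreal_mult[symmetric] del: ennreal_plus)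
    then show ?thesis using True v0 r by (simp add: epowr_def)
  next
    case False
    then have "v = u" using vu by simp
    then have "Psi Q h s s' = \<infinity>" unfolding Psi_def Let_def U V using v0 by simp
    then have "ennreal (1 / r) * (1 + Psi Q h s s') = \<infinity>" using r by (simp add: ennreal_mult_top)
    then show ?thesis using False by (simp add: epowr_def)
  qed
qed

lemma ratio_mono:
  fixes u v \<alpha> :: real
  assumes "v \<le> \<alpha>" "\<alpha> < u" "0 < u" shows "u / (u - v) \<le> u / (u - \<alpha>)"
  using assms by (intro divide_left_mono) auto

lemma ratio_antimono:
  fixes u v \<beta> :: real
  assumes "v < u" "u \<le> \<beta>" "0 \<le> v" shows "\<beta> / (\<beta> - v) \<le> u / (u - v)"
proof -
  have "\<beta> / (\<beta> - v) = 1 + v / (\<beta> - v)" "u / (u - v) = 1 + v / (u - v)" using assms by (auto simp: field_simps)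
  moreover have "v / (\<beta> - v) \<le> v / (u - v)" using assms by (intro divide_left_mono) auto
  ultimately show ?thesis by linarith
qed

section \<open>Quantiles of conjugate exponents\<close>

context exponents
begin

lemma conj_less_set: "1 < y \<Longrightarrow> {x. y / (y - 1) < q x} = {x. p x < y}"
  unfolding q using p_gt_1 by (auto simp: conj_less_iff)

text \<open>Conjugation is a decreasing involution of the exponents above 1, so
  \<open>{x. p x < \<alpha>}\<close> is a superlevel set of \<open>q\<close>. Heights
  \<open>y \<le> 1\<close> lie below \<open>q\<close> everywhere, and there \<open>t < 1\<close>
  decides.\<close>

lemma lower_level_conj:
  assumes Q: "Q \<in> cubes" and t: "t < 1" and al: "lower_level p Q t \<alpha>" "1 < \<alpha>"
  shows "upper_level q Q t (\<alpha> / (\<alpha> - 1))"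
  unfolding upper_level_def conj_less_set[OF al(2)]
proof (intro conjI allI impI)
  interpret dual: exponents q p a' b' a b by (rule dual)
  show "measure lebesgue (Q \<inter> {x. p x < \<alpha>}) \<le> t * measure lebesgue Q"
    using al by (simp add: lower_level_def upper_level_def)
  fix y assume y: "y < \<alpha> / (\<alpha> - 1)"
  show "t * measure lebesgue Q < measure lebesgue (Q \<inter> {x. y < q x})"
  proof (cases "1 < y")
    case False
    then have "y < q x" for x using dual.p_gt_1[of x] by simp
    then have "Q \<inter> {x. y < q x} = Q" by auto
    then show ?thesis using t measure_cube_pos[OF Q] by simp
  next
    case True
    define z where "z = y / (y - 1)"
    have z: "1 < z" "y = z / (z - 1)" using True conj_gt_1[of y] conj_conj[of y] by (auto simp: z_def)
    then have "- z < - \<alpha>" using y al(2) by (simp add: conj_less_iff)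
    then have "t * measure lebesgue Q < measure lebesgue (Q \<inter> {x. - z < - p x})"
      using al(1) unfolding lower_level_def upper_level_def by blast
    then show ?thesis unfolding z(2) conj_less_set[OF z(1)] by simp
  qed
qed

text \<open>Equality may fail: the conjugate of the level of \<open>q\<close> at \<open>t\<close> is
  the quantile of \<open>p\<close> from below, and it exceeds the level of \<open>p\<close> at
  \<open>1 - t\<close> if the values of \<open>p\<close> on \<open>Q\<close> have a gap exactly
  there.\<close>

lemma level_le_conj_level:
  assumes Q: "Q \<in> cubes" and v: "upper_level p Q (1 - t) v" and u: "upper_level q Q t u'" "1 < u'"
  shows "v \<le> u' / (u' - 1)"
proof (rule ccontr)
  interpret dual: exponents q p a' b' a b by (rule dual)
  assume "\<not> v \<le> u' / (u' - 1)"
  then obtain z where z: "u' / (u' - 1) < z" "z < v" using dense by (auto simp: not_le)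
  have z1: "1 < z" using conj_gt_1[OF u(2)] z(1) by linarith
  have "z / (z - 1) < u'" using z(1) conj_less_iff[OF z1 conj_gt_1[OF u(2)]] conj_conj[OF u(2)] by simp
  then have "t * measure lebesgue Q < measure lebesgue (Q \<inter> {x. z / (z - 1) < q x})" using u by (simp add: upper_level_def)
  then have lt: "t * measure lebesgue Q < measure lebesgue (Q \<inter> {x. p x < z})" unfolding conj_less_set[OF z1] .
  have gt: "(1 - t) * measure lebesgue Q < measure lebesgue (Q \<inter> {x. z < p x})" using v z by (simp add: upper_level_def)
  have sets: "{x. p x < z} \<in> sets lebesgue" "{x. z < p x} \<in> sets lebesgue"
    using superlevel_lebesgue[OF bm_p, of z] superlevel_lebesgue[OF bm_uminus[OF bm_p], of "- z"] by auto
  have "measure lebesgue (Q \<inter> {x. z < p x}) \<le> measure lebesgue (Q - {x. p x < z})"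
    using sets cube_lmeasurable[OF Q] cube_lebesgue[OF Q] by (intro measure_mono_fmeasurable fmeasurable_Diff) auto
  then show False using measure_split[OF cube_lmeasurable[OF Q] sets(1)] lt gt by (simp add: algebra_simps)
qed

lemma level_measure_le:
  assumes Q: "Q \<in> cubes" and v: "upper_level p Q (1 - t) v"
  shows "t * measure lebesgue Q \<le> measure lebesgue (Q \<inter> {x. p x \<le> v})"
proof -
  have "measure lebesgue Q = measure lebesgue (Q \<inter> {x. v < p x}) + measure lebesgue (Q - {x. v < p x})"
    by (intro measure_split cube_lmeasurable Q superlevel_lebesgue bm_p)
  moreover have "Q - {x. v < p x} = Q \<inter> {x. p x \<le> v}" by auto
  ultimately show ?thesis using v by (simp add: upper_level_def algebra_simps)
qed

text \<open>With \<open>u, v\<close> the levels of \<open>p\<close> and \<open>u', v'\<close> those of \<open>q\<close>, this turns the summand of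
  \<open>cube_sum_condition\<close> into a real expression.\<close>

lemma summand_eq:
  assumes Q: "Q \<in> cubes" and lt: "0 < l" "0 < t" "l + t < 1" and r: "0 < r" and qc: "q = conj_exponent p"
    and u: "upper_level p Q l u" and v: "upper_level p Q (1 - t) v"
    and u': "upper_level q Q t u'" and v': "upper_level q Q (1 - l) v'"
  shows "measure lebesgue Q * epowr t (ennreal (1/r) * (1 + Psi Q p l t)) * epowr l (ennreal (1/r) * (1 + Psi Q (conj_exponent p) t l)) =
     (if v < u \<and> v' < u' then measure lebesgue Q * (t powr (u / (u - v) / r) * l powr (u' / (u' - v') / r)) else 0)"
proof -
  interpret dual: exponents q p a' b' a b by (rule dual)
  have "0 < a" "0 < a'" using a(1) a'(1) by auto
  then have "epowr t (ennreal (1/r) * (1 + Psi Q p l t)) = (if v < u then t powr (u / (u - v) / r) else 0)"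
    "epowr l (ennreal (1/r) * (1 + Psi Q q t l)) = (if v' < u' then l powr (u' / (u' - v') / r) else 0)"
    using lt by (intro epowr_Psi[OF Q bm_p _ a(2) _ _ _ u v r] epowr_Psi[OF Q dual.bm_p _ a'(2) _ _ _ u' v' r]; simp)+
  then show ?thesis unfolding qc[symmetric] by simp
qed

text \<open>Replacing the level \<open>v\<close> by the quantile from below, which is at least
  \<open>v\<close>, increases the exponent of a base below 1; likewise for the conjugate exponent.
  Each quantile term is therefore dominated by the given summand.\<close>

lemma cube_sum_imp_quantile_sum:
  assumes "cube_sum_condition p" and qc: "q = conj_exponent p"
  shows "\<exists>r \<gamma> C. 1 < r \<and> 0 < \<gamma> \<and> \<gamma> < 1 / 2 \<and> quantile_sum_condition p r \<gamma> C"
proof -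
  interpret dual: exponents q p a' b' a b by (rule dual)
  define P where "P r \<gamma> C \<longleftrightarrow> 1 < r \<and> 0 < \<gamma> \<and> \<gamma> < 1/2 \<and> 1 \<le> C \<and>
    (\<forall>l t :: real. 0 < l \<and> l < \<gamma> \<and> 0 < t \<and> t < \<gamma> \<longrightarrow>
      (\<forall>F. countable F \<and> F \<subseteq> cubes \<and> disjoint F \<longrightarrow>
       (\<Sum>\<^sub>\<infinity>Q\<in>F. ennreal (measure lebesgue Q * epowr t (ennreal (1/r) * (1 + Psi Q p l t))
           * epowr l (ennreal (1/r) * (1 + Psi Q (conj_exponent p) t l)))) \<le> ennreal C))" for r \<gamma> C :: real
  have "\<exists>r \<gamma> C. P r \<gamma> C" using assms(1) unfolding P_def cube_sum_condition_def .
  then obtain r \<gamma> C where "P r \<gamma> C" by blast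
  note PH = this[unfolded P_def]
  have r: "1 < r" and \<gamma>: "0 < \<gamma>" "\<gamma> < 1/2" and C: "1 \<le> C" using PH by auto
  note H = conjunct2[OF conjunct2[OF conjunct2[OF conjunct2[OF PH]]], rule_format]
  have main: "(\<Sum>Q\<in>F. measure lebesgue Q * gap_term t l (\<alpha> Q) (\<beta> Q) powr (1 / r)) \<le> C"
    if l: "0 < l" "l < \<gamma>" and t: "0 < t" "t < \<gamma>" and F: "finite F" "F \<subseteq> cubes" "disjoint F"
      and ab: "\<And>Q. Q \<in> F \<Longrightarrow> \<alpha> Q < \<beta> Q" "\<And>Q. Q \<in> F \<Longrightarrow> lower_level p Q t (\<alpha> Q)" "\<And>Q. Q \<in> F \<Longrightarrow> upper_level p Q l (\<beta> Q)"
    for l t F \<alpha> \<beta>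
  proof -
    define T where "T Q = measure lebesgue Q * epowr t (ennreal (1/r) * (1 + Psi Q p l t))
           * epowr l (ennreal (1/r) * (1 + Psi Q (conj_exponent p) t l))" for Q
    have T0: "0 \<le> T Q" for Q by (simp add: T_def epowr_def)
    have "ennreal (sum T F) = (\<Sum>\<^sub>\<infinity>Q\<in>F. ennreal (T Q))" using F(1) T0 by (simp add: sum_ennreal)
    also have "\<dots> \<le> ennreal C" unfolding T_def using F by (intro H conjI l t countable_finite)
    finally have TC: "sum T F \<le> C" using C by simp
    have "measure lebesgue Q * gap_term t l (\<alpha> Q) (\<beta> Q) powr (1 / r) \<le> T Q" if Q: "Q \<in> F" for Q
    proof -
      have Qc: "Q \<in> cubes" using Q F by auto
      have lt: "0 < l" "0 < t" "l + t < 1" "l < 1" "t < 1" using l t \<gamma> by auto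
      define \<alpha>0 where "\<alpha>0 = \<alpha> Q"
      define u where "u = \<beta> Q"
      have u: "upper_level p Q l u" using ab(3)[OF Q] by (simp add: u_def)
      have al: "lower_level p Q t \<alpha>0" "\<alpha>0 < u" using ab(1,2)[OF Q] by (auto simp: \<alpha>0_def u_def)
      have "- \<alpha>0 \<le> - a"
        by (rule upper_level_bounds(2)[OF al(1)[unfolded lower_level_def] Qc lt(2,5), of "- b" "- a"]) (use a(2) b in auto)
      then have al1: "1 < \<alpha>0" using a(1) by simp
      have u1: "1 < u" using al1 al(2) by simp
      obtain v where v: "upper_level p Q (1 - t) v" using exists_upper_level[OF bm_p Qc, of "1 - t"] lt by auto
      obtain v' where v': "upper_level q Q (1 - l) v'" using exists_upper_level[OF dual.bm_p Qc, of "1 - l"] lt by auto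
      define u' where "u' = \<alpha>0 / (\<alpha>0 - 1)"
      have u': "upper_level q Q t u'" "1 < u'" unfolding u'_def
        using lower_level_conj[OF Qc lt(5) al(1) al1] conj_gt_1[OF al1] by auto
      have "v \<le> u' / (u' - 1)" by (rule level_le_conj_level[OF Qc v u'])
      then have va: "v \<le> \<alpha>0" unfolding u'_def conj_conj[OF al1] .
      have v'b: "v' \<le> u / (u - 1)" by (rule dual.level_le_conj_level[OF Qc v' u u1])
      have ul: "u / (u - 1) < u'" unfolding u'_def using conj_less_iff[OF u1 al1] al(2) by simp
      have e1: "u / (u - v) \<le> u / (u - \<alpha>0)" using va al u1 by (intro ratio_mono) auto
      have e2: "u' / (u' - v') \<le> u' / (u' - u / (u - 1))" using v'b ul u'(2) by (intro ratio_mono) auto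
      have e3: "u' / (u' - u / (u - 1)) = \<alpha>0 * (u - 1) / (u - \<alpha>0)" unfolding u'_def by (rule conj_ratio[OF al1 u1 al(2)])
      have "gap_term t l \<alpha>0 u powr (1 / r) = t powr (u / (u - \<alpha>0) / r) * l powr (u' / (u' - u / (u - 1)) / r)"
        unfolding gap_term_def e3 using lt by (simp add: powr_mult powr_powr)
      also have "\<dots> \<le> t powr (u / (u - v) / r) * l powr (u' / (u' - v') / r)"
        using e1 e2 lt r by (intro mult_mono powr_mono' divide_right_mono) auto
      finally have "measure lebesgue Q * gap_term t l \<alpha>0 u powr (1 / r) \<le> measure lebesgue Q * (t powr (u / (u - v) / r) * l powr (u' / (u' - v') / r))"
        by (rule mult_left_mono) simp
      also have "\<dots> = T Q"
        unfolding T_def summand_eq[OF Qc lt(1-3) order.strict_trans[OF zero_less_one r] qc u v u'(1) v']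
        using va al v'b ul by simp
      finally show ?thesis by (simp add: \<alpha>0_def u_def)
    qed
    then have "(\<Sum>Q\<in>F. measure lebesgue Q * gap_term t l (\<alpha> Q) (\<beta> Q) powr (1 / r)) \<le> sum T F" by (rule sum_mono)
    then show ?thesis using TC by simp
  qed
  have "quantile_sum_condition p r \<gamma> C"
    unfolding quantile_sum_condition_def by (intro allI impI, rule main) auto
  then show ?thesis using r \<gamma> by blast
qed

end

text \<open>Here summands must be bounded from above, so the levels are chosen the other way:
  \<open>v\<close> for \<open>p\<close> at \<open>1 - t\<close>, and \<open>\<beta>\<close>
  conjugate to the level of \<open>q\<close> at \<open>1 - l\<close>. For these the portions
  \<open>{x. p x \<le> v}\<close> and \<open>{x. \<beta> \<le> p x}\<close> have the measures
  required by \<open>gap_sum\<close>, and the exponents only become smaller.\<close>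

lemma (in local_exponents) averaging_imp_cube_sum:
  assumes av: "averaging_bounded p B" "1 \<le> B" and qc: "q = conj_exponent p"
  shows "cube_sum_condition p"
proof -
  interpret dual: exponents q p a' b' a b by (rule dual)
  define P where "P r \<gamma> C \<longleftrightarrow> 1 < r \<and> 0 < \<gamma> \<and> \<gamma> < 1 / 2 \<and> 1 \<le> C \<and>
    (\<forall>F \<tau> \<nu> \<alpha> \<beta>. finite F \<and> F \<subseteq> cubes \<and> disjoint F \<and> 0 < \<tau> \<and> \<tau> < \<gamma> \<and> 0 < \<nu> \<and> \<nu> < \<gamma> \<and>
       (\<forall>Q\<in>F. a \<le> \<alpha> Q \<and> \<alpha> Q < \<beta> Q \<and> \<beta> Q \<le> b \<and>
          \<tau> * measure lebesgue Q \<le> measure lebesgue (Q \<inter> {x. p x \<le> \<alpha> Q}) \<and>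
          \<nu> * measure lebesgue Q \<le> measure lebesgue (Q \<inter> {x. \<beta> Q \<le> p x})) \<longrightarrow>
       (\<Sum>Q\<in>F. measure lebesgue Q * gap_term \<tau> \<nu> (\<alpha> Q) (\<beta> Q) powr (1 / r)) \<le> C)" for r \<gamma> C :: real
  have "\<exists>r \<gamma> C. P r \<gamma> C" unfolding P_def by (rule gap_sum[OF av])
  then obtain r \<gamma> C where "P r \<gamma> C" by blast
  note g = this[unfolded P_def]
  have r: "1 < r" "0 < \<gamma>" "\<gamma> < 1 / 2" "1 \<le> C" using g by auto
  note gs = conjunct2[OF conjunct2[OF conjunct2[OF conjunct2[OF g]]], rule_format]
  have main: "(\<Sum>\<^sub>\<infinity>Q\<in>F. ennreal (measure lebesgue Q * epowr t (ennreal (1/r) * (1 + Psi Q p l t))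
           * epowr l (ennreal (1/r) * (1 + Psi Q (conj_exponent p) t l)))) \<le> ennreal C"
    if l: "0 < l" "l < \<gamma>" and t: "0 < t" "t < \<gamma>" and F: "F \<subseteq> cubes" "disjoint F" for l t F
  proof -
    have lt: "0 < l" "0 < t" "l + t < 1" "l < 1" "t < 1" using l t r by auto
    define T where "T Q = measure lebesgue Q * epowr t (ennreal (1/r) * (1 + Psi Q p l t))
           * epowr l (ennreal (1/r) * (1 + Psi Q (conj_exponent p) t l))" for Q
    have T0: "0 \<le> T Q" for Q by (simp add: T_def epowr_def)
    have ex: "\<exists>\<beta>. upper_level h Q s \<beta>" if "Q \<in> F" "bounded_measurable h" "0 < s" "s < 1" for Q h s
      using exists_upper_level that F(1) by blast
    have "\<forall>Q\<in>F. \<exists>\<beta>. upper_level p Q l \<beta>" "\<forall>Q\<in>F. \<exists>\<beta>. upper_level p Q (1 - t) \<beta>"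
      "\<forall>Q\<in>F. \<exists>\<beta>. upper_level q Q t \<beta>" "\<forall>Q\<in>F. \<exists>\<beta>. upper_level q Q (1 - l) \<beta>"
      using lt by (intro ballI ex bm_p dual.bm_p; simp)+
    from this[THEN bchoice] obtain u v u' v' where lev: "\<forall>Q\<in>F. upper_level p Q l (u Q)" "\<forall>Q\<in>F. upper_level p Q (1 - t) (v Q)"
      "\<forall>Q\<in>F. upper_level q Q t (u' Q)" "\<forall>Q\<in>F. upper_level q Q (1 - l) (v' Q)" by auto
    have T_eq: "T Q = (if v Q < u Q \<and> v' Q < u' Q then
        measure lebesgue Q * (t powr (u Q / (u Q - v Q) / r) * l powr (u' Q / (u' Q - v' Q) / r)) else 0)" if Q: "Q \<in> F" for Q
    proof -
      have "Q \<in> cubes" using Q F(1) by auto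
      then show ?thesis unfolding T_def using lev Q r by (intro summand_eq lt qc) auto
    qed
    have fin: "sum T G \<le> C" if G: "finite G" "G \<subseteq> F" for G
    proof -
      \<comment> \<open>On the other cubes one of the two values of \<open>Psi\<close> is infinite
        and the summand vanishes.\<close>
      define G' where "G' = {Q \<in> G. v Q < u Q \<and> v' Q < u' Q}"
      have G': "finite G'" "G' \<subseteq> F" "G' \<subseteq> cubes" "disjoint G'" using G F pairwise_subset[OF F(2), of G'] by (auto simp: G'_def)
      define \<beta> where "\<beta> Q = v' Q / (v' Q - 1)" for Q
      have fact: "a \<le> v Q" "1 < v' Q" "u Q \<le> \<beta> Q" "\<beta> Q \<le> b" "v Q < \<beta> Q" "1 < v Q"
          "t * measure lebesgue Q \<le> measure lebesgue (Q \<inter> {x. p x \<le> v Q})"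
          "l * measure lebesgue Q \<le> measure lebesgue (Q \<inter> {x. \<beta> Q \<le> p x})"
          "T Q \<le> measure lebesgue Q * gap_term t l (v Q) (\<beta> Q) powr (1 / r)" if Q: "Q \<in> G'" for Q
      proof -
        have QF: "Q \<in> F" "Q \<in> cubes" using Q G' by auto
        have vu: "v Q < u Q" "v' Q < u' Q" using Q by (auto simp: G'_def)
        have u: "upper_level p Q l (u Q)" and v: "upper_level p Q (1 - t) (v Q)"
          and u': "upper_level q Q t (u' Q)" and v': "upper_level q Q (1 - l) (v' Q)" using lev QF by auto
        show av: "a \<le> v Q" using lt by (intro upper_level_bounds(1)[OF v QF(2) _ _ a(2) b]) auto
        have a'v': "a' \<le> v' Q" using lt by (intro upper_level_bounds(1)[OF v' QF(2) _ _ a'(2) b']) auto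
        show v'1: "1 < v' Q" using a'v' a'(1) by simp
        show v1: "1 < v Q" using av a(1) by simp
        have u1: "1 < u Q" "1 < u' Q" using v1 v'1 vu by auto
        have v'u: "v' Q \<le> u Q / (u Q - 1)" by (rule dual.level_le_conj_level[OF QF(2) v' u u1(1)])
        have vu': "v Q \<le> u' Q / (u' Q - 1)" by (rule level_le_conj_level[OF QF(2) v u' u1(2)])
        show ub: "u Q \<le> \<beta> Q" unfolding \<beta>_def
          using v'u conj_le_iff[OF conj_gt_1[OF u1(1)] v'1] conj_conj[OF u1(1)] by simp
        show vb: "v Q < \<beta> Q" using vu ub by simp
        have b1: "1 < \<beta> Q" using v1 vb by simp
        have v'\<beta>: "v' Q = \<beta> Q / (\<beta> Q - 1)" using conj_conj[OF v'1] by (simp add: \<beta>_def)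
        show lm: "l * measure lebesgue Q \<le> measure lebesgue (Q \<inter> {x. \<beta> Q \<le> p x})"
        proof -
          have "l * measure lebesgue Q \<le> measure lebesgue (Q \<inter> {x. q x \<le> v' Q})" by (rule dual.level_measure_le[OF QF(2) v'])
          also have "{x. q x \<le> v' Q} = {x. \<beta> Q \<le> p x}" unfolding v'\<beta> q using p_gt_1 b1 by (auto simp: conj_le_iff)
          finally show ?thesis .
        qed
        show "t * measure lebesgue Q \<le> measure lebesgue (Q \<inter> {x. p x \<le> v Q})" by (rule level_measure_le[OF QF(2) v])
        show "\<beta> Q \<le> b"
        proof (rule ccontr)
          assume "\<not> \<beta> Q \<le> b"
          then have "\<not> \<beta> Q \<le> p x" for x using b[of x] by linarith
          then have "{x. \<beta> Q \<le> p x} = {}" by simp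
          moreover have "0 < l * measure lebesgue Q" using lt measure_cube_pos[OF QF(2)] by simp
          ultimately show False using lm by simp
        qed
        have e1: "\<beta> Q / (\<beta> Q - v Q) \<le> u Q / (u Q - v Q)" using vu ub v1 by (intro ratio_antimono) auto
        have "u' Q \<le> v Q / (v Q - 1)"
          using vu' conj_le_iff[OF conj_gt_1[OF u1(2)] v1] conj_conj[OF u1(2)] by simp
        then have e2: "v Q / (v Q - 1) / (v Q / (v Q - 1) - v' Q) \<le> u' Q / (u' Q - v' Q)"
          using vu v'1 by (intro ratio_antimono) auto
        have e3: "v Q / (v Q - 1) / (v Q / (v Q - 1) - v' Q) = v Q * (\<beta> Q - 1) / (\<beta> Q - v Q)"
          unfolding v'\<beta> by (rule conj_ratio[OF v1 b1 vb])
        have "T Q = measure lebesgue Q * (t powr (u Q / (u Q - v Q) / r) * l powr (u' Q / (u' Q - v' Q) / r))"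
          using T_eq[OF QF(1)] vu by simp
        also have "\<dots> \<le> measure lebesgue Q * (t powr (\<beta> Q / (\<beta> Q - v Q) / r) * l powr (v Q * (\<beta> Q - 1) / (\<beta> Q - v Q) / r))"
          using e1 e2[unfolded e3] lt r by (intro mult_left_mono mult_mono powr_mono' divide_right_mono) auto
        also have "t powr (\<beta> Q / (\<beta> Q - v Q) / r) * l powr (v Q * (\<beta> Q - 1) / (\<beta> Q - v Q) / r) = gap_term t l (v Q) (\<beta> Q) powr (1 / r)"
          unfolding gap_term_def using lt by (simp add: powr_mult powr_powr)
        finally show "T Q \<le> measure lebesgue Q * gap_term t l (v Q) (\<beta> Q) powr (1 / r)" .
      qed
      have "T Q = 0" if "Q \<in> G - G'" for Q
      proof -
        have "Q \<in> F" using that G by auto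
        from T_eq[OF this] show ?thesis using that by (auto simp: G'_def)
      qed
      then have "sum T G = sum T G'" using G by (intro sum.mono_neutral_right) (auto simp: G'_def)
      also have "\<dots> \<le> (\<Sum>Q\<in>G'. measure lebesgue Q * gap_term t l (v Q) (\<beta> Q) powr (1 / r))" by (intro sum_mono fact)
      also have "\<dots> \<le> C" using G' t l fact by (intro gs) auto
      finally show ?thesis .
    qed
    have "(\<Sum>\<^sub>\<infinity>Q\<in>F. ennreal (T Q)) = (SUP G\<in>{G. finite G \<and> G \<subseteq> F}. \<Sum>Q\<in>G. ennreal (T Q))"
      by (rule nonneg_infsum_complete) simp
    also have "\<dots> \<le> ennreal C"
    proof (rule SUP_least)
      fix G assume "G \<in> {G. finite G \<and> G \<subseteq> F}"
      then show "(\<Sum>Q\<in>G. ennreal (T Q)) \<le> ennreal C" using T0 fin[of G] by (simp add: sum_ennreal ennreal_leI)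
    qed
    finally show ?thesis unfolding T_def .
  qed
  show ?thesis
    unfolding cube_sum_condition_def
    by (rule exI[of _ r], rule exI[of _ \<gamma>], rule exI[of _ C]) (use r main in auto)
qed

text \<open>Bounded averaging already implies the A condition, so the estimates of
  \<open>local_exponents\<close> are at hand in the necessity direction too.\<close>

lemma (in exponents) maximal_bounded_iff:
  assumes qc: "q = conj_exponent p"
  shows "maximal_bounded p \<longleftrightarrow> A_condition p \<and> cube_sum_condition p"
proof (intro iffI conjI)
  assume "maximal_bounded p"
  then obtain B where B: "1 \<le> B" "averaging_bounded p B" using maximal_imp_averaging by blast
  have l: "local_condition p q (16 * B)" using averaging_imp_local_condition[OF B(2)] B(1) by simp
  show "A_condition p" by (rule local_imp_A_condition[OF l qc])
  interpret local_exponents p q a b a' b' "16 * B" by unfold_locales (use l B in auto)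
  show "cube_sum_condition p" by (rule averaging_imp_cube_sum[OF B(2,1) qc])
next
  assume as: "A_condition p \<and> cube_sum_condition p"
  obtain A where A: "1 \<le> A" "local_condition p q A" using A_condition_imp_local[OF _ qc] as by blast
  interpret local_exponents p q a b a' b' A by unfold_locales (use A in auto)
  obtain r \<gamma> C where "1 < r" "0 < \<gamma>" "\<gamma> < 1 / 2" "quantile_sum_condition p r \<gamma> C"
    using cube_sum_imp_quantile_sum[OF _ qc] as by blast
  then show "maximal_bounded p" by (intro maximal_boundedI)
qed

text \<open>All conditions see the exponent only through integrals and through measures of its level
  sets. This is what permits replacing \<open>p\<close> by an exponent bounded everywhere.\<close>

lemma conditions_cong_AE:
  assumes p: "p \<in> borel_measurable lebesgue" "p' \<in> borel_measurable lebesgue" and eq: "AE x in lebesgue. p x = p' x"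
  shows "maximal_bounded p = maximal_bounded p'" "A_condition p = A_condition p'" "cube_sum_condition p = cube_sum_condition p'"
proof -
  have norm: "Lp_norm h = Lp_norm h'" if h: "AE x in lebesgue. h x = h' x" for h h' :: "real ^ 'n \<Rightarrow> real"
  proof
    fix f
    have "(\<integral>\<^sup>+ x. ennreal ((\<bar>f x\<bar> / s) powr h x) \<partial>lebesgue) = (\<integral>\<^sup>+ x. ennreal ((\<bar>f x\<bar> / s) powr h' x) \<partial>lebesgue)" for s
      using h by (intro nn_integral_cong_AE) (auto elim: eventually_mono)
    then show "Lp_norm h f = Lp_norm h' f" unfolding Lp_norm_def by simp
  qed
  have qm: "conj_exponent p \<in> borel_measurable lebesgue" "conj_exponent p' \<in> borel_measurable lebesgue"
    using p unfolding conj_exponent_def[abs_def] by auto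
  have qeq: "AE x in lebesgue. conj_exponent p x = conj_exponent p' x"
    using eq by (auto simp: conj_exponent_def elim: eventually_mono)
  have Psi: "Psi Q h = Psi Q h'"
    if m: "h \<in> borel_measurable lebesgue" "h' \<in> borel_measurable lebesgue" and h: "AE x in lebesgue. h x = h' x" and Q: "Q \<in> cubes"
    for Q and h h' :: "real ^ 'n \<Rightarrow> real"
  proof -
    have Qm [measurable]: "Q \<in> sets lebesgue" using cube_lebesgue[OF Q] .
    note [measurable] = m
    have "emeasure lebesgue {x. \<alpha> < \<bar>h x * indicator Q x\<bar>} = emeasure lebesgue {x. \<alpha> < \<bar>h' x * indicator Q x\<bar>}" for \<alpha>
    proof (rule emeasure_eq_AE)
      show "AE x in lebesgue. (x \<in> {x. \<alpha> < \<bar>h x * indicator Q x\<bar>}) = (x \<in> {x. \<alpha> < \<bar>h' x * indicator Q x\<bar>})"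
        using h by (auto elim: eventually_mono)
      have "(\<lambda>x. \<bar>h x * indicator Q x\<bar>) \<in> borel_measurable lebesgue" "(\<lambda>x. \<bar>h' x * indicator Q x\<bar>) \<in> borel_measurable lebesgue"
        by measurable
      then show "{x. \<alpha> < \<bar>h x * indicator Q x\<bar>} \<in> sets lebesgue" "{x. \<alpha> < \<bar>h' x * indicator Q x\<bar>} \<in> sets lebesgue"
        by (simp_all add: borel_measurable_iff_greater)
    qed
    then have "rearrangement (\<lambda>x. h x * indicator Q x) = rearrangement (\<lambda>x. h' x * indicator Q x)"
      unfolding rearrangement_def[abs_def] by simp
    then show ?thesis unfolding Psi_def[abs_def] by simp
  qed
  show "maximal_bounded p = maximal_bounded p'" unfolding maximal_bounded_def Lp_space_def norm[OF eq] ..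
  show "A_condition p = A_condition p'" unfolding A_condition_def norm[OF eq] norm[OF qeq] ..
  have "(\<Sum>\<^sub>\<infinity>Q\<in>F. ennreal (measure lebesgue Q * epowr t (ennreal (1/r) * (1 + Psi Q p l t))
           * epowr l (ennreal (1/r) * (1 + Psi Q (conj_exponent p) t l)))) =
      (\<Sum>\<^sub>\<infinity>Q\<in>F. ennreal (measure lebesgue Q * epowr t (ennreal (1/r) * (1 + Psi Q p' l t))
           * epowr l (ennreal (1/r) * (1 + Psi Q (conj_exponent p') t l))))" if "F \<subseteq> cubes" for F r t l
  proof (rule infsum_cong)
    fix Q assume "Q \<in> F"
    then have "Q \<in> cubes" using that by auto
    then have "Psi Q p = Psi Q p'" "Psi Q (conj_exponent p) = Psi Q (conj_exponent p')"
      using Psi[OF p eq] Psi[OF qm qeq] by auto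
    then show "ennreal (measure lebesgue Q * epowr t (ennreal (1/r) * (1 + Psi Q p l t))
           * epowr l (ennreal (1/r) * (1 + Psi Q (conj_exponent p) t l))) =
      ennreal (measure lebesgue Q * epowr t (ennreal (1/r) * (1 + Psi Q p' l t))
           * epowr l (ennreal (1/r) * (1 + Psi Q (conj_exponent p') t l)))" by simp
  qed
  then show "cube_sum_condition p = cube_sum_condition p'" unfolding cube_sum_condition_def by (simp cong: conj_cong imp_cong)
qed

theorem theorem4p11:
  fixes p :: "real ^ 'n \<Rightarrow> real"
  assumes "p \<in> borel_measurable lebesgue"
    and "\<And>x. 1 \<le> p x"
    and "1 < essinf lebesgue (\<lambda>x. ereal (p x))"
    and "esssup lebesgue (\<lambda>x. ereal (p x)) < \<infinity>"
  shows "maximal_bounded p \<longleftrightarrow> A_condition p \<and> cube_sum_condition p"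
proof -
  obtain c where c: "1 < c" "AE x in lebesgue. c \<le> ereal (p x)"
    using assms(3) unfolding essinf_def less_Sup_iff by auto
  obtain a where a: "1 < ereal a" "ereal a < c" using ereal_dense2[OF c(1)] by blast
  obtain b0 where b0: "esssup lebesgue (\<lambda>x. ereal (p x)) < ereal b0" using ereal_dense2[OF assms(4)] by blast
  define b where "b = max a b0"
  have a1: "1 < a" "a \<le> b" using a by (auto simp: b_def)
  have "AE x in lebesgue. a \<le> p x"
    using c(2)
  proof eventually_elim
    case (elim x)
    have "ereal a \<le> ereal (p x)" using a(2) elim by (rule order_trans[OF less_imp_le])
    then show ?case by simp
  qed
  moreover have "AE x in lebesgue. p x \<le> b"
    using esssup_AE[of "\<lambda>x. ereal (p x)" lebesgue]
  proof eventually_elim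
    case (elim x)
    have "ereal (p x) \<le> ereal b0" using elim b0 by (rule order_trans[OF _ less_imp_le])
    then show ?case by (simp add: b_def)
  qed
  ultimately have bounds: "AE x in lebesgue. a \<le> p x \<and> p x \<le> b" by eventually_elim simp
  \<comment> \<open>Clamping turns the essential bounds into pointwise ones and keeps the conjugate
    exponent finite and bounded everywhere.\<close>
  define p' where "p' x = max a (min (p x) b)" for x
  have eq: "AE x in lebesgue. p x = p' x" using bounds by eventually_elim (auto simp: p'_def)
  have p'm: "p' \<in> borel_measurable lebesgue" unfolding p'_def using assms(1) by measurable
  have p': "a \<le> p' x" "p' x \<le> b" "1 < p' x" for x using a1 by (auto simp: p'_def)
  have b1: "1 < b" using a1 by simp
  interpret exponents p' "conj_exponent p'" a b "b / (b - 1)" "a / (a - 1)"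
  proof
    show "b / (b - 1) \<le> conj_exponent p' x" "conj_exponent p' x \<le> a / (a - 1)" for x
      unfolding conj_exponent_def using conj_le_iff[OF b1 p'(3)] conj_le_iff[OF p'(3) a1(1)] p' by auto
    show "1 < b / (b - 1)" using conj_gt_1[OF b1] .
  qed (use p'm a1 p' in \<open>auto simp: conj_exponent_def\<close>)
  show ?thesis unfolding conditions_cong_AE[OF assms(1) p'm eq] by (rule maximal_bounded_iff[OF refl])
qed

end
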